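(* Consider the affine and uniform model and its interior penalty DG discretization as described in the context, under all assumptions (U1)–(U5) listed there, with $p\in(0,1)$ the summability exponent of (U3) and with $\eta>0$ a sufficiently large penalty constant (in the sense of the context). Let $R\in\mathbb N$ be fixed and let $n=2^m$ with $m\in\mathbb N$. Let $\alpha>0$ and $C_{\rm DG}>0$ be the constants, independent of $\boldsymbol y$ and $h$, described in the context (such constants exist), and put $$b_j:=\frac{C_{\rm DG}\|\psi_j\|_{L^\infty(D)}}{\alpha\, a_{\min}},\qquad j\ge 1.$$ Let $$\lambda=\begin{cases}\frac{p}{2-p}&\text{if }p\in(2/3,1),\\ \frac{1}{2-2\varepsilon}\ \text{ for arbitrary }\varepsilon\in(0,1/2)&\text{if }p\in(0,2/3],\end{cases}$$ let $\varrho(\lambda):=\frac{2\zeta(2\lambda)}{(2\pi^2)^\lambda}$, where $\zeta(x)=\sum_{k\ge1}k^{-x}$, and choose the weights $$\gamma_{\mathfrak u}=\bigg(|\mathfrak u|!\prod_{j\in\mathfrak u}\frac{b_j}{\sqrt{\varrho(\lambda)}}\bigg)^{2/(1+\lambda)}\qquad\text{for }\mathfrak u\subseteq\{1,\ldots,s\}.$$ Then there exists a generating vector $\boldsymbol z\in\{0,\ldots,n-1\}^s$, constructed by the CBC algorithm with these weights, such that the randomly shifted lattice rule $Q_{\rm ran}$ with generating vector $\boldsymbol z$ satisfies $$\sqrt{\mathbb E_{\boldsymbol\Delta}\bigg\|\int_{[-1/2,1/2]^s}u_{s,h}(\cdot,\boldsymbol y)\,{\rm d}\boldsymbol y-Q_{\rm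 ran}(u_{s,h})\bigg\|_{L^2(D)}^2}=\begin{cases}\mathcal O(n^{-1/p+1/2})&\text{if }p\in(2/3,1),\\ \mathcal O(n^{-1+\varepsilon})&\text{if }p\in(0,2/3],\end{cases}$$ where in the second case $\varepsilon\in(0,1/2)$ is the arbitrary number used to define $\lambda$, and in both cases the implied coefficient is independent of the dimension $s$ (and of $n$).
   Context: **Affine and uniform model.** $D\subset\mathbb R^d$, $d\in\{1,2,3\}$, $f\in L^2(D)$, $U:=[-\frac12,\frac12]^{\mathbb N}$, and $a(\boldsymbol x,\boldsymbol y):=a_0(\boldsymbol x)+\sum_{j\ge1}y_j\psi_j(\boldsymbol x)$ for $\boldsymbol x\in D$, $\boldsymbol y\in U$, with real-valued functions $a_0,\psi_j$. Assumptions: (U1) $a_0\in L^\infty(D)$ and $\sum_{j\ge1}\|\psi_j\|_{L^\infty}<\infty$; (U2) there are constants $a_{\min},a_{\max}>0$ with $a_{\min}\le a(\boldsymbol x,\boldsymbol y)\le a_{\max}$ for all $\boldsymbol x\in D$, $\boldsymbol y\in U$; (U3) $\sum_{j\ge1}\|\psi_j\|_{L^\infty}^p<\infty$ for some $0<p<1$; (U4) $a_0\in W^{1,\infty}(D)$ and $\sum_{j\ge1}\|\psi_j\|_{W^{1,\infty}}<\infty$, where $\|v\|_{W^{1,\infty}}:=\max\{\|v\|_{L^\infty},\|\nabla v\|_{L^\infty}\}$; (U5) $D$ is a convex and bounded polyhedron. **Mesh and DG space.** $\mathcal T_h$ is a member of a shape- and contact-regular sequence of meshes of $D$ without hanging nodes: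 each $\mathcal T_h$ is a partition of $D$ into polyhedral elements admitting a matching simplicial submesh $\mathcal S_h$, and there are $\rho_1,\rho_2>0$ independent of $h$ such that every simplex $T'\in\mathcal S_h$ has inradius $\ge\rho_1\operatorname{diam}T'$, and $\rho_2\operatorname{diam}T\le\operatorname{diam}T'$ whenever $T'\subset T\in\mathcal T_h$. $\mathcal F$ is the set of all faces; $h_F$ is the diameter of the face $F$ (if $d=1$, $h_F$ is the minimum of the diameters of the elements adjacent to $F$). $N_\partial$ is the maximal number of faces of a mesh element. For a fixed polynomial degree $k\in\mathbb N$, $$V_h=\{v_h\in L^2(D): v_h|_T\in\mathcal P_k(T)\ \forall T\in\mathcal T_h\},$$ with $\mathcal P_k(T)$ the polynomials of total degree at most $k$. On a face shared by $T^+\ne T^-$, put $\{\![v]\!\}=\frac12(v|_{T^+}+v|_{T^-})$ (componentwise for vector fields) and $[\![v]\!]=v|_{T^+}\boldsymbol n_{T^+}+v|_{T^-}\boldsymbol n_{T^-}$ with outward unit normals; on $F\subset\partial D\cap\partial T$ put $\{\![v]\!\}=v|_T$, $[\![v]\!]=v|_T\boldsymbol n$. $C_{\rm tr}$ is a constant independent of $h$ with $(\operatorname{diam}T)^{1/2}\|v_h\|_{L^2(F)}\le C_{\rm tr}\|v_h\|_{L^2(T)}$ for all $v_h\in V_h$, $T\in\mathcal T_h$, faces $F\subset\partial T$. **DG problem.** Let $\theta\in\{-1,0,1\}$ and $$B_h(\boldsymbol y;w,v)=\sum_{T\in\mathcal T_h}\int_T a\nabla w\cdot\nabla v\,{\rm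 d}\boldsymbol x+\sum_{F\in\mathcal F}\int_F\Big[\theta\{\![a\nabla v]\!\}\cdot[\![w]\!]-\{\![a\nabla w]\!\}\cdot[\![v]\!]+\tfrac{\eta}{h_F}[\![w]\!]\cdot[\![v]\!]\Big]{\rm d}\sigma,\qquad a=a(\cdot,\boldsymbol y).$$ $u_h(\cdot,\boldsymbol y)\in V_h$ is the solution of $B_h(\boldsymbol y;u_h(\cdot,\boldsymbol y),v_h)=\int_D f v_h\,{\rm d}\boldsymbol x$ for all $v_h\in V_h$. The norm on $V_h$ is $\|v_h\|_{V_h}^2=\sum_T\|\sqrt{a(\cdot,\boldsymbol y)}\nabla v_h\|_{L^2(T)}^2+\sum_F\frac{\eta}{h_F}\|[\![v_h]\!]\|_{L^2(F)}^2$. The penalty $\eta>0$ is independent of $\boldsymbol y$ and *sufficiently large*, i.e. for some $\tau>1$ and $\tilde\tau>0$ (independent of $\boldsymbol y,h$), $\eta\ge\tau\frac{a_{\max}^2C_{\rm tr}^2N_\partial(\theta-1)^2}{4a_{\min}}$ and $\eta\ge\tilde\tau\frac{a_{\max}^2}{a_{\min}}$. The truncated solution is $u_{s,h}(\cdot,\boldsymbol y):=u_h(\cdot,(y_1,\ldots,y_s,0,0,\ldots))$, $\boldsymbol y\in[-\frac12,\frac12]^s$. **Constants.** $\alpha>0$ is a coercivity constant: $\alpha\|v_h\|_{V_h}^2\le B_h(\boldsymbol y;v_h,v_h)$ for all $v_h\in V_h$, $\boldsymbol y\in U$. $C_{\rm DG}>0$ is a constant such that for all $\boldsymbol y\in U$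 and all finitely supported multi-indices $\boldsymbol\nu\neq\boldsymbol0$, $\|\partial_{\boldsymbol y}^{\boldsymbol\nu}u_h(\cdot,\boldsymbol y)\|_{V_h}\le C_{\rm DG}\sum_{\boldsymbol0\ne\boldsymbol m\le\boldsymbol\nu}\binom{\boldsymbol\nu}{\boldsymbol m}\big\|\frac{\partial_{\boldsymbol y}^{\boldsymbol m}a(\cdot,\boldsymbol y)}{a(\cdot,\boldsymbol y)}\big\|_{L^\infty(D)}\|\partial_{\boldsymbol y}^{\boldsymbol\nu-\boldsymbol m}u_h(\cdot,\boldsymbol y)\|_{V_h}$. Both are independent of $\boldsymbol y$ and $h$. **QMC rule.** With $\boldsymbol t_i=\{i\boldsymbol z/n\}$, $i=1,\ldots,n$ ($\{\cdot\}$ the componentwise fractional part), and i.i.d. random shifts $\boldsymbol\Delta^{(1)},\ldots,\boldsymbol\Delta^{(R)}$ uniform on $[0,1]^s$, $$Q_{\rm ran}(G)=\frac1{nR}\sum_{i=1}^n\sum_{r=1}^RG\big(\{\boldsymbol t_i+\boldsymbol\Delta^{(r)}\}-(\tfrac12,\ldots,\tfrac12)\big);$$ $\mathbb E_{\boldsymbol\Delta}$ is the expectation over the shifts. For weights $(\gamma_{\mathfrak u})$ the weighted unanchored Sobolev norm is $$\|G\|_{s,\boldsymbol\gamma}^2=\sum_{\mathfrak u\subseteq\{1,\ldots,s\}}\frac1{\gamma_{\mathfrak u}}\int_{[-1/2,1/2]^{|\mathfrak u|}}\Big(\int_{[-1/2,1/2]^{s-|\mathfrak u|}}\tfrac{\partial^{|\mathfrak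 u|}}{\partial\boldsymbol y_{\mathfrak u}}G(\boldsymbol y)\,{\rm d}\boldsymbol y_{-\mathfrak u}\Big)^2{\rm d}\boldsymbol y_{\mathfrak u}.$$ The component-by-component (CBC) algorithm sets $z_1=1$ and, for $\ell=2,\ldots,s$, with $z_1,\ldots,z_{\ell-1}$ fixed, picks $z_\ell\in\{1\le z\le n-1:\gcd(z,n)=1\}$ minimizing the $\ell$-dimensional shift-averaged worst-case error (the square root of the expectation over one uniform shift of $\sup_{\|G\|_{\ell,\boldsymbol\gamma}\le1}|\int G-Q(G)|^2$, with $Q$ the rule with that single shift and weights $\gamma_{\mathfrak u}$, $\mathfrak u\subseteq\{1,\ldots,\ell\}$). *)

theory Defs
  imports "HOL-Probability.Probability"
begin

section \<open>Function spaces on a domain\<close>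

text \<open>
  Functions on a domain \<open>D\<close> are total functions of which only the values on \<open>D\<close> matter.
  All domains and mesh elements below are closed; since their boundaries are Lebesgue null sets,
  this makes no difference for \<open>L\<^sup>2\<close>, \<open>L\<^sup>\<infinity>\<close> and volume integrals.
\<close>

definition grad :: "('a::euclidean_space \<Rightarrow> real) \<Rightarrow> 'a \<Rightarrow> 'a" where
  "grad v x = (THE g. GDERIV v x :> g)"

definition L2 :: "'a::euclidean_space set \<Rightarrow> ('a \<Rightarrow> real) set" where
  "L2 D = {v. v \<in> borel_measurable (lebesgue_on D) \<and> integrable (lebesgue_on D) (\<lambda>x. (v x)\<^sup>2)}"

definition L2_norm :: "'a::euclidean_space set \<Rightarrow> ('a \<Rightarrow> 'b::real_normed_vector) \<Rightarrow> real" where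
  "L2_norm D v = sqrt (LINT x|lebesgue_on D. (norm (v x))\<^sup>2)"

definition Linf :: "'a::euclidean_space set \<Rightarrow> ('a \<Rightarrow> 'b::real_normed_vector) set" where
  "Linf D = {v. v \<in> borel_measurable (lebesgue_on D) \<and>
                esssup (lebesgue_on D) (\<lambda>x. ereal (norm (v x))) < \<infinity>}"

definition Linf_norm :: "'a::euclidean_space set \<Rightarrow> ('a \<Rightarrow> 'b::real_normed_vector) \<Rightarrow> real" where
  "Linf_norm D v = real_of_ereal (esssup (lebesgue_on D) (\<lambda>x. ereal (norm (v x))))"

text \<open>
  Infinite differentiability: \<open>\<Phi> [b\<^sub>1, \<dots>, b\<^sub>k]\<close> is the iterated partial derivative of \<open>\<phi>\<close> in the
  coordinate directions \<open>b\<^sub>1, \<dots>, b\<^sub>k\<close>, and each of these is (Frechet) differentiable everywhere.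
\<close>

definition smooth :: "('a::euclidean_space \<Rightarrow> real) \<Rightarrow> bool" where
  "smooth \<phi> \<longleftrightarrow> (\<exists>\<Phi> :: 'a list \<Rightarrow> 'a \<Rightarrow> real. \<Phi> [] = \<phi> \<and>
     (\<forall>w x. (\<Phi> w has_derivative (\<lambda>v. \<Sum>b\<in>Basis. (v \<bullet> b) * \<Phi> (b # w) x)) (at x)))"

definition test_fun :: "'a::euclidean_space set \<Rightarrow> ('a \<Rightarrow> real) set" where
  "test_fun D = {\<phi>. smooth \<phi> \<and> (\<exists>K. compact K \<and> K \<subseteq> interior D \<and> (\<forall>x. x \<notin> K \<longrightarrow> \<phi> x = 0))}"

definition has_weak_grad ::
    "'a::euclidean_space set \<Rightarrow> ('a \<Rightarrow> real) \<Rightarrow> ('a \<Rightarrow> 'a) \<Rightarrow> bool" where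
  "has_weak_grad D v g \<longleftrightarrow>
     (\<forall>K. compact K \<and> K \<subseteq> interior D \<longrightarrow>
        integrable (lebesgue_on K) v \<and> integrable (lebesgue_on K) g) \<and>
     (\<forall>\<phi>\<in>test_fun D. \<forall>b\<in>Basis.
        (LINT x|lebesgue_on D. v x * (grad \<phi> x \<bullet> b)) =
        - (LINT x|lebesgue_on D. (g x \<bullet> b) * \<phi> x))"

definition weak_grad :: "'a::euclidean_space set \<Rightarrow> ('a \<Rightarrow> real) \<Rightarrow> 'a \<Rightarrow> 'a" where
  "weak_grad D v = (SOME g. has_weak_grad D v g)"

text \<open>
  On a convex body \<open>D\<close> every \<open>W\<^sup>1\<^sup>,\<^sup>\<infinity>\<close> class has exactly one representative that is
  continuous (even Lipschitz) on \<open>D\<close>. Elements of \<open>W\<^sup>1\<^sup>,\<^sup>\<infinity>(D)\<close> are identified with that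
  representative, because the coefficient is evaluated pointwise and on faces.
\<close>

definition W1inf :: "'a::euclidean_space set \<Rightarrow> ('a \<Rightarrow> real) set" where
  "W1inf D = {v. continuous_on D v \<and> v \<in> Linf D \<and> (\<exists>g. has_weak_grad D v g \<and> g \<in> Linf D)}"

definition W1inf_norm :: "'a::euclidean_space set \<Rightarrow> ('a \<Rightarrow> real) \<Rightarrow> real" where
  "W1inf_norm D v = max (Linf_norm D v) (Linf_norm D (weak_grad D v))"


section \<open>The parametric coefficient\<close>

text \<open>
  Parameter sequences are indexed from \<open>0\<close>: \<open>y j\<close> stands for \<open>y\<^bsub>j+1\<^esub>\<close>, \<open>\<psi> j\<close> for \<open>\<psi>\<^bsub>j+1\<^esub>\<close>, and
  \<open>{1,\<dots>,s}\<close> becomes \<open>{..<s}\<close>.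
\<close>

definition params :: "(nat \<Rightarrow> real) set" where
  "params = {y. \<forall>j. y j \<in> {-1/2..1/2}}"

definition affine_coeff ::
    "('a \<Rightarrow> real) \<Rightarrow> (nat \<Rightarrow> 'a \<Rightarrow> real) \<Rightarrow> (nat \<Rightarrow> real) \<Rightarrow> 'a \<Rightarrow> real" where
  "affine_coeff a0 \<psi> y x = a0 x + (\<Sum>j. y j * \<psi> j x)"

text \<open>
  Partial derivatives in the parameters of a family of functions on the domain, taken pointwise in
  the domain variable; at the end points of the parameter interval they are one-sided.
\<close>

definition pderiv_param ::
    "nat \<Rightarrow> ((nat \<Rightarrow> real) \<Rightarrow> 'a \<Rightarrow> real) \<Rightarrow> (nat \<Rightarrow> real) \<Rightarrow> 'a \<Rightarrow> real" where
  "pderiv_param j G y x =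
     vector_derivative (\<lambda>t. G (y(j := t)) x) (at (y j) within {-1/2..1/2})"

definition mixed_pderiv ::
    "(nat \<Rightarrow> nat) \<Rightarrow> ((nat \<Rightarrow> real) \<Rightarrow> 'a \<Rightarrow> real) \<Rightarrow> (nat \<Rightarrow> real) \<Rightarrow> 'a \<Rightarrow> real" where
  "mixed_pderiv \<nu> G =
     foldr (\<lambda>j. pderiv_param j ^^ \<nu> j) (sorted_list_of_set {j. \<nu> j \<noteq> 0}) G"

definition multi_binom :: "(nat \<Rightarrow> nat) \<Rightarrow> (nat \<Rightarrow> nat) \<Rightarrow> nat" where
  "multi_binom \<nu> m = (\<Prod>j\<in>{j. \<nu> j \<noteq> 0}. \<nu> j choose m j)"

definition truncated :: "nat \<Rightarrow> ((nat \<Rightarrow> real) \<Rightarrow> 'b) \<Rightarrow> (nat \<Rightarrow> real) \<Rightarrow> 'b" where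
  "truncated s G y = G (\<lambda>j. if j < s then y j else 0)"


section \<open>Polyhedral meshes\<close>

text \<open>
  Points of the hyperplane \<open>n \<bullet> x = c\<close> near which \<open>T\<close> coincides with the half-space
  \<open>n \<bullet> x \<le> c\<close>: these are the boundary points of \<open>T\<close> at which the boundary is flat with outward
  unit normal \<open>n\<close>. A face is the closure of a connected component of such a set; for a convex
  polytope these are the facets (the two end points if the dimension is one).
\<close>

definition flat_points :: "'a::euclidean_space set \<Rightarrow> 'a \<Rightarrow> real \<Rightarrow> 'a set" where
  "flat_points T n c =
     {x. n \<bullet> x = c \<and> (\<exists>e>0. T \<inter> ball x e = {z \<in> ball x e. n \<bullet> z \<le> c})}"

definition faces :: "'a::euclidean_space set \<Rightarrow> 'a set set" where
  "faces T = {closure C | C n c. norm n = 1 \<and> C \<in> components (flat_points T n c)}"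

definition outer_normal :: "'a::euclidean_space set \<Rightarrow> 'a set \<Rightarrow> 'a" where
  "outer_normal T F =
     (THE n. norm n = 1 \<and> (\<exists>c. \<exists>C\<in>components (flat_points T n c). F = closure C))"

text \<open>A (closed, not necessarily convex) polyhedron of full dimension.\<close>

definition polyhedral_element :: "'a::euclidean_space set \<Rightarrow> bool" where
  "polyhedral_element T \<longleftrightarrow>
     compact T \<and> interior T \<noteq> {} \<and> connected (interior T) \<and> T = closure (interior T) \<and>
     finite (faces T) \<and> frontier T = \<Union>(faces T)"

definition polyhedral_mesh :: "'a::euclidean_space set \<Rightarrow> 'a set set \<Rightarrow> bool" where
  "polyhedral_mesh D \<T> \<longleftrightarrow>
     finite \<T> \<and> (\<forall>T\<in>\<T>. polyhedral_element T) \<and> \<Union>\<T> = D \<and>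
     (\<forall>T\<in>\<T>. \<forall>T'\<in>\<T>. T \<noteq> T' \<longrightarrow> interior T \<inter> interior T' = {})"

text \<open>No hanging nodes: every interior face of an element is also a face of a neighbour.\<close>

definition no_hanging_nodes :: "'a::euclidean_space set \<Rightarrow> 'a set set \<Rightarrow> bool" where
  "no_hanging_nodes D \<T> \<longleftrightarrow>
     (\<forall>T\<in>\<T>. \<forall>F\<in>faces T. F \<subseteq> frontier D \<or> (\<exists>T'\<in>\<T>. T' \<noteq> T \<and> F \<in> faces T'))"

definition matching_simplicial_submesh ::
    "'a::euclidean_space set \<Rightarrow> 'a set set \<Rightarrow> 'a set set \<Rightarrow> bool" where
  "matching_simplicial_submesh D \<T> \<S> \<longleftrightarrow>
     triangulation \<S> \<and> (\<forall>S\<in>\<S>. int DIM('a) simplex S) \<and> \<Union>\<S> = D \<and>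
     (\<forall>S\<in>\<S>. \<exists>T\<in>\<T>. S \<subseteq> T)"

definition inradius :: "'a::euclidean_space set \<Rightarrow> real" where
  "inradius S = Sup {r. 0 \<le> r \<and> (\<exists>x. cball x r \<subseteq> S)}"

text \<open>The sequence index takes the role of the mesh parameter \<open>h\<close>.\<close>

definition shape_contact_regular ::
    "'a::euclidean_space set \<Rightarrow> (nat \<Rightarrow> 'a set set) \<Rightarrow> bool" where
  "shape_contact_regular D \<T> \<longleftrightarrow>
     (\<exists>\<rho>1>0. \<exists>\<rho>2>0. \<forall>h. polyhedral_mesh D (\<T> h) \<and> no_hanging_nodes D (\<T> h) \<and>
        (\<exists>\<S>. matching_simplicial_submesh D (\<T> h) \<S> \<and>
           (\<forall>S\<in>\<S>. \<rho>1 * diameter S \<le> inradius S) \<and>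
           (\<forall>S\<in>\<S>. \<forall>T\<in>\<T> h. S \<subseteq> T \<longrightarrow> \<rho>2 * diameter T \<le> diameter S)))"

definition mesh_faces :: "'a::euclidean_space set set \<Rightarrow> 'a set set" where
  "mesh_faces \<T> = (\<Union>T\<in>\<T>. faces T)"

definition adjacent :: "'a::euclidean_space set set \<Rightarrow> 'a set \<Rightarrow> 'a set set" where
  "adjacent \<T> F = {T\<in>\<T>. F \<in> faces T}"

definition face_size :: "'a::euclidean_space set set \<Rightarrow> 'a set \<Rightarrow> real" where
  "face_size \<T> F =
     (if DIM('a) = 1 then Min (diameter ` adjacent \<T> F) else diameter F)"

definition max_faces :: "'a::euclidean_space set set \<Rightarrow> nat" where
  "max_faces \<T> = Max ((\<lambda>T. card (faces T)) ` \<T>)"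

text \<open>
  The surface (codimension one Lebesgue) measure of the hyperplane \<open>n \<bullet> x = c\<close>, \<open>norm n = 1\<close>, is
  the image of Lebesgue measure on the slab of unit thickness above it under orthogonal projection.
  In dimension one it is the unit point mass.
\<close>

definition hyperplane_measure :: "'a::euclidean_space \<Rightarrow> real \<Rightarrow> 'a measure" where
  "hyperplane_measure n c =
     distr (restrict_space lborel {x. c \<le> n \<bullet> x \<and> n \<bullet> x \<le> c + 1}) borel
       (\<lambda>x. x - (n \<bullet> x - c) *\<^sub>R n)"

definition face_measure :: "'a::euclidean_space set \<Rightarrow> 'a measure" where
  "face_measure F =
     (SOME \<mu>. \<exists>n c. norm n = 1 \<and> F \<subseteq> {x. n \<bullet> x = c} \<and> \<mu> = hyperplane_measure n c)"


section \<open>The interior penalty DG method\<close>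

text \<open>\<open>poly_space k\<close>: polynomials of total degree at most \<open>k\<close>.\<close>

definition poly_space :: "nat \<Rightarrow> ('a::euclidean_space \<Rightarrow> real) set" where
  "poly_space k =
     {\<lambda>x. \<Sum>\<alpha>\<in>{\<alpha> \<in> Basis \<rightarrow>\<^sub>E {..k}. (\<Sum>b\<in>Basis. \<alpha> b) \<le> k}. c \<alpha> * (\<Prod>b\<in>Basis. (x \<bullet> b) ^ \<alpha> b) | c. True}"

text \<open>
  Values on the mesh skeleton (a null set) are irrelevant; what happens on faces is always
  expressed by one-sided traces, i.e. limits from the interior of an element.
\<close>

definition DG_space :: "'a::euclidean_space set \<Rightarrow> 'a set set \<Rightarrow> nat \<Rightarrow> ('a \<Rightarrow> real) set" where
  "DG_space D \<T> k =
     {v \<in> L2 D. \<forall>T\<in>\<T>. \<exists>q\<in>poly_space k. \<forall>x\<in>interior T. v x = q x}"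

definition elem_trace :: "'a::euclidean_space set \<Rightarrow> ('a \<Rightarrow> 'b::t2_space) \<Rightarrow> 'a \<Rightarrow> 'b" where
  "elem_trace T v x = Lim (at x within interior T) v"

text \<open>
  A face has two adjacent elements if it is interior and one if it lies on the boundary of the
  domain, so that the following covers both cases.
\<close>

definition average ::
    "'a::euclidean_space set set \<Rightarrow> 'a set \<Rightarrow> ('a \<Rightarrow> 'b::{real_normed_vector}) \<Rightarrow> 'a \<Rightarrow> 'b" where
  "average \<T> F v x =
     (1 / real (card (adjacent \<T> F))) *\<^sub>R (\<Sum>T\<in>adjacent \<T> F. elem_trace T v x)"

definition jump ::
    "'a::euclidean_space set set \<Rightarrow> 'a set \<Rightarrow> ('a \<Rightarrow> real) \<Rightarrow> 'a \<Rightarrow> 'a" where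
  "jump \<T> F v x = (\<Sum>T\<in>adjacent \<T> F. elem_trace T v x *\<^sub>R outer_normal T F)"

text \<open>In the following, \<open>a\<close> is the coefficient at a fixed parameter value.\<close>

definition DG_form ::
    "'a::euclidean_space set set \<Rightarrow> real \<Rightarrow> real \<Rightarrow> ('a \<Rightarrow> real) \<Rightarrow> ('a \<Rightarrow> real) \<Rightarrow> ('a \<Rightarrow> real) \<Rightarrow> real"
  where
  "DG_form \<T> \<theta> \<eta> a w v =
     (\<Sum>T\<in>\<T>. LINT x|lebesgue_on T. a x * (grad w x \<bullet> grad v x)) +
     (\<Sum>F\<in>mesh_faces \<T>. LINT x:F|face_measure F.
        \<theta> * (average \<T> F (\<lambda>x. a x *\<^sub>R grad v x) x \<bullet> jump \<T> F w x)
        - average \<T> F (\<lambda>x. a x *\<^sub>R grad w x) x \<bullet> jump \<T> F v x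
        + \<eta> / face_size \<T> F * (jump \<T> F w x \<bullet> jump \<T> F v x))"

definition DG_norm ::
    "'a::euclidean_space set set \<Rightarrow> real \<Rightarrow> ('a \<Rightarrow> real) \<Rightarrow> ('a \<Rightarrow> real) \<Rightarrow> real" where
  "DG_norm \<T> \<eta> a v = sqrt (
     (\<Sum>T\<in>\<T>. (L2_norm T (\<lambda>x. sqrt (a x) *\<^sub>R grad v x))\<^sup>2) +
     (\<Sum>F\<in>mesh_faces \<T>. \<eta> / face_size \<T> F *
        (LINT x:F|face_measure F. (norm (jump \<T> F v x))\<^sup>2)))"

definition DG_solution ::
    "'a::euclidean_space set \<Rightarrow> 'a set set \<Rightarrow> nat \<Rightarrow> real \<Rightarrow> real \<Rightarrow> ('a \<Rightarrow> real) \<Rightarrow> ('a \<Rightarrow> real)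
     \<Rightarrow> ('a \<Rightarrow> real) \<Rightarrow> bool" where
  "DG_solution D \<T> k \<theta> \<eta> a f w \<longleftrightarrow>
     w \<in> DG_space D \<T> k \<and>
     (\<forall>v\<in>DG_space D \<T> k. DG_form \<T> \<theta> \<eta> a w v = (LINT x|lebesgue_on D. f x * v x))"

definition is_trace_const ::
    "'a::euclidean_space set \<Rightarrow> 'a set set \<Rightarrow> nat \<Rightarrow> real \<Rightarrow> bool" where
  "is_trace_const D \<T> k Ctr \<longleftrightarrow>
     (\<forall>v\<in>DG_space D \<T> k. \<forall>T\<in>\<T>. \<forall>F\<in>faces T.
        sqrt (diameter T) * sqrt (LINT x:F|face_measure F. (elem_trace T v x)\<^sup>2) \<le> Ctr * L2_norm T v)"


section \<open>Randomly shifted lattice rules\<close>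

definition cube_measure :: "nat set \<Rightarrow> (nat \<Rightarrow> real) measure" where
  "cube_measure I = PiM I (\<lambda>_. restrict_space lborel {-1/2..1/2})"

definition cube :: "nat \<Rightarrow> (nat \<Rightarrow> real) set" where
  "cube s = ({..<s} \<rightarrow>\<^sub>E {-1/2..1/2})"

definition shift_measure :: "nat \<Rightarrow> (nat \<Rightarrow> real) measure" where
  "shift_measure s = PiM {..<s} (\<lambda>_. uniform_measure lborel {0..1})"

text \<open>The joint law of \<open>R\<close> independent uniform shifts.\<close>

definition shifts_measure :: "nat \<Rightarrow> nat \<Rightarrow> (nat \<Rightarrow> nat \<Rightarrow> real) measure" where
  "shifts_measure R s = PiM {..<R} (\<lambda>_. shift_measure s)"

definition lattice_point :: "nat \<Rightarrow> nat \<Rightarrow> (nat \<Rightarrow> nat) \<Rightarrow> nat \<Rightarrow> (nat \<Rightarrow> real) \<Rightarrow> nat \<Rightarrow> real" where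
  "lattice_point n s z i \<Delta> =
     (\<lambda>j\<in>{..<s}. frac (frac (real i * real (z j) / real n) + \<Delta> j) - 1/2)"

definition Q_ran ::
    "nat \<Rightarrow> nat \<Rightarrow> nat \<Rightarrow> (nat \<Rightarrow> nat) \<Rightarrow> (nat \<Rightarrow> nat \<Rightarrow> real) \<Rightarrow> ((nat \<Rightarrow> real) \<Rightarrow> real) \<Rightarrow> real" where
  "Q_ran n R s z \<Delta> G =
     1 / (real n * real R) * (\<Sum>i\<in>{1..n}. \<Sum>r<R. G (lattice_point n s z i (\<Delta> r)))"

text \<open>
  \<open>g\<close> is the weak derivative of \<open>G\<close> on the \<open>s\<close>-dimensional cube, once in each of the variables in
  \<open>\<uu>\<close>. It suffices to test with products of univariate test functions, whose span is dense in the
  space of all test functions.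
\<close>

definition has_weak_mixed ::
    "nat \<Rightarrow> nat set \<Rightarrow> ((nat \<Rightarrow> real) \<Rightarrow> real) \<Rightarrow> ((nat \<Rightarrow> real) \<Rightarrow> real) \<Rightarrow> bool" where
  "has_weak_mixed s \<uu> G g \<longleftrightarrow>
     g \<in> borel_measurable (cube_measure {..<s}) \<and>
     integrable (cube_measure {..<s}) (\<lambda>y. (g y)\<^sup>2) \<and>
     (\<forall>\<phi>. (\<forall>j. \<phi> j \<in> test_fun {-1/2..1/2}) \<longrightarrow>
        (LINT y|cube_measure {..<s}.
           G y * (\<Prod>j<s. if j \<in> \<uu> then deriv (\<phi> j) (y j) else \<phi> j (y j))) =
        (-1) ^ card \<uu> * (LINT y|cube_measure {..<s}. g y * (\<Prod>j<s. \<phi> j (y j))))"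

definition weak_mixed :: "nat \<Rightarrow> nat set \<Rightarrow> ((nat \<Rightarrow> real) \<Rightarrow> real) \<Rightarrow> (nat \<Rightarrow> real) \<Rightarrow> real" where
  "weak_mixed s \<uu> G = (SOME g. has_weak_mixed s \<uu> G g)"

text \<open>
  The Sobolev space of dominating mixed smoothness one (continuous representatives, as point
  values enter the cubature rule).
\<close>

definition sobolev_space :: "nat \<Rightarrow> ((nat \<Rightarrow> real) \<Rightarrow> real) set" where
  "sobolev_space s =
     {G. continuous_on (cube s) G \<and> (\<forall>\<uu>\<subseteq>{..<s}. \<exists>g. has_weak_mixed s \<uu> G g)}"

text \<open>
  The squared norm is extended-real valued, so that for a vanishing weight \<open>\<gamma> \<uu> = 0\<close> the usual
  conventions \<open>0 / 0 = 0\<close> and \<open>c / 0 = \<infinity>\<close> for \<open>c > 0\<close> hold.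
\<close>

definition sobolev_norm2 ::
    "nat \<Rightarrow> (nat set \<Rightarrow> real) \<Rightarrow> ((nat \<Rightarrow> real) \<Rightarrow> real) \<Rightarrow> ennreal" where
  "sobolev_norm2 s \<gamma> G =
     (\<Sum>\<uu>\<in>Pow {..<s}.
        (\<integral>\<^sup>+ yu. ennreal ((LINT yc|cube_measure ({..<s} - \<uu>).
             weak_mixed s \<uu> G (merge \<uu> ({..<s} - \<uu>) (yu, yc)))\<^sup>2) \<partial>cube_measure \<uu>)
        / ennreal (\<gamma> \<uu>))"

text \<open>The shift-averaged worst-case error of the rule with generating vector \<open>z\<close>.\<close>

definition shift_avg_wce :: "nat \<Rightarrow> nat \<Rightarrow> (nat set \<Rightarrow> real) \<Rightarrow> (nat \<Rightarrow> nat) \<Rightarrow> real" where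
  "shift_avg_wce n s \<gamma> z = sqrt (LINT \<Delta>|shift_measure s.
     (SUP G\<in>{G \<in> sobolev_space s. sobolev_norm2 s \<gamma> G \<le> 1}.
        ((LINT y|cube_measure {..<s}. G y) - Q_ran n 1 s z (\<lambda>_. \<Delta>) G)\<^sup>2))"

text \<open>\<open>z\<close> is a possible outcome of the CBC algorithm (the minimizers need not be unique).\<close>

definition CBC_vector :: "nat \<Rightarrow> nat \<Rightarrow> (nat set \<Rightarrow> real) \<Rightarrow> (nat \<Rightarrow> nat) \<Rightarrow> bool" where
  "CBC_vector n s \<gamma> z \<longleftrightarrow>
     z 0 = 1 \<and>
     (\<forall>l\<in>{1..<s}.
        z l \<in> {c. 1 \<le> c \<and> c \<le> n - 1 \<and> gcd c n = 1} \<and>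
        (\<forall>c. 1 \<le> c \<and> c \<le> n - 1 \<and> gcd c n = 1 \<longrightarrow>
           shift_avg_wce n (Suc l) \<gamma> z \<le> shift_avg_wce n (Suc l) \<gamma> (z(l := c))))"

definition zeta :: "real \<Rightarrow> real" where
  "zeta x = (\<Sum>k. 1 / real (Suc k) powr x)"

definition rho :: "real \<Rightarrow> real" where
  "rho lam = 2 * zeta (2 * lam) / (2 * pi\<^sup>2) powr lam"

definition QMC_weight :: "(nat \<Rightarrow> real) \<Rightarrow> real \<Rightarrow> nat set \<Rightarrow> real" where
  "QMC_weight b lam \<uu> = (fact (card \<uu>) * (\<Prod>j\<in>\<uu>. b j / sqrt (rho lam))) powr (2 / (1 + lam))"

text \<open>
  Root mean square \<open>L\<^sup>2(D)\<close> error for an integrand \<open>G\<close> with values in \<open>L\<^sup>2(D)\<close>; the integral over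
  the parameters and the cubature rule are evaluated pointwise in the domain variable.
\<close>

definition QMC_rms_error ::
    "'a::euclidean_space set \<Rightarrow> nat \<Rightarrow> nat \<Rightarrow> nat \<Rightarrow> (nat \<Rightarrow> nat) \<Rightarrow> ((nat \<Rightarrow> real) \<Rightarrow> 'a \<Rightarrow> real) \<Rightarrow> real"
  where
  "QMC_rms_error D n R s z G = sqrt (LINT \<Delta>|shifts_measure R s.
     (L2_norm D (\<lambda>x. (LINT y|cube_measure {..<s}. G y x) - Q_ran n R s z \<Delta> (\<lambda>y. G y x)))\<^sup>2)"

end

theory Submission
 imports Defs
begin

text \<open>
 Two ingredients are combined. First, the worst-case error of a shifted rule over the unit ball of
 the Sobolev space is computed exactly: every function of the space is represented through its weak
 mixed derivatives and the kernel \<open>kern\<close>, the representer of the cubature error attains the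
 Cauchy-Schwarz bound, and averaging over the shift turns the kernel products into products of the
 Bernoulli polynomial \<open>bern2\<close>. So the CBC algorithm minimizes an explicit sum over subsets, and
 averaging its \<open>lam\<close>-th power over the odd candidates \<open>z l\<close> (Jensen's inequality and the decay of the
 discrete Fourier coefficients of \<open>bern2\<close>) yields the rate \<open>n powr (- 1 / lam)\<close>.

 Second, for truncated parameters the Galerkin system is finite, its matrix is affine in the
 parameters, and coercivity makes it positive definite on the parameter box. By Gaussian elimination
 the coefficients of the solution in a basis of the DG space are rational functions of the
 parameters without poles in the box, hence smooth. The recursion for the parametric derivatives,
 in which only first derivatives of the affine coefficient survive, bounds their mixed first
 derivatives by \<open>A * fact (card u) * (\<Prod>j\<in>u. \<alpha> * b j)\<close> with \<open>A\<close> independent of the dimension; for the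
 given weights all sums over subsets are then bounded uniformly in the dimension. The
 \<open>L\<^sup>2(D)\<close> error follows coefficientwise from the scalar case, with a constant that depends on the mesh.
\<close>

section \<open>Smooth test functions\<close>

text \<open>The CBC algorithm compares suprema over a Sobolev unit ball, so an upper bound for the
  worst-case error is of no use: the supremum must be computed exactly, with a function attaining
  it. Derivatives in that space are weak and \<open>weak_mixed\<close> is an arbitrary choice among
  them; hence the explicit test functions, a pointwise representation and uniqueness almost
  everywhere.

  The averaging argument produces the constant \<open>kap lam\<close>, not \<open>rho lam\<close>.
  The discrepancy is one factor per coordinate, and it is harmless: the factorials enter the subset
  sums with a power \<open>q < 1\<close>, so these sums stay bounded for every summable sequence,
  however large.

  The derivative recursion controls the DG norm, whereas the cubature theory is scalar. The passage
  to coefficients is an equivalence of norms in finite dimension and rests on definiteness of the DG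
  norm: a function that is constant on every element and has no jumps must vanish, on meshes of
  possibly nonconvex polyhedra. This is shown along a segment leading out of the domain that never
  meets two different face hyperplanes in one point.\<close>

lemmas B_integral_cong = Bochner_Integration.integral_cong
lemmas B_integral_sum = Bochner_Integration.integral_sum
lemmas B_integrable_sum = Bochner_Integration.integrable_sum
lemmas B_integral_diff = Bochner_Integration.integral_diff
lemmas mult_arg_cong = arg_cong2[of _ _ _ _ "(*)"]

text \<open>The empty set is left out because its term in the cubature error cancels: constants are
  integrated exactly.\<close>

abbreviation "PowN s \<equiv> Pow {..<s :: nat} - {{}}"

abbreviation "lat n z i j \<equiv> real i * real (z j) / real n"

abbreviation "cubeM s \<equiv> cube_measure {..<s}"

abbreviation "qerr n R s z \<Delta> f \<equiv> (LINT y|cubeM s. f y) - Q_ran n R s z \<Delta> f"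

text \<open>The classical flat function exp (-1/x), multiplied by a polynomial in 1/x so that the
  family is closed under differentiation.\<close>

definition flat_exp :: "real poly \<Rightarrow> real \<Rightarrow> real" where
 "flat_exp P x = (if x > 0 then poly P (1 / x) * exp (- (1 / x)) else 0)"

lemma poly_div_exp_at_top: "((\<lambda>t::real. poly P t * exp (- t)) \<longlongrightarrow> 0) at_top"
proof -
 have "((\<lambda>t. \<Sum>i\<le>degree P. coeff P i * (t ^ i / exp t)) \<longlongrightarrow> (\<Sum>i\<le>degree P. coeff P i * 0)) at_top"
  by (intro tendsto_sum tendsto_mult tendsto_const tendsto_power_div_exp_0)
 then show ?thesis
  by (simp add: poly_altdef sum_distrib_right exp_minus divide_inverse mult.assoc)
qed

text \<open>With t = 1/x the derivative of P(t) exp (-t) with respect to x is t^2 (P - P')(t) exp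
  (-t), and \<open>[:0, 0, 1:]\<close> is the polynomial t^2. At the origin the difference quotients
  are themselves polynomials in t times exp (-t).\<close>

lemma flat_exp_deriv:
 "(flat_exp P has_real_derivative flat_exp ([:0, 0, 1:] * (P - pderiv P)) x) (at x)"
proof -
 consider "x > 0" | "x < 0" | "x = 0" by linarith
 then show ?thesis
 proof cases
  case 1
  have "((\<lambda>x. poly P (1 / x) * exp (- (1 / x))) has_real_derivative
    poly ([:0, 0, 1:] * (P - pderiv P)) (1 / x) * exp (- (1 / x))) (at x)"
   using 1 by (auto intro!: derivative_eq_intros DERIV_chain'[OF _ poly_DERIV]
     simp: power2_eq_square field_simps)
  then show ?thesis
   using 1 by (subst DERIV_cong_ev[OF refl _ refl, of _ "\<lambda>x. poly P (1 / x) * exp (- (1 / x))"])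
    (auto simp: flat_exp_def intro!: eventually_mono[OF eventually_nhds_in_open[of "{0<..}"]])
 next
  case 2
  then show ?thesis
   by (subst DERIV_cong_ev[OF refl _ refl, of _ "\<lambda>x. 0"])
    (auto simp: flat_exp_def intro!: eventually_mono[OF eventually_nhds_in_open[of "{..<0}"]])
 next
  case 3
  have "((\<lambda>h. flat_exp P h / h) \<longlongrightarrow> 0) (at_right 0)"
  proof -
   \<comment> \<open>Division by \<open>h\<close> multiplies by \<open>1 / h\<close>, which
     \<open>pCons 0 P\<close> absorbs into the polynomial.\<close>
   have "((\<lambda>h::real. poly (pCons 0 P) (inverse h) * exp (- (inverse h))) \<longlongrightarrow> 0) (at_right 0)"
    by (rule filterlim_compose[OF poly_div_exp_at_top filterlim_inverse_at_top_right])
   then show ?thesis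
    by (rule Lim_transform_eventually)
     (auto simp: eventually_at_filter flat_exp_def divide_simps)
  qed
  moreover have "((\<lambda>h. flat_exp P h / h) \<longlongrightarrow> 0) (at_left 0)"
   by (rule Lim_transform_eventually[OF tendsto_const])
    (auto simp: eventually_at_filter flat_exp_def)
  ultimately have "((\<lambda>h. flat_exp P h / h) \<longlongrightarrow> 0) (at 0)"
   by (intro filterlim_split_at)
  then show ?thesis using 3 by (simp add: DERIV_def flat_exp_def)
 qed
qed

text \<open>\<open>smooth\<close> asks for all iterated derivatives at once. A class in which every
  member has a derivative that is again a member supplies them by iteration.\<close>

inductive_set smooth_gen :: "(real \<Rightarrow> real) set" where
 flat: "(\<lambda>x. flat_exp P (a * x + b)) \<in> smooth_gen"
| const: "(\<lambda>x. c) \<in> smooth_gen"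
| add: "f \<in> smooth_gen \<Longrightarrow> g \<in> smooth_gen \<Longrightarrow> (\<lambda>x. f x + g x) \<in> smooth_gen"
| mult: "f \<in> smooth_gen \<Longrightarrow> g \<in> smooth_gen \<Longrightarrow> (\<lambda>x. f x * g x) \<in> smooth_gen"

lemma smooth_gen_deriv:
 "f \<in> smooth_gen \<Longrightarrow> \<exists>g\<in>smooth_gen. \<forall>x. (f has_real_derivative g x) (at x)"
proof (induction rule: smooth_gen.induct)
 case (flat P a b)
 have "((\<lambda>x. flat_exp P (a * x + b)) has_real_derivative
   flat_exp ([:0, 0, 1:] * (P - pderiv P)) (a * x + b) * a) (at x)" for x
  by (rule DERIV_chain'[OF _ flat_exp_deriv]) (auto intro!: derivative_eq_intros)
 then show ?case
  by (intro bexI[of _ "\<lambda>x. flat_exp ([:0, 0, 1:] * (P - pderiv P)) (a * x + b) * a"])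
   (auto intro: smooth_gen.intros)
next
 case (const c)
 show ?case by (rule bexI[of _ "\<lambda>x. 0"]) (auto intro: smooth_gen.intros)
next
 case (add f g)
 then obtain f' g' where "f' \<in> smooth_gen" "g' \<in> smooth_gen"
  "\<forall>x. (f has_real_derivative f' x) (at x)" "\<forall>x. (g has_real_derivative g' x) (at x)" by blast
 then show ?case
  by (intro bexI[of _ "\<lambda>x. f' x + g' x"]) (auto intro: smooth_gen.intros DERIV_add)
next
 case (mult f g)
 then obtain f' g' where "f' \<in> smooth_gen" "g' \<in> smooth_gen"
  "\<forall>x. (f has_real_derivative f' x) (at x)" "\<forall>x. (g has_real_derivative g' x) (at x)" by blast
 then show ?case using mult
  by (intro bexI[of _ "\<lambda>x. f' x * g x + g' x * f x"]) (auto intro: smooth_gen.intros DERIV_mult)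
qed

text \<open>The only basis vector of the real line is 1, so the list of directions matters only
  through its length.\<close>

lemma smooth_realI:
 assumes "\<And>n x. (F n has_real_derivative F (Suc n) x) (at x)"
 shows "smooth (F 0)"
 unfolding smooth_def
proof (intro exI[of _ "\<lambda>w. F (length w)"] conjI allI)
 fix w :: "real list" and x :: real
 have "(\<lambda>v. \<Sum>b\<in>Basis. (v \<bullet> b) * F (length (b # w)) x) = (*) (F (Suc (length w)) x)"
  by (rule ext) simp
 then show "(F (length w) has_derivative (\<lambda>v. \<Sum>b\<in>Basis. (v \<bullet> b) * F (length (b # w)) x)) (at x)"
  using assms[of "length w" x] unfolding has_field_derivative_def by (simp only:)
qed simp

lemma smooth_realD:
 fixes f :: "real \<Rightarrow> real"
 assumes "smooth f"
 shows "\<exists>F. F 0 = f \<and> (\<forall>n x. (F n has_real_derivative F (Suc n) x) (at x))"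
proof -
 obtain \<Phi> where "\<Phi> [] = f"
  "\<And>w x. (\<Phi> w has_derivative (\<lambda>v. \<Sum>b\<in>Basis. (v \<bullet> b) * \<Phi> (b # w) x)) (at x)"
  using assms unfolding smooth_def by blast
 then show ?thesis
  by (intro exI[of _ "\<lambda>n. \<Phi> (replicate n 1)"])
   (auto simp: has_field_derivative_def mult_commute_abs)
qed

lemma smooth_gen_smooth: "f \<in> smooth_gen \<Longrightarrow> smooth f"
proof -
 assume f: "f \<in> smooth_gen"
 define nx where "nx g = (SOME g'. g' \<in> smooth_gen \<and> (\<forall>x. (g has_real_derivative g' x) (at x)))" for g :: "real \<Rightarrow> real"
 have nx: "nx g \<in> smooth_gen \<and> (\<forall>x. (g has_real_derivative nx g x) (at x))" if "g \<in> smooth_gen" for g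
  using someI_ex[OF smooth_gen_deriv[OF that, unfolded Bex_def]] unfolding nx_def .
 have "(nx ^^ n) f \<in> smooth_gen" for n by (induction n) (auto simp: f nx)
 then have "smooth ((nx ^^ 0) f)" by (intro smooth_realI) (simp add: nx)
 then show ?thesis by simp
qed

text \<open>The sequence of derivatives is shifted by one place; this is applied to the primitives
  \<open>cumul\<close>.\<close>

lemma smooth_real_antideriv:
 fixes f g :: "real \<Rightarrow> real"
 assumes "smooth f" "\<And>x. (g has_real_derivative f x) (at x)"
 shows "smooth g"
proof -
 obtain F where F: "F 0 = f" "\<And>n x. (F n has_real_derivative F (Suc n) x) (at x)"
  using smooth_realD[OF assms(1)] by blast
 have "smooth (case_nat g F 0)"
  by (rule smooth_realI) (auto split: nat.split simp: F assms)
 then show ?thesis by simp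
qed

text \<open>For \<open>c > 0\<close> it is positive exactly on the open interval from
  \<open>a\<close> to \<open>b\<close>. The parameter \<open>c\<close> is the steepness: as it tends
  to 0 the bump tends to 1 inside.\<close>

definition bump :: "real \<Rightarrow> real \<Rightarrow> real \<Rightarrow> real \<Rightarrow> real" where
 "bump a b c x = flat_exp 1 ((x - a) / c) * flat_exp 1 ((b - x) / c)"

lemma bump_smooth_gen: "bump a b c \<in> smooth_gen"
proof -
 have "(\<lambda>x. flat_exp 1 ((1/c) * x + (- a/c)) * flat_exp 1 ((-1/c) * x + b/c)) \<in> smooth_gen"
  by (intro smooth_gen.intros)
 then show ?thesis unfolding bump_def by (simp add: diff_divide_distrib algebra_simps)
qed

lemma smooth_real_continuous: "smooth (f :: real \<Rightarrow> real) \<Longrightarrow> continuous_on A f"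
 using smooth_realD[of f] by (metis DERIV_isCont continuous_at_imp_continuous_on)

lemma flat_exp_1: "0 \<le> flat_exp 1 x" "flat_exp 1 x \<le> 1" "flat_exp 1 x = 0 \<longleftrightarrow> x \<le> 0"
 by (auto simp: flat_exp_def)

lemma bump_bounds: "0 \<le> bump a b c x" "bump a b c x \<le> 1"
 unfolding bump_def using flat_exp_1 by (auto intro: mult_le_one)

lemma bump_eq_0: "c > 0 \<Longrightarrow> bump a b c x = 0 \<longleftrightarrow> x \<le> a \<or> b \<le> x"
 unfolding bump_def by (auto simp: flat_exp_1 divide_le_0_iff)

abbreviation "tests \<equiv> test_fun {-1/2..1/2 :: real}"

abbreviation "unif \<equiv> uniform_measure lborel {0..1 :: real}"

lemma bump_test_fun:
 assumes "-1/2 < a" "b < 1/2" "c > 0"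
 shows "bump a b c \<in> tests"
proof -
 have "compact {a..b} \<and> {a..b} \<subseteq> interior {-1/2..1/2} \<and> (\<forall>x. x \<notin> {a..b} \<longrightarrow> bump a b c x = 0)"
  using assms by (auto simp: bump_eq_0)
 then show ?thesis unfolding test_fun_def using bump_smooth_gen smooth_gen_smooth by blast
qed

section \<open>Lebesgue measure on the centred unit interval and primitives of test
  functions\<close>

definition unit_leb :: "real measure" where
 "unit_leb = restrict_space lborel {-1/2..1/2}"

lemma space_unit_leb: "space unit_leb = {-1/2..1/2}"
 by (simp add: unit_leb_def space_restrict_space)

lemma prob_space_unit_leb: "prob_space unit_leb"
 by (rule prob_spaceI) (simp add: unit_leb_def space_restrict_space emeasure_restrict_space)

lemma unit_leb_measurable: "f \<in> borel_measurable borel \<Longrightarrow> f \<in> borel_measurable unit_leb"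
 unfolding unit_leb_def by (rule measurable_restrict_space1) simp

lemma unit_leb_integral:
 fixes f :: "real \<Rightarrow> real"
 shows "(LINT x|unit_leb. f x) = (LINT x:{-1/2..1/2}|lborel. f x)"
 unfolding set_lebesgue_integral_def unit_leb_def by (subst integral_restrict_space) auto

definition cumul :: "(real \<Rightarrow> real) \<Rightarrow> real \<Rightarrow> real" where
 "cumul \<phi> y = (LINT x|unit_leb. \<phi> x * indicator {..y} x)"

lemma test_fun_realD:
 assumes "\<phi> \<in> test_fun {-1/2..1/2::real}"
 shows "\<exists>a b. -1/2 < a \<and> a \<le> b \<and> b < 1/2 \<and> (\<forall>x. x < a \<or> b < x \<longrightarrow> \<phi> x = 0)"
proof -
 obtain K where K: "compact K" "K \<subseteq> {-1/2<..<1/2}" "\<And>x. x \<notin> K \<Longrightarrow> \<phi> x = 0"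
  using assms unfolding test_fun_def by auto
 show ?thesis
 proof (cases "K = {}")
  case True
  then show ?thesis using K by (intro exI[of _ 0]) auto
 next
  case False
  obtain a b where ab: "a \<in> K" "\<And>x. x \<in> K \<Longrightarrow> a \<le> x" "b \<in> K" "\<And>x. x \<in> K \<Longrightarrow> x \<le> b"
   using compact_attains_inf[OF K(1) False] compact_attains_sup[OF K(1) False] by auto
  have "\<phi> x = 0" if "x < a \<or> b < x" for x
   using K(3)[of x] ab(2)[of x] ab(4)[of x] that by fastforce
  moreover have "-1/2 < a" "b < 1/2" "a \<le> b" using ab K(2) by auto
  ultimately show ?thesis by blast
 qed
qed

lemma test_funI:
 fixes \<phi> :: "real \<Rightarrow> real"
 assumes "smooth \<phi>" "-1/2 < a" "b < 1/2" "\<And>x. x < a \<or> b < x \<Longrightarrow> \<phi> x = 0"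
 shows "\<phi> \<in> tests"
proof -
 have "compact {a..b} \<and> {a..b} \<subseteq> interior {-1/2..1/2} \<and> (\<forall>x. x \<notin> {a..b} \<longrightarrow> \<phi> x = 0)"
  using assms(2,3) by (auto intro!: assms(4))
 then show ?thesis unfolding test_fun_def using assms(1) by blast
qed

lemma test_fun_continuous: "\<phi> \<in> test_fun {-1/2..1/2::real} \<Longrightarrow> continuous_on A \<phi>"
 unfolding test_fun_def using smooth_real_continuous by blast

text \<open>The lower limit \<open>B\<close> is left free so that any given \<open>y\<close> can be
  made an interior point before the fundamental theorem is applied.\<close>

lemma cumul_eq_integral:
 assumes "\<phi> \<in> tests" "B \<le> -1/2"
 shows "cumul \<phi> y = integral {B..y} \<phi>"
proof -
 obtain a b where ab: "-1/2 < a" "a \<le> b" "b < 1/2" "\<And>x. x < a \<or> b < x \<Longrightarrow> \<phi> x = 0"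
  using test_fun_realD[OF assms(1)] by blast
 have "cumul \<phi> y = (LINT x:{B..y}|lborel. \<phi> x)"
  unfolding cumul_def unit_leb_integral set_lebesgue_integral_def
 proof (intro B_integral_cong refl)
  fix x show "indicator {-1/2..1/2} x *\<^sub>R (\<phi> x * indicator {..y} x) = indicator {B..y} x *\<^sub>R \<phi> x"
   using ab(1-3) ab(4)[of x] assms(2) by (cases "x < a \<or> b < x") (auto simp: indicator_def)
 qed
 also have "\<dots> = integral {B..y} \<phi>"
  using borel_integrable_atLeastAtMost'[OF test_fun_continuous[OF assms(1)], of B y]
  by (intro set_borel_integral_eq_integral) auto
 finally show ?thesis .
qed

lemma cumul_deriv:
 assumes "\<phi> \<in> tests"
 shows "(cumul \<phi> has_real_derivative \<phi> y) (at y)"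
proof -
 define B where "B = min (y - 1) (-1/2)"
 have "((\<lambda>u. integral {B..u} \<phi>) has_real_derivative \<phi> y) (at y within {B..y+1})"
  by (rule integral_has_real_derivative) (auto simp: B_def test_fun_continuous[OF assms])
 then have "((\<lambda>u. integral {B..u} \<phi>) has_real_derivative \<phi> y) (at y)"
  by (subst (asm) at_within_interior) (auto simp: B_def)
 moreover have "cumul \<phi> = (\<lambda>u. integral {B..u} \<phi>)"
  by (rule ext, rule cumul_eq_integral[OF assms]) (simp add: B_def)
 ultimately show ?thesis by simp
qed

text \<open>To the right of the support the primitive equals the total integral, so mean zero is
  what gives it compact support.\<close>

lemma cumul_test_fun:
 assumes "\<phi> \<in> tests" "(LINT x|unit_leb. \<phi> x) = 0"
 shows "cumul \<phi> \<in> tests"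
proof -
 obtain a b where ab: "-1/2 < a" "a \<le> b" "b < 1/2" "\<And>x. x < a \<or> b < x \<Longrightarrow> \<phi> x = 0"
  using test_fun_realD[OF assms(1)] by blast
 have "smooth (cumul \<phi>)"
  using assms(1) cumul_deriv[OF assms(1)] smooth_real_antideriv unfolding test_fun_def by blast
 moreover have "cumul \<phi> x = 0" if "x < a \<or> b < x" for x
 proof (cases "x < a")
  case True
  then have "(\<lambda>t. \<phi> t * indicator {..x} t) = (\<lambda>t. 0)" using ab by (force simp: indicator_def)
  then show ?thesis by (simp only: cumul_def Bochner_Integration.integral_zero)
 next
  case False
  with that have "(\<lambda>t. \<phi> t * indicator {..x} t) = \<phi>" using ab by (force simp: indicator_def)
  then show ?thesis by (simp only: cumul_def assms(2))
 qed
 ultimately show ?thesis using ab by (intro test_funI)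
qed

lemma test_fun_diff:
 fixes f g :: "real \<Rightarrow> real"
 assumes "f \<in> tests" "g \<in> tests"
 shows "(\<lambda>x. c * f x + d * g x) \<in> tests"
proof -
 obtain a b where ab: "-1/2 < a" "a \<le> b" "b < 1/2" "\<And>x. x < a \<or> b < x \<Longrightarrow> f x = 0"
  using test_fun_realD[OF assms(1)] by blast
 obtain a' b' where ab': "-1/2 < a'" "a' \<le> b'" "b' < 1/2" "\<And>x. x < a' \<or> b' < x \<Longrightarrow> g x = 0"
  using test_fun_realD[OF assms(2)] by blast
 obtain F where F: "F 0 = f" "\<And>n x. (F n has_real_derivative F (Suc n) x) (at x)"
  using assms(1) smooth_realD unfolding test_fun_def by blast
 obtain G where G: "G 0 = g" "\<And>n x. (G n has_real_derivative G (Suc n) x) (at x)"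
  using assms(2) smooth_realD unfolding test_fun_def by blast
 have "smooth ((\<lambda>n x. c * F n x + d * G n x) 0)"
  by (rule smooth_realI) (auto intro!: derivative_eq_intros F G)
 then show ?thesis using ab ab'
  by (intro test_funI[of _ "min a a'" "max b b'"]) (auto simp: F G)
qed

lemma bounded_integrable_unit_leb:
 fixes f :: "real \<Rightarrow> real"
 assumes "f \<in> borel_measurable borel" "\<And>x. x \<in> {-1/2..1/2} \<Longrightarrow> \<bar>f x\<bar> \<le> C"
 shows "integrable unit_leb f"
proof -
 interpret prob_space unit_leb by (rule prob_space_unit_leb)
 show ?thesis
 proof (rule integrable_const_bound[of _ C])
  show "f \<in> borel_measurable unit_leb" by (rule unit_leb_measurable[OF assms(1)])
 qed (auto intro!: AE_I2 assms(2) simp: space_unit_leb)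
qed

lemma test_fun_measurable: "\<phi> \<in> test_fun {-1/2..1/2::real} \<Longrightarrow> \<phi> \<in> borel_measurable borel"
 by (intro borel_measurable_continuous_onI test_fun_continuous)

lemma integrable_mult_bounded_real:
 fixes f g :: "'a \<Rightarrow> real"
 assumes "integrable M g" "f \<in> borel_measurable M" "\<And>x. x \<in> space M \<Longrightarrow> \<bar>f x\<bar> \<le> C"
 shows "integrable M (\<lambda>x. g x * f x)"
proof (rule Bochner_Integration.integrable_bound[of _ "\<lambda>x. C * g x"])
 show "(\<lambda>x. g x * f x) \<in> borel_measurable M" using assms by auto
 show "AE x in M. norm (g x * f x) \<le> norm (C * g x)"
 proof (rule AE_I2)
  fix x assume "x \<in> space M"
  then have "\<bar>f x\<bar> \<le> \<bar>C\<bar>" using assms(3)[of x] by linarith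
  from mult_left_mono[OF this, of "\<bar>g x\<bar>"] show "norm (g x * f x) \<le> norm (C * g x)"
   by (simp add: abs_mult mult.commute)
 qed
qed (use assms in simp)

lemma unit_leb_mult_indicator_integrable:
 fixes f :: "real \<Rightarrow> real"
 assumes "integrable unit_leb f"
 shows "integrable unit_leb (\<lambda>x. f x * indicator {..y} x)"
 by (rule integrable_mult_bounded_real[OF assms, of _ 1])
  (auto intro!: unit_leb_measurable[OF borel_measurable_indicator] simp: indicator_le_1)

lemma cumul_bounds:
 assumes "\<And>x. 0 \<le> \<phi> x" "integrable unit_leb \<phi>" "(LINT x|unit_leb. \<phi> x) = 1"
 shows "0 \<le> cumul \<phi> y" "cumul \<phi> y \<le> 1"
proof -
 have i: "integrable unit_leb (\<lambda>x. \<phi> x * indicator {..y} x)"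
  by (rule unit_leb_mult_indicator_integrable[OF assms(2)])
 show "0 \<le> cumul \<phi> y" unfolding cumul_def by (rule integral_nonneg_AE) (simp add: assms)
 have "cumul \<phi> y \<le> (LINT x|unit_leb. \<phi> x)"
  unfolding cumul_def by (intro integral_mono i assms) (simp add: indicator_def assms)
 then show "cumul \<phi> y \<le> 1" unfolding assms(3) .
qed

text \<open>A bump of integral one; on shrinking intervals these approximate a point mass.\<close>

definition nbump :: "real \<Rightarrow> real \<Rightarrow> real \<Rightarrow> real \<Rightarrow> real" where
 "nbump a b c x = bump a b c x / (LINT x|unit_leb. bump a b c x)"

lemma bump_measurable: "bump a b c \<in> borel_measurable borel"
 using bump_smooth_gen smooth_gen_smooth smooth_real_continuous
 by (intro borel_measurable_continuous_onI) blast

text \<open>Otherwise the nonnegative bump would vanish almost everywhere, although it is positive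
  on an interval of positive length.\<close>

lemma bump_integral_pos:
 assumes "-1/2 < a" "a < b" "b < 1/2" "c > 0"
 shows "(LINT x|unit_leb. bump a b c x) > 0"
proof -
 have int: "integrable unit_leb (bump a b c)"
  by (rule bounded_integrable_unit_leb[of _ 1]) (auto simp: bump_measurable bump_bounds abs_le_iff order_trans[OF _ bump_bounds(1)])
 have "(LINT x|unit_leb. bump a b c x) \<noteq> 0"
 proof
  assume "(LINT x|unit_leb. bump a b c x) = 0"
  then have "AE x in unit_leb. bump a b c x = 0"
   by (subst (asm) integral_nonneg_eq_0_iff_AE[OF int]) (auto simp: bump_bounds)
  then have "AE x in lborel. x \<in> {-1/2..1/2} \<longrightarrow> bump a b c x = 0"
   unfolding unit_leb_def by (subst (asm) AE_restrict_space_iff) auto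
  then have "AE x in lborel. x \<notin> {a<..<b}"
  proof (rule AE_mp, intro AE_I2 impI notI)
   fix x assume "x \<in> {-1/2..1/2} \<longrightarrow> bump a b c x = 0" "x \<in> {a<..<b}"
   then show False using assms bump_eq_0[of c a b x] by auto
  qed
  then have "emeasure lborel {x \<in> space lborel. \<not> x \<notin> {a<..<b}} = 0"
   by (subst (asm) AE_iff_measurable[OF _ refl]) auto
  moreover have "{x \<in> space lborel. \<not> x \<notin> {a<..<b}} = {a<..<b}" by auto
  ultimately show False using assms by simp
 qed
 moreover have "(LINT x|unit_leb. bump a b c x) \<ge> 0"
  by (rule integral_nonneg_AE) (simp add: bump_bounds)
 ultimately show ?thesis by linarith
qed

lemma nbump:
 assumes "-1/2 < a" "a < b" "b < 1/2" "c > 0"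
 shows "nbump a b c \<in> tests" "nbump a b c x \<ge> 0" "(LINT x|unit_leb. nbump a b c x) = 1"
  "x \<le> a \<or> b \<le> x \<Longrightarrow> nbump a b c x = 0"
proof -
 note p = bump_integral_pos[OF assms]
 show "nbump a b c \<in> tests"
  using test_fun_diff[OF bump_test_fun bump_test_fun, of a b c a b c "inverse (LINT x|unit_leb. bump a b c x)" 0,
    OF assms(1,3,4,1,3,4)]
  unfolding nbump_def[abs_def] divide_inverse by (simp add: mult.commute)
 show "nbump a b c x \<ge> 0" unfolding nbump_def using bump_bounds p by simp
 show "(LINT x|unit_leb. nbump a b c x) = 1" unfolding nbump_def using p by simp
 show "x \<le> a \<or> b \<le> x \<Longrightarrow> nbump a b c x = 0" unfolding nbump_def using assms by (simp add: bump_eq_0)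
qed

section \<open>The uniform measure on the cube\<close>

lemma space_cube_measure: "space (cubeM s) = cube s"
 unfolding cube_measure_def unit_leb_def[symmetric] space_PiM cube_def space_unit_leb ..

lemma prob_space_cube_measure: "prob_space (cube_measure I)"
 unfolding cube_measure_def unit_leb_def[symmetric] by (intro prob_space_PiM prob_space_unit_leb)

lemma product_prob_space_unit_leb: "product_prob_space (\<lambda>_::nat. unit_leb)"
 by (intro product_prob_spaceI prob_space_unit_leb)

lemma cube_component_measurable:
 assumes "j \<in> I" shows "(\<lambda>y. y j) \<in> borel_measurable (cube_measure I)"
proof -
 have "(\<lambda>y. y j) \<in> measurable (cube_measure I) unit_leb"
  unfolding cube_measure_def unit_leb_def[symmetric] using assms by (rule measurable_component_singleton)
 moreover have "(\<lambda>x. x) \<in> measurable unit_leb borel"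
  by (rule unit_leb_measurable) simp
 ultimately show ?thesis by (rule measurable_compose)
qed

text \<open>Continuity refers to the product topology on all sequences. Points of the cube are
  constantly \<open>undefined\<close> from index \<open>s\<close> on, so every coordinate, also a
  high one, is measurable.\<close>

lemma continuous_cube_measurable:
 fixes G :: "(nat \<Rightarrow> real) \<Rightarrow> real"
 assumes "continuous_on (cube s) G"
 shows "G \<in> borel_measurable (cubeM s)"
proof -
 have "(\<lambda>y. y i) \<in> borel_measurable (cubeM s)" for i
 proof (cases "i < s")
  case True
  then show ?thesis by (intro cube_component_measurable) simp
 next
  case False
  have "(\<lambda>y. undefined :: real) \<in> borel_measurable (cubeM s)" by simp
  then show ?thesis
   by (rule measurable_cong[THEN iffD1, rotated])
    (use False in \<open>auto simp: space_cube_measure cube_def PiE_def extensional_def\<close>)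
 qed
 then have "(\<lambda>y. y) \<in> measurable (cubeM s) borel"
  by (rule measurable_coordinatewise_then_product)
 then have "(\<lambda>y. y) \<in> measurable (cubeM s) (restrict_space borel (cube s))"
  by (intro measurable_restrict_space2) (auto simp: space_cube_measure)
 from measurable_compose[OF this borel_measurable_continuous_on_restrict[OF assms]]
 show ?thesis .
qed

text \<open>Tychonoff's theorem, once the coordinates from \<open>s\<close> on are regarded as
  ranging over the single value \<open>undefined\<close>.\<close>

lemma compact_cube: "compact (cube s)"
proof -
 have eq: "cube s = PiE UNIV (\<lambda>j. if j < s then {-1/2..1/2} else {undefined})"
  unfolding cube_def by (auto simp: PiE_def Pi_def extensional_def split: if_splits)
 have "compactin (product_topology (\<lambda>i. euclidean) UNIV) (cube s)"
  unfolding eq by (subst compactin_PiE) auto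
 then show ?thesis by (simp add: euclidean_product_topology)
qed

lemma continuous_cube_bounded:
 fixes G :: "(nat \<Rightarrow> real) \<Rightarrow> real"
 assumes "continuous_on (cube s) G"
 shows "\<exists>C. \<forall>y\<in>cube s. \<bar>G y\<bar> \<le> C"
 using compact_imp_bounded[OF compact_continuous_image[OF assms compact_cube]]
 unfolding bounded_iff by auto

lemma continuous_cube_integrable:
 fixes G :: "(nat \<Rightarrow> real) \<Rightarrow> real"
 assumes "continuous_on (cube s) G"
 shows "integrable (cubeM s) G"
proof -
 interpret prob_space "cubeM s" by (rule prob_space_cube_measure)
 obtain C where "\<forall>y\<in>cube s. \<bar>G y\<bar> \<le> C" using continuous_cube_bounded[OF assms] by blast
 then show ?thesis
  by (intro integrable_const_bound[of _ C] AE_I2 continuous_cube_measurable assms)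
   (auto simp: space_cube_measure)
qed

lemma cube_integral_prod:
 fixes f :: "nat \<Rightarrow> real \<Rightarrow> real"
 assumes "finite I" "\<And>i. i \<in> I \<Longrightarrow> integrable unit_leb (f i)"
 shows "(LINT y|cube_measure I. (\<Prod>i\<in>I. f i (y i))) = (\<Prod>i\<in>I. LINT x|unit_leb. f i x)"
  and "integrable (cube_measure I) (\<lambda>y. \<Prod>i\<in>I. f i (y i))"
proof -
 interpret product_prob_space "\<lambda>_::nat. unit_leb" by (rule product_prob_space_unit_leb)
 show "(LINT y|cube_measure I. (\<Prod>i\<in>I. f i (y i))) = (\<Prod>i\<in>I. LINT x|unit_leb. f i x)"
  unfolding cube_measure_def unit_leb_def[symmetric] by (rule product_integral_prod[OF assms])
 show "integrable (cube_measure I) (\<lambda>y. \<Prod>i\<in>I. f i (y i))"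
  unfolding cube_measure_def unit_leb_def[symmetric] by (rule product_integrable_prod[OF assms])
qed

lemma cube_prod_measurable:
 fixes f :: "nat \<Rightarrow> real \<Rightarrow> real"
 assumes "\<And>j. j \<in> I \<Longrightarrow> f j \<in> borel_measurable borel" "I \<subseteq> J"
 shows "(\<lambda>y. \<Prod>j\<in>I. f j (y j)) \<in> borel_measurable (cube_measure J)"
proof (intro borel_measurable_prod)
 fix j assume "j \<in> I"
 then show "(\<lambda>y. f j (y j)) \<in> borel_measurable (cube_measure J)"
  using assms by (intro measurable_compose[OF cube_component_measurable]) auto
qed

lemma prod_abs_le:
 fixes f :: "'i \<Rightarrow> real"
 assumes "\<And>j. j \<in> I \<Longrightarrow> \<bar>f j\<bar> \<le> C j"
 shows "\<bar>\<Prod>j\<in>I. f j\<bar> \<le> (\<Prod>j\<in>I. C j)"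
 unfolding abs_prod using assms by (intro prod_mono) auto

lemma integrable_mult_cube_prod:
 fixes f :: "nat \<Rightarrow> real \<Rightarrow> real"
 assumes "integrable (cube_measure J) g" "I \<subseteq> J"
  "\<And>j. j \<in> I \<Longrightarrow> f j \<in> borel_measurable borel"
  "\<And>j. j \<in> I \<Longrightarrow> \<exists>C. \<forall>x\<in>{-1/2..1/2}. \<bar>f j x\<bar> \<le> C"
 shows "integrable (cube_measure J) (\<lambda>y. g y * (\<Prod>j\<in>I. f j (y j)))"
proof -
 obtain C where C: "\<And>j x. j \<in> I \<Longrightarrow> x \<in> {-1/2..1/2} \<Longrightarrow> \<bar>f j x\<bar> \<le> C j"
  using assms(4) by metis
 show ?thesis
 proof (rule integrable_mult_bounded_real[OF assms(1) cube_prod_measurable[OF assms(3,2)]])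
  fix y assume "y \<in> space (cube_measure J)"
  then have "y j \<in> {-1/2..1/2}" if "j \<in> I" for j
   using that assms(2) unfolding cube_measure_def unit_leb_def[symmetric] space_PiM by (auto simp: space_unit_leb PiE_def Pi_def)
  then show "\<bar>\<Prod>j\<in>I. f j (y j)\<bar> \<le> (\<Prod>j\<in>I. C j)" by (intro prod_abs_le C)
 qed
qed

lemma test_fun_bounded:
 assumes "\<phi> \<in> test_fun {-1/2..1/2::real}"
 shows "\<exists>C. \<forall>x. \<bar>\<phi> x\<bar> \<le> C"
proof -
 obtain a b where ab: "\<forall>x. x < a \<or> b < x \<longrightarrow> \<phi> x = 0" using test_fun_realD[OF assms] by blast
 obtain C where C: "\<forall>x\<in>{a..b}. \<bar>\<phi> x\<bar> \<le> C"
  using compact_imp_bounded[OF compact_continuous_image[OF test_fun_continuous[OF assms, of "{a..b}"]]]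
  unfolding bounded_iff by auto
 have "\<bar>\<phi> x\<bar> \<le> max C 0" for x using ab C by (cases "x \<in> {a..b}") (auto simp: le_max_iff_disj)
 then show ?thesis by blast
qed

lemma test_fun_integrable: "\<phi> \<in> tests \<Longrightarrow> integrable unit_leb \<phi>"
 using test_fun_bounded[of \<phi>] bounded_integrable_unit_leb[OF test_fun_measurable] by blast

lemma flat_exp_1_tendsto: "(flat_exp 1 \<longlongrightarrow> 1) at_top"
proof -
 have "((\<lambda>x::real. exp (- inverse x)) \<longlongrightarrow> exp (- 0)) at_top"
  by (intro tendsto_intros tendsto_inverse_0_at_top filterlim_ident)
 moreover have "eventually (\<lambda>x::real. exp (- inverse x) = flat_exp 1 x) at_top"
  by (rule eventually_mono[OF eventually_gt_at_top[of 0]]) (simp add: flat_exp_def inverse_eq_divide)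
 ultimately show ?thesis by (simp add: Lim_transform_eventually)
qed

text \<open>Approximates the indicator of \<open>{a<..<b}\<close> by genuine test functions: the
  shrinking margins keep the support compact inside the open unit interval while the steepness
  grows.\<close>

definition clip_bump :: "real \<Rightarrow> real \<Rightarrow> nat \<Rightarrow> real \<Rightarrow> real" where
 "clip_bump a b k =
   bump (max a (-1/2 + inverse (real (k + 3)))) (min b (1/2 - inverse (real (k + 3)))) (inverse (real (Suc k)))"

lemma clip_bump_test_fun: "clip_bump a b k \<in> tests"
 unfolding clip_bump_def
proof (rule bump_test_fun)
 have "inverse (real (k + 3)) > 0" by simp
 then show "-1/2 < max a (-1/2 + inverse (real (k + 3)))" "min b (1/2 - inverse (real (k + 3))) < 1/2"
  unfolding less_max_iff_disj min_less_iff_disj by linarith+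
qed simp

lemma clip_bump_bounds: "0 \<le> clip_bump a b k x" "clip_bump a b k x \<le> 1"
 unfolding clip_bump_def by (auto simp: bump_bounds)

lemma inverse_shift_tendsto: "(\<lambda>k. inverse (real (k + 3))) \<longlonglongrightarrow> 0"
 using LIMSEQ_ignore_initial_segment[OF lim_inverse_n, of 3] by simp

lemma clip_bump_tendsto:
 "(\<lambda>k. clip_bump a b k x) \<longlonglongrightarrow> indicator ({a<..<b} \<inter> {-1/2<..<1/2}) x"
proof (cases "x \<in> {a<..<b} \<inter> {-1/2<..<1/2}")
 case True
 have S: "filterlim (\<lambda>k. real (Suc k)) at_top sequentially"
  by (intro filterlim_compose[OF filterlim_real_sequentially filterlim_Suc])
 have 1: "(\<lambda>k. flat_exp 1 (v k * real (Suc k))) \<longlonglongrightarrow> 1" if "v \<longlonglongrightarrow> c" "c > 0" for v c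
  by (rule filterlim_compose[OF flat_exp_1_tendsto]) (rule filterlim_tendsto_pos_mult_at_top[OF that S])
 have "(\<lambda>k. x - max a (-1/2 + inverse (real (k + 3)))) \<longlonglongrightarrow> x - max a (-1/2 + 0)"
  by (intro tendsto_intros inverse_shift_tendsto)
 moreover have "(\<lambda>k. min b (1/2 - inverse (real (k + 3))) - x) \<longlonglongrightarrow> min b (1/2 - 0) - x"
  by (intro tendsto_intros inverse_shift_tendsto)
 ultimately have "(\<lambda>k. clip_bump a b k x) \<longlonglongrightarrow> 1 * 1"
  unfolding clip_bump_def bump_def divide_inverse inverse_inverse_eq
  by (intro tendsto_mult 1) (use True in auto)
 then show ?thesis using True by simp
next
 case False
 then have "clip_bump a b k x = 0" for k
  unfolding clip_bump_def
  by (subst bump_eq_0) (auto simp: min_le_iff_disj le_max_iff_disj intro: order_trans[of x "-1/2"] order_trans[of _ "1/2" x])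
 then show ?thesis using False by simp
qed

lemma AE_unit_leb_interior: "AE x in unit_leb. x \<in> {-1/2<..<1/2}"
proof -
 have "AE x in lborel. x \<noteq> -1/2 \<and> x \<noteq> (1/2::real)"
  by (intro AE_conjI AE_lborel_singleton)
 then show ?thesis unfolding unit_leb_def by (subst AE_restrict_space_iff) auto
qed

lemma AE_cube_interior:
 assumes "finite I" shows "AE y in cube_measure I. \<forall>j\<in>I. y j \<in> {-1/2<..<1/2}"
proof (rule AE_finite_allI[OF assms])
 fix j assume "j \<in> I"
 then show "AE y in cube_measure I. y j \<in> {-1/2<..<1/2}"
  unfolding cube_measure_def unit_leb_def[symmetric]
   by (intro AE_PiM_component prob_space_unit_leb AE_unit_leb_interior)
qed

lemma unit_leb_lint_const: "(LINT x|unit_leb. (c::real)) = c"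
proof -
 interpret prob_space unit_leb by (rule prob_space_unit_leb)
 show ?thesis using prob_space by simp
qed

text \<open>Test functions of mean one that tend to the constant 1. The offset 3 bounds the margins
  by 1/3, so that the supporting interval is nonempty already for \<open>k = 0\<close>.\<close>

definition plateau :: "nat \<Rightarrow> real \<Rightarrow> real" where
 "plateau k = nbump (-1/2 + inverse (real (k + 3))) (1/2 - inverse (real (k + 3))) (inverse (real (Suc k)))"

lemma plateau_conds: "-1/2 < -1/2 + inverse (real (k + 3))"
  "-1/2 + inverse (real (k + 3)) < 1/2 - inverse (real (k + 3))" "1/2 - inverse (real (k + 3)) < 1/2"
  "inverse (real (Suc k)) > 0"
proof -
 have "inverse (real (k + 3)) \<le> inverse 3" by (rule le_imp_inverse_le) auto
 then show "-1/2 + inverse (real (k + 3)) < 1/2 - inverse (real (k + 3))" by simp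
qed auto

lemmas plateau_props =
 nbump[OF plateau_conds(1)[of k] plateau_conds(2)[of k] plateau_conds(3)[of k] plateau_conds(4)[of k],
  folded plateau_def] for k

lemma plateau_eq: "plateau k x = clip_bump (-1) 1 k x / (LINT x|unit_leb. clip_bump (-1) 1 k x)"
proof -
 have "max (-1) (-1/2 + inverse (real (k + 3))) = -1/2 + inverse (real (k + 3))"
  "min 1 (1/2 - inverse (real (k + 3))) = 1/2 - inverse (real (k + 3))"
  using plateau_conds[of k] by (auto simp only: max_def min_def split: if_splits)
 then show ?thesis unfolding plateau_def nbump_def clip_bump_def by simp
qed

text \<open>The normalising integrals tend to 1 by dominated convergence; hence their inverses form
  a bounded sequence, which gives the uniform bound.\<close>

lemma plateau_lim:
 shows "\<exists>C. \<forall>k x. \<bar>plateau k x\<bar> \<le> C"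
  and "\<And>x. x \<in> {-1/2<..<1/2} \<Longrightarrow> (\<lambda>k. plateau k x) \<longlonglongrightarrow> 1"
proof -
 define Z where "Z k = (LINT x|unit_leb. clip_bump (-1) 1 k x)" for k
 interpret prob_space unit_leb by (rule prob_space_unit_leb)
 have "Z \<longlonglongrightarrow> (LINT x|unit_leb. 1)"
  unfolding Z_def
 proof (rule integral_dominated_convergence[of _ _ _ "\<lambda>_. 1"])
  show "AE x in unit_leb. (\<lambda>i. clip_bump (- 1) 1 i x) \<longlonglongrightarrow> 1"
  proof (rule AE_mp[OF AE_unit_leb_interior], intro AE_I2 impI)
   fix x :: real assume "x \<in> {-1/2<..<1/2}"
   then show "(\<lambda>i. clip_bump (- 1) 1 i x) \<longlonglongrightarrow> 1" using clip_bump_tendsto[of "-1" 1 x] by simp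
  qed
  show "(\<lambda>x. clip_bump (-1) 1 k x) \<in> borel_measurable unit_leb" for k
   by (rule unit_leb_measurable[OF test_fun_measurable[OF clip_bump_test_fun]])
  show "AE x in unit_leb. norm (clip_bump (-1) 1 k x) \<le> 1" for k
   by (rule AE_I2) (simp add: clip_bump_bounds)
  show "integrable unit_leb (\<lambda>_. 1::real)" by (rule integrable_const)
 qed simp
 then have Z: "Z \<longlonglongrightarrow> 1" by (simp only: unit_leb_lint_const)
 then have iZ: "(\<lambda>k. inverse (Z k)) \<longlonglongrightarrow> inverse 1" by (intro tendsto_inverse) auto
 then have "Bseq (\<lambda>k. inverse (Z k))" by (intro convergent_imp_Bseq convergentI)
 then obtain C where C: "\<And>k. \<bar>inverse (Z k)\<bar> \<le> C" by (auto simp: Bseq_def)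
 have "\<bar>plateau k x\<bar> \<le> C" for k x
 proof -
  have "\<bar>clip_bump (-1) 1 k x\<bar> * \<bar>inverse (Z k)\<bar> \<le> 1 * C"
   by (intro mult_mono C) (auto simp: clip_bump_bounds)
  then show ?thesis unfolding plateau_eq by (simp add: divide_inverse abs_mult Z_def)
 qed
 then show "\<exists>C. \<forall>k x. \<bar>plateau k x\<bar> \<le> C" by blast
 fix x :: real assume "x \<in> {-1/2<..<1/2}"
 then have "(\<lambda>k. clip_bump (-1) 1 k x) \<longlonglongrightarrow> 1" using clip_bump_tendsto[of "-1" 1 x] by simp
 from tendsto_mult[OF this iZ] show "(\<lambda>k. plateau k x) \<longlonglongrightarrow> 1"
  unfolding plateau_eq by (simp add: divide_inverse Z_def)
qed

lemma cumul_plateau_tendsto: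
 assumes "y \<in> {-1/2..1/2}"
 shows "(\<lambda>k. cumul (plateau k) y) \<longlonglongrightarrow> y + 1/2"
proof -
 obtain C where C: "\<And>k x. \<bar>plateau k x\<bar> \<le> C" using plateau_lim(1) by blast
 interpret prob_space unit_leb by (rule prob_space_unit_leb)
 have "(\<lambda>k. cumul (plateau k) y) \<longlonglongrightarrow> (LINT x|unit_leb. 1 * indicator {..y} x)"
  unfolding cumul_def
 proof (rule integral_dominated_convergence[of _ _ _ "\<lambda>_. C"])
  show "AE x in unit_leb. (\<lambda>k. plateau k x * indicator {..y} x) \<longlonglongrightarrow> 1 * indicator {..y} x"
   by (rule AE_mp[OF AE_unit_leb_interior], intro AE_I2 impI tendsto_mult tendsto_const plateau_lim(2))
  show "(\<lambda>x. plateau k x * indicator {..y} x) \<in> borel_measurable unit_leb" for k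
   by (rule borel_measurable_integrable)
    (rule unit_leb_mult_indicator_integrable[OF test_fun_integrable[OF plateau_props(1)]])
  show "AE x in unit_leb. norm (plateau k x * indicator {..y} x) \<le> C" for k
   by (rule AE_I2) (use C[of k] order_trans[OF abs_ge_zero C] in \<open>auto simp: indicator_def\<close>)
  show "integrable unit_leb (\<lambda>_. C)" by (rule integrable_const)
  show "(\<lambda>x. 1 * indicator {..y} x :: real) \<in> borel_measurable unit_leb"
   by (rule unit_leb_measurable) simp
 qed
 also have "(LINT x|unit_leb. 1 * indicator {..y} x :: real) = (LINT x|lborel. indicator {-1/2..y} x)"
  unfolding unit_leb_integral set_lebesgue_integral_def
  using assms by (intro B_integral_cong refl) (auto simp: indicator_def)
 also have "\<dots> = y + 1/2" using assms by (simp add: algebra_simps)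
 finally show ?thesis .
qed

lemma cumul_diff:
 assumes "integrable unit_leb f" "integrable unit_leb g"
 shows "cumul (\<lambda>x. 1 * f x + (-1) * g x) y = cumul f y - cumul g y"
 unfolding cumul_def
 using B_integral_diff[OF unit_leb_mult_indicator_integrable[OF assms(1), of y]
   unit_leb_mult_indicator_integrable[OF assms(2), of y]]
 by (simp add: algebra_simps)

text \<open>The distribution function of the point mass at \<open>t\<close> minus that of the
  uniform distribution. Integration by parts against it produces the value at \<open>t\<close> minus
  the mean.\<close>

definition kern :: "real \<Rightarrow> real \<Rightarrow> real" where
 "kern t x = (if t < x then 1 else 0) - (x + 1/2)"

lemma kern_measurable: "kern t \<in> borel_measurable borel"
 unfolding kern_def[abs_def] by measurable

lemma kern_bounded: "x \<in> {-1/2..1/2} \<Longrightarrow> \<bar>kern t x\<bar> \<le> 1"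
 by (auto simp: kern_def)

text \<open>Only boxes on the upper side of \<open>t\<close> are considered, because the approximate
  point masses below are placed to the right of \<open>t\<close>; such boxes eventually fit into any
  basic product neighbourhood.\<close>

lemma continuous_cube_near:
 fixes G :: "(nat \<Rightarrow> real) \<Rightarrow> real"
 assumes G: "continuous_on (cube s) G" and t: "t \<in> cube s" and e: "e > 0"
  and b: "\<And>j. j < s \<Longrightarrow> b j \<longlonglongrightarrow> t j"
 shows "eventually (\<lambda>k. \<forall>y\<in>cube s. (\<forall>j<s. t j < y j \<and> y j < b j k) \<longrightarrow> \<bar>G y - G t\<bar> < e) sequentially"
proof -
 obtain V where V: "open V" "t \<in> V" "\<And>y. y \<in> cube s \<Longrightarrow> y \<in> V \<Longrightarrow> G y \<in> ball (G t) e"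
  using G t e unfolding continuous_on_topological by (metis open_ball centre_in_ball)
 have "openin (product_topology (\<lambda>i. euclidean) UNIV) V"
  using V(1) by (simp add: euclidean_product_topology)
 then obtain X where X: "t \<in> PiE UNIV X" "\<And>i. open (X i)" "PiE UNIV X \<subseteq> V"
  using product_topology_open_contains_basis[of "\<lambda>i. euclidean" UNIV V t] V(2) by auto
 have "eventually (\<lambda>k. \<forall>j\<in>{..<s}. \<forall>x. t j < x \<and> x < b j k \<longrightarrow> x \<in> X j) sequentially"
 proof (rule eventually_ball_finite, simp, intro ballI)
  fix j assume j: "j \<in> {..<s}"
  have "t j \<in> X j" using X(1) by auto
  then obtain d where d: "d > 0" "ball (t j) d \<subseteq> X j" using X(2)[of j] openE by blast
  have "eventually (\<lambda>k. b j k < t j + d) sequentially"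
   by (rule order_tendstoD(2)[OF b]) (use j d(1) in auto)
  then show "eventually (\<lambda>k. \<forall>x. t j < x \<and> x < b j k \<longrightarrow> x \<in> X j) sequentially"
   by (rule eventually_mono) (intro allI impI subsetD[OF d(2)], simp add: dist_real_def)
 qed
 then show ?thesis
 proof (rule eventually_mono, intro ballI impI)
  fix k y assume k: "\<forall>j\<in>{..<s}. \<forall>x. t j < x \<and> x < b j k \<longrightarrow> x \<in> X j"
   and y: "y \<in> cube s" "\<forall>j<s. t j < y j \<and> y j < b j k"
  have "y j \<in> X j" for j
  proof (cases "j < s")
   case True then show ?thesis using k y by auto
  next
   case False
   then have "y j = t j" using y(1) t by (auto simp: cube_def PiE_def extensional_def)
   then show ?thesis using X(1) by auto
  qed
  then have "y \<in> V" using X(3) by auto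
  from V(3)[OF y(1) this] show "\<bar>G y - G t\<bar> < e" by (simp add: dist_real_def abs_minus_commute)
 qed
qed

lemma has_weak_mixed_integrable:
 assumes "has_weak_mixed s u G g"
 shows "integrable (cubeM s) g"
proof -
 interpret prob_space "cubeM s" by (rule prob_space_cube_measure)
 have "g \<in> borel_measurable (cubeM s)" "integrable (cubeM s) (\<lambda>y. (g y)\<^sup>2)"
  using assms unfolding has_weak_mixed_def by blast+
 then show ?thesis by (rule square_integrable_imp_integrable)
qed

lemma cumul_nbump_right:
 assumes "-1/2 < a" "a < b" "b < 1/2" "c > 0"
 shows "y \<le> a \<Longrightarrow> cumul (nbump a b c) y = 0" "b \<le> y \<Longrightarrow> cumul (nbump a b c) y = 1"
proof -
 assume "y \<le> a"
 then have "(\<lambda>x. nbump a b c x * indicator {..y} x) = (\<lambda>x. 0)"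
  using nbump(4)[OF assms] by (auto simp: indicator_def fun_eq_iff)
 then show "cumul (nbump a b c) y = 0" unfolding cumul_def by (simp only: Bochner_Integration.integral_zero)
next
 assume "b \<le> y"
 then have "(\<lambda>x. nbump a b c x * indicator {..y} x) = nbump a b c"
  using nbump(4)[OF assms] by (auto simp: indicator_def fun_eq_iff)
 then show "cumul (nbump a b c) y = 1" unfolding cumul_def by (simp only: nbump(3)[OF assms])
qed

text \<open>Dominated convergence for tensor products. Pointwise convergence of the factors is asked
  only inside the open interval, since the boundary of the cube is a null set.\<close>

lemma tensor_convergence:
 fixes f :: "(nat \<Rightarrow> real) \<Rightarrow> real"
 assumes f: "integrable (cubeM s) f"
  and h: "\<And>k j. h k j \<in> borel_measurable borel" "\<And>k j x. j < s \<Longrightarrow> \<bar>h k j x\<bar> \<le> C" "\<And>j. H j \<in> borel_measurable borel"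
  and lim: "\<And>j x. j < s \<Longrightarrow> x \<in> {-1/2<..<1/2} \<Longrightarrow> (\<lambda>k. h k j x) \<longlonglongrightarrow> H j x"
 shows "(\<lambda>k. LINT y|cubeM s. f y * (\<Prod>j<s. h k j (y j))) \<longlonglongrightarrow> (LINT y|cubeM s. f y * (\<Prod>j<s. H j (y j)))"
proof (rule integral_dominated_convergence[of _ _ _ "\<lambda>y. (\<Prod>j<s. C) * \<bar>f y\<bar>"])
 let ?M = "cubeM s"
 show "integrable ?M (\<lambda>y. (\<Prod>j<s. C) * \<bar>f y\<bar>)" using f by auto
 show "(\<lambda>y. f y * (\<Prod>j<s. H j (y j))) \<in> borel_measurable ?M" "(\<lambda>y. f y * (\<Prod>j<s. h k j (y j))) \<in> borel_measurable ?M" for k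
  using f cube_prod_measurable[of "{..<s}" H "{..<s}", OF h(3)] cube_prod_measurable[of "{..<s}" "h k" "{..<s}", OF h(1)] by auto
 show "AE y in ?M. norm (f y * (\<Prod>j<s. h k j (y j))) \<le> (\<Prod>j<s. C) * \<bar>f y\<bar>" for k
 proof (rule AE_I2)
  fix y :: "nat \<Rightarrow> real"
  have "\<bar>\<Prod>j<s. h k j (y j)\<bar> \<le> (\<Prod>j<s. C)" by (rule prod_abs_le) (simp add: h(2))
  then show "norm (f y * (\<Prod>j<s. h k j (y j))) \<le> (\<Prod>j<s. C) * \<bar>f y\<bar>"
   unfolding real_norm_def abs_mult by (metis abs_ge_zero mult.commute mult_right_mono)
 qed
 show "AE y in ?M. (\<lambda>k. f y * (\<Prod>j<s. h k j (y j))) \<longlonglongrightarrow> f y * (\<Prod>j<s. H j (y j))"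
  by (rule AE_mp[OF AE_cube_interior[of "{..<s}"]]) (auto intro!: AE_I2 tendsto_intros lim)
qed

section \<open>Representation by weak mixed derivatives\<close>

abbreviation kprod :: "(nat \<Rightarrow> real) \<Rightarrow> nat set \<Rightarrow> (nat \<Rightarrow> real) \<Rightarrow> real" where
 "kprod t u y \<equiv> \<Prod>j\<in>u. kern (t j) (y j)"

text \<open>\<open>G\<close> is tested with a product of approximate point masses
  \<open>\<delta> j k\<close> near \<open>t j\<close>. Writing each factor as
  (\<open>\<delta>\<close> - \<open>plateau\<close>) + \<open>plateau\<close> and expanding gives
  one term per subset \<open>u\<close>. For \<open>j\<close> in \<open>u\<close> the difference has
  mean zero, hence is the derivative of a test function \<open>\<Psi> j k\<close>, and that
  derivative is moved onto \<open>G\<close>. In the limit \<open>\<Psi> j k\<close> becomes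
  \<open>kern (t j)\<close>, the plateaus become 1, and the left-hand side becomes
  \<open>G t\<close> by continuity.\<close>

theorem weak_representation:
 assumes G: "continuous_on (cube s) G"
  and g: "\<And>u. u \<subseteq> {..<s} \<Longrightarrow> has_weak_mixed s u G (g u)"
  and t: "t \<in> cube s" "\<And>j. j < s \<Longrightarrow> t j < 1/2"
 shows "G t = (\<Sum>u\<in>Pow {..<s}. (-1) ^ card u *
      (LINT y|cubeM s. g u y * (\<Prod>j\<in>u. kern (t j) (y j))))"
proof -
 let ?M = "cubeM s"
 interpret prob_space ?M by (rule prob_space_cube_measure)
 \<comment> \<open>The bump lives between \<open>t j + d\<close> and \<open>t j + 2 * d\<close>.
   This lies strictly to the right of \<open>t j\<close>, so \<open>t j = -1/2\<close> is covered,
   and strictly below 1/2, because \<open>d\<close> is at most a third of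
   \<open>1/2 - t j\<close>.\<close>
 define d where "d j k = (1/2 - t j) * inverse (real (k + 3))" for j k
 define \<delta> where "\<delta> j k = nbump (t j + d j k) (t j + 2 * d j k) 1" for j k
 have tj: "-1/2 \<le> t j" "t j < 1/2" if "j < s" for j
  using that t by (auto simp: cube_def)
 have d0: "0 < d j k" "t j + 2 * d j k < 1/2" if "j < s" for j k
 proof -
  have "inverse (real (k + 3)) \<le> inverse 3" by (rule le_imp_inverse_le) auto
  then have "d j k \<le> (1/2 - t j) * inverse 3" unfolding d_def using tj[OF that] by (intro mult_left_mono) auto
  then show "t j + 2 * d j k < 1/2" using tj[OF that] by simp
  show "0 < d j k" unfolding d_def using tj[OF that] by (intro mult_pos_pos) auto
 qed
 have dc: "-1/2 < t j + d j k" "t j + d j k < t j + 2 * d j k" "t j + 2 * d j k < 1/2" "1 > (0::real)"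
  if "j < s" for j k using d0[OF that, of k] tj[OF that] by auto
 have \<delta>: "\<delta> j k \<in> tests" "\<delta> j k x \<ge> 0" "(LINT x|unit_leb. \<delta> j k x) = 1"
  "x \<le> t j + d j k \<or> t j + 2 * d j k \<le> x \<Longrightarrow> \<delta> j k x = 0" if "j < s" for j k x
  unfolding \<delta>_def using nbump[OF dc(1)[OF that, of k] dc(2)[OF that, of k] dc(3)[OF that, of k] zero_less_one] by blast+
 have dlim: "d j \<longlonglongrightarrow> 0" for j
  unfolding d_def using tendsto_mult[OF tendsto_const inverse_shift_tendsto, of "1/2 - t j"] by simp
 define \<Psi> where "\<Psi> j k = cumul (\<lambda>x. 1 * \<delta> j k x + (-1) * plateau k x)" for j k
 have \<delta>\<chi>: "(\<lambda>x. 1 * \<delta> j k x + (-1) * plateau k x) \<in> tests" if "j < s" for j k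
  by (rule test_fun_diff[OF \<delta>(1)[OF that] plateau_props(1)])
 have int0: "(LINT x|unit_leb. 1 * \<delta> j k x + (-1) * plateau k x) = 0" if "j < s" for j k
  using test_fun_integrable[OF \<delta>(1)[OF that, of k]] test_fun_integrable[OF plateau_props(1)[of k]]
  by (simp add: \<delta>(3)[OF that] plateau_props(3))
 have \<Psi>test: "\<Psi> j k \<in> tests" if "j < s" for j k
  unfolding \<Psi>_def by (rule cumul_test_fun[OF \<delta>\<chi>[OF that] int0[OF that]])
 have \<Psi>deriv: "deriv (\<Psi> j k) x = \<delta> j k x - plateau k x" if "j < s" for j k x
  using DERIV_imp_deriv[OF cumul_deriv[OF \<delta>\<chi>[OF that]]] unfolding \<Psi>_def by simp
 have \<Psi>eq: "\<Psi> j k x = cumul (\<delta> j k) x - cumul (plateau k) x" if "j < s" for j k x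
  unfolding \<Psi>_def
  by (rule cumul_diff[OF test_fun_integrable[OF \<delta>(1)[OF that]] test_fun_integrable[OF plateau_props(1)]])
 have \<Psi>bd: "\<bar>\<Psi> j k x\<bar> \<le> 1" if "j < s" for j k x
  unfolding \<Psi>eq[OF that]
  using cumul_bounds[of "\<delta> j k" x, OF \<delta>(2)[OF that] test_fun_integrable[OF \<delta>(1)[OF that]] \<delta>(3)[OF that]]
   cumul_bounds[of "plateau k" x, OF plateau_props(2) test_fun_integrable[OF plateau_props(1)] plateau_props(3)]
  by (simp add: abs_le_iff)
 have \<Psi>lim: "(\<lambda>k. \<Psi> j k x) \<longlonglongrightarrow> kern (t j) x" if j: "j < s" and x: "x \<in> {-1/2..1/2}" for j x
 proof -
  have "(\<lambda>k. cumul (\<delta> j k) x) \<longlonglongrightarrow> (if t j < x then 1 else 0)"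
  proof (cases "t j < x")
   case True
   have "(\<lambda>k. t j + 2 * d j k) \<longlonglongrightarrow> t j + 2 * 0" by (intro tendsto_intros dlim)
   then have "eventually (\<lambda>k. t j + 2 * d j k < x) sequentially"
    using True by (intro order_tendstoD(2)) auto
   then have "eventually (\<lambda>k. cumul (\<delta> j k) x = 1) sequentially"
   proof (rule eventually_mono)
    fix k assume "t j + 2 * d j k < x"
    then show "cumul (\<delta> j k) x = 1"
     unfolding \<delta>_def by (intro cumul_nbump_right(2)[OF dc(1)[OF j, of k] dc(2)[OF j, of k] dc(3)[OF j, of k] zero_less_one]) simp
   qed
   then show ?thesis using True by (simp add: tendsto_eventually)
  next
   case False
   have "cumul (\<delta> j k) x = 0" for k
    unfolding \<delta>_def using False d0(1)[OF j, of k] by (intro cumul_nbump_right(1)[OF dc(1)[OF j, of k] dc(2)[OF j, of k] dc(3)[OF j, of k] zero_less_one]) auto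
   then show ?thesis using False by simp
  qed
  from tendsto_diff[OF this cumul_plateau_tendsto[OF x]] show ?thesis
   unfolding \<Psi>eq[OF j] kern_def by simp
 qed
 define \<phi> where "\<phi> u k j = (if j \<in> u then \<Psi> j k else plateau k)" for u k j
 have \<phi>test: "\<phi> u k j \<in> tests" if "u \<subseteq> {..<s}" for u k j
  using that \<Psi>test plateau_props(1) by (auto simp: \<phi>_def)
 let ?d = "\<lambda>k y. \<Prod>j<s. \<delta> j k (y j)" and ?p = "\<lambda>u k y. \<Prod>j<s. \<phi> u k j (y j)" and ?K = "\<lambda>u y. \<Prod>j\<in>u. kern (t j) (y j)"
 have expand: "?d k y =
   (\<Sum>u\<in>Pow {..<s}. \<Prod>j<s. if j \<in> u then deriv (\<phi> u k j) (y j) else \<phi> u k j (y j))" for k y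
 proof -
  have "?d k y = (\<Prod>j<s. (\<delta> j k (y j) - plateau k (y j)) + plateau k (y j))" by simp
  also have "\<dots> = (\<Sum>u\<in>Pow {..<s}. (\<Prod>j\<in>u. \<delta> j k (y j) - plateau k (y j)) * (\<Prod>j\<in>{..<s} - u. plateau k (y j)))"
   by (rule prod_add) simp
  also have "\<dots> = (\<Sum>u\<in>Pow {..<s}. \<Prod>j<s. if j \<in> u then deriv (\<phi> u k j) (y j) else \<phi> u k j (y j))"
  proof (rule sum.cong[OF refl])
   fix u assume u: "u \<in> Pow {..<s}"
   then have "(\<Prod>j<s. if j \<in> u then deriv (\<phi> u k j) (y j) else \<phi> u k j (y j)) =
     (\<Prod>j\<in>u. if j \<in> u then deriv (\<phi> u k j) (y j) else \<phi> u k j (y j)) *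
     (\<Prod>j\<in>{..<s} - u. if j \<in> u then deriv (\<phi> u k j) (y j) else \<phi> u k j (y j))"
    by (subst prod.subset_diff[of u "{..<s}"]) (auto simp: mult.commute)
   also have "\<dots> = (\<Prod>j\<in>u. \<delta> j k (y j) - plateau k (y j)) * (\<Prod>j\<in>{..<s} - u. plateau k (y j))"
    using u by (intro mult_arg_cong prod.cong) (auto simp: \<phi>_def \<Psi>deriv)
   finally show "(\<Prod>j\<in>u. \<delta> j k (y j) - plateau k (y j)) * (\<Prod>j\<in>{..<s} - u. plateau k (y j)) =
    (\<Prod>j<s. if j \<in> u then deriv (\<phi> u k j) (y j) else \<phi> u k j (y j))" by simp
  qed
  finally show ?thesis .
 qed
 have dtest: "\<exists>f\<in>tests. deriv (\<phi> u k j) = f" if "u \<subseteq> {..<s}" "j \<in> u" for u k j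
  using that \<delta>\<chi>[of j k] \<Psi>deriv[of j k] by (auto simp: \<phi>_def fun_eq_iff subset_iff intro!: bexI[rotated])
 have Gint: "integrable ?M G" by (rule continuous_cube_integrable[OF G])
 have main: "(LINT y|?M. G y * ?d k y) =
   (\<Sum>u\<in>Pow {..<s}. (-1) ^ card u * (LINT y|?M. g u y * ?p u k y))" for k
 proof -
  define h where "h u j = (if j \<in> u then deriv (\<phi> u k j) else \<phi> u k j)" for u j
  have htest: "h u j \<in> tests" if "u \<subseteq> {..<s}" for u j
   using dtest[OF that, of j k] \<phi>test[OF that] by (auto simp: h_def)
  have hh: "(\<Prod>j<s. if j \<in> u then deriv (\<phi> u k j) (y j) else \<phi> u k j (y j)) = (\<Prod>j<s. h u j (y j))" for u y
   by (rule prod.cong) (auto simp: h_def)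
  have "(LINT y|?M. G y * ?d k y) = (LINT y|?M. (\<Sum>u\<in>Pow {..<s}. G y * (\<Prod>j<s. h u j (y j))))"
   unfolding expand hh sum_distrib_left ..
  also have "\<dots> = (\<Sum>u\<in>Pow {..<s}. LINT y|?M. G y * (\<Prod>j<s. h u j (y j)))"
  proof (rule B_integral_sum)
   fix u assume "u \<in> Pow {..<s}"
   then have u: "u \<subseteq> {..<s}" by simp
   show "integrable ?M (\<lambda>y. G y * (\<Prod>j<s. h u j (y j)))"
   proof (rule integrable_mult_cube_prod[OF Gint])
    show "h u j \<in> borel_measurable borel" for j by (rule test_fun_measurable[OF htest[OF u]])
    show "\<exists>C. \<forall>x\<in>{-1/2..1/2}. \<bar>h u j x\<bar> \<le> C" for j using test_fun_bounded[OF htest[OF u, of j]] by blast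
   qed simp
  qed
  also have "\<dots> = (\<Sum>u\<in>Pow {..<s}. (-1) ^ card u * (LINT y|?M. g u y * ?p u k y))"
  proof (rule sum.cong[OF refl])
   fix u assume "u \<in> Pow {..<s}"
   then have u: "u \<subseteq> {..<s}" by simp
   show "(LINT y|?M. G y * (\<Prod>j<s. h u j (y j))) = (-1) ^ card u * (LINT y|?M. g u y * ?p u k y)"
    using g[OF u] \<phi>test[OF u, of k] unfolding has_weak_mixed_def hh[symmetric] by blast
  qed
  finally show ?thesis .
 qed
 \<comment> \<open>Localisation: the product of bumps has total mass one and vanishes off the
   shrinking box, inside which \<open>G\<close> differs from \<open>G t\<close> by less than
   \<open>e/2\<close>.\<close>
 have lhs: "(\<lambda>k. LINT y|?M. G y * ?d k y) \<longlonglongrightarrow> G t"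
 proof (rule LIMSEQ_I)
  fix e :: real assume "e > 0"
  have "(\<lambda>k. t j + 2 * d j k) \<longlonglongrightarrow> t j" for j
   using tendsto_add[OF tendsto_const tendsto_mult[OF tendsto_const dlim], of "t j" 2 j] by simp
  from continuous_cube_near[OF G t(1), of "e/2", OF _ this] \<open>e > 0\<close>
  obtain N where N: "\<And>k y. k \<ge> N \<Longrightarrow> y \<in> cube s \<Longrightarrow> (\<forall>j<s. t j < y j \<and> y j < t j + 2 * d j k) \<Longrightarrow> \<bar>G y - G t\<bar> < e/2"
   unfolding eventually_sequentially by auto
  show "\<exists>N. \<forall>k\<ge>N. norm ((LINT y|?M. G y * ?d k y) - G t) < e"
  proof (intro exI[of _ N] allI impI)
   fix k assume k: "k \<ge> N"
   have I1: "integrable ?M (\<lambda>y. \<Prod>j<s. \<delta> j k (y j))" "(LINT y|?M. ?d k y) = 1"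
    using cube_integral_prod[of "{..<s}" "\<lambda>j. \<delta> j k"] test_fun_integrable[OF \<delta>(1)] \<delta>(3) by auto
   have I2: "integrable ?M (\<lambda>y. G y * ?d k y)"
   proof (rule integrable_mult_cube_prod[OF Gint])
    fix j assume "j \<in> {..<s}"
    then have j: "j < s" by simp
    show "\<delta> j k \<in> borel_measurable borel" by (rule test_fun_measurable[OF \<delta>(1)[OF j]])
    show "\<exists>C. \<forall>x\<in>{-1/2..1/2}. \<bar>\<delta> j k x\<bar> \<le> C" using test_fun_bounded[OF \<delta>(1)[OF j, of k]] by blast
   qed simp
   have "(LINT y|?M. G y * ?d k y) - G t =
     (LINT y|?M. G y * ?d k y) - (LINT y|?M. G t * ?d k y)"
    using I1(2) by simp
   also have "\<dots> = (LINT y|?M. G y * ?d k y - G t * ?d k y)"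
    using I1(1) I2 by (intro B_integral_diff[symmetric]) auto
   also have "\<bar>\<dots>\<bar> \<le> (LINT y|?M. (e/2) * ?d k y)"
   proof -
    have "\<bar>G y * ?d k y - G t * ?d k y\<bar> \<le> (e/2) * ?d k y"
     if "y \<in> space ?M" for y
    proof (cases "\<forall>j<s. t j < y j \<and> y j < t j + 2 * d j k")
     case True
     have "?d k y \<ge> 0" by (intro prod_nonneg) (auto simp: \<delta>(2))
     moreover have "\<bar>G y - G t\<bar> \<le> e/2" using N[OF k _ True] that by (simp add: space_cube_measure less_imp_le)
     ultimately have "\<bar>G y - G t\<bar> * ?d k y \<le> (e/2) * ?d k y"
      by (intro mult_right_mono)
     then show ?thesis using \<open>?d k y \<ge> 0\<close>
      by (simp only: left_diff_distrib[symmetric] abs_mult abs_of_nonneg)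
    next
     case False
     then obtain j where j: "j < s" "y j \<le> t j \<or> t j + 2 * d j k \<le> y j" by force
     then have "\<delta> j k (y j) = 0" using d0(1)[OF j(1), of k] by (intro \<delta>(4)) auto
     then have "?d k y = 0" using j(1) by (intro prod_zero) auto
     then show ?thesis by (simp only: mult_zero_right diff_self abs_zero order_refl)
    qed
    then show ?thesis using I1(1) I2
     by (intro order_trans[OF integral_abs_bound] integral_mono) auto
   qed
   also have "\<dots> = e/2" using I1(2) by simp
   finally show "norm ((LINT y|?M. G y * ?d k y) - G t) < e" using \<open>e > 0\<close> by simp
  qed
 qed
 obtain C where C: "\<And>k x. \<bar>plateau k x\<bar> \<le> C" using plateau_lim(1) by blast
 have rhs: "(\<lambda>k. LINT y|?M. g u y * ?p u k y) \<longlonglongrightarrow>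
   (LINT y|?M. g u y * ?K u y)" if u: "u \<subseteq> {..<s}" for u
 proof -
  have "(\<lambda>k. LINT y|?M. g u y * ?p u k y) \<longlonglongrightarrow> (LINT y|?M. g u y * (\<Prod>j<s. (if j \<in> u then kern (t j) else (\<lambda>_. 1)) (y j)))"
  proof (rule tensor_convergence[OF has_weak_mixed_integrable[OF g[OF u]] test_fun_measurable[OF \<phi>test[OF u]], where C = "max 1 C"])
   show "\<bar>\<phi> u k j x\<bar> \<le> max 1 C" if "j < s" for k j x
    using \<Psi>bd[OF that, of k x] C[of k x] by (auto simp: \<phi>_def le_max_iff_disj)
   show "(if j \<in> u then kern (t j) else (\<lambda>_. 1)) \<in> borel_measurable borel" for j by (auto intro: kern_measurable)
   show "(\<lambda>k. \<phi> u k j x) \<longlonglongrightarrow> (if j \<in> u then kern (t j) else (\<lambda>_. 1)) x" if "j < s" "x \<in> {-1/2<..<1/2}" for j x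
    using \<Psi>lim[OF that(1), of x] plateau_lim(2)[of x] that(2) by (auto simp: \<phi>_def)
  qed
  moreover have "(\<Prod>j<s. (if j \<in> u then kern (t j) else (\<lambda>_. 1)) (y j)) = ?K u y" for y
   using u by (intro prod.mono_neutral_cong_right) auto
  ultimately show ?thesis by simp
 qed
 have "(\<lambda>k. LINT y|?M. G y * ?d k y) \<longlonglongrightarrow>
   (\<Sum>u\<in>Pow {..<s}. (-1) ^ card u * (LINT y|?M. g u y * ?K u y))"
  unfolding main by (intro tendsto_sum tendsto_mult tendsto_const rhs) auto
 then show ?thesis using lhs LIMSEQ_unique by blast
qed

text \<open>A weak derivative of order zero need not be \<open>G\<close> pointwise; equality of
  means follows from testing with products of plateaus.\<close>

lemma weak_mixed_empty_integral:
 assumes G: "continuous_on (cube s) G" and g: "has_weak_mixed s {} G g"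
 shows "(LINT y|cubeM s. g y) = (LINT y|cubeM s. G y)"
proof -
 let ?M = "cubeM s"
 obtain C where C: "\<And>k x. \<bar>plateau k x\<bar> \<le> C" using plateau_lim(1) by blast
 have lim: "(\<lambda>k. LINT y|?M. f y * (\<Prod>j<s. plateau k (y j))) \<longlonglongrightarrow> (LINT y|?M. f y)" if f: "integrable ?M f" for f
  using tensor_convergence[OF f, of "\<lambda>k j. plateau k" C "\<lambda>_ _. 1"] C plateau_lim(2) test_fun_measurable[OF plateau_props(1)] by simp
 have "(LINT y|?M. G y * (\<Prod>j<s. plateau k (y j))) = (LINT y|?M. g y * (\<Prod>j<s. plateau k (y j)))" for k
  using g plateau_props(1)[of k] unfolding has_weak_mixed_def by (auto dest!: spec[of _ "\<lambda>j. plateau k"])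
 then show ?thesis
  using lim[OF continuous_cube_integrable[OF G]] lim[OF has_weak_mixed_integrable[OF g]] LIMSEQ_unique by auto
qed

text \<open>The indicator of a box is a bounded pointwise limit of products of clipped bumps, off
  the boundary of the cube.\<close>

lemma weak_zero_boxes:
 fixes d :: "(nat \<Rightarrow> real) \<Rightarrow> real"
 assumes d: "integrable (cubeM s) d"
  and test: "\<And>\<phi>. (\<And>j. \<phi> j \<in> tests) \<Longrightarrow> (LINT y|cubeM s. d y * (\<Prod>j<s. \<phi> j (y j))) = 0"
 shows "(LINT y|cubeM s. d y * (\<Prod>j<s. indicator {a j<..<b j} (y j))) = 0"
proof -
 let ?M = "cubeM s"
 have "(\<lambda>k. LINT y|?M. d y * (\<Prod>j<s. clip_bump (a j) (b j) k (y j))) \<longlonglongrightarrow>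
   (LINT y|?M. d y * (\<Prod>j<s. indicator {a j<..<b j} (y j)))"
 proof (rule tensor_convergence[OF d test_fun_measurable[OF clip_bump_test_fun], where C = 1])
  show "\<bar>clip_bump (a j) (b j) k x\<bar> \<le> 1" for k j x by (simp add: clip_bump_bounds)
  show "(\<lambda>k. clip_bump (a j) (b j) k x) \<longlonglongrightarrow> indicator {a j<..<b j} x" if "x \<in> {-1/2<..<1/2}" for j x
   using clip_bump_tendsto[of "a j" "b j" x] that by (simp add: indicator_def)
 qed simp
 moreover have "(LINT y|?M. d y * (\<Prod>j<s. clip_bump (a j) (b j) k (y j))) = 0" for k
  by (rule test) (rule clip_bump_test_fun)
 ultimately show ?thesis by (simp add: LIMSEQ_const_iff)
qed

text \<open>Intervals are replaced by Borel sets one coordinate at a time; \<open>J\<close> collects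
  the coordinates already treated. In each coordinate the sets for which the integral vanishes form
  a Dynkin system that contains the intersection-stable generator of open intervals.\<close>

lemma weak_zero_rectangles:
 fixes d :: "(nat \<Rightarrow> real) \<Rightarrow> real"
 assumes d: "integrable (cubeM s) d"
  and boxes: "\<And>a b. (LINT y|cubeM s. d y * (\<Prod>j<s. indicator {a j<..<b j} (y j))) = 0"
  and "finite J" "J \<subseteq> {..<s}"
  and "\<And>j. j \<in> J \<Longrightarrow> A j \<in> sets borel"
  and "\<And>j. j \<in> {..<s} - J \<Longrightarrow> \<exists>a b. A j = {a<..<b::real}"
 shows "(LINT y|cubeM s. d y * (\<Prod>j<s. indicator (A j) (y j))) = 0"
 using assms(3-6)
proof (induction J arbitrary: A rule: finite_induct)
 case empty
 then have "\<forall>j\<in>{..<s}. \<exists>a b. A j = {a<..<b}" by auto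
 then obtain a b where "\<forall>j\<in>{..<s}. A j = {a j<..<b j}" by metis
 then have "(\<Prod>j<s. indicator (A j) (y j)) = (\<Prod>j<s. indicator {a j<..<b j} (y j) :: real)" for y :: "nat \<Rightarrow> real"
  by (intro prod.cong) auto
 then show ?case using boxes[of a b] by simp
next
 case (insert i J)
 let ?M = "cubeM s"
 have i: "i < s" using insert.prems by auto
 define P where "P B = (LINT y|?M. d y * (\<Prod>j<s. indicator ((A(i := B)) j) (y j)))" for B
 define r where "r y = d y * (\<Prod>j\<in>{..<s} - {i}. indicator (A j) (y j))" for y
 have meas: "A j \<in> sets borel" if "j < s" for j
  using insert.prems(2)[of j] insert.prems(3)[of j] that by (cases "j \<in> insert i J") auto
 have r: "integrable ?M r"
  unfolding r_def
 proof (rule integrable_mult_cube_prod[OF d])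
  show "indicator (A j) \<in> borel_measurable borel" if "j \<in> {..<s} - {i}" for j
   using that by (intro borel_measurable_indicator meas) auto
 qed (auto intro!: exI[of _ 1] simp: indicator_def)
 have P: "P B = (LINT y|?M. r y * indicator B (y i))" for B
  unfolding P_def r_def using i
  by (subst prod.remove[of _ i]) (auto intro!: B_integral_cong prod.cong simp: mult_ac)
 have rB: "integrable ?M (\<lambda>y. r y * indicator B (y i))" if "B \<in> sets borel" for B
  using i that by (intro integrable_mult_bounded_real[OF r, of _ 1] measurable_compose[OF cube_component_measurable[of i "{..<s}"]])
    (auto simp: indicator_def)
 have P0: "P {a<..<b} = 0" for a b
  unfolding P_def
 proof (rule insert.IH)
  show "J \<subseteq> {..<s}" using insert.prems by auto
  show "(A(i := {a<..<b})) j \<in> sets borel" if "j \<in> J" for j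
   using that insert.prems(2)[of j] insert.hyps by auto
  show "\<exists>a' b'. (A(i := {a<..<b})) j = {a'<..<b'}" if "j \<in> {..<s} - J" for j
   using that insert.prems(3)[of j] by auto
 qed
 have sub: "range (\<lambda>(a, b). {a<..<b::real}) \<subseteq> Pow UNIV" by simp
 have borel: "sigma_sets UNIV (range (\<lambda>(a, b). {a<..<b::real})) = sets borel"
 proof -
  have "(\<lambda>(a, b). box a b) = (\<lambda>(a, b). {a<..<b::real})" by (auto simp: fun_eq_iff)
  then have "sets borel = sets (sigma UNIV (range (\<lambda>(a, b). {a<..<b::real})))"
   using arg_cong[OF borel_eq_box[where 'a=real], of sets] by (simp only:)
  then show ?thesis by (simp only: sets_measure_of[OF sub])
 qed
 have Ai: "A i \<in> sigma_sets UNIV (range (\<lambda>(a, b). {a<..<b::real}))"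
  using meas[OF i] by (simp only: borel)
 have Ist: "Int_stable (range (\<lambda>(a, b). {a<..<b::real}))"
 proof (rule Int_stableI)
  fix x y assume "x \<in> range (\<lambda>(a, b). {a<..<b::real})" "y \<in> range (\<lambda>(a, b). {a<..<b::real})"
  then obtain a b a' b' where "x = {a<..<b}" "y = {a'<..<b'}" by auto
  then have "x \<inter> y = (\<lambda>(a, b). {a<..<b}) (max a a', min b b')" by auto
  then show "x \<inter> y \<in> range (\<lambda>(a, b). {a<..<b::real})" by blast
 qed
 have "P (A i) = 0"
  using Ist sub Ai
 proof (induct rule: sigma_sets_induct_disjoint)
  case (compl B)
  \<comment> \<open>Coordinates of the cube lie in this interval, so the whole line may be replaced
    by a generator.\<close>
  have 1: "P UNIV = P {-1<..<1}"
   unfolding P by (rule B_integral_cong) (use i in \<open>auto simp: space_cube_measure cube_def indicator_def PiE_def Pi_def\<close>)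
  have "P (UNIV - B) = (LINT y|?M. r y * indicator UNIV (y i) - r y * indicator B (y i))"
   unfolding P by (rule B_integral_cong) (auto simp: indicator_def)
  also have "\<dots> = P UNIV - P B"
   unfolding P using compl borel by (intro B_integral_diff rB) auto
  finally have "P (UNIV - B) = P UNIV - P B" .
  then show ?case using 1 P0[of "-1" 1] compl by simp
 next
  case (union B)
  have "(\<lambda>n. LINT y|?M. r y * indicator (\<Union>i<n. B i) (y i)) \<longlonglongrightarrow> (LINT y|?M. r y * indicator (\<Union>i. B i) (y i))"
  proof (rule integral_dominated_convergence[of _ _ _ "\<lambda>y. \<bar>r y\<bar>"])
   show "integrable ?M (\<lambda>y. \<bar>r y\<bar>)" using r by auto
   have "B n \<in> sets borel" for n using union borel by auto
   then have U: "(\<Union>i<n. B i) \<in> sets borel" "(\<Union>i. B i) \<in> sets borel" for n :: nat by auto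
   show "(\<lambda>y. r y * indicator (\<Union>i. B i) (y i)) \<in> borel_measurable ?M" using rB[OF U(2)] by auto
   show "(\<lambda>y. r y * indicator (\<Union>i<n. B i) (y i)) \<in> borel_measurable ?M" for n using rB[OF U(1)] by auto
   show "AE y in ?M. (\<lambda>n. r y * indicator (\<Union>i<n. B i) (y i)) \<longlonglongrightarrow> r y * indicator (\<Union>i. B i) (y i)"
    by (intro AE_I2 tendsto_mult tendsto_const LIMSEQ_indicator_UN)
  qed (auto simp: indicator_def)
  moreover have "(LINT y|?M. r y * indicator (\<Union>i<n. B i) (y i)) = 0" for n
  proof -
   have ind: "indicator (\<Union>i<n. B i) x = (\<Sum>i<n. indicator (B i) x :: real)" for x
    using union(1) by (intro indicator_UN_disjoint) (auto simp: disjoint_family_on_def)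
   then have "(LINT y|?M. r y * indicator (\<Union>i<n. B i) (y i)) = (\<Sum>k<n. P (B k))"
    unfolding P ind sum_distrib_left using union borel
    by (intro B_integral_sum rB) auto
   then show ?thesis using union by simp
  qed
  ultimately show ?case unfolding P by (simp add: LIMSEQ_const_iff)
 next
  case (basic B)
  then show ?case using P0 by auto
 next
  case empty
  show ?case by (simp add: P)
 qed
 then show ?case by (simp add: P_def)
qed

text \<open>The difference of two weak derivatives integrates to zero over all measurable
  rectangles, hence, by a second Dynkin argument, over all measurable sets. This makes the Sobolev
  norm independent of the choice made in \<open>weak_mixed\<close>.\<close>

theorem weak_mixed_unique:
 assumes g: "has_weak_mixed s u G g" and g': "has_weak_mixed s u G g'"
 shows "AE y in cubeM s. g y = g' y"
proof -
 let ?M = "cubeM s"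
 note gi = has_weak_mixed_integrable[OF g] has_weak_mixed_integrable[OF g']
 define d where "d y = g y - g' y" for y
 have d: "integrable ?M d" unfolding d_def using gi by auto
 have test: "(LINT y|?M. d y * (\<Prod>j<s. \<phi> j (y j))) = 0" if \<phi>: "\<And>j. \<phi> j \<in> tests" for \<phi>
 proof -
  have "(-1) ^ card u * (LINT y|?M. h y * (\<Prod>j<s. \<phi> j (y j))) =
    (LINT y|?M. G y * (\<Prod>j<s. if j \<in> u then deriv (\<phi> j) (y j) else \<phi> j (y j)))"
   if "has_weak_mixed s u G h" for h
   using that \<phi> unfolding has_weak_mixed_def by simp
  from this[OF g] this[OF g']
  have "(-1) ^ card u * (LINT y|?M. g y * (\<Prod>j<s. \<phi> j (y j))) = (-1) ^ card u * (LINT y|?M. g' y * (\<Prod>j<s. \<phi> j (y j)))"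
   by (rule trans[OF _ sym])
  then have "(LINT y|?M. g y * (\<Prod>j<s. \<phi> j (y j))) = (LINT y|?M. g' y * (\<Prod>j<s. \<phi> j (y j)))" by simp
  moreover have "integrable ?M (\<lambda>y. h y * (\<Prod>j<s. \<phi> j (y j)))" if "integrable ?M h" for h
  proof (rule integrable_mult_cube_prod[OF that subset_refl])
   fix j
   show "\<phi> j \<in> borel_measurable borel" by (rule test_fun_measurable[OF \<phi>])
   show "\<exists>C. \<forall>x\<in>{-1/2..1/2}. \<bar>\<phi> j x\<bar> \<le> C" using test_fun_bounded[OF \<phi>, of j] by blast
  qed
  ultimately show ?thesis unfolding d_def left_diff_distrib using gi
   by (subst B_integral_diff) auto
 qed
 have rect: "(LINT y|?M. d y * (\<Prod>j<s. indicator (A j) (y j))) = 0" if "\<And>j. j < s \<Longrightarrow> A j \<in> sets borel" for A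
  by (rule weak_zero_rectangles[OF d weak_zero_boxes[OF d test], of "{..<s}"]) (auto intro: that)
 have Z: "(LINT y|?M. indicator B y * d y) = 0" if "B \<in> sets ?M" for B
 proof -
  define R where "R = {Pi\<^sub>E {..<s} E | E. \<forall>i\<in>{..<s}. E i \<in> sets unit_leb}"
  have sp: "space ?M = (\<Pi>\<^sub>E i\<in>{..<s}. space unit_leb)"
   unfolding cube_measure_def unit_leb_def[symmetric] space_PiM ..
  have "sets (PiM {..<s} (\<lambda>_. unit_leb)) = sigma_sets (\<Pi>\<^sub>E i\<in>{..<s}. space unit_leb) R"
   unfolding R_def sets_PiM by (subst prod_algebra_eq_finite) (auto intro!: arg_cong2[where f=sigma_sets])
  then have sM: "sigma_sets (space ?M) R = sets ?M"
   unfolding sp unfolding cube_measure_def unit_leb_def[symmetric] ..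
  have BR: "B \<in> sigma_sets (space ?M) R" using that by (simp only: sM)
  have IR: "Int_stable R" unfolding R_def by (rule Int_stable_PiE)
  have RP: "R \<subseteq> Pow (space ?M)" unfolding R_def sp using sets.sets_into_space by (auto simp: PiE_def Pi_def) blast
  have basic: "(LINT y|?M. indicator X y * d y) = 0" if X: "X \<in> R" for X
  proof -
   obtain E where E: "X = Pi\<^sub>E {..<s} E" "\<And>i. i < s \<Longrightarrow> E i \<in> sets unit_leb" using X unfolding R_def by auto
   have Eb: "E i \<in> sets borel" if "i < s" for i
    using E(2)[OF that] unfolding unit_leb_def by (auto simp: sets_restrict_space)
   have "(LINT y|?M. indicator X y * d y) = (LINT y|?M. d y * (\<Prod>j<s. indicator (E j) (y j)))"
   proof (rule B_integral_cong[OF refl])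
    fix y :: "nat \<Rightarrow> real" assume y: "y \<in> space ?M"
    have "(\<Prod>j<s. indicator (E j) (y j) :: real) = indicator X y"
     using y E(1) unfolding sp by (auto simp: indicator_def PiE_def Pi_def prod_eq_1_iff intro!: prod_zero)
    then show "indicator X y * d y = d y * (\<Prod>j<s. indicator (E j) (y j))" by simp
   qed
   then show ?thesis using rect[OF Eb] by simp
  qed
  show ?thesis using IR RP BR
  proof (induct rule: sigma_sets_induct_disjoint)
   case (compl X)
   have "space ?M \<in> R" unfolding R_def sp by (auto intro!: exI[of _ "\<lambda>_. space unit_leb"])
   then have "(LINT y|?M. indicator (space ?M) y * d y) = 0" by (rule basic)
   moreover have "integrable ?M (\<lambda>y. indicator X y * d y)" if "X \<in> sets ?M" for X
    using integrable_mult_indicator[OF that d] by simp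
   ultimately show ?case using compl sM
    by (subst B_integral_cong[OF refl, of _ _ "\<lambda>y. indicator (space ?M) y * d y - indicator X y * d y"])
     (auto simp: indicator_def)
  next
   case (union X)
   have X: "X n \<in> sets ?M" for n using union sM by auto
   have "(\<lambda>n. LINT y|?M. indicator (\<Union>i<n. X i) y * d y) \<longlonglongrightarrow> (LINT y|?M. indicator (\<Union>i. X i) y * d y)"
   proof (rule integral_dominated_convergence[of _ _ _ "\<lambda>y. \<bar>d y\<bar>"])
    show "integrable ?M (\<lambda>y. \<bar>d y\<bar>)" using d by auto
    show "(\<lambda>y. indicator (\<Union>i. X i) y * d y) \<in> borel_measurable ?M" using X d by auto
    show "(\<lambda>y. indicator (\<Union>i<n. X i) y * d y) \<in> borel_measurable ?M" for n using X d by auto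
    show "AE y in ?M. (\<lambda>n. indicator (\<Union>i<n. X i) y * d y) \<longlonglongrightarrow> indicator (\<Union>i. X i) y * d y"
     by (intro AE_I2 tendsto_mult tendsto_const LIMSEQ_indicator_UN)
   qed (auto simp: indicator_def)
   moreover have "(LINT y|?M. indicator (\<Union>i<n. X i) y * d y) = 0" for n
   proof -
    have ind: "indicator (\<Union>i<n. X i) x = (\<Sum>i<n. indicator (X i) x :: real)" for x
     using union(1) by (intro indicator_UN_disjoint) (auto simp: disjoint_family_on_def)
    then have "(LINT y|?M. indicator (\<Union>i<n. X i) y * d y) = (\<Sum>k<n. LINT y|?M. indicator (X k) y * d y)"
     unfolding ind sum_distrib_right using integrable_mult_indicator[OF X d]
     by (intro B_integral_sum) auto
    then show ?thesis using union by simp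
   qed
   ultimately show ?case by (simp add: LIMSEQ_const_iff)
  qed (auto simp: basic)
 qed
 have "AE y in ?M. d y = 0"
 proof -
  interpret prob_space ?M by (rule prob_space_cube_measure)
  show ?thesis by (rule density_zero[OF d]) (auto simp: set_lebesgue_integral_def Z)
 qed
 then show ?thesis unfolding d_def by simp
qed

section \<open>Univariate integrals of the kernel and of its primitive\<close>

lemma unit_leb_tail:
 fixes p P :: "real \<Rightarrow> real"
 assumes t: "-1/2 \<le> t" "t \<le> 1/2" and P: "\<And>x. (P has_real_derivative p x) (at x)" and p: "\<And>x. isCont p x"
 shows "(LINT x|unit_leb. (if t < x then p x else 0)) = P (1/2) - P t"
  and "integrable unit_leb (\<lambda>x. if t < x then p x else 0)"
proof -
 have "(LINT x|unit_leb. (if t < x then p x else 0)) = (LINT x|lborel. p x * indicator {t..1/2} x)"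
  unfolding unit_leb_integral set_lebesgue_integral_def
 proof (rule integral_cong_AE)
  have pm: "p \<in> borel_measurable borel"
   using p by (intro borel_measurable_continuous_onI) (simp add: continuous_on_eq_continuous_at)
  show "(\<lambda>x. indicator {-1/2..1/2} x *\<^sub>R (if t < x then p x else 0)) \<in> borel_measurable lborel"
   "(\<lambda>x. p x * indicator {t..1/2} x) \<in> borel_measurable lborel" using pm by measurable
  show "AE x in lborel. indicator {-1/2..1/2} x *\<^sub>R (if t < x then p x else 0) = p x * indicator {t..1/2} x"
   using AE_lborel_singleton[of t] by eventually_elim (use t in \<open>auto simp: indicator_def\<close>)
 qed
 also have "\<dots> = P (1/2) - P t" by (rule integral_FTC_Icc_real) (use t P p in auto)
 finally show "(LINT x|unit_leb. (if t < x then p x else 0)) = P (1/2) - P t" .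
 have pc: "continuous_on A p" for A using p by (simp add: continuous_at_imp_continuous_on)
 obtain C where C: "\<forall>x\<in>{-1/2..1/2}. \<bar>p x\<bar> \<le> C"
  using compact_imp_bounded[OF compact_continuous_image[OF pc, of "{-1/2..1/2}"]] unfolding bounded_iff by auto
 show "integrable unit_leb (\<lambda>x. if t < x then p x else 0)"
 proof (rule bounded_integrable_unit_leb[of _ "max C 0"])
  have "p \<in> borel_measurable borel" by (rule borel_measurable_continuous_onI[OF pc])
  then show "(\<lambda>x. if t < x then p x else 0) \<in> borel_measurable borel" by measurable
 qed (use C in \<open>auto simp: le_max_iff_disj\<close>)
qed

lemma unit_leb_FTC:
 fixes p P :: "real \<Rightarrow> real"
 assumes P: "\<And>x. (P has_real_derivative p x) (at x)" and p: "\<And>x. isCont p x"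
 shows "(LINT x|unit_leb. p x) = P (1/2) - P (-1/2)" "integrable unit_leb p"
proof -
 have pc: "continuous_on A p" for A using p by (simp add: continuous_at_imp_continuous_on)
 have pm: "p \<in> borel_measurable borel" by (rule borel_measurable_continuous_onI[OF pc])
 obtain C where C: "\<forall>x\<in>{-1/2..1/2}. \<bar>p x\<bar> \<le> C"
  using compact_imp_bounded[OF compact_continuous_image[OF pc, of "{-1/2..1/2}"]] unfolding bounded_iff by auto
 show "integrable unit_leb p" by (rule bounded_integrable_unit_leb[OF pm, of C]) (use C in auto)
 have "(LINT x|unit_leb. p x) = (LINT x|lborel. p x * indicator {-1/2..1/2} x)"
  unfolding unit_leb_integral set_lebesgue_integral_def by (simp add: mult.commute)
 also have "\<dots> = P (1/2) - P (-1/2)" by (rule integral_FTC_Icc_real) (use P p in auto)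
 finally show "(LINT x|unit_leb. p x) = P (1/2) - P (-1/2)" .
qed

text \<open>A primitive of \<open>kern t\<close>, with the additive constant that gives it mean
  zero.\<close>

definition kprim :: "real \<Rightarrow> real \<Rightarrow> real" where
 "kprim t x = max (x - t) 0 - (x + 1/2)\<^sup>2 / 2 + (1/6 - (1/2 - t)\<^sup>2 / 2)"

text \<open>With X = t + 1/2 and Y = t' + 1/2 this equals B2(|X - Y|)/2 + (X - 1/2)(Y - 1/2), where
  B2 is the second Bernoulli polynomial: the mean-free part of the reproducing kernel of the
  univariate unanchored Sobolev space.\<close>

definition kcov :: "real \<Rightarrow> real \<Rightarrow> real" where
 "kcov t t' = 1/3 - max (t + 1/2) (t' + 1/2) + ((t + 1/2)\<^sup>2 + (t' + 1/2)\<^sup>2) / 2"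

text \<open>Multiplied out, the product of two kernels is a sum of tails starting at
  \<open>max t t'\<close>, \<open>t\<close> and \<open>t'\<close> and of a quadratic polynomial,
  each with an elementary primitive.\<close>

lemma kern_kern_integral:
 assumes "-1/2 \<le> t" "t \<le> 1/2" "-1/2 \<le> t'" "t' \<le> 1/2"
 shows "(LINT x|unit_leb. kern t x * kern t' x) = kcov t t'"
proof -
 have d1: "((\<lambda>x. x) has_real_derivative 1) (at x)" for x :: real by (rule DERIV_ident)
 have d2: "((\<lambda>x. (x + 1/2)\<^sup>2 / 2) has_real_derivative x + 1/2) (at x)" for x :: real
  by (auto intro!: derivative_eq_intros)
 have d3: "((\<lambda>x. (x + 1/2)^3 / 3) has_real_derivative (x + 1/2)\<^sup>2) (at x)" for x :: real
  by (auto intro!: derivative_eq_intros)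
 have m: "-1/2 \<le> max t t'" "max t t' \<le> 1/2" using assms by auto
 note a = unit_leb_tail[OF m d1] unit_leb_tail[OF assms(1,2) d2] unit_leb_tail[OF assms(3,4) d2]
  unit_leb_FTC[OF d3]
 have "(LINT x|unit_leb. kern t x * kern t' x) = (LINT x|unit_leb.
   ((if max t t' < x then 1 else 0) - (if t < x then x + 1/2 else 0)) - (if t' < x then x + 1/2 else 0) + (x + 1/2)\<^sup>2)"
  by (rule B_integral_cong) (auto simp: kern_def algebra_simps power2_eq_square)
 also have "\<dots> = ((1/2 - max t t') - ((1/2 + 1/2)\<^sup>2 / 2 - (t + 1/2)\<^sup>2 / 2)) - ((1/2 + 1/2)\<^sup>2 / 2 - (t' + 1/2)\<^sup>2 / 2)
   + ((1/2 + 1/2)^3 / 3 - (-1/2 + 1/2)^3 / 3)"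
  using a by (subst Bochner_Integration.integral_add B_integral_diff; simp)+
 also have "\<dots> = kcov t t'" by (simp add: kcov_def field_simps max_def)
 finally show ?thesis .
qed

lemma kprim_alt: "kprim t x = (if t < x then x - t else 0) - (x + 1/2)\<^sup>2 / 2 + (1/6 - (1/2 - t)\<^sup>2 / 2)"
 by (simp add: kprim_def)

lemma kprim_continuous: "continuous_on A (kprim t)"
 unfolding kprim_def[abs_def] by (intro continuous_intros) auto

lemma kprim_mean:
 assumes "-1/2 \<le> t" "t \<le> 1/2"
 shows "(LINT x|unit_leb. kprim t x) = 0"
proof -
 have d1: "((\<lambda>x. (x - t)\<^sup>2 / 2) has_real_derivative x - t) (at x)" for x :: real
  by (auto intro!: derivative_eq_intros)
 have d2: "((\<lambda>x. (x + 1/2)^3 / 6 - x * (1/6 - (1/2 - t)\<^sup>2 / 2)) has_real_derivative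
   (x + 1/2)\<^sup>2 / 2 - (1/6 - (1/2 - t)\<^sup>2 / 2)) (at x)" for x :: real
  by (auto intro!: derivative_eq_intros)
 note a = unit_leb_tail[OF assms d1] unit_leb_FTC[OF d2]
 have "(LINT x|unit_leb. kprim t x) = (LINT x|unit_leb. (if t < x then x - t else 0) - ((x + 1/2)\<^sup>2 / 2 - (1/6 - (1/2 - t)\<^sup>2 / 2)))"
  by (rule B_integral_cong) (auto simp: kprim_alt)
 also have "\<dots> = (LINT x|unit_leb. (if t < x then x - t else 0)) - (LINT x|unit_leb. (x + 1/2)\<^sup>2 / 2 - (1/6 - (1/2 - t)\<^sup>2 / 2))"
  by (rule B_integral_diff) (use a in auto)
 also have "\<dots> = 0" using a by (simp add: field_simps power2_eq_square power3_eq_cube)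
 finally show ?thesis .
qed

section \<open>Weak derivatives of tensor products\<close>

definition weak_deriv1 :: "(real \<Rightarrow> real) \<Rightarrow> (real \<Rightarrow> real) \<Rightarrow> bool" where
 "weak_deriv1 m m' \<longleftrightarrow> (\<forall>\<phi>\<in>tests.
   (LINT x|unit_leb. m x * deriv \<phi> x) = - (LINT x|unit_leb. m' x * \<phi> x))"

lemma test_fun_deriv:
 assumes "\<phi> \<in> test_fun {-1/2..1/2::real}"
 shows "(\<phi> has_real_derivative deriv \<phi> x) (at x)" "isCont (deriv \<phi>) x" "isCont \<phi> x"
  "\<phi> (-1/2) = 0" "\<phi> (1/2) = 0" "deriv \<phi> \<in> tests"
proof -
 obtain F where F: "F 0 = \<phi>" "\<And>n x. (F n has_real_derivative F (Suc n) x) (at x)"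
  using assms smooth_realD unfolding test_fun_def by blast
 have d: "deriv \<phi> = F 1" using F(2)[of 0] by (auto simp: F(1) fun_eq_iff intro!: DERIV_imp_deriv)
 show D: "(\<phi> has_real_derivative deriv \<phi> x) (at x)" for x using F(2)[of 0] by (simp add: d F(1))
 show "isCont (deriv \<phi>) x" unfolding d using DERIV_isCont[OF F(2)] .
 show "isCont \<phi> x" using D DERIV_isCont by blast
 obtain a b where ab: "-1/2 < a" "b < 1/2" "\<And>x. x < a \<or> b < x \<Longrightarrow> \<phi> x = 0" using test_fun_realD[OF assms] by blast
 show "\<phi> (-1/2) = 0" "\<phi> (1/2) = 0" using ab by auto
 have "smooth ((\<lambda>n. F (Suc n)) 0)" by (rule smooth_realI) (rule F)
 then have "smooth (deriv \<phi>)" by (simp add: d)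
 moreover have "deriv \<phi> x = 0" if "x < a \<or> b < x" for x
 proof -
  have "open ({..<a} \<union> {b<..})" by auto
  then have "eventually (\<lambda>y. \<phi> y = 0) (nhds x)"
   using that ab(3) by (auto simp: eventually_nhds intro!: exI[of _ "{..<a} \<union> {b<..}"])
  then have "deriv \<phi> x = deriv (\<lambda>_. 0) x" by (intro deriv_cong_ev refl)
  then show ?thesis by simp
 qed
 ultimately show "deriv \<phi> \<in> tests" using ab by (intro test_funI)
qed

text \<open>\<open>kprim t\<close> has a kink at \<open>t\<close>. The part beyond \<open>t\<close>
  is integrated separately: its total derivative is that of \<open>(x - t) * \<phi> x\<close>, which
  vanishes at \<open>t\<close> as well as at 1/2.\<close>

lemma weak_deriv1_kprim:
 assumes "-1/2 \<le> t" "t \<le> 1/2"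
 shows "weak_deriv1 (kprim t) (kern t)"
 unfolding weak_deriv1_def
proof
 fix \<phi> :: "real \<Rightarrow> real" assume \<phi>: "\<phi> \<in> tests"
 note D = test_fun_deriv[OF \<phi>]
 define q where "q x = (x + 1/2)\<^sup>2 / 2 - (1/6 - (1/2 - t)\<^sup>2 / 2)" for x :: real
 have d1: "((\<lambda>x. (x - t) * \<phi> x) has_real_derivative (x - t) * deriv \<phi> x + \<phi> x) (at x)" for x
  using D(1)[of x] by (auto intro!: derivative_eq_intros)
 have d2: "((\<lambda>x. q x * \<phi> x) has_real_derivative q x * deriv \<phi> x + (x + 1/2) * \<phi> x) (at x)" for x
  unfolding q_def using D(1)[of x] by (auto intro!: derivative_eq_intros)
 have c1: "isCont (\<lambda>x. (x - t) * deriv \<phi> x + \<phi> x) x" for x using D by (intro continuous_intros)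
 have c2: "isCont (\<lambda>x. q x * deriv \<phi> x + (x + 1/2) * \<phi> x) x" for x unfolding q_def using D by (intro continuous_intros) auto
 note a = unit_leb_tail[OF assms d1 c1] unit_leb_FTC[OF d2 c2]
 have bd: "\<exists>C. \<forall>x\<in>{-1/2..1/2}. \<bar>kprim t x\<bar> \<le> C"
  using compact_imp_bounded[OF compact_continuous_image[OF kprim_continuous, of "{-1/2..1/2}" t]] unfolding bounded_iff by auto
 then obtain C where C: "\<And>x. x \<in> {-1/2..1/2} \<Longrightarrow> \<bar>kprim t x\<bar> \<le> C" by blast
 have i1: "integrable unit_leb (\<lambda>x. deriv \<phi> x * kprim t x)"
  by (rule integrable_mult_bounded_real[OF test_fun_integrable[OF D(6)], of _ C])
    (auto intro!: unit_leb_measurable borel_measurable_continuous_onI kprim_continuous C simp: space_unit_leb)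
 have i2: "integrable unit_leb (\<lambda>x. \<phi> x * kern t x)"
  by (rule integrable_mult_bounded_real[OF test_fun_integrable[OF \<phi>], of _ 1])
    (auto intro!: unit_leb_measurable kern_measurable kern_bounded simp: space_unit_leb)
 have "(LINT x|unit_leb. kprim t x * deriv \<phi> x) + (LINT x|unit_leb. kern t x * \<phi> x) =
   (LINT x|unit_leb. kprim t x * deriv \<phi> x + kern t x * \<phi> x)"
  using i1 i2 by (subst Bochner_Integration.integral_add) (auto simp: mult.commute)
 also have "\<dots> = (LINT x|unit_leb. (if t < x then (x - t) * deriv \<phi> x + \<phi> x else 0) - (q x * deriv \<phi> x + (x + 1/2) * \<phi> x))"
  by (rule B_integral_cong) (auto simp: kprim_alt kern_def q_def algebra_simps)
 also have "\<dots> = 0"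
  using a D(4,5) by (subst B_integral_diff) auto
 finally show "(LINT x|unit_leb. kprim t x * deriv \<phi> x) = - (LINT x|unit_leb. kern t x * \<phi> x)" by linarith
qed

lemma weak_deriv1_const: "weak_deriv1 (\<lambda>_. 1) (\<lambda>_. 0)"
 unfolding weak_deriv1_def
proof
 fix \<phi> :: "real \<Rightarrow> real" assume \<phi>: "\<phi> \<in> tests"
 note D = test_fun_deriv[OF \<phi>]
 show "(LINT x|unit_leb. 1 * deriv \<phi> x) = - (LINT x|unit_leb. 0 * \<phi> x)"
  using unit_leb_FTC(1)[OF D(1) D(2)] D(4,5) by simp
qed

definition bdd_meas :: "(real \<Rightarrow> real) \<Rightarrow> bool" where
 "bdd_meas m \<longleftrightarrow> m \<in> borel_measurable borel \<and> (\<exists>C. \<forall>x\<in>{-1/2..1/2}. \<bar>m x\<bar> \<le> C)"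

lemma bdd_meas_mult: "bdd_meas f \<Longrightarrow> bdd_meas g \<Longrightarrow> bdd_meas (\<lambda>x. f x * g x)"
proof -
 assume "bdd_meas f" "bdd_meas g"
 then obtain C C' where f: "f \<in> borel_measurable borel" "\<And>x. x \<in> {-1/2..1/2} \<Longrightarrow> \<bar>f x\<bar> \<le> C"
  and g: "g \<in> borel_measurable borel" "\<And>x. x \<in> {-1/2..1/2} \<Longrightarrow> \<bar>g x\<bar> \<le> C'"
  unfolding bdd_meas_def by blast
 have "\<bar>f x * g x\<bar> \<le> C * C'" if "x \<in> {-1/2..1/2}" for x
  unfolding abs_mult using f(2)[OF that] g(2)[OF that] by (intro mult_mono) auto
 then show ?thesis unfolding bdd_meas_def using f g by (intro conjI exI[of _ "C * C'"]) auto
qed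

lemma bdd_meas_integrable: "bdd_meas f \<Longrightarrow> integrable unit_leb f"
 unfolding bdd_meas_def by (elim conjE exE, rule bounded_integrable_unit_leb) auto

lemma bdd_meas_kern: "bdd_meas (kern t)"
 unfolding bdd_meas_def using kern_measurable kern_bounded by blast

lemma bdd_meas_continuous:
 assumes "continuous_on UNIV m" shows "bdd_meas m"
 unfolding bdd_meas_def
proof
 show "m \<in> borel_measurable borel" by (rule borel_measurable_continuous_onI[OF assms])
 show "\<exists>C. \<forall>x\<in>{-1/2..1/2}. \<bar>m x\<bar> \<le> C"
  using compact_imp_bounded[OF compact_continuous_image[OF continuous_on_subset[OF assms], of "{-1/2..1/2}"]]
  unfolding bounded_iff by auto
qed

lemma bdd_meas_test: "\<phi> \<in> tests \<Longrightarrow> bdd_meas \<phi>"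
 by (intro bdd_meas_continuous test_fun_continuous)

lemma bdd_meas_cube_prod:
 assumes "\<And>j. j \<in> I \<Longrightarrow> bdd_meas (f j)" "finite I" "I \<subseteq> J"
 shows "integrable (cube_measure J) (\<lambda>y. \<Prod>j\<in>I. f j (y j))"
  "\<exists>C. \<forall>y\<in>space (cube_measure J). \<bar>\<Prod>j\<in>I. f j (y j)\<bar> \<le> C"
  "(\<lambda>y. \<Prod>j\<in>I. f j (y j)) \<in> borel_measurable (cube_measure J)"
proof -
 interpret prob_space "cube_measure J" by (rule prob_space_cube_measure)
 show m: "(\<lambda>y. \<Prod>j\<in>I. f j (y j)) \<in> borel_measurable (cube_measure J)"
  using assms by (intro cube_prod_measurable) (auto simp: bdd_meas_def)
 obtain C where C: "\<And>j x. j \<in> I \<Longrightarrow> x \<in> {-1/2..1/2} \<Longrightarrow> \<bar>f j x\<bar> \<le> C j"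
  using assms(1) unfolding bdd_meas_def by metis
 have b: "\<bar>\<Prod>j\<in>I. f j (y j)\<bar> \<le> (\<Prod>j\<in>I. C j)" if y: "y \<in> space (cube_measure J)" for y
 proof (rule prod_abs_le, rule C)
  fix j assume "j \<in> I"
  then show "y j \<in> {-1/2..1/2}"
   using y assms(3) unfolding cube_measure_def unit_leb_def[symmetric] space_PiM
   by (auto simp: space_unit_leb PiE_def Pi_def)
 qed
 then show "\<exists>C. \<forall>y\<in>space (cube_measure J). \<bar>\<Prod>j\<in>I. f j (y j)\<bar> \<le> C" by blast
 show "integrable (cube_measure J) (\<lambda>y. \<Prod>j\<in>I. f j (y j))"
  by (rule integrable_const_bound[OF _ m, of "\<Prod>j\<in>I. C j"]) (auto intro!: AE_I2 b)
qed

text \<open>By Fubini the pairing with product test functions factors, and every coordinate in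
  \<open>u\<close> contributes one sign.\<close>

lemma has_weak_mixed_prod:
 assumes u: "u \<subseteq> {..<s}"
  and m: "\<And>j. j < s \<Longrightarrow> bdd_meas (m j)" "\<And>j. j < s \<Longrightarrow> bdd_meas (m' j)"
   "\<And>j. j < s \<Longrightarrow> weak_deriv1 (m j) (m' j)"
 shows "has_weak_mixed s u (\<lambda>y. \<Prod>j<s. m j (y j)) (\<lambda>y. \<Prod>j<s. (if j \<in> u then m' j else m j) (y j))"
 unfolding has_weak_mixed_def
proof (intro conjI allI impI)
 let ?M = "cubeM s"
 define g where "g j = (if j \<in> u then m' j else m j)" for j
 have g: "bdd_meas (g j)" if "j < s" for j using m that by (simp add: g_def)
 note G = bdd_meas_cube_prod[of "{..<s}" g "{..<s}"]
 have "bdd_meas (\<lambda>x. (g j x)\<^sup>2)" if "j < s" for j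
  unfolding power2_eq_square by (rule bdd_meas_mult[OF g g]) (use that in auto)
 then have "integrable ?M (\<lambda>y. \<Prod>j<s. (g j (y j))\<^sup>2)" by (intro bdd_meas_cube_prod(1)) auto
 then show "integrable ?M (\<lambda>y. (\<Prod>j<s. (if j \<in> u then m' j else m j) (y j))\<^sup>2)"
  unfolding g_def prod_power_distrib .
 show "(\<lambda>y. \<Prod>j<s. (if j \<in> u then m' j else m j) (y j)) \<in> borel_measurable ?M"
  using G(3) g unfolding g_def by simp
 fix \<phi> :: "nat \<Rightarrow> real \<Rightarrow> real" assume "\<forall>j. \<phi> j \<in> test_fun {- 1 / 2..1 / 2}"
 then have \<phi>: "\<phi> j \<in> tests" for j by blast
 have "(LINT y|?M. (\<Prod>j<s. m j (y j)) * (\<Prod>j<s. if j \<in> u then deriv (\<phi> j) (y j) else \<phi> j (y j))) =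
   (LINT y|?M. (\<Prod>j<s. (\<lambda>x. m j x * (if j \<in> u then deriv (\<phi> j) x else \<phi> j x)) (y j)))"
  by (simp add: prod.distrib)
 also have "\<dots> = (\<Prod>j<s. LINT x|unit_leb. m j x * (if j \<in> u then deriv (\<phi> j) x else \<phi> j x))"
 proof (rule cube_integral_prod(1))
  show "integrable unit_leb (\<lambda>x. m j x * (if j \<in> u then deriv (\<phi> j) x else \<phi> j x))" if "j \<in> {..<s}" for j
   using that m(1)[of j] bdd_meas_test[OF \<phi>[of j]] bdd_meas_test[OF test_fun_deriv(6)[OF \<phi>[of j]]]
   by (cases "j \<in> u") (auto intro!: bdd_meas_integrable bdd_meas_mult)
 qed simp
 also have "\<dots> = (\<Prod>j<s. (if j \<in> u then -1 else 1) * (LINT x|unit_leb. g j x * \<phi> j x))"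
  using m(3) \<phi> by (intro prod.cong) (auto simp: weak_deriv1_def g_def)
 also have "\<dots> = (-1) ^ card u * (\<Prod>j<s. LINT x|unit_leb. g j x * \<phi> j x)"
  using u by (simp add: prod.distrib prod.If_cases Int_absorb1)
 also have "(\<Prod>j<s. LINT x|unit_leb. g j x * \<phi> j x) = (LINT y|?M. (\<Prod>j<s. (\<lambda>x. g j x * \<phi> j x) (y j)))"
  using g bdd_meas_test[OF \<phi>] by (intro cube_integral_prod(1)[symmetric]) (auto intro!: bdd_meas_integrable bdd_meas_mult)
 also have "\<dots> = (LINT y|?M. (\<Prod>j<s. (if j \<in> u then m' j else m j) (y j)) * (\<Prod>j<s. \<phi> j (y j)))"
  by (simp add: prod.distrib g_def)
 finally show "(LINT y|?M. (\<Prod>j<s. m j (y j)) * (\<Prod>j<s. if j \<in> u then deriv (\<phi> j) (y j) else \<phi> j (y j))) =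
    (- 1) ^ card u * (LINT y|?M. (\<Prod>j<s. (if j \<in> u then m' j else m j) (y j)) * (\<Prod>j<s. \<phi> j (y j)))" .
qed

lemma square_integrable_mult:
 fixes f g :: "'a \<Rightarrow> real"
 assumes "f \<in> borel_measurable M" "g \<in> borel_measurable M" "integrable M (\<lambda>x. (f x)\<^sup>2)" "integrable M (\<lambda>x. (g x)\<^sup>2)"
 shows "integrable M (\<lambda>x. f x * g x)"
proof (rule Bochner_Integration.integrable_bound[of _ "\<lambda>x. (f x)\<^sup>2 + (g x)\<^sup>2"])
 show "AE x in M. norm (f x * g x) \<le> norm ((f x)\<^sup>2 + (g x)\<^sup>2)"
 proof (rule AE_I2)
  fix x
  have "0 \<le> (\<bar>f x\<bar> - \<bar>g x\<bar>)\<^sup>2" by simp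
  then have "2 * \<bar>f x * g x\<bar> \<le> (f x)\<^sup>2 + (g x)\<^sup>2" by (simp add: power2_diff abs_mult)
  then show "norm (f x * g x) \<le> norm ((f x)\<^sup>2 + (g x)\<^sup>2)" by simp
 qed
qed (use assms in auto)

lemma has_weak_mixed_sum:
 assumes "finite K" "\<And>k. k \<in> K \<Longrightarrow> has_weak_mixed s u (G k) (g k)"
  "\<And>k. k \<in> K \<Longrightarrow> integrable (cubeM s) (G k)"
 shows "has_weak_mixed s u (\<lambda>y. \<Sum>k\<in>K. c k * G k y) (\<lambda>y. \<Sum>k\<in>K. c k * g k y)"
 unfolding has_weak_mixed_def
proof (intro conjI allI impI)
 let ?M = "cubeM s"
 have g: "g k \<in> borel_measurable ?M" "integrable ?M (\<lambda>y. (g k y)\<^sup>2)"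
  "\<forall>\<phi>. (\<forall>j. \<phi> j \<in> tests) \<longrightarrow>
    (LINT y|?M. G k y * (\<Prod>j<s. if j \<in> u then deriv (\<phi> j) (y j) else \<phi> j (y j))) =
    (-1) ^ card u * (LINT y|?M. g k y * (\<Prod>j<s. \<phi> j (y j)))" if "k \<in> K" for k
  using assms(2)[OF that] unfolding has_weak_mixed_def by blast+
 show "(\<lambda>y. \<Sum>k\<in>K. c k * g k y) \<in> borel_measurable ?M" using g by auto
 have "(\<lambda>y. (\<Sum>k\<in>K. c k * g k y)\<^sup>2) = (\<lambda>y. \<Sum>k\<in>K. \<Sum>l\<in>K. (c k * c l) * (g k y * g l y))"
  by (simp add: power2_eq_square sum_product mult_ac)
 moreover have "integrable ?M (\<lambda>y. g k y * g l y)" if "k \<in> K" "l \<in> K" for k l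
  using g that by (intro square_integrable_mult) auto
 ultimately show "integrable ?M (\<lambda>y. (\<Sum>k\<in>K. c k * g k y)\<^sup>2)"
  by (simp only:) (intro B_integrable_sum integrable_mult_right)
 fix \<phi> :: "nat \<Rightarrow> real \<Rightarrow> real" assume \<phi>0: "\<forall>j. \<phi> j \<in> test_fun {- 1 / 2..1 / 2}"
 then have \<phi>: "\<phi> j \<in> tests" for j by blast
 define h where "h j = (if j \<in> u then deriv (\<phi> j) else \<phi> j)" for j
 have h: "bdd_meas (h j)" for j unfolding h_def using \<phi> test_fun_deriv(6) bdd_meas_test by auto
 have hh: "(\<Prod>j<s. if j \<in> u then deriv (\<phi> j) (y j) else \<phi> j (y j)) = (\<Prod>j<s. h j (y j))" for y
  by (rule prod.cong) (auto simp: h_def)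
 have i: "integrable ?M (\<lambda>y. c k * (f y * (\<Prod>j<s. h j (y j))))" if "integrable ?M f" "\<And>j. bdd_meas (h j)" for f k h
  using that by (intro integrable_mult_right integrable_mult_cube_prod) (auto simp: bdd_meas_def)
 have "(LINT y|?M. (\<Sum>k\<in>K. c k * G k y) * (\<Prod>j<s. h j (y j))) = (LINT y|?M. (\<Sum>k\<in>K. c k * (G k y * (\<Prod>j<s. h j (y j)))))"
  by (simp only: sum_distrib_right mult.assoc)
 also have "\<dots> = (\<Sum>k\<in>K. LINT y|?M. c k * (G k y * (\<Prod>j<s. h j (y j))))"
  by (intro B_integral_sum i assms(3) h)
 also have "\<dots> = (\<Sum>k\<in>K. (-1) ^ card u * (LINT y|?M. c k * (g k y * (\<Prod>j<s. \<phi> j (y j)))))"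
 proof (rule sum.cong[OF refl])
  fix k assume k: "k \<in> K"
  show "(LINT y|?M. c k * (G k y * (\<Prod>j<s. h j (y j)))) = (-1) ^ card u * (LINT y|?M. c k * (g k y * (\<Prod>j<s. \<phi> j (y j))))"
   using g(3)[OF k, rule_format, of \<phi>] \<phi> by (simp add: hh)
 qed
 also have "\<dots> = (-1) ^ card u * (LINT y|?M. (\<Sum>k\<in>K. c k * (g k y * (\<Prod>j<s. \<phi> j (y j)))))"
  unfolding sum_distrib_left[symmetric]
  by (intro mult_arg_cong refl B_integral_sum[symmetric] i
    has_weak_mixed_integrable[OF assms(2)] bdd_meas_test \<phi>)
 also have "(LINT y|?M. (\<Sum>k\<in>K. c k * (g k y * (\<Prod>j<s. \<phi> j (y j))))) = (LINT y|?M. (\<Sum>k\<in>K. c k * g k y) * (\<Prod>j<s. \<phi> j (y j)))"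
  by (simp only: sum_distrib_right mult.assoc)
 finally show "(LINT y|?M. (\<Sum>k\<in>K. c k * G k y) * (\<Prod>j<s. if j \<in> u then deriv (\<phi> j) (y j) else \<phi> j (y j))) =
   (- 1) ^ card u * (LINT y|?M. (\<Sum>k\<in>K. c k * g k y) * (\<Prod>j<s. \<phi> j (y j)))" unfolding hh .
qed

section \<open>The component-by-component bound\<close>

definition bern2 :: "real \<Rightarrow> real" where "bern2 x = x\<^sup>2 - x + 1/6"

section \<open>Discrete Fourier transform of the Bernoulli polynomial\<close>

definition rou :: "nat \<Rightarrow> complex" where
 "rou n = exp (2 * of_real pi * \<i> / of_nat n)"

text \<open>Closed form of the aliased Fourier coefficients of the second Bernoulli polynomial: the
  sum of 1/(2 pi^2 l^2) over all nonzero integers l congruent to \<open>h\<close> modulo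
  \<open>n\<close>. Working with it keeps all frequency sums finite.\<close>

definition dftc :: "nat \<Rightarrow> nat \<Rightarrow> real" where
 "dftc n h = (if h = 0 then 1 / (6 * (real n)\<^sup>2) else 1 / (2 * (real n)\<^sup>2 * (sin (pi * real h / real n))\<^sup>2))"

lemma dftc_nonneg: "dftc n h \<ge> 0" by (simp add: dftc_def)

lemma rou_power: "rou n ^ k = exp (2 * of_real pi * \<i> * of_nat k / of_nat n)"
 unfolding rou_def exp_of_nat_mult[symmetric] by (simp add: mult_ac)

lemma rou_power_eq_1: "n \<ge> 1 \<Longrightarrow> rou n ^ k = 1 \<longleftrightarrow> n dvd k"
 unfolding rou_power by (rule complex_root_unity_eq_1)

lemma rou_power_mod: "n \<ge> 1 \<Longrightarrow> rou n ^ k = rou n ^ (k mod n)"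
proof -
 assume n: "n \<ge> 1"
 have "rou n ^ k = rou n ^ (n * (k div n) + k mod n)" by simp
 also have "\<dots> = (rou n ^ n) ^ (k div n) * rou n ^ (k mod n)" by (simp only: power_add power_mult)
 also have "rou n ^ n = 1" using rou_power_eq_1[OF n] by simp
 finally show ?thesis by simp
qed

lemma rou_nonzero: "rou n \<noteq> 0" by (simp add: rou_def)

lemma root_sum_0: "(\<omega>::complex) ^ n = 1 \<Longrightarrow> \<omega> \<noteq> 1 \<Longrightarrow> (\<Sum>k<n. \<omega> ^ k) = 0"
 by (simp add: sum_gp_strict)

lemma rou_orth: "n \<ge> 1 \<Longrightarrow> (\<Sum>i<n. rou n ^ (d * i)) = (if n dvd d then of_nat n else 0)"
proof -
 assume n: "n \<ge> 1"
 have "(rou n ^ d) ^ n = 1" using rou_power_eq_1[OF n, of "d * n"] by (simp add: power_mult)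
 then show ?thesis
  using rou_power_eq_1[OF n, of d] root_sum_0[of "rou n ^ d" n] by (auto simp: power_mult)
qed

text \<open>Summation by parts. At a nontrivial \<open>N\<close>-th root of unity the last sum
  vanishes and the moment becomes explicit.\<close>

lemma sum_k_power: "((\<omega>::complex) - 1) * (\<Sum>k<N. of_nat k * \<omega> ^ k) = of_nat N * \<omega> ^ N - (\<Sum>k<N. \<omega> ^ Suc k)"
 by (induction N) (auto simp: algebra_simps)

lemma sum_k2_power: "((\<omega>::complex) - 1) * (\<Sum>k<N. (of_nat k)\<^sup>2 * \<omega> ^ k) =
  (of_nat N)\<^sup>2 * \<omega> ^ N - 2 * \<omega> * (\<Sum>k<N. of_nat k * \<omega> ^ k) - (\<Sum>k<N. \<omega> ^ Suc k)"
 by (induction N) (auto simp: algebra_simps power2_eq_square)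

lemma bern2_dft_nonzero:
 assumes n: "n \<ge> 1" and \<omega>: "\<omega> ^ n = 1" "\<omega> \<noteq> (1::complex)"
 shows "(\<Sum>k<n. complex_of_real (bern2 (real k / real n)) * \<omega> ^ k) = - 2 * \<omega> / (of_nat n * (\<omega> - 1)\<^sup>2)"
proof -
 have s0: "(\<Sum>k<n. \<omega> ^ k) = 0" by (rule root_sum_0[OF \<omega>])
 then have s0': "(\<Sum>k<n. \<omega> ^ Suc k) = 0" by (simp add: sum_distrib_left[symmetric])
 have w: "\<omega> - 1 \<noteq> 0" using \<omega> by simp
 have s1: "(\<Sum>k<n. of_nat k * \<omega> ^ k) = of_nat n / (\<omega> - 1)"
  using sum_k_power[of \<omega> n] w s0' \<omega>(1) by (simp add: field_simps)
 have s2: "(\<Sum>k<n. (of_nat k)\<^sup>2 * \<omega> ^ k) = ((of_nat n)\<^sup>2 - 2 * \<omega> * (of_nat n / (\<omega> - 1))) / (\<omega> - 1)"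
  using sum_k2_power[of \<omega> n] w s0' \<omega>(1) s1 by (simp add: nonzero_eq_divide_eq mult.commute)
 have "(\<Sum>k<n. complex_of_real (bern2 (real k / real n)) * \<omega> ^ k) =
   (\<Sum>k<n. (1 / (of_nat n)\<^sup>2) * ((of_nat k)\<^sup>2 * \<omega> ^ k) - (1 / of_nat n) * (of_nat k * \<omega> ^ k) + (1/6) * \<omega> ^ k)"
  by (rule sum.cong) (auto simp: bern2_def algebra_simps power_divide)
 also have "\<dots> = (1 / (of_nat n)\<^sup>2) * (\<Sum>k<n. (of_nat k)\<^sup>2 * \<omega> ^ k) - (1 / of_nat n) * (\<Sum>k<n. of_nat k * \<omega> ^ k)
   + (1/6) * (\<Sum>k<n. \<omega> ^ k)"
  by (simp add: sum.distrib sum_subtractf sum_distrib_left)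
 also have "\<dots> = - 2 * \<omega> / (of_nat n * (\<omega> - 1)\<^sup>2)"
 proof -
  have "(1 / N\<^sup>2) * ((N\<^sup>2 - 2 * \<omega> * (N / v)) / v) - 1 / N * (N / v) + 1 / 6 * 0 = - 2 * \<omega> / (N * v\<^sup>2)"
   if "N \<noteq> 0" "v \<noteq> 0" for N v :: complex
   using that by (simp add: field_simps power2_eq_square)
  then show ?thesis unfolding s0 s1 s2 using w n by simp
 qed
 finally show ?thesis .
qed

lemma bern2_sum: "n \<ge> 1 \<Longrightarrow> (\<Sum>k<n. bern2 (real k / real n)) = 1 / (6 * real n)"
proof -
 assume n: "n \<ge> 1"
 have 1: "(\<Sum>k<n. real k) = real n * (real n - 1) / 2" by (induction n) (auto simp: field_simps)
 have 2: "(\<Sum>k<n. (real k)\<^sup>2) = (real n - 1) * real n * (2 * real n - 1) / 6"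
  by (induction n) (auto simp: field_simps power2_eq_square)
 have "(\<Sum>k<n. bern2 (real k / real n)) = (1 / (real n)\<^sup>2) * (\<Sum>k<n. (real k)\<^sup>2) - (1 / real n) * (\<Sum>k<n. real k) + real n / 6"
  by (simp add: bern2_def sum.distrib sum_subtractf sum_distrib_left power_divide)
 also have "\<dots> = 1 / (6 * real n)" unfolding 1 2 using n by (simp add: field_simps power2_eq_square)
 finally show ?thesis .
qed

text \<open>With e = exp (i x) the root is e^(-2), the quotient becomes -1/(e - 1/e)^2, and e - 1/e
  = 2 i sin x.\<close>

lemma rou_ratio: "\<omega> = inverse (exp (2 * \<i> * of_real x)) \<Longrightarrow> sin x \<noteq> 0 \<Longrightarrow> - \<omega> / (\<omega> - 1)\<^sup>2 = of_real (1 / (4 * (sin x)\<^sup>2))"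
proof -
 assume w: "\<omega> = inverse (exp (2 * \<i> * of_real x))" and s: "sin x \<noteq> 0"
 define e where "e = exp (\<i> * of_real x)"
 have e0: "e \<noteq> 0" by (simp add: e_def)
 have w': "\<omega> = inverse (e * e)" unfolding w e_def exp_add[symmetric] by (simp add: algebra_simps)
 have ss: "of_real (sin x) = (e - inverse e) / (2 * \<i>)"
  unfolding e_def exp_minus[symmetric] using sin_exp_eq[of "complex_of_real x"] by (simp add: sin_of_real)
 have "complex_of_real (4 * (sin x)\<^sup>2) = 4 * (of_real (sin x))\<^sup>2" by simp
 also have "\<dots> = - (e - inverse e)\<^sup>2" unfolding ss by (simp add: power_divide power_mult_distrib)
 finally have 1: "complex_of_real (4 * (sin x)\<^sup>2) = - (e - inverse e)\<^sup>2" .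
 have "complex_of_real (4 * (sin x)\<^sup>2) \<noteq> 0" using s by simp
 then have 2: "e - inverse e \<noteq> 0" unfolding 1 by auto
 have "(\<omega> - 1)\<^sup>2 = \<omega> * (e - inverse e)\<^sup>2"
  unfolding w' using e0 by (simp add: field_simps power2_eq_square)
 then have "- \<omega> / (\<omega> - 1)\<^sup>2 = 1 / (- (e - inverse e)\<^sup>2)"
 proof -
  have "\<omega> \<noteq> 0" using e0 w' by simp
  then show ?thesis unfolding \<open>(\<omega> - 1)\<^sup>2 = _\<close> using 2 by (simp add: field_simps)
 qed
 then show ?thesis unfolding of_real_divide 1 by simp
qed

text \<open>The coefficients are first identified with \<open>dftc\<close> (fact
  \<open>hat\<close>). In the inverse transform all terms but one then drop out, because distinct
  exponents below \<open>n\<close> leave a sum over a nontrivial root of unity.\<close>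

lemma bern2_dft:
 assumes n: "n \<ge> 1" and k: "k < n"
 shows "complex_of_real (bern2 (real k / real n)) = (\<Sum>h<n. of_real (dftc n h) * rou n ^ (h * k))"
proof -
 define b where "b l = complex_of_real (bern2 (real l / real n))" for l :: nat
 define W where "W = rou n"
 have W0: "W \<noteq> 0" by (simp add: W_def rou_nonzero)
 have hat: "(1 / of_nat n) * (\<Sum>l<n. b l * inverse W ^ (h * l)) = of_real (dftc n h)" if h: "h < n" for h
 proof (cases "h = 0")
  case True
  have "(\<Sum>l<n. b l) = of_real (1 / (6 * real n))"
   unfolding b_def of_real_sum[symmetric] bern2_sum[OF n] ..
  then show ?thesis using True n by (simp add: dftc_def power2_eq_square)
 next
  case False
  define \<omega> where "\<omega> = inverse W ^ h"
  have wn: "\<omega> ^ n = 1"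
   using rou_power_eq_1[OF n, of "h * n"] unfolding \<omega>_def W_def by (simp add: power_inverse power_mult)
  have w1: "\<omega> \<noteq> 1"
   using rou_power_eq_1[OF n, of h] h False unfolding \<omega>_def W_def
   by (auto simp: power_inverse inverse_eq_1_iff dest: dvd_imp_le)
  have x: "sin (pi * real h / real n) \<noteq> 0"
  proof -
   have "0 < pi * real h / real n" "pi * real h / real n < pi"
    using h False by (auto simp: field_simps)
   then show ?thesis using sin_gt_zero by fastforce
  qed
  have w2: "\<omega> = inverse (exp (2 * \<i> * of_real (pi * real h / real n)))"
   unfolding \<omega>_def W_def power_inverse rou_power by (simp add: mult_ac)
  have "(\<Sum>l<n. b l * inverse W ^ (h * l)) = (\<Sum>l<n. b l * \<omega> ^ l)" by (simp add: \<omega>_def power_mult)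
  also have "\<dots> = 2 / of_nat n * (- \<omega> / (\<omega> - 1)\<^sup>2)"
   unfolding b_def bern2_dft_nonzero[OF n wn w1] by simp
  also have "\<dots> = of_real (2 / real n * (1 / (4 * (sin (pi * real h / real n))\<^sup>2)))"
   unfolding rou_ratio[OF w2 x] by simp
  finally show ?thesis using False by (simp add: dftc_def power2_eq_square)
 qed
 have "(\<Sum>h<n. of_real (dftc n h) * W ^ (h * k)) =
   (\<Sum>h<n. \<Sum>l<n. (1 / of_nat n) * b l * (W ^ k * inverse W ^ l) ^ h)"
 proof (rule sum.cong[OF refl])
  fix h assume "h \<in> {..<n}"
  then have "of_real (dftc n h) * W ^ (h * k) = (1 / of_nat n) * (\<Sum>l<n. b l * inverse W ^ (h * l)) * W ^ (h * k)"
   using hat[of h] by simp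
  also have "\<dots> = (\<Sum>l<n. (1 / of_nat n) * b l * (inverse W ^ (h * l) * W ^ (h * k)))"
   by (simp only: sum_distrib_left sum_distrib_right mult.assoc)
  also have "\<dots> = (\<Sum>l<n. (1 / of_nat n) * b l * (W ^ k * inverse W ^ l) ^ h)"
   by (simp only: power_mult_distrib power_mult[symmetric] mult.commute[of h] mult.commute[of "W ^ _"])
  finally show "of_real (dftc n h) * W ^ (h * k) = (\<Sum>l<n. (1 / of_nat n) * b l * (W ^ k * inverse W ^ l) ^ h)" .
 qed
 also have "\<dots> = (\<Sum>l<n. (1 / of_nat n) * b l * (\<Sum>h<n. (W ^ k * inverse W ^ l) ^ h))"
  by (subst sum.swap) (simp add: sum_distrib_left)
 also have "\<dots> = (\<Sum>l<n. if l = k then b l else 0)"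
 proof (rule sum.cong[OF refl])
  fix l assume "l \<in> {..<n}"
  then have l: "l < n" by simp
  show "(1 / of_nat n) * b l * (\<Sum>h<n. (W ^ k * inverse W ^ l) ^ h) = (if l = k then b l else 0)"
  proof (cases "l = k")
   case True
   have "W ^ k * inverse W ^ l = 1" using True W0 by (simp add: power_inverse)
   then show ?thesis using True n by simp
  next
   case False
   have "W ^ k \<noteq> W ^ l"
    unfolding W_def rou_power using complex_root_unity_eq[OF n, of k l] False k l by (auto simp: cong_def)
   then have 1: "W ^ k * inverse W ^ l \<noteq> 1" using W0 by (simp add: power_inverse field_simps)
   have "W ^ n = 1" using rou_power_eq_1[OF n, of n] by (simp add: W_def)
   then have "(W ^ k * inverse W ^ l) ^ n = 1"
    by (simp add: power_mult_distrib power_inverse power_mult[symmetric] mult.commute[of _ n])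
      (simp add: power_mult)
   then show ?thesis using root_sum_0[OF _ 1] False by simp
  qed
 qed
 also have "\<dots> = b k" using k by simp
 finally show ?thesis by (simp add: b_def W_def)
qed

text \<open>The lattice mean of a product of Bernoulli polynomials, written over the frequency
  vectors modulo \<open>n\<close> that are orthogonal to \<open>z\<close> modulo \<open>n\<close>.
  In contrast to the sum over points it has nonnegative terms only, as concave powers
  require.\<close>

definition korob :: "nat \<Rightarrow> nat set \<Rightarrow> (nat \<Rightarrow> nat) \<Rightarrow> real" where
 "korob n u z = (\<Sum>h\<in>PiE u (\<lambda>_. {..<n}). if n dvd (\<Sum>j\<in>u. h j * z j) then (\<Prod>j\<in>u. dftc n (h j)) else 0)"

lemma frac_mod: "n \<ge> 1 \<Longrightarrow> frac (real k / real n) = real (k mod n) / real n"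
proof -
 assume n: "n \<ge> 1"
 have "real k = real n * real (k div n) + real (k mod n)"
  by (metis of_nat_add of_nat_mult mult_div_mod_eq)
 then have "real k / real n - real (k mod n) / real n = real (k div n)"
  using n by (simp add: field_simps)
 then have "real k / real n - real (k mod n) / real n \<in> \<int>" by simp
 moreover have "real (k mod n) / real n < 1" using n by simp
 ultimately show ?thesis by (simp add: frac_unique_iff)
qed

text \<open>After the transform is inserted and the sums are exchanged, the sum over the points
  \<open>i\<close> is a character sum that detects divisibility of the inner product by
  \<open>n\<close>.\<close>

lemma lattice_korob:
 assumes n: "n \<ge> 1" and u: "finite u"
 shows "(1 / real n) * (\<Sum>i=1..n. \<Prod>j\<in>u. bern2 (frac (lat n z i j))) = korob n u z"
proof -
 have "complex_of_real (\<Sum>i=1..n. \<Prod>j\<in>u. bern2 (frac (lat n z i j))) =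
   (\<Sum>i=1..n. \<Prod>j\<in>u. \<Sum>h<n. of_real (dftc n h) * rou n ^ (h * (i * z j)))"
  unfolding of_real_sum of_real_prod
 proof (intro sum.cong prod.cong refl)
  fix i j
  have "bern2 (frac (lat n z i j)) = bern2 (real ((i * z j) mod n) / real n)"
   using frac_mod[OF n, of "i * z j"] by simp
  then have "complex_of_real (bern2 (frac (lat n z i j))) =
    (\<Sum>h<n. of_real (dftc n h) * rou n ^ (h * ((i * z j) mod n)))"
   using bern2_dft[OF n, of "(i * z j) mod n"] n by simp
  also have "\<dots> = (\<Sum>h<n. of_real (dftc n h) * rou n ^ (h * (i * z j)))"
   by (intro sum.cong refl mult_arg_cong)
    (metis n rou_power_mod mod_mult_right_eq)
  finally show "complex_of_real (bern2 (frac (lat n z i j))) =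
    (\<Sum>h<n. of_real (dftc n h) * rou n ^ (h * (i * z j)))" .
 qed
 also have "\<dots> = (\<Sum>i=1..n. \<Sum>h\<in>PiE u (\<lambda>_. {..<n}). \<Prod>j\<in>u. of_real (dftc n (h j)) * rou n ^ (h j * (i * z j)))"
  using u by (subst prod_sum_PiE) auto
 also have "\<dots> = (\<Sum>i=1..n. \<Sum>h\<in>PiE u (\<lambda>_. {..<n}). of_real (\<Prod>j\<in>u. dftc n (h j)) * rou n ^ ((\<Sum>j\<in>u. h j * z j) * i))"
  by (simp add: prod.distrib power_sum[symmetric] sum_distrib_right sum_distrib_left mult_ac)
 also have "\<dots> = (\<Sum>h\<in>PiE u (\<lambda>_. {..<n}). of_real (\<Prod>j\<in>u. dftc n (h j)) * (\<Sum>i=1..n. rou n ^ ((\<Sum>j\<in>u. h j * z j) * i)))"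
  by (subst sum.swap) (simp add: sum_distrib_left)
 also have "\<dots> = (\<Sum>h\<in>PiE u (\<lambda>_. {..<n}). of_real (\<Prod>j\<in>u. dftc n (h j)) * (if n dvd (\<Sum>j\<in>u. h j * z j) then of_nat n else 0))"
 proof -
  have "(\<Sum>i=1..n. rou n ^ (d * i)) = (if n dvd d then of_nat n else 0)" for d
  proof -
   have "(\<Sum>i=1..n. rou n ^ (d * i)) = (\<Sum>i<n. rou n ^ (d * Suc i))"
    by (rule sum.reindex_bij_witness[of _ Suc "\<lambda>i. i - 1"]) auto
   also have "\<dots> = rou n ^ d * (\<Sum>i<n. rou n ^ (d * i))" by (simp add: sum_distrib_left power_add)
   finally show ?thesis using rou_orth[OF n, of d] rou_power_eq_1[OF n, of d] by auto
  qed
  then show ?thesis by simp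
 qed
 also have "\<dots> = complex_of_real (real n * korob n u z)"
  unfolding korob_def sum_distrib_left of_real_sum by (intro sum.cong) auto
 finally have "(\<Sum>i=1..n. \<Prod>j\<in>u. bern2 (frac (lat n z i j))) = real n * korob n u z"
  by (simp only: of_real_eq_iff)
 then show ?thesis using n by simp
qed

lemma korob_nonneg: "korob n u z \<ge> 0"
 unfolding korob_def by (auto intro!: sum_nonneg prod_nonneg dftc_nonneg)

text \<open>Since x is at most 2, the third-order Taylor remainder x^3/6 is at most 2x/3. Any
  positive constant would serve in place of 1/3.\<close>

lemma sin_lower:
 assumes "0 \<le> x" "x \<le> pi / 2" shows "x / 3 \<le> sin x"
proof -
 have "\<bar>sin x - (\<Sum>m<3. sin_coeff m * x ^ m)\<bar> \<le> inverse (fact 3) * \<bar>x\<bar> ^ 3"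
  by (rule Maclaurin_sin_bound)
 moreover have "(\<Sum>m<3. sin_coeff m * x ^ m) = x" by (simp add: numeral_3_eq_3 sin_coeff_def)
 ultimately have 1: "\<bar>sin x - x\<bar> \<le> x ^ 3 / 6" using assms by (simp add: fact_numeral field_simps)
 have "x \<le> 2" using assms pi_less_4 by simp
 then have "x * x \<le> 2 * 2" using assms by (intro mult_mono) auto
 then have "x * (x * x) \<le> x * 4" using assms by (intro mult_left_mono) auto
 moreover have "x ^ 3 = x * (x * x)" by (simp add: power3_eq_cube)
 ultimately show ?thesis using 1 by linarith
qed

text \<open>The sine is symmetric under \<open>h\<close> -> \<open>n - h\<close>, so it may be
  evaluated at the smaller of the two, where the linear lower bound holds.\<close>

lemma dftc_upper:
 assumes h: "0 < h" "h < n"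
 shows "dftc n h \<le> 2 / (real (min h (n - h)))\<^sup>2"
proof -
 define k where "k = min h (n - h)"
 have k: "0 < k" "2 * k \<le> n" using h by (auto simp: k_def)
 have "sin (pi * real h / real n) = sin (pi * real k / real n)"
 proof (cases "k = h")
  case False
  then have "real k = real n - real h" using h by (auto simp: k_def min_def of_nat_diff split: if_splits)
  then have "pi * real k / real n = pi - pi * real h / real n" using h by (simp add: right_diff_distrib diff_divide_distrib)
  then show ?thesis by (simp add: sin_diff)
 qed simp
 moreover have "pi * real k / real n / 3 \<le> sin (pi * real k / real n)"
 proof (rule sin_lower)
  have "pi * (2 * real k) \<le> pi * real n" using k by (intro mult_left_mono) auto
  then show "pi * real k / real n \<le> pi / 2" using h by (simp add: field_simps)
 qed simp
 ultimately have s: "real k / real n * (2 / 3) \<le> sin (pi * real h / real n)"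
 proof -
  have "2 * (real k / real n / 3) \<le> pi * (real k / real n / 3)"
   using pi_ge_two by (intro mult_right_mono) auto
  then show ?thesis using \<open>sin (pi * real h / real n) = _\<close> \<open>_ / 3 \<le> _\<close> by simp
 qed
 have "(real k / real n * (2 / 3))\<^sup>2 \<le> (sin (pi * real h / real n))\<^sup>2"
  using s by (intro power_mono) auto
 then have "2 * (real n)\<^sup>2 * (real k / real n * (2 / 3))\<^sup>2 \<le> 2 * (real n)\<^sup>2 * (sin (pi * real h / real n))\<^sup>2"
  by (intro mult_left_mono) auto
 then have "8 / 9 * (real k)\<^sup>2 \<le> 2 * (real n)\<^sup>2 * (sin (pi * real h / real n))\<^sup>2"
  using h by (simp add: power_mult_distrib power_divide)
 moreover have k2: "(real k)\<^sup>2 > 0" using k by simp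
 moreover have "0 < 2 * (real n)\<^sup>2 * (sin (pi * real h / real n))\<^sup>2"
  using k2 \<open>8 / 9 * _ \<le> _\<close> by linarith
 ultimately have "1 / (2 * (real n)\<^sup>2 * (sin (pi * real h / real n))\<^sup>2) \<le> 1 / (8 / 9 * (real k)\<^sup>2)"
  by (intro divide_left_mono mult_pos_pos[of "_ * _ * _"]) auto
 also have "\<dots> \<le> 2 / (real k)\<^sup>2" using k by (simp add: field_simps)
 finally show ?thesis using h by (simp add: dftc_def k_def)
qed

text \<open>After division by the total, each summand lies between 0 and 1 and can only grow under a
  power \<open>l \<le> 1\<close>.\<close>

lemma sum_powr_le:
 fixes a :: "'i \<Rightarrow> real"
 assumes "finite I" "\<And>i. i \<in> I \<Longrightarrow> a i \<ge> 0" "0 < l" "l \<le> 1"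
 shows "(\<Sum>i\<in>I. a i) powr l \<le> (\<Sum>i\<in>I. a i powr l)"
proof (cases "(\<Sum>i\<in>I. a i) = 0")
 case True
 then show ?thesis by (auto intro!: sum_nonneg)
next
 case False
 define S where "S = (\<Sum>i\<in>I. a i)"
 have S: "S > 0" using False assms by (auto simp: S_def less_le sum_nonneg)
 have "a i / S \<le> (a i / S) powr l" if i: "i \<in> I" for i
 proof (cases "a i = 0")
  case False
  have "a i \<le> S" unfolding S_def using assms(1,2) i by (intro member_le_sum) auto
  then have "0 < a i / S" "a i / S \<le> 1" using assms(2)[OF i] False S by auto
  then have "(a i / S) powr 1 \<le> (a i / S) powr l" using assms by (intro powr_mono') auto
  moreover have "(a i / S) powr 1 = a i / S" using \<open>0 < a i / S\<close> by (intro powr_one) simp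
  ultimately show ?thesis by (simp only:)
 qed simp
 then have "(\<Sum>i\<in>I. a i / S) \<le> (\<Sum>i\<in>I. (a i / S) powr l)" by (rule sum_mono)
 moreover have "(\<Sum>i\<in>I. a i / S) = 1" using S by (simp add: S_def sum_divide_distrib[symmetric])
 ultimately have "1 \<le> (\<Sum>i\<in>I. a i powr l / S powr l)" using assms S by (simp add: powr_divide)
 then have "1 \<le> (\<Sum>i\<in>I. a i powr l) / S powr l" by (simp add: sum_divide_distrib)
 then show ?thesis using S by (simp add: S_def[symmetric] le_divide_eq)
qed

lemma zeta_partial:
 assumes "x > 1"
 shows "(\<Sum>k=1..<N. real k powr (- x)) \<le> zeta x" and "zeta x \<ge> 0"
proof -
 have s: "summable (\<lambda>k. 1 / real (Suc k) powr x)"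
 proof -
  have "summable (\<lambda>k. real k powr (- x))" using assms by (simp add: summable_real_powr_iff)
  then have "summable (\<lambda>k. real (Suc k) powr (- x))" by (subst summable_Suc_iff)
  then show ?thesis by (simp only: powr_minus_divide)
 qed
 have "(\<Sum>k=1..<N. real k powr (- x)) = (\<Sum>k<N-1. 1 / real (Suc k) powr x)"
  by (rule sum.reindex_bij_witness[of _ Suc "\<lambda>i. i - 1"]) (auto simp: powr_minus_divide)
 also have "\<dots> \<le> zeta x" unfolding zeta_def by (rule sum_le_suminf[OF s]) auto
 finally show "(\<Sum>k=1..<N. real k powr (- x)) \<le> zeta x" .
 show "zeta x \<ge> 0" unfolding zeta_def by (rule suminf_nonneg[OF s]) auto
qed


text \<open>The minimum is replaced by a sum over both candidates, so that each half can later be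
  compared with the zeta series.\<close>

lemma dftc_powr_le:
 assumes "0 < h" "h < n" "1/2 < l" "l \<le> 1"
 shows "dftc n h powr l \<le> 2 * (real h powr (- (2 * l)) + real (n - h) powr (- (2 * l)))"
proof -
 define k where "k = min h (n - h)"
 have k: "k > 0" using assms by (auto simp: k_def)
 have "dftc n h powr l \<le> (2 / (real k)\<^sup>2) powr l"
  using assms dftc_upper[OF assms(1,2)] dftc_nonneg unfolding k_def by (intro powr_mono2) auto
 also have "\<dots> = 2 powr l * (real k powr (- (2 * l)))"
  using k by (simp add: powr_divide powr_minus_divide powr_powr[symmetric])
 also have "\<dots> \<le> 2 powr 1 * (real k powr (- (2 * l)))"
  using assms by (intro mult_right_mono powr_mono) auto
 also have "\<dots> \<le> 2 * (real h powr (- (2 * l)) + real (n - h) powr (- (2 * l)))"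
  by (cases "k = h") (auto simp: k_def min_def split: if_splits)
 finally show ?thesis .
qed

text \<open>The multiples of \<open>2 ^ e\<close> are \<open>2 ^ e * k\<close> with
  \<open>k < N\<close>, and the power of \<open>2 ^ e\<close> scales out. The terms in
  \<open>k\<close> and in \<open>N - k\<close> each contribute a partial zeta sum, whence 4 = 2 *
  2.\<close>

lemma dftc_tail:
 assumes l: "1/2 < l" "l \<le> 1" and e: "e \<le> m"
 shows "(\<Sum>h | 0 < h \<and> h < 2 ^ m \<and> 2 ^ e dvd h. dftc (2 ^ m) h powr l) \<le> 4 * (2 ^ e) powr (- (2 * l)) * zeta (2 * l)"
proof -
 define N :: nat where "N = 2 ^ (m - e)"
 have nN: "(2::nat) ^ m = 2 ^ e * N" unfolding N_def using e by (simp add: power_add[symmetric])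
 have zb: "(\<Sum>k=1..<N. real k powr (- (2 * l))) \<le> zeta (2 * l)" by (rule zeta_partial) (use l in simp)
 have "(\<Sum>h | 0 < h \<and> h < 2 ^ m \<and> 2 ^ e dvd h. dftc (2 ^ m) h powr l) = (\<Sum>k=1..<N. dftc (2 ^ m) (2 ^ e * k) powr l)"
  by (rule sum.reindex_bij_witness[of _ "\<lambda>k. 2 ^ e * k" "\<lambda>h. h div 2 ^ e"]) (auto simp: nN elim!: dvdE)
 also have "\<dots> \<le> (\<Sum>k=1..<N. 2 * (2 ^ e) powr (- (2 * l)) * (real k powr (- (2 * l)) + real (N - k) powr (- (2 * l))))"
 proof (rule sum_mono)
  fix k assume k: "k \<in> {1..<N}"
  have "2 ^ m - 2 ^ e * k = 2 ^ e * (N - k)" unfolding nN by (simp add: diff_mult_distrib2)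
  then have "dftc (2 ^ m) (2 ^ e * k) powr l \<le>
    2 * (real (2 ^ e * k) powr (- (2 * l)) + real (2 ^ e * (N - k)) powr (- (2 * l)))"
   using dftc_powr_le[of "2 ^ e * k" "2 ^ m" l] k l nN by simp
  also have "\<dots> = 2 * (2 ^ e) powr (- (2 * l)) * (real k powr (- (2 * l)) + real (N - k) powr (- (2 * l)))"
   by (simp add: powr_mult distrib_left)
  finally show "dftc (2 ^ m) (2 ^ e * k) powr l \<le>
    2 * (2 ^ e) powr (- (2 * l)) * (real k powr (- (2 * l)) + real (N - k) powr (- (2 * l)))" .
 qed
 also have "\<dots> = 2 * (2 ^ e) powr (- (2 * l)) * ((\<Sum>k=1..<N. real k powr (- (2 * l))) + (\<Sum>k=1..<N. real (N - k) powr (- (2 * l))))"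
  by (simp only: sum_distrib_left[symmetric] sum.distrib)
 also have "(\<Sum>k=1..<N. real (N - k) powr (- (2 * l))) = (\<Sum>k=1..<N. real k powr (- (2 * l)))"
  by (rule sum.reindex_bij_witness[of _ "\<lambda>k. N - k" "\<lambda>k. N - k"]) auto
 also have "2 * (2 ^ e) powr (- (2 * l)) * ((\<Sum>k=1..<N. real k powr (- (2 * l))) + (\<Sum>k=1..<N. real k powr (- (2 * l)))) \<le>
   2 * (2 ^ e) powr (- (2 * l)) * (zeta (2 * l) + zeta (2 * l))"
  by (intro mult_left_mono add_mono zb) auto
 also have "\<dots> = 4 * (2 ^ e) powr (- (2 * l)) * zeta (2 * l)" by simp
 finally show ?thesis .
qed

text \<open>Bounds the sum of the \<open>l\<close>-th powers of all Fourier coefficients uniformly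
  in \<open>n\<close>: 1 for frequency zero, the zeta term for the others.\<close>

definition kap :: "real \<Rightarrow> real" where "kap l = 1 + 4 * zeta (2 * l)"

lemma kap_ge_1: "1/2 < l \<Longrightarrow> kap l \<ge> 1"
 unfolding kap_def using zeta_partial(2)[of "2 * l"] by simp

lemma dftc_0_le:
 assumes "1/2 < l" "n \<ge> 1"
 shows "dftc n 0 powr l \<le> 1 / real n"
proof -
 have "dftc n 0 powr l \<le> (1 / (real n)\<^sup>2) powr l"
  using assms by (intro powr_mono2) (auto simp: dftc_def field_simps)
 also have "\<dots> = real n powr (- (2 * l))"
  using assms by (simp add: powr_divide powr_minus_divide powr_powr[symmetric])
 also have "\<dots> \<le> real n powr (- 1)" using assms by (intro powr_mono) auto
 also have "\<dots> = 1 / real n" using assms by (simp add: powr_minus_divide)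
 finally show ?thesis .
qed

lemma dftc_sum:
 assumes l: "1/2 < l" "l \<le> 1"
 shows "(\<Sum>h<2 ^ m. dftc (2 ^ m) h powr l) \<le> kap l"
proof -
 have "{..<2 ^ m :: nat} = insert 0 {h. 0 < h \<and> h < 2 ^ m \<and> 2 ^ 0 dvd h}" by auto
 then have "(\<Sum>h<2 ^ m. dftc (2 ^ m) h powr l) = dftc (2 ^ m) 0 powr l + (\<Sum>h | 0 < h \<and> h < 2 ^ m \<and> 2 ^ 0 dvd h. dftc (2 ^ m) h powr l)"
  by (simp only:) (subst sum.insert, auto)
 also have "\<dots> \<le> 1 / real (2 ^ m) + 4 * (2 ^ 0) powr (- (2 * l)) * zeta (2 * l)"
  by (intro add_mono dftc_0_le dftc_tail l) auto
 also have "\<dots> \<le> kap l" by (simp add: kap_def)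
 finally show ?thesis .
qed

lemma odd_part: "(c::nat) > 0 \<Longrightarrow> \<exists>e d. c = 2 ^ e * d \<and> odd d"
proof (induction c rule: less_induct)
 case (less c)
 show ?case
 proof (cases "odd c")
  case True then show ?thesis by (intro exI[of _ 0] exI[of _ c]) simp
 next
  case False
  then obtain c' where c': "c = 2 * c'" by auto
  with less.prems have "c' < c" "c' > 0" by auto
  then obtain e d where "c' = 2 ^ e * d" "odd d" using less.IH[of c'] by blast
  then show ?thesis using c' by (intro exI[of _ "Suc e"] exI[of _ d]) simp
 qed
qed

text \<open>The odd part of \<open>h\<close> is a unit modulo \<open>N = 2 ^ (m - e)\<close>, so two
  solutions are congruent modulo \<open>N\<close>. A solution is then determined by its quotient by
  \<open>N\<close>, for which \<open>2 ^ e\<close> values remain.\<close>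

lemma residue_count:
 fixes h C :: nat
 assumes h: "h = 2 ^ e * h'" "odd h'" and e: "e \<le> m"
 shows "card {w. w < 2 ^ m \<and> odd w \<and> 2 ^ m dvd h * w + C} \<le> 2 ^ e"
proof -
 define N :: nat where "N = 2 ^ (m - e)"
 have nN: "(2::nat) ^ m = 2 ^ e * N" unfolding N_def using e by (simp add: power_add[symmetric])
 let ?A = "{w::nat. w < 2 ^ m \<and> odd w \<and> 2 ^ m dvd h * w + C}"
 have "inj_on (\<lambda>w. w div N) ?A"
 proof (rule inj_onI)
  fix w1 w2 assume w: "w1 \<in> ?A" "w2 \<in> ?A" "w1 div N = w2 div N"
  have "int (2 ^ e * N) dvd int (h * w1 + C)" "int (2 ^ e * N) dvd int (h * w2 + C)"
   using w nN by (auto simp only: int_dvd_int_iff mem_Collect_eq)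
  then have "int (2 ^ e * N) dvd int (h * w1 + C) - int (h * w2 + C)" by (rule dvd_diff)
  then have "int (2 ^ e) * int N dvd int (2 ^ e) * (int h' * (int w1 - int w2))"
   unfolding h by (simp add: algebra_simps)
  then have "int N dvd int h' * (int w1 - int w2)" by (subst (asm) dvd_mult_cancel_left) simp
  moreover have "coprime (int N) (int h')" using h(2) by (simp add: N_def coprime_int_iff)
  ultimately have "int N dvd int w1 - int w2" by (simp add: coprime_dvd_mult_right_iff)
  then have "int w1 mod int N = int w2 mod int N" by (simp add: mod_eq_dvd_iff)
  then have "w1 mod N = w2 mod N" by (metis of_nat_mod of_nat_eq_iff)
  then show "w1 = w2" using w(3) by (metis div_mult_mod_eq)
 qed
 moreover have "(\<lambda>w. w div N) ` ?A \<subseteq> {..<2 ^ e}"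
  by (auto simp: nN less_mult_imp_div_less)
 ultimately have "card ?A \<le> card {..<2 ^ e :: nat}" by (intro card_inj_on_le) auto
 then show ?thesis by simp
qed

text \<open>If \<open>2 ^ m\<close> divides \<open>C\<close>, only frequency zero is admissible.
  Otherwise let \<open>2 ^ e\<close> be the exact power of two in \<open>C\<close>: as
  \<open>w\<close> is odd, an admissible \<open>h\<close> contains exactly the same power. Each such
  \<open>h\<close> is hit by at most \<open>2 ^ e\<close> values of \<open>w\<close>, and this loss
  is compensated by the factor \<open>(2 ^ e) powr (- (2 * l))\<close> of the tail because
  \<open>2 * l > 1\<close>.\<close>

lemma residue_sum:
 assumes l: "1/2 < l" "l \<le> 1"
 shows "(\<Sum>w | w < 2 ^ m \<and> odd w. \<Sum>h<2 ^ m. if 2 ^ m dvd h * w + C then dftc (2 ^ m) h powr l else 0) \<le> kap l"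
proof -
 let ?W = "{w. w < 2 ^ m \<and> odd (w::nat)}"
 let ?n = "2 ^ m :: nat"
 let ?t = "\<lambda>h w. if ?n dvd h * w + C then dftc ?n h powr l else 0" and ?V = "\<lambda>h. {w. w < ?n \<and> odd w \<and> ?n dvd h * w + C}"
 have fW: "finite ?W" by auto
 have z0: "zeta (2 * l) \<ge> 0" using l by (intro zeta_partial(2)) simp
 show ?thesis
 proof (cases "?n dvd C")
  case True
  have "(\<Sum>h<?n. ?t h w) \<le> 1 / real ?n" if w: "w \<in> ?W" for w
  proof -
   have "(\<Sum>h<?n. ?t h w) = (\<Sum>h<?n. if h = 0 then dftc ?n 0 powr l else 0)"
   proof (rule sum.cong[OF refl])
    fix h assume h: "h \<in> {..<?n}"
    have "?n dvd h * w + C \<longleftrightarrow> ?n dvd h * w" using True by (simp add: dvd_add_left_iff)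
    also have "\<dots> \<longleftrightarrow> ?n dvd h" using w by (intro coprime_dvd_mult_left_iff) simp
    also have "\<dots> \<longleftrightarrow> h = 0" using h by (auto dest: dvd_imp_le)
    finally show "(?t h w) = (if h = 0 then dftc ?n 0 powr l else 0)" by auto
   qed
   also have "\<dots> = dftc ?n 0 powr l" by simp
   finally show ?thesis using dftc_0_le[OF l(1), of ?n] by simp
  qed
  then have "(\<Sum>w\<in>?W. \<Sum>h<?n. ?t h w) \<le> (\<Sum>w\<in>?W. 1 / real ?n)"
   by (rule sum_mono)
  also have "\<dots> = real (card ?W) / real ?n" by simp
  also have "\<dots> \<le> 1"
  proof -
   have "card ?W \<le> card {..<?n}" by (intro card_mono) auto
   then have "real (card ?W) \<le> real ?n" by simp
   then show ?thesis by (simp add: divide_le_eq)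
  qed
  finally show ?thesis using z0 by (simp add: kap_def)
 next
  case False
  then have "C > 0" by (metis dvd_0_right gr0I)
  then obtain e d where C: "C = 2 ^ e * d" "odd d" using odd_part by blast
  have e: "e < m" using False C(1) by (metis dvd_triv_left le_imp_power_dvd not_less dvd_mult2)
  have hprop: "\<exists>h'. h = 2 ^ e * h' \<and> odd h'" if "odd w" "?n dvd h * w + C" for h w
  proof -
   have "2 ^ e dvd ?n" using e by (intro le_imp_power_dvd) simp
   then have "2 ^ e dvd h * w + C" using that(2) dvd_trans by blast
   then have "2 ^ e dvd h * w" unfolding C(1) by (simp add: dvd_add_left_iff)
   then have "2 ^ e dvd h" using that(1) by (subst (asm) coprime_dvd_mult_left_iff) auto
   then obtain h' where h': "h = 2 ^ e * h'" by (elim dvdE)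
   have "odd h'"
   proof
    assume "even h'"
    have "2 ^ Suc e dvd ?n" using e by (intro le_imp_power_dvd) simp
    then have "2 ^ Suc e dvd h * w + C" using that(2) dvd_trans by blast
    moreover have "h * w + C = 2 ^ e * (h' * w + d)" unfolding h' C(1) by (simp add: algebra_simps)
    ultimately have "2 dvd h' * w + d" by simp
    then show False using \<open>even h'\<close> C(2) by simp
   qed
   then show ?thesis using h' by blast
  qed
  let ?H = "{h. 0 < h \<and> h < ?n \<and> 2 ^ e dvd h}"
  have "(\<Sum>w\<in>?W. \<Sum>h<?n. ?t h w) =
    (\<Sum>h<?n. \<Sum>w\<in>?W. ?t h w)"
   by (rule sum.swap)
  also have "\<dots> = (\<Sum>h<?n. real (card (?V h)) * dftc ?n h powr l)"
   by (intro sum.cong refl) (simp add: sum.If_cases Int_def conj_assoc)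
  also have "\<dots> \<le> (\<Sum>h<?n. if h \<in> ?H then 2 ^ e * dftc ?n h powr l else 0)"
  proof (rule sum_mono)
   fix h assume h: "h \<in> {..<?n}"
   show "real (card (?V h)) * dftc ?n h powr l \<le> (if h \<in> ?H then 2 ^ e * dftc ?n h powr l else 0)"
   proof (cases "(?V h) = {}")
    case True
    then have "card (?V h) = 0" by (simp only: card.empty)
    then show ?thesis unfolding \<open>card _ = 0\<close> using dftc_nonneg by auto
   next
    case False
    then obtain w where "odd w" "?n dvd h * w + C" by auto
    then obtain h' where h': "h = 2 ^ e * h'" "odd h'" using hprop by blast
    have "h > 0" using h' by (auto intro!: gr0I)
    then have "h \<in> ?H" using h h' by auto
    moreover have "real (card (?V h)) \<le> real (2 ^ e)"
     using residue_count[OF h', of m C] e by (intro of_nat_mono) auto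
    ultimately show ?thesis by (simp add: mult_right_mono)
   qed
  qed
  also have "\<dots> = 2 ^ e * (\<Sum>h\<in>?H. dftc ?n h powr l)"
  proof -
   have "{..<?n} \<inter> ?H = ?H" by auto
   then show ?thesis by (simp only: sum.inter_restrict[symmetric, OF finite_lessThan] sum_distrib_left)
  qed
  also have "\<dots> \<le> 2 ^ e * (4 * (2 ^ e) powr (- (2 * l)) * zeta (2 * l))"
   using e by (intro mult_left_mono dftc_tail l) auto
  also have "\<dots> = 4 * ((2 ^ e) powr 1 * (2 ^ e) powr (- (2 * l))) * zeta (2 * l)" by simp
  also have "\<dots> \<le> 4 * 1 * zeta (2 * l)"
  proof -
   have "(2 ^ e) powr 1 * (2 ^ e) powr (- (2 * l)) = (2 ^ e :: real) powr (1 + - (2 * l))" by (simp only: powr_add)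
   also have "\<dots> \<le> (2 ^ e) powr 0" using l by (intro powr_mono) auto
   finally show ?thesis using z0 by (intro mult_right_mono mult_left_mono) auto
  qed
  finally show ?thesis by (simp add: kap_def)
 qed
qed

section \<open>Averaging over the candidates for one component\<close>

lemma prod_powr:
 fixes f :: "'i \<Rightarrow> real"
 assumes "finite u" "\<And>j. j \<in> u \<Longrightarrow> f j \<ge> 0"
 shows "(\<Prod>j\<in>u. f j) powr x = (\<Prod>j\<in>u. f j powr x)"
 using assms by (induct u rule: finite_induct) (auto simp: powr_mult prod_nonneg)

lemma sum_PiE_insert:
 fixes F :: "('i \<Rightarrow> 'b) \<Rightarrow> real"
 assumes "l \<notin> u"
 shows "(\<Sum>h\<in>PiE (insert l u) (\<lambda>_. B). F h) = (\<Sum>h\<in>PiE u (\<lambda>_. B). \<Sum>c\<in>B. F (h(l := c)))"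
proof -
 have "(\<Sum>h\<in>PiE (insert l u) (\<lambda>_. B). F h) = (\<Sum>(c, h)\<in>B \<times> PiE u (\<lambda>_. B). F (h(l := c)))"
  unfolding PiE_insert_eq
 proof (subst sum.reindex)
  show "inj_on (\<lambda>(y, g). g(l := y)) (B \<times> PiE u (\<lambda>_. B))"
   using inj_combinator[OF assms, of "\<lambda>_. B"] .
 qed (auto intro!: sum.cong)
 also have "\<dots> = (\<Sum>c\<in>B. \<Sum>h\<in>PiE u (\<lambda>_. B). F (h(l := c)))" by (simp only: sum.cartesian_product)
 also have "\<dots> = (\<Sum>h\<in>PiE u (\<lambda>_. B). \<Sum>c\<in>B. F (h(l := c)))" by (rule sum.swap)
 finally show ?thesis .
qed

text \<open>Singles out the frequency of the new component, so that \<open>z l\<close> enters only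
  through one congruence per term.\<close>

lemma korob_insert:
 assumes "finite u" "l \<notin> u"
 shows "korob n (insert l u) z = (\<Sum>h\<in>PiE u (\<lambda>_. {..<n}). \<Sum>c<n.
   if n dvd c * z l + (\<Sum>j\<in>u. h j * z j) then dftc n c * (\<Prod>j\<in>u. dftc n (h j)) else 0)"
 unfolding korob_def sum_PiE_insert[OF assms(2)]
proof (intro sum.cong refl)
 fix h c
 have 1: "(\<Sum>j\<in>u. (h(l := c)) j * z j) = (\<Sum>j\<in>u. h j * z j)" "(\<Prod>j\<in>u. dftc n ((h(l := c)) j)) = (\<Prod>j\<in>u. dftc n (h j))"
  using assms by (auto intro!: sum.cong prod.cong)
 show "(if n dvd (\<Sum>j\<in>insert l u. (h(l := c)) j * z j) then \<Prod>j\<in>insert l u. dftc n ((h(l := c)) j) else 0) =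
  (if n dvd c * z l + (\<Sum>j\<in>u. h j * z j) then dftc n c * (\<Prod>j\<in>u. dftc n (h j)) else 0)"
  using assms by (simp add: 1 del: fun_upd_apply) simp
qed

lemma korob_cong: "(\<And>j. j \<in> u \<Longrightarrow> z j = z' j) \<Longrightarrow> korob n u z = korob n u z'"
 unfolding korob_def by (intro sum.cong refl if_cong arg_cong2[of _ _ _ _ "(dvd)"]) auto

text \<open>The square of the shift-averaged worst-case error, as shown in
  \<open>shift_avg_wce_eq\<close>.\<close>

definition cbc_err :: "nat \<Rightarrow> (nat set \<Rightarrow> real) \<Rightarrow> nat \<Rightarrow> (nat \<Rightarrow> nat) \<Rightarrow> real" where
 "cbc_err n \<gamma> l z = (\<Sum>u\<in>Pow {..<l} - {{}}. \<gamma> u * korob n u z)"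

text \<open>The terms of the error that involve the index \<open>l\<close>. The others do not see
  \<open>z l\<close>, so the choice of \<open>z l\<close> minimizes exactly this part.\<close>

definition cbc_inc :: "nat \<Rightarrow> (nat set \<Rightarrow> real) \<Rightarrow> nat \<Rightarrow> (nat \<Rightarrow> nat) \<Rightarrow> real" where
 "cbc_inc n \<gamma> l z = (\<Sum>u\<in>Pow {..<l}. \<gamma> (insert l u) * korob n (insert l u) z)"

lemma sum_Pow_Suc:
 fixes F :: "nat set \<Rightarrow> real"
 shows "(\<Sum>u\<in>Pow {..<Suc l} - {{}}. F u) = (\<Sum>u\<in>Pow {..<l} - {{}}. F u) + (\<Sum>u\<in>Pow {..<l}. F (insert l u))"
proof -
 have "Pow {..<Suc l} - {{}} = (Pow {..<l} - {{}}) \<union> insert l ` Pow {..<l}"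
  unfolding lessThan_Suc Pow_insert by auto
 moreover have "(Pow {..<l} - {{}}) \<inter> insert l ` Pow {..<l} = {}" by auto
 moreover have "inj_on (insert l) (Pow {..<l})" by (auto simp: inj_on_def)
 ultimately show ?thesis by (simp add: sum.union_disjoint sum.reindex)
qed

lemma cbc_err_Suc: "cbc_err n \<gamma> (Suc l) z = cbc_err n \<gamma> l z + cbc_inc n \<gamma> l z"
 unfolding cbc_err_def cbc_inc_def sum_Pow_Suc ..

text \<open>The concave power is taken inside three sums: over subsets, over the old frequencies and
  over the new one. The sum over odd \<open>w\<close> then acts on a single congruence, where
  \<open>residue_sum\<close> applies, and the remaining sum over old frequencies factors into power
  sums bounded by \<open>kap lam\<close>.\<close>

lemma cbc_inc_powr_sum:
 assumes l: "1/2 < lam" "lam \<le> 1" and \<gamma>: "\<And>u. \<gamma> u \<ge> 0" and n: "n = 2 ^ m"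
 shows "(\<Sum>w | w < n \<and> odd w. cbc_inc n \<gamma> l (z(l := w)) powr lam) \<le> (\<Sum>u\<in>Pow {..<l}. \<gamma> (insert l u) powr lam * kap lam ^ card (insert l u))"
proof -
 let ?W = "{w. w < n \<and> odd w}"
 let ?P = "\<lambda>u. PiE u (\<lambda>_. {..<n})"
 have fP: "finite (?P u)" if "u \<in> Pow {..<l}" for u using that by (intro finite_PiE) (auto intro: finite_subset)
 define A where "A u h = (\<Sum>j\<in>u. h j * z j)" for u and h :: "nat \<Rightarrow> nat"
 define p where "p u h = (\<Prod>j\<in>u. dftc n (h j))" for u :: "nat set" and h
 have p0: "p u h \<ge> 0" for u h unfolding p_def by (intro prod_nonneg) (auto simp: dftc_nonneg)
 have one: "cbc_inc n \<gamma> l (z(l := w)) powr lam \<le>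
   (\<Sum>u\<in>Pow {..<l}. \<gamma> (insert l u) powr lam * (\<Sum>h\<in>?P u. p u h powr lam * (\<Sum>c<n. if n dvd c * w + A u h then dftc n c powr lam else 0)))" for w
 proof -
  have ki: "korob n (insert l u) (z(l := w)) = (\<Sum>h\<in>?P u. \<Sum>c<n. if n dvd c * w + A u h then dftc n c * p u h else 0)"
   if u: "u \<in> Pow {..<l}" for u
  proof -
   have "(\<Sum>j\<in>u. h j * (z(l := w)) j) = A u h" for h unfolding A_def using u by (intro sum.cong) auto
   moreover have "finite u" "l \<notin> u" using u by (auto intro: finite_subset)
   ultimately show ?thesis unfolding korob_insert[OF \<open>finite u\<close> \<open>l \<notin> u\<close>] p_def by (simp only: fun_upd_same)
  qed
  have "cbc_inc n \<gamma> l (z(l := w)) powr lam \<le> (\<Sum>u\<in>Pow {..<l}. (\<gamma> (insert l u) * korob n (insert l u) (z(l := w))) powr lam)"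
   unfolding cbc_inc_def using \<gamma> korob_nonneg l by (intro sum_powr_le) auto
  also have "\<dots> = (\<Sum>u\<in>Pow {..<l}. \<gamma> (insert l u) powr lam * (\<Sum>h\<in>?P u. \<Sum>c<n. if n dvd c * w + A u h then dftc n c * p u h else 0) powr lam)"
   using \<gamma> korob_nonneg by (intro sum.cong refl) (simp add: powr_mult ki)
  also have "\<dots> \<le> (\<Sum>u\<in>Pow {..<l}. \<gamma> (insert l u) powr lam * (\<Sum>h\<in>?P u. \<Sum>c<n. (if n dvd c * w + A u h then dftc n c * p u h else 0) powr lam))"
  proof (intro sum_mono mult_left_mono)
   fix u assume u: "u \<in> Pow {..<l}"
   have nn: "(if n dvd c * w + A u h then dftc n c * p u h else 0) \<ge> 0" for c h
    using dftc_nonneg p0 by auto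
   have "(\<Sum>h\<in>?P u. \<Sum>c<n. if n dvd c * w + A u h then dftc n c * p u h else 0) powr lam \<le>
     (\<Sum>h\<in>?P u. (\<Sum>c<n. if n dvd c * w + A u h then dftc n c * p u h else 0) powr lam)"
    using l by (intro sum_powr_le fP[OF u] sum_nonneg nn) auto
   also have "\<dots> \<le> (\<Sum>h\<in>?P u. \<Sum>c<n. (if n dvd c * w + A u h then dftc n c * p u h else 0) powr lam)"
    using l by (intro sum_mono sum_powr_le nn) auto
   finally show "(\<Sum>h\<in>?P u. \<Sum>c<n. if n dvd c * w + A u h then dftc n c * p u h else 0) powr lam \<le> \<dots>" .
  qed auto
  also have "\<dots> = (\<Sum>u\<in>Pow {..<l}. \<gamma> (insert l u) powr lam * (\<Sum>h\<in>?P u. p u h powr lam * (\<Sum>c<n. if n dvd c * w + A u h then dftc n c powr lam else 0)))"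
   unfolding sum_distrib_left
   by (intro sum.cong refl mult_arg_cong) (use p0 dftc_nonneg in \<open>auto simp: powr_mult\<close>)
  finally show ?thesis .
 qed
 have "(\<Sum>w\<in>?W. cbc_inc n \<gamma> l (z(l := w)) powr lam) \<le>
   (\<Sum>w\<in>?W. \<Sum>u\<in>Pow {..<l}. \<gamma> (insert l u) powr lam * (\<Sum>h\<in>?P u. p u h powr lam * (\<Sum>c<n. if n dvd c * w + A u h then dftc n c powr lam else 0)))"
  by (intro sum_mono one)
 also have "\<dots> = (\<Sum>u\<in>Pow {..<l}. \<gamma> (insert l u) powr lam * (\<Sum>h\<in>?P u. p u h powr lam * (\<Sum>w\<in>?W. \<Sum>c<n. if n dvd c * w + A u h then dftc n c powr lam else 0)))"
  apply (subst sum.swap)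
  apply (intro sum.cong refl)
  apply (subst sum_distrib_left[symmetric])
  apply (intro mult_arg_cong refl)
  apply (subst sum.swap)
  apply (simp only: sum_distrib_left)
  done
 also have "\<dots> \<le> (\<Sum>u\<in>Pow {..<l}. \<gamma> (insert l u) powr lam * (\<Sum>h\<in>?P u. p u h powr lam * kap lam))"
  unfolding n by (intro sum_mono mult_left_mono residue_sum l) auto
 also have "\<dots> \<le> (\<Sum>u\<in>Pow {..<l}. \<gamma> (insert l u) powr lam * kap lam ^ card (insert l u))"
 proof (intro sum_mono mult_left_mono)
  fix u assume u: "u \<in> Pow {..<l}"
  then have fu: "finite u" by (auto intro: finite_subset)
  have k1: "kap lam \<ge> 1" using l by (intro kap_ge_1)
  have "(\<Sum>h\<in>?P u. p u h powr lam) = (\<Sum>h\<in>?P u. \<Prod>j\<in>u. dftc n (h j) powr lam)"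
   unfolding p_def using dftc_nonneg fu by (intro sum.cong refl prod_powr) auto
  also have "\<dots> = (\<Prod>j\<in>u. \<Sum>c<n. dftc n c powr lam)" using fu by (subst prod_sum_PiE) auto
  also have "\<dots> \<le> (\<Prod>j\<in>u. kap lam)" unfolding n by (intro prod_mono) (auto intro!: sum_nonneg dftc_sum l)
  also have "\<dots> = kap lam ^ card u" by simp
  finally have "(\<Sum>h\<in>?P u. p u h powr lam) * kap lam \<le> kap lam ^ card u * kap lam" using k1 by (intro mult_right_mono) auto
  moreover have "card (insert l u) = Suc (card u)" using u fu by (subst card_insert_disjoint) auto
  ultimately show "(\<Sum>h\<in>?P u. p u h powr lam * kap lam) \<le> kap lam ^ card (insert l u)"
   unfolding sum_distrib_right[symmetric] by (simp add: mult.commute)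
 qed auto
 finally show ?thesis .
qed

lemma card_odd: "m \<ge> 1 \<Longrightarrow> card {w. w < 2 ^ m \<and> odd (w::nat)} = 2 ^ (m - 1)"
proof -
 assume m: "m \<ge> 1"
 then have "(2::nat) ^ m = 2 * 2 ^ (m - 1)" by (cases m) auto
 then have "{w. w < 2 ^ m \<and> odd (w::nat)} = (\<lambda>k. 2 * k + 1) ` {..<2 ^ (m - 1)}"
  by (auto elim!: oddE simp: image_iff)
 moreover have "inj_on (\<lambda>k::nat. 2 * k + 1) {..<2 ^ (m - 1)}" by (auto simp: inj_on_def)
 ultimately show ?thesis by (simp add: card_image)
qed

text \<open>There are \<open>n / 2\<close> odd candidates, and some candidate is not worse than the
  mean.\<close>

lemma cbc_inc_exists:
 assumes l: "1/2 < lam" "lam \<le> 1" and \<gamma>: "\<And>u. \<gamma> u \<ge> 0" and n: "n = 2 ^ m" "m \<ge> 1"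
 shows "\<exists>w<n. odd w \<and> cbc_inc n \<gamma> l (z(l := w)) powr lam \<le>
   2 / real n * (\<Sum>u\<in>Pow {..<l}. \<gamma> (insert l u) powr lam * kap lam ^ card (insert l u))" (is "\<exists>w<n. _ \<and> ?f w \<le> 2 / real n * ?K")
proof (rule ccontr)
 assume "\<not> ?thesis"
 then have gt: "?f w > 2 / real n * ?K" if "w < n" "odd w" for w using that by (meson not_le)
 let ?W = "{w. w < n \<and> odd w}"
 have cW: "real (card ?W) = real n / 2" using card_odd[OF n(2)] n by (cases m) auto
 have "1 \<in> ?W" using n one_less_power[of "2::nat" m] by auto
 then have "(\<Sum>w\<in>?W. 2 / real n * ?K) < (\<Sum>w\<in>?W. ?f w)"
  using gt by (intro sum_strict_mono) auto
 also have "\<dots> \<le> ?K" by (rule cbc_inc_powr_sum[OF l \<gamma> n(1)])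
 finally have "real (card ?W) * (2 / real n * ?K) < ?K" by (simp only: sum_constant)
 then show False unfolding cW using n by simp
qed

text \<open>In each step the chosen component is at least as good as the candidate known to beat the
  mean, and the concave power is subadditive, so the increments simply add up.\<close>

theorem cbc_bound:
 assumes l: "1/2 < lam" "lam \<le> 1" and \<gamma>: "\<And>u. \<gamma> u \<ge> 0" and n: "n = 2 ^ m" "m \<ge> 1"
  and z0: "z 0 = 1"
  and opt: "\<And>l c. 1 \<le> l \<Longrightarrow> l < s \<Longrightarrow> c < n \<Longrightarrow> odd c \<Longrightarrow> cbc_err n \<gamma> (Suc l) z \<le> cbc_err n \<gamma> (Suc l) (z(l := c))"
 shows "cbc_err n \<gamma> s z powr lam \<le> 2 / real n * (\<Sum>u\<in>PowN s. \<gamma> u powr lam * kap lam ^ card u)"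
 using opt
proof (induction s)
 case 0
 then show ?case by (simp add: cbc_err_def)
next
 case (Suc s)
 obtain w where w: "w < n" "odd w" "cbc_inc n \<gamma> s (z(s := w)) powr lam \<le>
   2 / real n * (\<Sum>u\<in>Pow {..<s}. \<gamma> (insert s u) powr lam * kap lam ^ card (insert s u))"
  using cbc_inc_exists[where lam=lam and \<gamma>=\<gamma> and n=n and m=m and z=z and l=s, OF l \<gamma> n] by (elim exE conjE)
 \<comment> \<open>Component 0 is prescribed and not minimized; there the increment has the same
   value \<open>\<gamma> {0} * dftc n 0\<close> for every odd choice.\<close>
 have le: "cbc_inc n \<gamma> s z \<le> cbc_inc n \<gamma> s (z(s := w))"
 proof (cases "s = 0")
  case True
  have "korob n {0} z' = dftc n 0" if "odd (z' 0)" for z'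
  proof -
   have "korob n {0} z' = (\<Sum>c<n. if n dvd c * z' 0 then dftc n c else 0)"
    using korob_insert[of "{}" 0 n z'] unfolding PiE_empty_domain by (simp cong: if_cong)
   also have "\<dots> = (\<Sum>c<n. if c = 0 then dftc n 0 else 0)"
   proof (rule sum.cong[OF refl])
    fix c assume c: "c \<in> {..<n}"
    have "n dvd c * z' 0 \<longleftrightarrow> n dvd c" using that n by (intro coprime_dvd_mult_left_iff) simp
    also have "\<dots> \<longleftrightarrow> c = 0" using c by (auto dest: dvd_imp_le)
    finally show "(if n dvd c * z' 0 then dftc n c else 0) = (if c = 0 then dftc n 0 else 0)" by auto
   qed
   also have "\<dots> = dftc n 0" using n by simp
   finally show ?thesis .
  qed
  from this[of z] this[of "z(0 := w)"] show ?thesis using True z0 w(2) by (simp add: cbc_inc_def)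
 next
  case False
  have "cbc_err n \<gamma> s (z(s := w)) = cbc_err n \<gamma> s z"
   unfolding cbc_err_def by (intro sum.cong refl mult_arg_cong korob_cong) auto
  moreover have "cbc_err n \<gamma> (Suc s) z \<le> cbc_err n \<gamma> (Suc s) (z(s := w))" by (rule Suc.prems) (use w False in auto)
  ultimately show ?thesis unfolding cbc_err_Suc by linarith
 qed
 have nn: "cbc_err n \<gamma> s z \<ge> 0" "cbc_inc n \<gamma> s z \<ge> 0"
  unfolding cbc_err_def cbc_inc_def using \<gamma> korob_nonneg by (auto intro!: sum_nonneg)
 \<comment> \<open>The two summands are written as a sum over \<open>{False, True}\<close> to apply
   \<open>sum_powr_le\<close>.\<close>
 have "cbc_err n \<gamma> (Suc s) z powr lam = (\<Sum>i\<in>{False, True}. if i then cbc_inc n \<gamma> s z else cbc_err n \<gamma> s z) powr lam"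
  by (simp add: cbc_err_Suc)
 also have "\<dots> \<le> (\<Sum>i\<in>{False, True}. (if i then cbc_inc n \<gamma> s z else cbc_err n \<gamma> s z) powr lam)"
  using nn l by (intro sum_powr_le) auto
 also have "\<dots> = cbc_err n \<gamma> s z powr lam + cbc_inc n \<gamma> s z powr lam" by simp
 also have "\<dots> \<le> cbc_err n \<gamma> s z powr lam + cbc_inc n \<gamma> s (z(s := w)) powr lam"
  using le nn l by (intro add_left_mono powr_mono2) auto
 also have "\<dots> \<le> 2 / real n * (\<Sum>u\<in>PowN s. \<gamma> u powr lam * kap lam ^ card u) +
   2 / real n * (\<Sum>u\<in>Pow {..<s}. \<gamma> (insert s u) powr lam * kap lam ^ card (insert s u))"
  using Suc by (intro add_mono w(3)) auto
 also have "\<dots> = 2 / real n * (\<Sum>u\<in>Pow {..<Suc s} - {{}}. \<gamma> u powr lam * kap lam ^ card u)"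
  unfolding sum_Pow_Suc by (simp only: distrib_left)
 finally show ?case .
qed

section \<open>Worst-case error of cubature rules\<close>

text \<open>The projection in the unanchored norm: coordinates outside \<open>u\<close> are
  integrated out.\<close>

definition bar :: "nat \<Rightarrow> nat set \<Rightarrow> ((nat \<Rightarrow> real) \<Rightarrow> real) \<Rightarrow> (nat \<Rightarrow> real) \<Rightarrow> real" where
 "bar s u g yu = (LINT yc|cube_measure ({..<s} - u). g (merge u ({..<s} - u) (yu, yc)))"

lemma sigma_finite_cube: "sigma_finite_measure (cube_measure I)"
proof -
 interpret prob_space "cube_measure I" by (rule prob_space_cube_measure)
 show ?thesis by unfold_locales
qed

lemma measurable_merge_cube:
 assumes "u \<subseteq> {..<s}"
 shows "merge u ({..<s} - u) \<in> measurable (cube_measure u \<Otimes>\<^sub>M cube_measure ({..<s} - u)) (cubeM s)"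
proof -
 have "u \<union> ({..<s} - u) = {..<s}" using assms by auto
 then show ?thesis
  using measurable_merge[of u "{..<s} - u" "\<lambda>_. unit_leb"] unfolding cube_measure_def unit_leb_def[symmetric] by simp
qed

lemma bar_measurable:
 assumes "u \<subseteq> {..<s}" "g \<in> borel_measurable (cubeM s)"
 shows "bar s u g \<in> borel_measurable (cube_measure u)"
proof -
 interpret sigma_finite_measure "cube_measure ({..<s} - u)" by (rule sigma_finite_cube)
 have "(\<lambda>p. g (merge u ({..<s} - u) p)) \<in> borel_measurable (cube_measure u \<Otimes>\<^sub>M cube_measure ({..<s} - u))"
  by (rule measurable_compose[OF measurable_merge_cube[OF assms(1)] assms(2)])
 then have "(\<lambda>(x, y). g (merge u ({..<s} - u) (x, y))) \<in> borel_measurable (cube_measure u \<Otimes>\<^sub>M cube_measure ({..<s} - u))"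
  by (simp add: case_prod_unfold)
 from borel_measurable_lebesgue_integral[OF this] show ?thesis unfolding bar_def[abs_def] .
qed

lemma integral_fold_bar:
 assumes u: "u \<subseteq> {..<s}" and f: "integrable (cubeM s) f"
 shows "(LINT y|cubeM s. f y) = (LINT yu|cube_measure u. bar s u f yu)"
proof -
 interpret product_prob_space "\<lambda>_::nat. unit_leb" by (rule product_prob_space_unit_leb)
 have un: "u \<union> ({..<s} - u) = {..<s}" using u by auto
 have fu: "finite u" using u finite_subset by blast
 show ?thesis
  using product_integral_fold[of u "{..<s} - u" f] f fu
  unfolding un bar_def cube_measure_def unit_leb_def[symmetric] by auto
qed

text \<open>By Fubini, a null set of the cube meets almost every slice in a null set.\<close>

lemma bar_cong_AE:
 assumes u: "u \<subseteq> {..<s}" and g: "g \<in> borel_measurable (cubeM s)" "g' \<in> borel_measurable (cubeM s)"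
  and ae: "AE y in cubeM s. g y = g' y"
 shows "AE yu in cube_measure u. bar s u g yu = bar s u g' yu"
proof -
 interpret product_prob_space "\<lambda>_::nat. unit_leb" by (rule product_prob_space_unit_leb)
 let ?A = "cube_measure u" and ?B = "cube_measure ({..<s} - u)"
 interpret A: sigma_finite_measure ?A by (rule sigma_finite_cube)
 interpret B: sigma_finite_measure ?B by (rule sigma_finite_cube)
 interpret P: pair_sigma_finite ?A ?B ..
 have un: "u \<union> ({..<s} - u) = {..<s}" using u by auto
 have fu: "finite u" using u finite_subset by blast
 note mm = measurable_merge_cube[OF u]
 have d: "distr (?A \<Otimes>\<^sub>M ?B) (cubeM s) (merge u ({..<s} - u)) = cubeM s"
  using distr_merge[of u "{..<s} - u"] fu unfolding un cube_measure_def unit_leb_def[symmetric] by auto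
 have "AE p in ?A \<Otimes>\<^sub>M ?B. g (merge u ({..<s} - u) p) = g' (merge u ({..<s} - u) p)"
  by (rule AE_distrD[OF mm]) (simp only: d ae)
 then have "AE x in ?A. AE y in ?B. g (merge u ({..<s} - u) (x, y)) = g' (merge u ({..<s} - u) (x, y))"
  by (rule P.AE_pair)
 moreover have "AE x in ?A. x \<in> space ?A" by (rule AE_space)
 ultimately show ?thesis
 proof eventually_elim
  case (elim x)
  have "(\<lambda>y. merge u ({..<s} - u) (x, y)) \<in> measurable ?B (cubeM s)"
   using measurable_compose[OF measurable_Pair1'[OF elim(2)] mm] by simp
  then show ?case unfolding bar_def using elim(1) g
   by (intro integral_cong_AE) (auto intro: measurable_compose)
 qed
qed

lemma Cauchy_Schwarz_integral:
 fixes f g :: "'a \<Rightarrow> real"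
 assumes m: "f \<in> borel_measurable M" "g \<in> borel_measurable M"
  and i: "integrable M (\<lambda>x. (f x)\<^sup>2)" "integrable M (\<lambda>x. (g x)\<^sup>2)"
 shows "\<bar>LINT x|M. f x * g x\<bar> \<le> sqrt (LINT x|M. (f x)\<^sup>2) * sqrt (LINT x|M. (g x)\<^sup>2)"
proof -
 define A where "A = (LINT x|M. (f x)\<^sup>2)"
 define B where "B = (LINT x|M. (g x)\<^sup>2)"
 define C where "C = (LINT x|M. f x * g x)"
 have AB: "A \<ge> 0" "B \<ge> 0" unfolding A_def B_def by (auto intro!: integral_nonneg_AE)
 have fg: "integrable M (\<lambda>x. f x * g x)" by (rule square_integrable_mult[OF m i])
 have q: "0 \<le> A - 2 * l * C + l\<^sup>2 * B" for l
 proof -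
  have "0 \<le> (LINT x|M. (f x - l * g x)\<^sup>2)" by (rule integral_nonneg_AE) auto
  also have "\<dots> = (LINT x|M. (f x)\<^sup>2 - (2 * l) * (f x * g x) + l\<^sup>2 * (g x)\<^sup>2)"
   by (rule B_integral_cong) (auto simp: power2_eq_square algebra_simps)
  also have "\<dots> = A - 2 * l * C + l\<^sup>2 * B"
   using i fg by (simp add: A_def B_def C_def)
  finally show ?thesis .
 qed
 have "C\<^sup>2 \<le> A * B"
 proof (cases "B = 0")
  case True
  have "C = 0"
  proof (rule ccontr)
   assume C: "C \<noteq> 0"
   \<comment> \<open>With \<open>B = 0\<close> the quadratic form is affine in \<open>l\<close>;
     this value of \<open>l\<close> makes it equal to -1.\<close>
   show False using q[of "(A + 1) / (2 * C)"] C AB True by (simp add: field_simps)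
  qed
  then show ?thesis using True by simp
 next
  case False
  then have B: "B > 0" using AB by simp
  have "0 \<le> A - C\<^sup>2 / B" using q[of "C / B"] B by (simp add: power2_eq_square field_simps)
  then show ?thesis using B by (simp add: field_simps)
 qed
 then have "sqrt (C\<^sup>2) \<le> sqrt (A * B)" by (rule real_sqrt_le_mono)
 then show ?thesis by (simp add: A_def B_def C_def real_sqrt_mult)
qed

text \<open>An arbitrary equal-weight rule. Nodes stay below 1/2 in each coordinate because the
  pointwise representation needs room to the right; shifted lattice points comply since
  \<open>frac\<close> is below 1.\<close>

locale cubature =
 fixes s :: nat and I :: "nat set" and t :: "nat \<Rightarrow> nat \<Rightarrow> real" and \<gamma> :: "nat set \<Rightarrow> real"
 assumes fin: "finite I" "I \<noteq> {}" and t_cube: "\<And>i. i \<in> I \<Longrightarrow> t i \<in> cube s"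
  and t_less: "\<And>i j. i \<in> I \<Longrightarrow> j < s \<Longrightarrow> t i j < 1/2" and \<gamma>_nonneg: "\<And>u. \<gamma> u \<ge> 0"
begin

definition N :: real where "N = real (card I)"

definition err :: "((nat \<Rightarrow> real) \<Rightarrow> real) \<Rightarrow> real" where
 "err G = (LINT y|cubeM s. G y) - (1 / N) * (\<Sum>i\<in>I. G (t i))"

definition ker :: "nat set \<Rightarrow> (nat \<Rightarrow> real) \<Rightarrow> real" where
 "ker u y = (1 / N) * (\<Sum>i\<in>I. kprod (t i) u y)"

definition Kq :: "nat set \<Rightarrow> real" where
 "Kq u = (1 / N\<^sup>2) * (\<Sum>i\<in>I. \<Sum>i'\<in>I. \<Prod>j\<in>u. kcov (t i j) (t i' j))"

definition wce2 :: real where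
 "wce2 = (\<Sum>u\<in>PowN s. \<gamma> u * Kq u)"

lemma N_pos: "N > 0"
proof -
 have "card I > 0" using fin card_gt_0_iff by blast
 then show ?thesis unfolding N_def by simp
qed

lemma t_range: "i \<in> I \<Longrightarrow> j < s \<Longrightarrow> -1/2 \<le> t i j \<and> t i j \<le> 1/2"
proof -
 assume "i \<in> I" "j < s"
 then have "t i j \<in> {-1/2..1/2}" using t_cube[of i] unfolding cube_def by (intro PiE_mem[of "t i"]) auto
 then show ?thesis by simp
qed

lemma ker_props:
 assumes u: "u \<subseteq> {..<s}"
 shows "ker u \<in> borel_measurable (cube_measure u)" "integrable (cube_measure u) (\<lambda>y. (ker u y)\<^sup>2)"
  "(LINT y|cube_measure u. (ker u y)\<^sup>2) = Kq u"
proof -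
 have fu: "finite u" using u finite_subset by blast
 have m: "(\<lambda>y. kprod (t i) u y) \<in> borel_measurable (cube_measure u)" for i
  by (rule bdd_meas_cube_prod(3)[OF bdd_meas_kern fu subset_refl])
 then show "ker u \<in> borel_measurable (cube_measure u)" unfolding ker_def[abs_def] by auto
 have eq: "(ker u y)\<^sup>2 = (\<Sum>i\<in>I. \<Sum>i'\<in>I. (1 / N\<^sup>2) * (\<Prod>j\<in>u. kern (t i j) (y j) * kern (t i' j) (y j)))" for y
 proof -
  have "(ker u y)\<^sup>2 = (1 / N\<^sup>2) * ((\<Sum>i\<in>I. kprod (t i) u y) * (\<Sum>i\<in>I. kprod (t i) u y))"
   unfolding ker_def by (simp add: power2_eq_square)
  then show ?thesis unfolding sum_product prod.distrib[symmetric] by (simp only: sum_distrib_left)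
 qed
 have i: "integrable (cube_measure u) (\<lambda>y. \<Prod>j\<in>u. kern (t i j) (y j) * kern (t i' j) (y j))" for i i'
  by (rule bdd_meas_cube_prod(1)[OF bdd_meas_mult[OF bdd_meas_kern bdd_meas_kern] fu subset_refl])
 show "integrable (cube_measure u) (\<lambda>y. (ker u y)\<^sup>2)"
  unfolding eq by (intro B_integrable_sum integrable_mult_right i)
 have "(LINT y|cube_measure u. (\<Prod>j\<in>u. kern (t i j) (y j) * kern (t i' j) (y j))) = (\<Prod>j\<in>u. kcov (t i j) (t i' j))"
  if "i \<in> I" "i' \<in> I" for i i'
 proof -
  have "(LINT y|cube_measure u. (\<Prod>j\<in>u. (\<lambda>x. kern (t i j) x * kern (t i' j) x) (y j))) =
    (\<Prod>j\<in>u. LINT x|unit_leb. kern (t i j) x * kern (t i' j) x)"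
   by (rule cube_integral_prod(1)[OF fu]) (rule bdd_meas_integrable[OF bdd_meas_mult[OF bdd_meas_kern bdd_meas_kern]])
  also have "\<dots> = (\<Prod>j\<in>u. kcov (t i j) (t i' j))"
   using t_range[OF that(1)] t_range[OF that(2)] u by (intro prod.cong refl kern_kern_integral) auto
  finally show ?thesis .
 qed
 then have one: "(LINT y|cube_measure u. (1 / N\<^sup>2) * (\<Prod>j\<in>u. kern (t i j) (y j) * kern (t i' j) (y j))) =
   (1 / N\<^sup>2) * (\<Prod>j\<in>u. kcov (t i j) (t i' j))" if "i \<in> I" "i' \<in> I" for i i' using that by simp
 have "(LINT y|cube_measure u. (ker u y)\<^sup>2) =
   (\<Sum>i\<in>I. LINT y|cube_measure u. (\<Sum>i'\<in>I. (1 / N\<^sup>2) * (\<Prod>j\<in>u. kern (t i j) (y j) * kern (t i' j) (y j))))"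
  unfolding eq by (intro B_integral_sum B_integrable_sum integrable_mult_right i)
 also have "\<dots> = (\<Sum>i\<in>I. \<Sum>i'\<in>I. LINT y|cube_measure u. (1 / N\<^sup>2) * (\<Prod>j\<in>u. kern (t i j) (y j) * kern (t i' j) (y j)))"
  by (intro sum.cong refl B_integral_sum integrable_mult_right i)
 also have "\<dots> = (\<Sum>i\<in>I. \<Sum>i'\<in>I. (1 / N\<^sup>2) * (\<Prod>j\<in>u. kcov (t i j) (t i' j)))"
  by (intro sum.cong refl one)
 finally show "(LINT y|cube_measure u. (ker u y)\<^sup>2) = Kq u"
  unfolding Kq_def sum_distrib_left .
qed

lemma Kq_nonneg: "u \<subseteq> {..<s} \<Longrightarrow> Kq u \<ge> 0"
proof -
 assume "u \<subseteq> {..<s}"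
 moreover have "0 \<le> (LINT y|cube_measure u. (ker u y)\<^sup>2)" by (rule integral_nonneg_AE) simp
 ultimately show ?thesis by (simp add: ker_props(3))
qed

lemma wce2_nonneg: "wce2 \<ge> 0"
 unfolding wce2_def by (intro sum_nonneg mult_nonneg_nonneg \<gamma>_nonneg Kq_nonneg) auto

text \<open>The kernel depends on the coordinates in \<open>u\<close> only, so the remaining
  integrations fall on the derivative and turn it into its projection.\<close>

lemma integral_bar_ker:
 assumes u: "u \<subseteq> {..<s}" and g: "integrable (cubeM s) g"
 shows "(1 / N) * (\<Sum>i\<in>I. LINT y|cubeM s. g y * kprod (t i) u y) =
  (LINT yu|cube_measure u. bar s u g yu * ker u yu)"
proof -
 have fu: "finite u" using u finite_subset by blast
 have gi: "integrable (cubeM s) (\<lambda>y. g y * kprod (t i) u y)" for i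
  using u bdd_meas_kern by (intro integrable_mult_cube_prod[OF g]) (auto simp: bdd_meas_def)
 have "(1 / N) * (\<Sum>i\<in>I. LINT y|cubeM s. g y * kprod (t i) u y) =
   (1 / N) * (LINT y|cubeM s. (\<Sum>i\<in>I. g y * kprod (t i) u y))"
  by (subst B_integral_sum) (auto intro: gi)
 also have "\<dots> = (LINT y|cubeM s. g y * ker u y)"
  by (simp only: Bochner_Integration.integral_mult_right_zero[symmetric])
    (rule B_integral_cong, auto simp: ker_def sum_distrib_left mult_ac)
 also have "\<dots> = (LINT yu|cube_measure u. bar s u (\<lambda>y. g y * ker u y) yu)"
 proof (rule integral_fold_bar[OF u])
  have "integrable (cubeM s) (\<lambda>y. (1 / N) * (\<Sum>i\<in>I. g y * kprod (t i) u y))"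
   by (intro integrable_mult_right B_integrable_sum gi)
  then show "integrable (cubeM s) (\<lambda>y. g y * ker u y)"
   by (simp add: ker_def sum_distrib_left mult_ac)
 qed
 also have "\<dots> = (LINT yu|cube_measure u. bar s u g yu * ker u yu)"
 proof (rule B_integral_cong[OF refl])
  fix yu
  have "ker u (merge u ({..<s} - u) (yu, yc)) = ker u yu" for yc
   unfolding ker_def by (intro mult_arg_cong refl sum.cong prod.cong) (simp add: merge_def)
  then show "bar s u (\<lambda>y. g y * ker u y) yu = bar s u g yu * ker u yu"
   unfolding bar_def by simp
 qed
 finally show ?thesis .
qed

text \<open>The representation is averaged over the nodes; its term for the empty set is the
  integral and cancels.\<close>

lemma err_eq:
 assumes G: "continuous_on (cube s) G"
  and g: "\<And>u. u \<subseteq> {..<s} \<Longrightarrow> has_weak_mixed s u G (g u)"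
 shows "err G = - (\<Sum>u\<in>PowN s. (-1) ^ card u * (LINT yu|cube_measure u. bar s u (g u) yu * ker u yu))"
proof -
 let ?q = "\<lambda>u. (1 / N) * (\<Sum>i\<in>I. LINT y|cubeM s. g u y * kprod (t i) u y)"
 have "(\<Sum>i\<in>I. G (t i)) = (\<Sum>i\<in>I. \<Sum>u\<in>Pow {..<s}. (-1) ^ card u *
      (LINT y|cubeM s. g u y * kprod (t i) u y))"
  by (intro sum.cong refl weak_representation G g t_cube t_less)
 also have "\<dots> = (\<Sum>u\<in>Pow {..<s}. (-1) ^ card u * (\<Sum>i\<in>I. LINT y|cubeM s. g u y * kprod (t i) u y))"
  by (subst sum.swap) (simp only: sum_distrib_left)
 finally have "(1 / N) * (\<Sum>i\<in>I. G (t i)) = (\<Sum>u\<in>Pow {..<s}. (-1) ^ card u * ?q u)"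
  by (simp add: sum_distrib_left mult.left_commute)
 also have "\<dots> = (\<Sum>u\<in>insert {} (PowN s). (-1) ^ card u * ?q u)"
  by (rule sum.cong) auto
 also have "\<dots> = (LINT y|cubeM s. g {} y) +
   (\<Sum>u\<in>PowN s. (-1) ^ card u * ?q u)"
  using N_pos by (subst sum.insert) (auto simp: N_def)
 also have "(\<Sum>u\<in>PowN s. (-1) ^ card u * ?q u) =
   (\<Sum>u\<in>PowN s. (-1) ^ card u * (LINT yu|cube_measure u. bar s u (g u) yu * ker u yu))"
  by (intro sum.cong refl mult_arg_cong integral_bar_ker has_weak_mixed_integrable[OF g]) auto
 finally show ?thesis
  unfolding err_def using weak_mixed_empty_integral[OF G g[of "{}"]] by simp
qed

text \<open>Cauchy-Schwarz in L2 for each subset, then over subsets after distributing the weight as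
  sqrt (V/\<gamma>) times sqrt (\<gamma> Kq). The hypothesis on vanishing weights is what makes this
  factorization valid under the convention x / 0 = 0.\<close>

theorem err_bound:
 assumes G: "continuous_on (cube s) G"
  and g: "\<And>u. u \<subseteq> {..<s} \<Longrightarrow> has_weak_mixed s u G (g u)"
  and V: "\<And>u. u \<subseteq> {..<s} \<Longrightarrow> u \<noteq> {} \<Longrightarrow> integrable (cube_measure u) (\<lambda>y. (bar s u (g u) y)\<^sup>2)"
   "\<And>u. u \<subseteq> {..<s} \<Longrightarrow> u \<noteq> {} \<Longrightarrow> (LINT y|cube_measure u. (bar s u (g u) y)\<^sup>2) = V u"
   "\<And>u. u \<subseteq> {..<s} \<Longrightarrow> u \<noteq> {} \<Longrightarrow> \<gamma> u = 0 \<Longrightarrow> V u = 0"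
 shows "(err G)\<^sup>2 \<le> (\<Sum>u\<in>PowN s. V u / \<gamma> u) * wce2"
proof -
 let ?S = "PowN s"
 have Vn: "V u \<ge> 0" if "u \<in> ?S" for u
 proof -
  have "V u = (LINT y|cube_measure u. (bar s u (g u) y)\<^sup>2)" using V(2)[of u] that by auto
  also have "\<dots> \<ge> 0" by (rule integral_nonneg_AE) simp
  finally show ?thesis .
 qed
 have "err G = - (\<Sum>u\<in>?S. (-1) ^ card u * (LINT yu|cube_measure u. bar s u (g u) yu * ker u yu))"
  by (rule err_eq[OF G g])
 then have "\<bar>err G\<bar> \<le> (\<Sum>u\<in>?S. \<bar>(-1) ^ card u * (LINT yu|cube_measure u. bar s u (g u) yu * ker u yu)\<bar>)"
  by (simp only: abs_minus_cancel sum_abs)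
 also have "\<dots> \<le> (\<Sum>u\<in>?S. \<bar>sqrt (V u / \<gamma> u)\<bar> * \<bar>sqrt (\<gamma> u * Kq u)\<bar>)"
 proof (rule sum_mono)
  fix u assume u: "u \<in> ?S"
  then have us: "u \<subseteq> {..<s}" "u \<noteq> {}" by auto
  have "g u \<in> borel_measurable (cubeM s)" using g[OF us(1)] unfolding has_weak_mixed_def by blast
  then have "\<bar>LINT yu|cube_measure u. bar s u (g u) yu * ker u yu\<bar> \<le> sqrt (V u) * sqrt (Kq u)"
   using Cauchy_Schwarz_integral[OF bar_measurable[OF us(1)] ker_props(1)[OF us(1)] V(1)[OF us] ker_props(2)[OF us(1)]]
   unfolding V(2)[OF us] ker_props(3)[OF us(1)] by simp
  also have "\<dots> = sqrt (V u / \<gamma> u) * sqrt (\<gamma> u * Kq u)"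
   using V(3)[OF us] \<gamma>_nonneg[of u] by (cases "\<gamma> u = 0") (auto simp: real_sqrt_mult[symmetric])
  also have "\<dots> = \<bar>sqrt (V u / \<gamma> u)\<bar> * \<bar>sqrt (\<gamma> u * Kq u)\<bar>"
   using Vn[OF u] \<gamma>_nonneg[of u] Kq_nonneg[OF us(1)] by simp
  finally show "\<bar>(-1) ^ card u * (LINT yu|cube_measure u. bar s u (g u) yu * ker u yu)\<bar> \<le> \<dots>"
   by (simp add: abs_mult power_abs)
 qed
 also have "\<dots> \<le> L2_set (\<lambda>u. sqrt (V u / \<gamma> u)) ?S * L2_set (\<lambda>u. sqrt (\<gamma> u * Kq u)) ?S"
  by (rule L2_set_mult_ineq)
 also have "\<dots> = sqrt ((\<Sum>u\<in>?S. V u / \<gamma> u) * wce2)"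
 proof -
  have "(\<Sum>u\<in>?S. (sqrt (V u / \<gamma> u))\<^sup>2) = (\<Sum>u\<in>?S. V u / \<gamma> u)"
   using Vn \<gamma>_nonneg by (intro sum.cong refl) auto
  moreover have "(\<Sum>u\<in>?S. (sqrt (\<gamma> u * Kq u))\<^sup>2) = wce2"
   unfolding wce2_def using Kq_nonneg \<gamma>_nonneg by (intro sum.cong refl) auto
  ultimately show ?thesis by (simp add: L2_set_def real_sqrt_mult)
 qed
 finally have "\<bar>err G\<bar>\<^sup>2 \<le> (sqrt ((\<Sum>u\<in>?S. V u / \<gamma> u) * wce2))\<^sup>2" by (intro power_mono) auto
 moreover have "(\<Sum>u\<in>?S. V u / \<gamma> u) * wce2 \<ge> 0"
  using Vn \<gamma>_nonneg wce2_nonneg by (intro mult_nonneg_nonneg sum_nonneg) auto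
 ultimately show ?thesis by simp
qed

section \<open>The extremal function\<close>

definition rprod :: "nat set \<Rightarrow> nat \<Rightarrow> nat \<Rightarrow> real \<Rightarrow> real" where
 "rprod w i j = (if j \<in> w then kprim (t i j) else (\<lambda>_. 1))"

definition rprod' :: "nat set \<Rightarrow> nat \<Rightarrow> nat \<Rightarrow> real \<Rightarrow> real" where
 "rprod' w i j = (if j \<in> w then kern (t i j) else (\<lambda>_. 0))"

text \<open>\<open>c\<close> times the Riesz representer of the error functional. Equality in
  Cauchy-Schwarz requires the projected derivative for \<open>u\<close> to be proportional to
  \<open>\<gamma> u\<close> times \<open>ker u\<close>; products of the mean-free primitives
  \<open>kprim\<close> over \<open>w\<close>, constant in the other coordinates, achieve this for
  all \<open>u\<close> at once.\<close>

definition representer :: "real \<Rightarrow> (nat \<Rightarrow> real) \<Rightarrow> real" where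
 "representer c y = (\<Sum>(w, i)\<in>(PowN s) \<times> I. (- c * \<gamma> w * (-1) ^ card w / N) * (\<Prod>j<s. rprod w i j (y j)))"

definition representer' :: "real \<Rightarrow> nat set \<Rightarrow> (nat \<Rightarrow> real) \<Rightarrow> real" where
 "representer' c u y = (\<Sum>(w, i)\<in>(PowN s) \<times> I. (- c * \<gamma> w * (-1) ^ card w / N) *
   (\<Prod>j<s. (if j \<in> u then rprod' w i j else rprod w i j) (y j)))"

lemma rprod_props:
 assumes "i \<in> I" "j < s"
 shows "bdd_meas (rprod w i j)" "bdd_meas (rprod' w i j)" "weak_deriv1 (rprod w i j) (rprod' w i j)"
  "(LINT x|unit_leb. rprod w i j x) = (if j \<in> w then 0 else 1)"
proof -
 have c: "bdd_meas (\<lambda>_. c)" for c by (rule bdd_meas_continuous) simp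
 show "bdd_meas (rprod w i j)" "bdd_meas (rprod' w i j)"
  by (auto simp: rprod_def rprod'_def intro: c bdd_meas_kern bdd_meas_continuous kprim_continuous)
 show "weak_deriv1 (rprod w i j) (rprod' w i j)"
  using t_range[OF assms] by (auto simp: rprod_def rprod'_def weak_deriv1_const intro: weak_deriv1_kprim)
 show "(LINT x|unit_leb. rprod w i j x) = (if j \<in> w then 0 else 1)"
  using t_range[OF assms] unit_leb_lint_const[of 1] by (auto simp: rprod_def kprim_mean)
qed

lemma representer_continuous: "continuous_on (cube s) (representer c)"
proof -
 have "continuous_on (cube s) (\<lambda>y. rprod w i j (y j))" for w i j
  by (rule continuous_on_compose2[of UNIV "rprod w i j"])
   (auto simp: rprod_def intro: kprim_continuous continuous_on_product_then_coordinatewise continuous_on_id)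
 then show ?thesis unfolding representer_def[abs_def] case_prod_unfold
  by (intro continuous_on_sum continuous_on_mult continuous_on_prod continuous_on_const)
qed

lemma representer_weak:
 assumes u: "u \<subseteq> {..<s}"
 shows "has_weak_mixed s u (representer c) (representer' c u)"
proof -
 have "has_weak_mixed s u (\<lambda>y. \<Sum>p\<in>(PowN s) \<times> I. (- c * \<gamma> (fst p) * (-1) ^ card (fst p) / N) * (\<Prod>j<s. rprod (fst p) (snd p) j (y j)))
   (\<lambda>y. \<Sum>p\<in>(PowN s) \<times> I. (- c * \<gamma> (fst p) * (-1) ^ card (fst p) / N) *
    (\<Prod>j<s. (if j \<in> u then rprod' (fst p) (snd p) j else rprod (fst p) (snd p) j) (y j)))"
 proof (rule has_weak_mixed_sum)
  fix p assume "p \<in> (PowN s) \<times> I"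
  then have i: "snd p \<in> I" by auto
  show "has_weak_mixed s u (\<lambda>y. \<Prod>j<s. rprod (fst p) (snd p) j (y j))
   (\<lambda>y. \<Prod>j<s. (if j \<in> u then rprod' (fst p) (snd p) j else rprod (fst p) (snd p) j) (y j))"
   using rprod_props[OF i] by (intro has_weak_mixed_prod u) auto
  show "integrable (cubeM s) (\<lambda>y. \<Prod>j<s. rprod (fst p) (snd p) j (y j))"
   using rprod_props(1)[OF i] by (intro bdd_meas_cube_prod(1)) auto
 qed (use fin in auto)
 then show ?thesis unfolding representer_def[abs_def] representer'_def[abs_def] case_prod_unfold .
qed

text \<open>Only \<open>w = u\<close> survives: an index in \<open>u\<close> but not in
  \<open>w\<close> differentiates a constant, and an index in \<open>w\<close> but not in
  \<open>u\<close> integrates a function of mean zero.\<close>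

lemma bar_representer:
 assumes u: "u \<subseteq> {..<s}" and yu: "yu \<in> space (cube_measure u)"
 shows "bar s u (representer' c u) yu = (if u = {} then 0 else - c * \<gamma> u * (-1) ^ card u * ker u yu)"
proof -
 let ?C = "{..<s} - u"
 let ?K = "(PowN s) \<times> I"
 define co where "co w = - c * \<gamma> w * (-1) ^ card w / N" for w
 have fu: "finite u" using u finite_subset by blast
 have split: "(\<Prod>j<s. (if j \<in> u then rprod' w i j else rprod w i j) (merge u ?C (yu, yc) j)) =
   (\<Prod>j\<in>u. rprod' w i j (yu j)) * (\<Prod>j\<in>?C. rprod w i j (yc j))" for w i yc
 proof -
  have "(\<Prod>j<s. (if j \<in> u then rprod' w i j else rprod w i j) (merge u ?C (yu, yc) j)) =
   (\<Prod>j\<in>u. (if j \<in> u then rprod' w i j else rprod w i j) (merge u ?C (yu, yc) j)) *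
   (\<Prod>j\<in>?C. (if j \<in> u then rprod' w i j else rprod w i j) (merge u ?C (yu, yc) j))"
   using u by (subst prod.subset_diff[of u "{..<s}"]) (auto simp: mult.commute)
  also have "\<dots> = (\<Prod>j\<in>u. rprod' w i j (yu j)) * (\<Prod>j\<in>?C. rprod w i j (yc j))"
   by (intro mult_arg_cong prod.cong) (auto simp: merge_def)
  finally show ?thesis .
 qed
 have int: "(LINT yc|cube_measure ?C. (\<Prod>j\<in>?C. rprod w i j (yc j))) = (\<Prod>j\<in>?C. if j \<in> w then 0 else 1)"
  "integrable (cube_measure ?C) (\<lambda>yc. \<Prod>j\<in>?C. rprod w i j (yc j))" if "i \<in> I" for w i
 proof -
  have "(LINT yc|cube_measure ?C. (\<Prod>j\<in>?C. rprod w i j (yc j))) = (\<Prod>j\<in>?C. LINT x|unit_leb. rprod w i j x)"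
   using rprod_props(1)[OF that] by (intro cube_integral_prod(1)) (auto intro: bdd_meas_integrable)
  also have "\<dots> = (\<Prod>j\<in>?C. if j \<in> w then 0 else 1)"
   using rprod_props(4)[OF that] by (intro prod.cong) auto
  finally show "(LINT yc|cube_measure ?C. (\<Prod>j\<in>?C. rprod w i j (yc j))) = (\<Prod>j\<in>?C. if j \<in> w then 0 else 1)" .
  show "integrable (cube_measure ?C) (\<lambda>yc. \<Prod>j\<in>?C. rprod w i j (yc j))"
   using rprod_props(1)[OF that] by (intro bdd_meas_cube_prod(1)) auto
 qed
 have "bar s u (representer' c u) yu = (LINT yc|cube_measure ?C.
   (\<Sum>p\<in>?K. co (fst p) * ((\<Prod>j\<in>u. rprod' (fst p) (snd p) j (yu j)) * (\<Prod>j\<in>?C. rprod (fst p) (snd p) j (yc j)))))"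
  unfolding bar_def representer'_def case_prod_unfold split co_def ..
 also have "\<dots> = (\<Sum>p\<in>?K. LINT yc|cube_measure ?C. co (fst p) * ((\<Prod>j\<in>u. rprod' (fst p) (snd p) j (yu j)) * (\<Prod>j\<in>?C. rprod (fst p) (snd p) j (yc j))))"
  by (intro B_integral_sum integrable_mult_right int) auto
 also have "\<dots> = (\<Sum>p\<in>?K. co (fst p) * ((\<Prod>j\<in>u. rprod' (fst p) (snd p) j (yu j)) * (\<Prod>j\<in>?C. if j \<in> fst p then 0 else 1)))"
  using int(1) by (intro sum.cong refl) auto
 also have "\<dots> = (\<Sum>p\<in>?K. if fst p = u then co u * kprod (t (snd p)) u yu else 0)"
 proof (rule sum.cong[OF refl])
  fix p assume p: "p \<in> ?K"
  show "co (fst p) * ((\<Prod>j\<in>u. rprod' (fst p) (snd p) j (yu j)) * (\<Prod>j\<in>?C. if j \<in> fst p then 0 else 1)) =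
   (if fst p = u then co u * kprod (t (snd p)) u yu else 0)"
  proof (cases "fst p = u")
   case True
   have "(\<Prod>j\<in>u. rprod' (fst p) (snd p) j (yu j)) = kprod (t (snd p)) u yu"
    using True by (intro prod.cong) (auto simp: rprod'_def)
   moreover have "(\<Prod>j\<in>?C. if j \<in> fst p then 0 else 1) = (1::real)" using True by (intro prod.neutral) auto
   ultimately show ?thesis using True by simp
  next
   case False
   then consider j where "j \<in> u" "j \<notin> fst p" | j where "j \<in> fst p" "j \<notin> u" by blast
   then show ?thesis
   proof cases
    case (1 j)
    then have "(\<Prod>j\<in>u. rprod' (fst p) (snd p) j (yu j)) = 0"
     using fu by (intro prod_zero) (auto simp: rprod'_def)
    then show ?thesis using False by simp
   next
    case (2 j)
    then have "(\<Prod>j\<in>?C. if j \<in> fst p then 0 else 1) = (0::real)"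
     using p by (intro prod_zero) auto
    then show ?thesis using False by simp
   qed
  qed
 qed
 also have "\<dots> = (\<Sum>w\<in>PowN s. \<Sum>i\<in>I. if w = u then co u * kprod (t i) u yu else 0)"
  unfolding sum.cartesian_product by (simp add: case_prod_unfold)
 also have "\<dots> = (\<Sum>w\<in>PowN s. if w = u then co u * (\<Sum>i\<in>I. kprod (t i) u yu) else 0)"
  by (intro sum.cong refl) (auto simp: sum_distrib_left)
 also have "\<dots> = (if u \<in> PowN s then co u * (\<Sum>i\<in>I. kprod (t i) u yu) else 0)"
  by (subst sum.delta) auto
 also have "\<dots> = (if u = {} then 0 else - c * \<gamma> u * (-1) ^ card u * ker u yu)"
  using u by (simp add: co_def ker_def)
 finally show ?thesis .
qed

lemma err_representer: "err (representer c) = c * wce2"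
proof -
 have "err (representer c) = - (\<Sum>u\<in>PowN s. (-1) ^ card u * (LINT yu|cube_measure u. bar s u (representer' c u) yu * ker u yu))"
  by (rule err_eq[OF representer_continuous representer_weak])
 also have "\<dots> = - (\<Sum>u\<in>PowN s. - c * (\<gamma> u * Kq u))"
 proof (intro arg_cong[of _ _ uminus] sum.cong refl)
  fix u assume u: "u \<in> PowN s"
  have "(LINT yu|cube_measure u. bar s u (representer' c u) yu * ker u yu) =
   (LINT yu|cube_measure u. (- c * \<gamma> u * (-1) ^ card u) * (ker u yu)\<^sup>2)"
   using u by (intro B_integral_cong refl) (auto simp: bar_representer power2_eq_square)
  also have "\<dots> = (- c * \<gamma> u * (-1) ^ card u) * Kq u"
   using u ker_props(3)[of u] by simp
  finally show "(-1) ^ card u * (LINT yu|cube_measure u. bar s u (representer' c u) yu * ker u yu) = - c * (\<gamma> u * Kq u)"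
   by (simp add: power_mult_distrib[symmetric] mult.assoc[symmetric])
 qed
 also have "\<dots> = c * wce2" by (simp add: wce2_def sum_distrib_left sum_negf)
 finally show ?thesis .
qed

lemma weak_mixed_someI: "G \<in> sobolev_space s \<Longrightarrow> u \<subseteq> {..<s} \<Longrightarrow> has_weak_mixed s u G (weak_mixed s u G)"
proof -
 assume "G \<in> sobolev_space s" "u \<subseteq> {..<s}"
 then have "\<exists>g. has_weak_mixed s u G g" unfolding sobolev_space_def by auto
 then show ?thesis unfolding weak_mixed_def by (rule someI_ex)
qed

lemma representer_sobolev: "representer c \<in> sobolev_space s"
 unfolding sobolev_space_def using representer_continuous representer_weak by blast

text \<open>Uniqueness of weak derivatives replaces the unspecified \<open>weak_mixed\<close> by the
  explicit \<open>representer'\<close>; for a vanishing weight the term is 0 / 0 = 0.\<close>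

lemma norm_representer: "sobolev_norm2 s \<gamma> (representer c) = ennreal (c\<^sup>2 * wce2)"
proof -
 let ?G = "representer c"
 have trm: "(\<integral>\<^sup>+ yu. ennreal ((LINT yc|cube_measure ({..<s} - u). weak_mixed s u ?G (merge u ({..<s} - u) (yu, yc)))\<^sup>2) \<partial>cube_measure u)
    / ennreal (\<gamma> u) = ennreal (if u = {} then 0 else c\<^sup>2 * (\<gamma> u * Kq u))" if u: "u \<in> Pow {..<s}" for u
 proof -
  have us: "u \<subseteq> {..<s}" using u by simp
  note w = weak_mixed_someI[OF representer_sobolev us, of c]
  have ae: "AE yu in cube_measure u. bar s u (weak_mixed s u ?G) yu = bar s u (representer' c u) yu"
  proof (rule bar_cong_AE[OF us])
   show "weak_mixed s u ?G \<in> borel_measurable (cubeM s)" "representer' c u \<in> borel_measurable (cubeM s)"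
    using w representer_weak[OF us, of c] unfolding has_weak_mixed_def by blast+
  qed (rule weak_mixed_unique[OF w representer_weak[OF us]])
  define d where "d = (if u = {} then 0 else c * \<gamma> u)"
  have "(\<integral>\<^sup>+ yu. ennreal ((bar s u (weak_mixed s u ?G) yu)\<^sup>2) \<partial>cube_measure u) = (\<integral>\<^sup>+ yu. ennreal (d\<^sup>2 * (ker u yu)\<^sup>2) \<partial>cube_measure u)"
  proof (rule nn_integral_cong_AE)
   have "AE yu in cube_measure u. yu \<in> space (cube_measure u)" by (rule AE_space)
   with ae show "AE yu in cube_measure u. ennreal ((bar s u (weak_mixed s u ?G) yu)\<^sup>2) = ennreal (d\<^sup>2 * (ker u yu)\<^sup>2)"
   proof eventually_elim
    case (elim yu)
    have "((-1::real) ^ card u)\<^sup>2 = 1" by (cases "even (card u)") auto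
    then show ?case unfolding elim(1) bar_representer[OF us elim(2)] d_def
     by (cases "u = {}") (simp_all add: power_mult_distrib)
   qed
  qed
  also have "\<dots> = ennreal (d\<^sup>2 * Kq u)"
   using ker_props[OF us] by (subst nn_integral_eq_integral) auto
  finally have I: "(\<integral>\<^sup>+ yu. ennreal ((bar s u (weak_mixed s u ?G) yu)\<^sup>2) \<partial>cube_measure u) = ennreal (d\<^sup>2 * Kq u)" .
  have "ennreal (d\<^sup>2 * Kq u) / ennreal (\<gamma> u) = ennreal (if u = {} then 0 else c\<^sup>2 * (\<gamma> u * Kq u))"
  proof (cases "\<gamma> u = 0 \<or> u = {}")
   case True
   then show ?thesis by (auto simp: d_def ennreal_zero_divide)
  next
   case False
   then have "\<gamma> u > 0" using \<gamma>_nonneg[of u] by simp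
   have "d\<^sup>2 * Kq u / \<gamma> u = c\<^sup>2 * (\<gamma> u * Kq u)"
    using False \<open>\<gamma> u > 0\<close> by (simp add: d_def power2_eq_square field_simps)
   moreover have "ennreal (d\<^sup>2 * Kq u) / ennreal (\<gamma> u) = ennreal (d\<^sup>2 * Kq u / \<gamma> u)"
    using \<open>\<gamma> u > 0\<close> Kq_nonneg[OF us] by (intro divide_ennreal mult_nonneg_nonneg) auto
   ultimately show ?thesis using False by simp
  qed
  then show ?thesis using I unfolding bar_def by simp
 qed
 have "sobolev_norm2 s \<gamma> ?G = (\<Sum>u\<in>Pow {..<s}. ennreal (if u = {} then 0 else c\<^sup>2 * (\<gamma> u * Kq u)))"
  unfolding sobolev_norm2_def by (rule sum.cong[OF refl trm])
 also have "\<dots> = ennreal (\<Sum>u\<in>Pow {..<s}. if u = {} then 0 else c\<^sup>2 * (\<gamma> u * Kq u))"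
  using Kq_nonneg \<gamma>_nonneg by (intro sum_ennreal) auto
 also have "(\<Sum>u\<in>Pow {..<s}. if u = {} then 0 else c\<^sup>2 * (\<gamma> u * Kq u)) = (\<Sum>u\<in>PowN s. c\<^sup>2 * (\<gamma> u * Kq u))"
  by (intro sum.mono_neutral_cong_right) auto
 also have "\<dots> = c\<^sup>2 * wce2" by (simp add: wce2_def sum_distrib_left)
 finally show ?thesis .
qed

text \<open>A norm of at most one in the extended reals forces every projected square integral to be
  finite, and to be zero where the weight is zero. The norm can then be rewritten with real
  numbers.\<close>

lemma err_unit_ball:
 assumes G: "G \<in> sobolev_space s" and n: "sobolev_norm2 s \<gamma> G \<le> 1"
 shows "(err G)\<^sup>2 \<le> wce2"
proof -
 let ?S = "PowN s"
 define g where "g u = weak_mixed s u G" for u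
 have g: "has_weak_mixed s u G (g u)" if "u \<subseteq> {..<s}" for u unfolding g_def by (rule weak_mixed_someI[OF G that])
 define W where "W u = (\<integral>\<^sup>+ yu. ennreal ((bar s u (g u) yu)\<^sup>2) \<partial>cube_measure u)" for u
 have sum: "(\<Sum>u\<in>Pow {..<s}. W u / ennreal (\<gamma> u)) \<le> 1"
  using n unfolding sobolev_norm2_def W_def g_def bar_def .
 have le1: "W u / ennreal (\<gamma> u) \<le> 1" if "u \<subseteq> {..<s}" for u
  using sum that by (intro order_trans[OF _ sum] member_le_sum) auto
 have Wfin: "W u < \<infinity> \<and> (\<gamma> u = 0 \<longrightarrow> W u = 0)" if u: "u \<subseteq> {..<s}" for u
 proof (cases "\<gamma> u = 0")
  case True
  have "W u = 0"
  proof (rule ccontr)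
   assume "W u \<noteq> 0"
   then have "W u / ennreal (\<gamma> u) = \<infinity>" using True by (simp add: ennreal_divide_zero)
   then show False using le1[OF u] by (simp add: top_unique)
  qed
  then show ?thesis by simp
 next
  case False
  then have "\<gamma> u > 0" using \<gamma>_nonneg[of u] by simp
  have "W u \<noteq> \<infinity>"
  proof
   assume "W u = \<infinity>"
   then have "W u / ennreal (\<gamma> u) = \<infinity>" using \<open>\<gamma> u > 0\<close> by (simp add: ennreal_top_divide)
   then show False using le1[OF u] by (simp add: top_unique)
  qed
  then show ?thesis using False by (simp add: less_top)
 qed
 have bm: "bar s u (g u) \<in> borel_measurable (cube_measure u)" if "u \<subseteq> {..<s}" for u
  using g[OF that] unfolding has_weak_mixed_def by (intro bar_measurable[OF that]) blast
 have int: "integrable (cube_measure u) (\<lambda>y. (bar s u (g u) y)\<^sup>2)" if u: "u \<subseteq> {..<s}" for u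
  unfolding integrable_iff_bounded using bm[OF u] Wfin[OF u] by (auto simp: W_def)
 define V where "V u = (LINT y|cube_measure u. (bar s u (g u) y)\<^sup>2)" for u
 have WV: "W u = ennreal (V u)" if u: "u \<subseteq> {..<s}" for u
  unfolding W_def V_def by (rule nn_integral_eq_integral[OF int[OF u]]) auto
 have Vn: "V u \<ge> 0" for u unfolding V_def by (rule integral_nonneg_AE) auto
 have V0: "\<gamma> u = 0 \<Longrightarrow> V u = 0" if u: "u \<subseteq> {..<s}" for u
  using Wfin[OF u] WV[OF u] Vn[of u] by auto
 have eq: "W u / ennreal (\<gamma> u) = ennreal (V u / \<gamma> u)" if u: "u \<subseteq> {..<s}" for u
 proof (cases "\<gamma> u = 0")
  case True
  then show ?thesis using V0[OF u] WV[OF u] by (simp add: ennreal_zero_divide)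
 next
  case False
  then show ?thesis using WV[OF u] Vn[of u] \<gamma>_nonneg[of u] by (simp add: divide_ennreal)
 qed
 have "(\<Sum>u\<in>Pow {..<s}. ennreal (V u / \<gamma> u)) \<le> 1"
 proof -
  have "(\<Sum>u\<in>Pow {..<s}. ennreal (V u / \<gamma> u)) = (\<Sum>u\<in>Pow {..<s}. W u / ennreal (\<gamma> u))"
   by (intro sum.cong refl eq[symmetric]) auto
  then show ?thesis using sum by simp
 qed
 moreover have "(\<Sum>u\<in>Pow {..<s}. ennreal (V u / \<gamma> u)) = ennreal (\<Sum>u\<in>Pow {..<s}. V u / \<gamma> u)"
  using Vn \<gamma>_nonneg by (intro sum_ennreal) auto
 ultimately have le: "(\<Sum>u\<in>Pow {..<s}. V u / \<gamma> u) \<le> 1"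
  by (simp add: ennreal_le_1)
 have "(\<Sum>u\<in>?S. V u / \<gamma> u) \<le> (\<Sum>u\<in>Pow {..<s}. V u / \<gamma> u)"
  using Vn \<gamma>_nonneg by (intro sum_mono2) auto
 then have le': "(\<Sum>u\<in>?S. V u / \<gamma> u) \<le> 1" using le by simp
 have "(err G)\<^sup>2 \<le> (\<Sum>u\<in>?S. V u / \<gamma> u) * wce2"
  using G int V0 by (intro err_bound[where g=g] g) (auto simp: sobolev_space_def V_def)
 also have "\<dots> \<le> 1 * wce2" using le' wce2_nonneg by (intro mult_right_mono) auto
 finally show ?thesis by simp
qed

theorem sup_err: "(SUP G\<in>{G \<in> sobolev_space s. sobolev_norm2 s \<gamma> G \<le> 1}. (err G)\<^sup>2) = wce2"
proof (rule cSup_eq_maximum)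
 \<comment> \<open>Normalises the representer. If \<open>wce2 = 0\<close> then \<open>c = 0\<close>
   by the convention 1 / 0 = 0, and the zero function attains the supremum.\<close>
 define c where "c = 1 / sqrt wce2"
 have cw: "c\<^sup>2 * wce2 \<le> 1" using wce2_nonneg by (simp add: c_def power_divide)
 have "(err (representer c))\<^sup>2 = wce2"
  unfolding err_representer c_def using wce2_nonneg by (simp add: power_mult_distrib power_divide power2_eq_square)
 moreover have "sobolev_norm2 s \<gamma> (representer c) \<le> 1"
  unfolding norm_representer using cw by (simp add: ennreal_le_1)
 ultimately show "wce2 \<in> (\<lambda>G. (err G)\<^sup>2) ` {G \<in> sobolev_space s. sobolev_norm2 s \<gamma> G \<le> 1}"
  using representer_sobolev by (intro image_eqI[of _ _ "representer c"]) auto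
next
 fix x assume "x \<in> (\<lambda>G. (err G)\<^sup>2) ` {G \<in> sobolev_space s. sobolev_norm2 s \<gamma> G \<le> 1}"
 then show "x \<le> wce2" using err_unit_ball by auto
qed

end

section \<open>Averaging over the shift\<close>

lemma uniform_lint:
 fixes f :: "real \<Rightarrow> real"
 assumes "f \<in> borel_measurable borel"
 shows "(LINT x|unif. f x) = (LINT x|lborel. indicator {0..1} x * f x)"
proof -
 have "unif = density lborel (\<lambda>x::real. ennreal (indicator {0..1} x))"
  unfolding uniform_measure_def by (rule density_cong) (auto simp: indicator_def divide_ennreal_def)
 then show ?thesis using assms by (simp add: integral_density)
qed

lemma uniform_lint_const: "(LINT x|unif. (c::real)) = c"
 by (subst uniform_lint) auto

lemma prob_uniform: "prob_space (unif)"
 by (rule prob_space_uniform_measure) auto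

lemma bounded_integrable_uniform:
 fixes f :: "real \<Rightarrow> real"
 assumes "f \<in> borel_measurable borel" "\<And>x. \<bar>f x\<bar> \<le> C"
 shows "integrable (unif) f"
proof -
 interpret prob_space "unif" by (rule prob_uniform)
 show ?thesis by (rule integrable_const_bound[of _ C]) (use assms in auto)
qed

lemma indicator_tail:
 fixes p P :: "real \<Rightarrow> real"
 assumes t: "0 \<le> t" "t \<le> 1" and P: "\<And>x. (P has_real_derivative p x) (at x)" and p: "\<And>x. isCont p x"
 shows "(LINT x|lborel. indicator {0..1} x * (if t \<le> x then p x else 0)) = P 1 - P t"
  and "integrable lborel (\<lambda>x. indicator {0..1} x * (if t \<le> x then p x else 0))"
proof -
 have eq: "(\<lambda>x. indicator {0..1} x * (if t \<le> x then p x else 0)) = (\<lambda>x. p x * indicator {t..1} x)"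
  using t by (auto simp: indicator_def fun_eq_iff)
 show "(LINT x|lborel. indicator {0..1} x * (if t \<le> x then p x else 0)) = P 1 - P t"
  unfolding eq by (rule integral_FTC_Icc_real) (use t P p in auto)
 show "integrable lborel (\<lambda>x. indicator {0..1} x * (if t \<le> x then p x else 0))"
  using borel_integrable_atLeastAtMost'[of t 1 p] p unfolding eq set_integrable_def
  by (simp add: continuous_at_imp_continuous_on mult.commute)
qed

lemma frac_shift: "0 \<le> a \<Longrightarrow> a < 1 \<Longrightarrow> 0 \<le> x \<Longrightarrow> x < 1 \<Longrightarrow> frac (a + x) = (if 1 - a \<le> x then a + x - 1 else a + x)"
 by (auto simp: frac_unique_iff)

lemma frac_measurable: "(frac :: real \<Rightarrow> real) \<in> borel_measurable borel"
 unfolding frac_def[abs_def] by measurable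

lemma kcov_measurable: "(\<lambda>x. kcov (frac (a + x) - 1/2) (frac (b + x) - 1/2)) \<in> borel_measurable borel"
proof -
 have [measurable]: "(\<lambda>x. frac (c + x)) \<in> borel_measurable borel" for c :: real
  by (rule measurable_compose[OF _ frac_measurable]) simp
 show ?thesis unfolding kcov_def by measurable
qed

lemma kcov_bounded: "\<bar>kcov (frac x - 1/2) (frac y - 1/2)\<bar> \<le> 3"
proof -
 have 1: "0 \<le> frac x" "frac x \<le> 1" "0 \<le> frac y" "frac y \<le> 1" using frac_lt_1 less_imp_le by auto
 then have "(frac x)\<^sup>2 \<le> 1" "(frac y)\<^sup>2 \<le> 1" by (auto simp: power_le_one)
 moreover have "0 \<le> (frac x)\<^sup>2" "0 \<le> (frac y)\<^sup>2" by auto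
 moreover have "0 \<le> max (frac x) (frac y)" "max (frac x) (frac y) \<le> 1" using 1 by (auto simp: le_max_iff_disj)
 moreover have "kcov (frac x - 1/2) (frac y - 1/2) = 1/3 - max (frac x) (frac y) + ((frac x)\<^sup>2 + (frac y)\<^sup>2) / 2"
  by (simp add: kcov_def)
 moreover have "\<bar>1/3 - m + (A + B) / 2\<bar> \<le> 3" if "0 \<le> A" "A \<le> 1" "0 \<le> B" "B \<le> 1" "0 \<le> m" "m \<le> 1" for A B m :: real
  using that unfolding abs_le_iff add_divide_distrib by (intro conjI; linarith)
 ultimately show ?thesis by simp
qed

text \<open>While \<open>x\<close> runs through the unit interval, \<open>a + x\<close> wraps around
  at \<open>1 - a\<close> and \<open>b + x\<close> at \<open>1 - b\<close>. The integrand is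
  \<open>f1\<close> before the first wrap, \<open>f2\<close> is its change at the first and
  \<open>f3\<close> its change at the second, so it is a sum of three tails with polynomial
  primitives.\<close>

lemma kcov_average_ordered:
 assumes "0 \<le> b" "b \<le> a" "a < 1"
 shows "(LINT x|unif. kcov (frac (a + x) - 1/2) (frac (b + x) - 1/2)) = bern2 (a - b)"
proof -
 define f1 where "f1 x = 1/3 - (a + x) + ((a + x)\<^sup>2 + (b + x)\<^sup>2) / 2" for x
 define f2 where "f2 x = 1/2 - (b + x)" for x
 define f3 where "f3 x = 3/2 - a - x" for x
 have d1: "((\<lambda>x. x/3 - (a + x)\<^sup>2 / 2 + ((a + x)^3 + (b + x)^3) / 6) has_real_derivative f1 x) (at x)" for x
  unfolding f1_def by (auto intro!: derivative_eq_intros simp: field_simps)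
 have d2: "((\<lambda>x. x/2 - (b + x)\<^sup>2 / 2) has_real_derivative f2 x) (at x)" for x
  unfolding f2_def by (auto intro!: derivative_eq_intros simp: field_simps)
 have d3: "((\<lambda>x. (3/2 - a) * x - x\<^sup>2 / 2) has_real_derivative f3 x) (at x)" for x
  unfolding f3_def by (auto intro!: derivative_eq_intros simp: field_simps)
 have c: "isCont f1 x" "isCont f2 x" "isCont f3 x" for x
  unfolding f1_def f2_def f3_def by (intro continuous_intros; simp)+
 have t: "0 \<le> (0::real)" "(0::real) \<le> 1" "0 \<le> 1 - a" "1 - a \<le> 1" "0 \<le> 1 - b" "1 - b \<le> 1" using assms by auto
 note T1 = indicator_tail[OF t(1,2) d1 c(1)] and T2 = indicator_tail[OF t(3,4) d2 c(2)] and T3 = indicator_tail[OF t(5,6) d3 c(3)]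
 let ?g = "\<lambda>t p x. indicator {0..1} x * (if t \<le> x then p x else 0) :: real"
 have "(LINT x|unif. kcov (frac (a + x) - 1/2) (frac (b + x) - 1/2)) =
   (LINT x|lborel. indicator {0..1} x * kcov (frac (a + x) - 1/2) (frac (b + x) - 1/2))"
  by (rule uniform_lint[OF kcov_measurable])
 also have "\<dots> = (LINT x|lborel. ?g 0 f1 x + ?g (1 - a) f2 x + ?g (1 - b) f3 x)"
 proof (rule integral_cong_AE)
  show "(\<lambda>x. indicator {0..1} x * kcov (frac (a + x) - 1/2) (frac (b + x) - 1/2)) \<in> borel_measurable lborel"
   using kcov_measurable[of a b] by simp
  show "(\<lambda>x. ?g 0 f1 x + ?g (1 - a) f2 x + ?g (1 - b) f3 x) \<in> borel_measurable lborel"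
   using T1(2) T2(2) T3(2) by (intro borel_measurable_add borel_measurable_integrable) auto
  show "AE x in lborel. indicator {0..1} x * kcov (frac (a + x) - 1/2) (frac (b + x) - 1/2) =
    ?g 0 f1 x + ?g (1 - a) f2 x + ?g (1 - b) f3 x"
   using AE_lborel_singleton[of 1]
  proof eventually_elim
   case (elim x)
   show ?case
   proof (cases "0 \<le> x \<and> x < 1")
    case True
    then have fr: "frac (a + x) = (if 1 - a \<le> x then a + x - 1 else a + x)" "frac (b + x) = (if 1 - b \<le> x then b + x - 1 else b + x)"
     using frac_shift[of a x] frac_shift[of b x] assms by auto
    consider "x < 1 - a" | "1 - a \<le> x" "x < 1 - b" | "1 - b \<le> x" using assms by linarith
    then show ?thesis
    proof cases
     case 1
     then have "x < 1 - b" using assms by simp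
     then show ?thesis using 1 True assms unfolding fr
      by (simp add: kcov_def f1_def max_absorb1)
    next
     case 2
     have "max (a + x - 1) (b + x) = b + x" using assms by simp
     then show ?thesis using 2 True assms unfolding fr
      by (simp add: kcov_def f1_def f2_def power2_eq_square algebra_simps) (simp add: field_simps)
    next
     case 3
     have "1 - a \<le> x" using 3 assms by simp
     then show ?thesis using 3 True assms unfolding fr
      by (simp add: kcov_def f1_def f2_def f3_def power2_eq_square max_absorb1) (simp add: field_simps)
    qed
   qed (use elim in \<open>auto simp: indicator_def\<close>)
  qed
 qed
 also have "\<dots> = ((1/3 - (a + 1)\<^sup>2 / 2 + ((a + 1)^3 + (b + 1)^3) / 6) - (0/3 - (a + 0)\<^sup>2 / 2 + ((a + 0)^3 + (b + 0)^3) / 6)) +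
   ((1/2 - (b + 1)\<^sup>2 / 2) - ((1 - a)/2 - (b + (1 - a))\<^sup>2 / 2)) + (((3/2 - a) * 1 - 1\<^sup>2 / 2) - ((3/2 - a) * (1 - b) - (1 - b)\<^sup>2 / 2))"
  using T1 T2 T3 by (subst Bochner_Integration.integral_add Bochner_Integration.integrable_add; simp)+
 also have "\<dots> = bern2 (a - b)" by (simp add: bern2_def field_simps power2_eq_square power3_eq_cube)
 finally show ?thesis .
qed

lemma bern2_frac_minus: "bern2 (frac (- x)) = bern2 (frac x)"
proof (cases "x \<in> \<int>")
 case False
 then have eq: "frac (- x) = 1 - frac x" by (simp add: frac_neg)
 show ?thesis unfolding eq by (simp add: bern2_def power2_eq_square algebra_simps)
next
 case True
 then have "frac x = 0" "frac (- x) = 0" by (auto simp: frac_eq_0_iff)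
 then show ?thesis by (simp only:)
qed

lemma kcov_sym: "kcov x y = kcov y x" by (simp add: kcov_def max.commute add.commute)

abbreviation "skcov d x y \<equiv> kcov (frac (frac x + d) - 1/2) (frac (frac y + d) - 1/2)"

text \<open>Symmetry of \<open>kcov\<close> and of the Bernoulli polynomial about 1/2 reduce to the
  case of ordered fractional parts.\<close>

lemma kcov_average:
 "(LINT x|unif. skcov x a b) = bern2 (frac (a - b))"
proof -
 have f: "0 \<le> frac a" "frac a < 1" "0 \<le> frac b" "frac b < 1" by (auto simp: frac_lt_1)
 have fd: "frac (x - y) = frac x - frac y" if "frac y \<le> frac x" for x y :: real
 proof -
  have "x - y - (frac x - frac y) = of_int (\<lfloor>x\<rfloor> - \<lfloor>y\<rfloor>)" by (simp add: frac_def)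
  then have "x - y - (frac x - frac y) \<in> \<int>" by (metis Ints_of_int)
  moreover have "frac x - frac y < 1" using frac_lt_1[of x] frac_ge_0[of y] by linarith
  ultimately show ?thesis using that by (simp add: frac_unique_iff)
 qed
 show ?thesis
 proof (cases "frac b \<le> frac a")
  case True
  then show ?thesis using kcov_average_ordered[OF f(3) True f(2)] fd[OF True] by simp
 next
  case False
  then have le: "frac a \<le> frac b" by simp
  have "bern2 (frac (a - b)) = bern2 (frac (b - a))" using bern2_frac_minus[of "b - a"] by simp
  then show ?thesis using kcov_average_ordered[OF f(1) le f(4)] fd[OF le] by (simp add: kcov_sym)
 qed
qed

lemma product_prob_uniform: "product_prob_space (\<lambda>_::nat. unif)"
 by (intro product_prob_spaceI prob_uniform)

lemma shift_component_measurable: "j < s \<Longrightarrow> (\<lambda>\<Delta>. \<Delta> j) \<in> borel_measurable (shift_measure s)"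
proof -
 assume "j < s"
 then have "(\<lambda>\<Delta>. \<Delta> j) \<in> measurable (shift_measure s) (unif)"
  unfolding shift_measure_def by (intro measurable_component_singleton) simp
 then show ?thesis by (simp cong: measurable_cong_sets)
qed

lemma prob_space_shift_measure: "prob_space (shift_measure s)"
 unfolding shift_measure_def by (intro prob_space_PiM prob_uniform)

lemma shift_prod_integral:
 assumes u: "u \<subseteq> {..<s}"
 shows "(LINT \<Delta>|shift_measure s. (\<Prod>j\<in>u. skcov (\<Delta> j) (a j) (b j))) =
  (\<Prod>j\<in>u. bern2 (frac (a j - b j)))"
  and "integrable (shift_measure s) (\<lambda>\<Delta>. \<Prod>j\<in>u. skcov (\<Delta> j) (a j) (b j))"
proof -
 interpret product_prob_space "\<lambda>_::nat. unif" by (rule product_prob_uniform)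
 define F where "F j x = (if j \<in> u then skcov x (a j) (b j) else 1)" for j x
 have eq: "(\<Prod>j\<in>u. skcov (\<Delta> j) (a j) (b j)) = (\<Prod>j<s. F j (\<Delta> j))" for \<Delta>
 proof -
  have "(\<Prod>j<s. F j (\<Delta> j)) = (\<Prod>j\<in>{..<s} \<inter> u. skcov (\<Delta> j) (a j) (b j))"
   unfolding F_def by (rule prod.inter_restrict[symmetric]) simp
  moreover have "{..<s} \<inter> u = u" using u by auto
  ultimately show ?thesis by simp
 qed
 have i: "integrable (unif) (F j)" for j
  unfolding F_def using kcov_measurable kcov_bounded
  by (cases "j \<in> u") (auto intro!: bounded_integrable_uniform[of _ 3])
 show "integrable (shift_measure s) (\<lambda>\<Delta>. \<Prod>j\<in>u. skcov (\<Delta> j) (a j) (b j))"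
  unfolding eq shift_measure_def by (rule product_integrable_prod) (auto intro: i)
 have "(LINT \<Delta>|shift_measure s. (\<Prod>j<s. F j (\<Delta> j))) = (\<Prod>j<s. LINT x|unif. F j x)"
  unfolding shift_measure_def by (rule product_integral_prod) (auto intro: i)
 also have "\<dots> = (\<Prod>j<s. if j \<in> u then bern2 (frac (a j - b j)) else 1)"
 proof (intro prod.cong refl)
  fix j show "(LINT x|unif. F j x) = (if j \<in> u then bern2 (frac (a j - b j)) else 1)"
   by (cases "j \<in> u") (simp_all only: F_def if_True if_False kcov_average uniform_lint_const)
 qed
 also have "\<dots> = (\<Prod>j\<in>{..<s} \<inter> u. bern2 (frac (a j - b j)))"
  by (rule prod.inter_restrict[symmetric]) simp
 also have "{..<s} \<inter> u = u" using u by auto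
 finally show "(LINT \<Delta>|shift_measure s. (\<Prod>j\<in>u. skcov (\<Delta> j) (a j) (b j))) =
  (\<Prod>j\<in>u. bern2 (frac (a j - b j)))" unfolding eq .
qed

lemma frac_eq_diff_Ints: "x - y \<in> \<int> \<Longrightarrow> frac x = frac (y::real)"
proof -
 assume "x - y \<in> \<int>"
 then obtain k where "x - y = of_int k" by (elim Ints_cases)
 then have "x = y + of_int k" by simp
 then show ?thesis by (simp add: frac_def)
qed

text \<open>Modulo 1 the difference of two lattice points is a lattice point, and for fixed
  \<open>i'\<close> subtraction permutes the residues.\<close>

lemma lattice_double_sum:
 assumes n: "n \<ge> 1"
 shows "(\<Sum>i=1..n. \<Sum>i'=1..n. \<Prod>j\<in>u. bern2 (frac (lat n z i j - lat n z i' j))) =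
  real n * (\<Sum>i=1..n. \<Prod>j\<in>u. bern2 (frac (lat n z i j)))"
proof -
 have one: "(\<Sum>i=1..n. \<Prod>j\<in>u. bern2 (frac (lat n z i j - lat n z i' j))) =
   (\<Sum>i=1..n. \<Prod>j\<in>u. bern2 (frac (lat n z i j)))" if i': "i' \<in> {1..n}" for i'
 \<comment> \<open>Both maps pick the representative in \<open>{1..n}\<close>; in the branch that
   adds \<open>n\<close> the argument changes by the integer \<open>z j\<close>.\<close>
 proof (rule sum.reindex_bij_witness[of _ "\<lambda>d. if d + i' \<le> n then d + i' else d + i' - n" "\<lambda>i. if i' < i then i - i' else i + n - i'"])
  fix i assume i: "i \<in> {1..n}"
  show "(\<Prod>j\<in>u. bern2 (frac (lat n z (if i' < i then i - i' else i + n - i') j))) =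
    (\<Prod>j\<in>u. bern2 (frac (lat n z i j - lat n z i' j)))"
  proof (intro prod.cong refl arg_cong[of _ _ bern2] frac_eq_diff_Ints)
   fix j
   have "lat n z (if i' < i then i - i' else i + n - i') j - (lat n z i j - lat n z i' j)
     = (if i' < i then 0 else real (z j))"
    using i i' n by (auto simp: of_nat_diff field_simps)
   then show "lat n z (if i' < i then i - i' else i + n - i') j - (lat n z i j - lat n z i' j) \<in> \<int>"
    by simp
  qed
 qed (use i' in auto)
 have "(\<Sum>i'=1..n. \<Sum>i=1..n. \<Prod>j\<in>u. bern2 (frac (lat n z i j - lat n z i' j))) =
  (\<Sum>i'=1..n. \<Sum>i=1..n. \<Prod>j\<in>u. bern2 (frac (lat n z i j)))"
 proof (rule sum.cong[OF refl])
  fix i' assume "i' \<in> {1..n}"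
  from one[OF this] show "(\<Sum>i=1..n. \<Prod>j\<in>u. bern2 (frac (lat n z i j - lat n z i' j))) =
   (\<Sum>i=1..n. \<Prod>j\<in>u. bern2 (frac (lat n z i j)))" .
 qed
 then show ?thesis by (subst sum.swap) simp
qed

lemma cubature_lattice:
 assumes "n \<ge> 1" "\<And>u. \<gamma> u \<ge> 0"
 shows "cubature s {1..n} (\<lambda>i. lattice_point n s z i \<Delta>) \<gamma>"
proof
 show "lattice_point n s z i \<Delta> \<in> cube s" for i
  unfolding lattice_point_def cube_def using less_imp_le[OF frac_lt_1[where 'a=real]] by (auto simp: restrict_def PiE_def extensional_def)
 show "lattice_point n s z i \<Delta> j < 1/2" if "j < s" for i j
  using that frac_lt_1[where 'a=real] by (simp add: lattice_point_def)
qed (use assms in auto)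

lemma err_lattice:
 assumes "n \<ge> 1"
 shows "cubature.err s {1..n} (\<lambda>i. lattice_point n s z i \<Delta>) G = qerr n 1 s z (\<lambda>_. \<Delta>) G"
proof -
 interpret cubature s "{1..n}" "\<lambda>i. lattice_point n s z i \<Delta>" "\<lambda>_. 0" by (rule cubature_lattice) (use assms in auto)
 show ?thesis unfolding err_def Q_ran_def N_def by simp
qed

text \<open>Integrated over the shift, each kernel factor becomes the Bernoulli polynomial at the
  difference of two nodes. The double sum over nodes then reduces to a single one, which is
  \<open>korob\<close>.\<close>

lemma wce2_lattice:
 fixes \<gamma> :: "nat set \<Rightarrow> real"
 assumes n: "n \<ge> 1" and \<gamma>: "\<And>u. \<gamma> u \<ge> 0"
 shows "integrable (shift_measure s) (\<lambda>\<Delta>. cubature.wce2 s {1..n} (\<lambda>i. lattice_point n s z i \<Delta>) \<gamma>)"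
  "(LINT \<Delta>|shift_measure s. cubature.wce2 s {1..n} (\<lambda>i. lattice_point n s z i \<Delta>) \<gamma>) = cbc_err n \<gamma> s z"
proof -
 let ?g = "\<lambda>u. \<gamma> u / (real n)\<^sup>2"
 let ?P = "\<lambda>u i i' \<Delta>. \<Prod>j\<in>u. skcov (\<Delta> j) (lat n z i j) (lat n z i' j)"
 have eq: "cubature.wce2 s {1..n} (\<lambda>i. lattice_point n s z i \<Delta>) \<gamma> =
   (\<Sum>u\<in>PowN s. \<Sum>i=1..n. \<Sum>i'=1..n. ?g u * ?P u i i' \<Delta>)" for \<Delta>
 proof -
  interpret cubature s "{1..n}" "\<lambda>i. lattice_point n s z i \<Delta>" \<gamma> by (rule cubature_lattice[OF assms])
  have N: "N = real n" unfolding N_def by simp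
  have pe: "(\<Prod>j\<in>u. kcov (lattice_point n s z i \<Delta> j) (lattice_point n s z i' \<Delta> j)) = ?P u i i' \<Delta>" if "u \<subseteq> {..<s}" for u i i'
   using that by (intro prod.cong refl) (auto simp: lattice_point_def)
  have "\<gamma> u * Kq u = (\<Sum>i=1..n. \<Sum>i'=1..n. ?g u * ?P u i i' \<Delta>)" if "u \<subseteq> {..<s}" for u
  proof -
   have "Kq u = (1 / (real n)\<^sup>2) * (\<Sum>i=1..n. \<Sum>i'=1..n. ?P u i i' \<Delta>)"
    unfolding Kq_def N by (simp only: pe[OF that])
   then have "\<gamma> u * Kq u = ?g u * (\<Sum>i=1..n. \<Sum>i'=1..n. ?P u i i' \<Delta>)" by simp
   then show ?thesis by (simp only: sum_distrib_left)
  qed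
  then show ?thesis unfolding wce2_def by (intro sum.cong refl) auto
 qed
 have i: "integrable (shift_measure s) (\<lambda>\<Delta>. ?g u * ?P u i i' \<Delta>)" if "u \<in> PowN s" for u i i'
  using that by (intro integrable_mult_right shift_prod_integral(2)) auto
 show "integrable (shift_measure s) (\<lambda>\<Delta>. cubature.wce2 s {1..n} (\<lambda>i. lattice_point n s z i \<Delta>) \<gamma>)"
  unfolding eq by (intro B_integrable_sum i)
 have "(LINT \<Delta>|shift_measure s. cubature.wce2 s {1..n} (\<lambda>i. lattice_point n s z i \<Delta>) \<gamma>) =
   (\<Sum>u\<in>PowN s. LINT \<Delta>|shift_measure s. (\<Sum>i=1..n. \<Sum>i'=1..n. ?g u * ?P u i i' \<Delta>))"
  unfolding eq by (intro B_integral_sum B_integrable_sum i)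
 also have "\<dots> = (\<Sum>u\<in>PowN s. \<Sum>i=1..n. LINT \<Delta>|shift_measure s. (\<Sum>i'=1..n. ?g u * ?P u i i' \<Delta>))"
  by (intro sum.cong refl B_integral_sum B_integrable_sum i)
 also have "\<dots> = (\<Sum>u\<in>PowN s. \<Sum>i=1..n. \<Sum>i'=1..n. LINT \<Delta>|shift_measure s. ?g u * ?P u i i' \<Delta>)"
  by (intro sum.cong refl B_integral_sum i)
 also have "\<dots> = (\<Sum>u\<in>PowN s. \<Sum>i=1..n. \<Sum>i'=1..n. ?g u * (\<Prod>j\<in>u. bern2 (frac (lat n z i j - lat n z i' j))))"
  by (intro sum.cong refl, subst integral_mult_right_zero, subst shift_prod_integral(1)) auto
 also have "\<dots> = (\<Sum>u\<in>PowN s. \<gamma> u * korob n u z)"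
 proof (rule sum.cong[OF refl])
  fix u assume "u \<in> PowN s"
  then have fu: "finite u" by (auto intro: finite_subset)
  have "(\<Sum>i=1..n. \<Sum>i'=1..n. ?g u * (\<Prod>j\<in>u. bern2 (frac (lat n z i j - lat n z i' j)))) =
    ?g u * (real n * (\<Sum>i=1..n. \<Prod>j\<in>u. bern2 (frac (lat n z i j))))"
   unfolding sum_distrib_left[symmetric] lattice_double_sum[OF n] ..
  also have "\<dots> = \<gamma> u * ((1 / real n) * (\<Sum>i=1..n. \<Prod>j\<in>u. bern2 (frac (lat n z i j))))"
   using n by (simp add: power2_eq_square)
  also have "\<dots> = \<gamma> u * korob n u z" unfolding lattice_korob[OF n fu] ..
  finally show "(\<Sum>i=1..n. \<Sum>i'=1..n. ?g u * (\<Prod>j\<in>u. bern2 (frac (lat n z i j - lat n z i' j)))) = \<gamma> u * korob n u z" .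
 qed
 finally show "(LINT \<Delta>|shift_measure s. cubature.wce2 s {1..n} (\<lambda>i. lattice_point n s z i \<Delta>) \<gamma>) = cbc_err n \<gamma> s z"
  unfolding cbc_err_def .
qed

text \<open>Through this identity the minimality required by \<open>CBC_vector\<close> becomes a
  statement about the explicit sum \<open>cbc_err\<close>.\<close>

theorem shift_avg_wce_eq:
 assumes n: "n \<ge> 1" and \<gamma>: "\<And>u. \<gamma> u \<ge> 0"
 shows "shift_avg_wce n s \<gamma> z = sqrt (cbc_err n \<gamma> s z)"
proof -
 have "(SUP G\<in>{G \<in> sobolev_space s. sobolev_norm2 s \<gamma> G \<le> 1}.
    (qerr n 1 s z (\<lambda>_. \<Delta>) G)\<^sup>2) =
  cubature.wce2 s {1..n} (\<lambda>i. lattice_point n s z i \<Delta>) \<gamma>" for \<Delta>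
  using cubature.sup_err[OF cubature_lattice[OF assms], of s z \<Delta>]
  unfolding err_lattice[OF n, of s z \<Delta>] .
 then show ?thesis unfolding shift_avg_wce_def wce2_lattice(2)[OF assms, symmetric] by simp
qed

section \<open>Rational functions on the parameter box\<close>

text \<open>Unlike \<open>cube\<close>, it leaves the coordinates from \<open>s\<close> on free, so
  both points of the cube and sequences extended by zero belong to it.\<close>

definition pbox :: "nat \<Rightarrow> (nat \<Rightarrow> real) set" where
 "pbox s = {y. \<forall>j<s. y j \<in> {-1/2..1/2}}"

text \<open>Rational functions without poles on the box, generated syntactically: continuity,
  closure under partial derivatives and dependence on the first \<open>s\<close> coordinates alone
  follow by rule induction.\<close>

inductive_set ratf :: "nat \<Rightarrow> ((nat \<Rightarrow> real) \<Rightarrow> real) set" for s where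
 const: "(\<lambda>y. c) \<in> ratf s"
| coord: "j < s \<Longrightarrow> (\<lambda>y. y j) \<in> ratf s"
| add: "f \<in> ratf s \<Longrightarrow> g \<in> ratf s \<Longrightarrow> (\<lambda>y. f y + g y) \<in> ratf s"
| mult: "f \<in> ratf s \<Longrightarrow> g \<in> ratf s \<Longrightarrow> (\<lambda>y. f y * g y) \<in> ratf s"
| inv: "f \<in> ratf s \<Longrightarrow> (\<forall>y\<in>pbox s. f y \<noteq> 0) \<Longrightarrow> (\<lambda>y. inverse (f y)) \<in> ratf s"

lemma ratf_uminus: "f \<in> ratf s \<Longrightarrow> (\<lambda>y. - f y) \<in> ratf s"
 using ratf.mult[OF ratf.const[of "-1"], of f s] by simp

lemma ratf_diff: "f \<in> ratf s \<Longrightarrow> g \<in> ratf s \<Longrightarrow> (\<lambda>y. f y - g y) \<in> ratf s"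
 using ratf.add[OF _ ratf_uminus, of f s g] by simp

lemma ratf_divide: "f \<in> ratf s \<Longrightarrow> g \<in> ratf s \<Longrightarrow> (\<And>y. y \<in> pbox s \<Longrightarrow> g y \<noteq> 0) \<Longrightarrow> (\<lambda>y. f y / g y) \<in> ratf s"
 unfolding divide_inverse by (intro ratf.mult ratf.inv) auto

lemma ratf_sum: "finite A \<Longrightarrow> (\<And>i. i \<in> A \<Longrightarrow> f i \<in> ratf s) \<Longrightarrow> (\<lambda>y. \<Sum>i\<in>A. f i y) \<in> ratf s"
proof (induction A rule: finite_induct)
 case (insert i A)
 then have "(\<lambda>y. f i y + (\<Sum>i\<in>A. f i y)) \<in> ratf s" by (intro ratf.add) auto
 then show ?case using insert by simp
qed (auto intro: ratf.const)

lemma ratf_cong: "f \<in> ratf s \<Longrightarrow> (\<And>j. j < s \<Longrightarrow> y j = y' j) \<Longrightarrow> f y = f y'"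
 by (induction rule: ratf.induct) auto

lemma ratf_deriv:
 "f \<in> ratf s \<Longrightarrow> j < s \<Longrightarrow>
  \<exists>f'\<in>ratf s. \<forall>y\<in>pbox s. ((\<lambda>t. f (y(j := t))) has_real_derivative f' y) (at (y j))"
proof (induction rule: ratf.induct)
 case (const c)
 show ?case by (rule bexI[of _ "\<lambda>y. 0"]) (auto intro: ratf.const)
next
 case (coord i)
 show ?case
 proof (rule bexI[of _ "\<lambda>y. if i = j then 1 else 0"])
  show "(\<lambda>y. if i = j then 1 else 0) \<in> ratf s" by (rule ratf.const)
  show "\<forall>y\<in>pbox s. ((\<lambda>t. (y(j := t)) i) has_real_derivative (if i = j then 1 else 0)) (at (y j))"
   by (cases "i = j") auto
 qed
next
 case (add f g)
 then obtain f' g' where "f' \<in> ratf s" "g' \<in> ratf s"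
  "\<forall>y\<in>pbox s. ((\<lambda>t. f (y(j := t))) has_real_derivative f' y) (at (y j))"
  "\<forall>y\<in>pbox s. ((\<lambda>t. g (y(j := t))) has_real_derivative g' y) (at (y j))" by blast
 then show ?case by (intro bexI[of _ "\<lambda>y. f' y + g' y"] ratf.add ballI DERIV_add) (auto simp del: fun_upd_apply)
next
 case (mult f g)
 then obtain f' g' where *: "f' \<in> ratf s" "g' \<in> ratf s"
  "\<forall>y\<in>pbox s. ((\<lambda>t. f (y(j := t))) has_real_derivative f' y) (at (y j))"
  "\<forall>y\<in>pbox s. ((\<lambda>t. g (y(j := t))) has_real_derivative g' y) (at (y j))" by blast
 show ?case
 proof (rule bexI[of _ "\<lambda>y. f' y * g y + g' y * f y"])
  show "\<forall>y\<in>pbox s. ((\<lambda>t. f (y(j := t)) * g (y(j := t))) has_real_derivative f' y * g y + g' y * f y) (at (y j))"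
  proof
   fix y assume "y \<in> pbox s"
   from DERIV_mult[OF *(3)[rule_format, OF this] *(4)[rule_format, OF this]]
   show "((\<lambda>t. f (y(j := t)) * g (y(j := t))) has_real_derivative f' y * g y + g' y * f y) (at (y j))" by simp
  qed
 qed (intro ratf.add ratf.mult * mult)
next
 case (inv f)
 then obtain f' where *: "f' \<in> ratf s"
  "\<forall>y\<in>pbox s. ((\<lambda>t. f (y(j := t))) has_real_derivative f' y) (at (y j))" by blast
 show ?case
 proof (rule bexI[of _ "\<lambda>y. - (inverse (f y) * f' y * inverse (f y))"])
  show "\<forall>y\<in>pbox s. ((\<lambda>t. inverse (f (y(j := t)))) has_real_derivative - (inverse (f y) * f' y * inverse (f y))) (at (y j))"
  proof
   fix y assume y: "y \<in> pbox s"
   have "f (y(j := y j)) \<noteq> 0" using inv y by simp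
   from DERIV_inverse'[OF *(2)[rule_format, OF y] this, unfolded fun_upd_triv]
   show "((\<lambda>t. inverse (f (y(j := t)))) has_real_derivative - (inverse (f y) * f' y * inverse (f y))) (at (y j))" .
  qed
 qed (intro ratf_uminus ratf.mult ratf.inv * inv)
qed

text \<open>A partial derivative chosen inside \<open>ratf\<close>, so that it can be iterated. It
  is a two-sided derivative also at the ends of the interval, since denominators do not vanish
  there.\<close>

definition rpd :: "nat \<Rightarrow> nat \<Rightarrow> ((nat \<Rightarrow> real) \<Rightarrow> real) \<Rightarrow> (nat \<Rightarrow> real) \<Rightarrow> real" where
 "rpd s j f = (SOME f'. f' \<in> ratf s \<and> (\<forall>y\<in>pbox s. ((\<lambda>t. f (y(j := t))) has_real_derivative f' y) (at (y j))))"

lemma rpd: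
 assumes "f \<in> ratf s" "j < s"
 shows "rpd s j f \<in> ratf s" "\<And>y. y \<in> pbox s \<Longrightarrow> ((\<lambda>t. f (y(j := t))) has_real_derivative rpd s j f y) (at (y j))"
proof -
 have "\<exists>f'. f' \<in> ratf s \<and> (\<forall>y\<in>pbox s. ((\<lambda>t. f (y(j := t))) has_real_derivative f' y) (at (y j)))"
  using ratf_deriv[OF assms] by blast
 from someI_ex[OF this] show "rpd s j f \<in> ratf s"
  "\<And>y. y \<in> pbox s \<Longrightarrow> ((\<lambda>t. f (y(j := t))) has_real_derivative rpd s j f y) (at (y j))"
  unfolding rpd_def by blast+
qed

lemma ratf_continuous: "f \<in> ratf s \<Longrightarrow> continuous_on (pbox s) f"
proof (induction rule: ratf.induct)
 case (coord j)
 show ?case by (rule continuous_on_product_then_coordinatewise[OF continuous_on_id])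
qed (auto intro!: continuous_intros)

lemma cube_subset_pbox: "cube s \<subseteq> pbox s"
proof
 fix y assume y: "y \<in> cube s"
 have "y j \<in> {-1/2..1/2}" if "j < s" for j
  using y that unfolding cube_def by (intro PiE_mem[of y]) auto
 then show "y \<in> pbox s" unfolding pbox_def by blast
qed

lemma ratf_continuous_cube: "f \<in> ratf s \<Longrightarrow> continuous_on (cube s) f"
 using ratf_continuous continuous_on_subset cube_subset_pbox by blast

lemma pbox_upd: "y \<in> pbox s \<Longrightarrow> x \<in> {-1/2..1/2} \<Longrightarrow> y(j := x) \<in> pbox s"
 by (simp add: pbox_def)

text \<open>The fundamental theorem for the product with \<open>\<phi>\<close>, whose boundary
  values are zero.\<close>

lemma ratf_by_parts_1:
 assumes f: "f \<in> ratf s" and j: "j < s" and y: "y \<in> pbox s" and \<phi>: "\<phi> \<in> tests"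
 shows "(LINT x|unit_leb. f (y(j := x)) * deriv \<phi> x) = - (LINT x|unit_leb. rpd s j f (y(j := x)) * \<phi> x)"
proof -
 let ?g = "rpd s j f"
 note D = test_fun_deriv[OF \<phi>]
 have df: "((\<lambda>t. f (y(j := t))) has_real_derivative ?g (y(j := x))) (at x)" if "x \<in> {-1/2..1/2}" for x
  using rpd(2)[OF f j pbox_upd[OF y that], of j] by simp
 have cg: "isCont (\<lambda>t. ?g (y(j := t))) x" if "x \<in> {-1/2..1/2}" for x
  using DERIV_isCont[OF rpd(2)[OF rpd(1)[OF f j] j pbox_upd[OF y that, of j]]] by simp
 have int: "integrable unit_leb (\<lambda>x. h x * k x)"
  if "\<And>x. x \<in> {-1/2..1/2} \<Longrightarrow> isCont h x" "\<And>x. isCont k x" for h k :: "real \<Rightarrow> real"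
 proof -
  have "continuous_on {-1/2..1/2} (\<lambda>x. h x * k x)"
   using that by (intro continuous_on_mult continuous_at_imp_continuous_on) auto
  then have "set_integrable lborel {-1/2..1/2} (\<lambda>x. h x * k x)" by (rule borel_integrable_atLeastAtMost')
  then show ?thesis unfolding unit_leb_def set_integrable_def by (subst integrable_restrict_space) auto
 qed
 have "(LINT x|unit_leb. f (y(j := x)) * deriv \<phi> x) + (LINT x|unit_leb. ?g (y(j := x)) * \<phi> x) =
  (LINT x|unit_leb. f (y(j := x)) * deriv \<phi> x + ?g (y(j := x)) * \<phi> x)"
  by (intro Bochner_Integration.integral_add[symmetric] int D cg DERIV_isCont[OF df])
 also have "\<dots> = (LINT x|lborel. (f (y(j := x)) * deriv \<phi> x + ?g (y(j := x)) * \<phi> x) * indicator {-1/2..1/2} x)"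
  unfolding unit_leb_integral set_lebesgue_integral_def by (simp add: mult.commute)
 also have "\<dots> = f (y(j := 1/2)) * \<phi> (1/2) - f (y(j := -1/2)) * \<phi> (-1/2)"
 proof (rule integral_FTC_Icc_real)
  fix x :: real assume "-1/2 \<le> x" "x \<le> 1/2"
  then have x: "x \<in> {-1/2..1/2}" by simp
  from DERIV_mult[OF df[OF x] D(1)[of x]]
  show "((\<lambda>x. f (y(j := x)) * \<phi> x) has_real_derivative f (y(j := x)) * deriv \<phi> x + ?g (y(j := x)) * \<phi> x) (at x)"
   by (simp add: mult.commute add.commute)
  show "isCont (\<lambda>x. f (y(j := x)) * deriv \<phi> x + ?g (y(j := x)) * \<phi> x) x"
   by (intro continuous_intros D cg[OF x] DERIV_isCont[OF df[OF x]])
 qed simp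
 also have "\<dots> = 0" using D by simp
 finally show ?thesis by linarith
qed

lemma ratf_mult_prod_integrable:
 assumes "f \<in> ratf s" "\<And>j. \<phi> j \<in> tests"
 shows "integrable (cubeM s) (\<lambda>y. f y * (\<Prod>j<s. \<phi> j (y j)))"
 using bdd_meas_test[OF assms(2)]
 by (intro integrable_mult_cube_prod continuous_cube_integrable ratf_continuous_cube assms) (auto simp: bdd_meas_def)

lemma ratf_by_parts:
 assumes f: "f \<in> ratf s" and j: "j < s" and \<phi>: "\<And>k. \<phi> k \<in> tests"
 shows "(LINT y|cubeM s. f y * (\<Prod>k<s. (\<phi>(j := deriv (\<phi> j))) k (y k))) =
  - (LINT y|cubeM s. rpd s j f y * (\<Prod>k<s. \<phi> k (y k)))"
proof -
 interpret product_prob_space "\<lambda>_::nat. unit_leb" by (rule product_prob_space_unit_leb)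
 let ?I = "{..<s} - {j}"
 have ins: "insert j ?I = {..<s}" using j by auto
 define P where "P x = (\<Prod>k\<in>?I. \<phi> k (x k))" for x :: "nat \<Rightarrow> real"
 have test': "(\<phi>(j := deriv (\<phi> j))) k \<in> tests" for k
  using \<phi> test_fun_deriv(6) by simp
 have fold: "(LINT y|cubeM s. F y) = (LINT x|cube_measure ?I. LINT y|unit_leb. F (x(j := y)))"
  if "integrable (cubeM s) F" for F :: "(nat \<Rightarrow> real) \<Rightarrow> real"
  using product_integral_insert[of ?I j F] that unfolding ins cube_measure_def unit_leb_def[symmetric] by simp
 have split: "(\<Prod>k<s. w k ((x(j := y)) k)) = w j y * (\<Prod>k\<in>?I. w k (x k))" for w :: "nat \<Rightarrow> real \<Rightarrow> real" and x y
  using j by (subst prod.remove[of _ j]) (auto intro!: prod.cong)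
 have "(LINT y|cubeM s. f y * (\<Prod>k<s. (\<phi>(j := deriv (\<phi> j))) k (y k))) =
  (LINT x|cube_measure ?I. LINT y|unit_leb. f (x(j := y)) * (\<Prod>k<s. (\<phi>(j := deriv (\<phi> j))) k ((x(j := y)) k)))"
  by (rule fold[OF ratf_mult_prod_integrable[OF f test']])
 also have "\<dots> = (LINT x|cube_measure ?I. - (LINT y|unit_leb. rpd s j f (x(j := y)) * (\<Prod>k<s. \<phi> k ((x(j := y)) k))))"
 proof (rule B_integral_cong[OF refl])
  fix x assume x: "x \<in> space (cube_measure ?I)"
  have "x k \<in> {-1/2..1/2}" if "k \<in> ?I" for k
   using x that unfolding cube_measure_def unit_leb_def[symmetric] space_PiM space_unit_leb by (rule PiE_mem)
  then have "x(j := 0) \<in> pbox s" by (auto simp: pbox_def)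
  note bp = ratf_by_parts_1[OF f j this \<phi>, of j]
  have "(\<Prod>k\<in>?I. (\<phi>(j := deriv (\<phi> j))) k (x k)) = P x" unfolding P_def by (intro prod.cong) auto
  then have "(LINT y|unit_leb. f (x(j := y)) * (\<Prod>k<s. (\<phi>(j := deriv (\<phi> j))) k ((x(j := y)) k))) =
   (LINT y|unit_leb. (f (x(j := y)) * deriv (\<phi> j) y) * P x)"
   unfolding split by (simp add: mult.assoc)
  also have "\<dots> = - (LINT y|unit_leb. rpd s j f (x(j := y)) * \<phi> j y) * P x"
   using bp by simp
  also have "\<dots> = - (LINT y|unit_leb. (rpd s j f (x(j := y)) * \<phi> j y) * P x)" by simp
  also have "\<dots> = - (LINT y|unit_leb. rpd s j f (x(j := y)) * (\<Prod>k<s. \<phi> k ((x(j := y)) k)))"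
   unfolding split P_def by (simp only: mult.assoc)
  finally show "(LINT y|unit_leb. f (x(j := y)) * (\<Prod>k<s. (\<phi>(j := deriv (\<phi> j))) k ((x(j := y)) k))) =
   - (LINT y|unit_leb. rpd s j f (x(j := y)) * (\<Prod>k<s. \<phi> k ((x(j := y)) k)))" .
 qed
 also have "\<dots> = - (LINT y|cubeM s. rpd s j f y * (\<Prod>k<s. \<phi> k (y k)))"
  unfolding fold[OF ratf_mult_prod_integrable[OF rpd(1)[OF f j] \<phi>]] by simp
 finally show ?thesis .
qed

lemma foldr_rpd_ratf: "f \<in> ratf s \<Longrightarrow> set js \<subseteq> {..<s} \<Longrightarrow> foldr (rpd s) js f \<in> ratf s"
 by (induction js) (auto intro: rpd)

text \<open>Induction on the list: the tail is treated with the test function for \<open>j\<close>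
  replaced by its derivative, and one integration by parts in coordinate \<open>j\<close> returns
  that derivative to the integrand.\<close>

lemma ratf_weak_mixed:
 assumes f: "f \<in> ratf s" and js: "set js \<subseteq> {..<s}" "distinct js"
 shows "has_weak_mixed s (set js) f (foldr (rpd s) js f)"
 unfolding has_weak_mixed_def
proof (intro conjI allI impI)
 let ?M = "cubeM s"
 have F: "foldr (rpd s) js f \<in> ratf s" by (rule foldr_rpd_ratf[OF f js(1)])
 show "foldr (rpd s) js f \<in> borel_measurable ?M" by (rule continuous_cube_measurable[OF ratf_continuous_cube[OF F]])
 have "(\<lambda>y. foldr (rpd s) js f y * foldr (rpd s) js f y) \<in> ratf s" by (rule ratf.mult[OF F F])
 then show "integrable ?M (\<lambda>y. (foldr (rpd s) js f y)\<^sup>2)"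
  unfolding power2_eq_square by (rule continuous_cube_integrable[OF ratf_continuous_cube])
 fix \<phi> :: "nat \<Rightarrow> real \<Rightarrow> real" assume \<phi>: "\<forall>j. \<phi> j \<in> test_fun {- 1 / 2..1 / 2}"
 show "(LINT y|?M. f y * (\<Prod>j<s. if j \<in> set js then deriv (\<phi> j) (y j) else \<phi> j (y j))) =
    (- 1) ^ card (set js) * (LINT y|?M. foldr (rpd s) js f y * (\<Prod>j<s. \<phi> j (y j)))"
  using js \<phi>
 proof (induction js arbitrary: \<phi>)
  case (Cons j js)
  let ?\<phi> = "\<phi>(j := deriv (\<phi> j))"
  have t: "\<forall>k. ?\<phi> k \<in> test_fun {- 1 / 2..1 / 2}" using Cons.prems test_fun_deriv(6) by auto
  have "(LINT y|?M. f y * (\<Prod>k<s. if k \<in> set (j # js) then deriv (\<phi> k) (y k) else \<phi> k (y k))) =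
    (LINT y|?M. f y * (\<Prod>k<s. if k \<in> set js then deriv (?\<phi> k) (y k) else ?\<phi> k (y k)))"
  proof (intro B_integral_cong refl mult_arg_cong prod.cong)
   fix y and k show "(if k \<in> set (j # js) then deriv (\<phi> k) (y k) else \<phi> k (y k)) =
    (if k \<in> set js then deriv (?\<phi> k) (y k) else ?\<phi> k (y k))"
    using Cons.prems(2) by (cases "k = j") auto
  qed
  also have "\<dots> = (- 1) ^ card (set js) * (LINT y|?M. foldr (rpd s) js f y * (\<Prod>k<s. ?\<phi> k (y k)))"
   using Cons.prems by (intro Cons.IH t) auto
  also have "(LINT y|?M. foldr (rpd s) js f y * (\<Prod>k<s. ?\<phi> k (y k))) =
    - (LINT y|?M. rpd s j (foldr (rpd s) js f) y * (\<Prod>k<s. \<phi> k (y k)))"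
   using Cons.prems by (intro ratf_by_parts foldr_rpd_ratf f) auto
  finally show ?case using Cons.prems by simp
 qed simp
qed

section \<open>Subset sums with factorial weights\<close>

text \<open>\<open>fact l\<close> times the elementary symmetric polynomial is the squarefree part
  of the multinomial expansion of the power. The induction splits the subsets according to whether
  they contain the last index.\<close>

lemma elem_sym_bound:
 fixes \<beta> :: "nat \<Rightarrow> real"
 assumes "\<And>j. \<beta> j \<ge> 0"
 shows "fact l * (\<Sum>u\<in>{u. u \<subseteq> {..<s} \<and> card u = l}. \<Prod>j\<in>u. \<beta> j) \<le> (\<Sum>j<s. \<beta> j) ^ l"
proof (induction s arbitrary: l)
 case 0
 have "{u. u \<subseteq> {..<0::nat} \<and> card u = l} = (if l = 0 then {{}} else {})" by auto
 then show ?case by simp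
next
 case (Suc s)
 define E where "E l s = (\<Sum>u\<in>{u. u \<subseteq> {..<s} \<and> card u = l}. \<Prod>j\<in>u. \<beta> j)" for l s
 define x where "x = (\<Sum>j<s. \<beta> j)"
 have x: "x \<ge> 0" unfolding x_def by (intro sum_nonneg assms)
 have IH: "fact l * E l s \<le> x ^ l" for l using Suc.IH unfolding E_def x_def .
 show ?case
 proof (cases l)
  case 0
  have "{u. u \<subseteq> {..<Suc s} \<and> card u = 0} = {{}}" by (auto dest: finite_subset)
  then show ?thesis using 0 by simp
 next
  case (Suc l')
  have "{u. u \<subseteq> {..<Suc s} \<and> card u = Suc l'} = {u. u \<subseteq> {..<s} \<and> card u = Suc l'} \<union> insert s ` {u. u \<subseteq> {..<s} \<and> card u = l'}" (is "?A = ?B \<union> ?C")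
  proof (intro equalityI subsetI)
   fix u assume u: "u \<in> ?A"
   show "u \<in> ?B \<union> ?C"
   proof (cases "s \<in> u")
    case True
    then have "u = insert s (u - {s})" by auto
    moreover have "u - {s} \<subseteq> {..<s}" using u by (auto simp: less_Suc_eq)
    moreover have "card (u - {s}) = l'" using u True by simp
    ultimately show ?thesis by blast
   next
    case False
    then have "u \<subseteq> {..<s}" using u by (auto simp: less_Suc_eq)
    then show ?thesis using u by simp
   qed
  next
   fix u assume "u \<in> ?B \<union> ?C"
   then show "u \<in> ?A"
   proof
    assume "u \<in> ?C"
    then obtain v where v: "v \<subseteq> {..<s}" "card v = l'" "u = insert s v" by auto
    then have "finite v" "s \<notin> v" using finite_subset by auto
    then show ?thesis using v by auto
   qed auto
  qed
  moreover have "?B \<inter> ?C = {}" by auto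
  moreover have "finite ?B" "finite ?C" by auto
  moreover have "inj_on (insert s) {u. u \<subseteq> {..<s} \<and> card u = l'}" by (auto simp: inj_on_def)
  moreover have "(\<Prod>j\<in>insert s v. \<beta> j) = \<beta> s * (\<Prod>j\<in>v. \<beta> j)" if "v \<in> {u. u \<subseteq> {..<s} \<and> card u = l'}" for v
   using that by (subst prod.insert) (auto intro: finite_subset)
  ultimately have "E (Suc l') (Suc s) = E (Suc l') s + \<beta> s * E l' s"
   unfolding E_def by (simp add: sum.union_disjoint sum.reindex sum_distrib_left)
  then have "fact l * E l (Suc s) = fact (Suc l') * E (Suc l') s + real (Suc l') * \<beta> s * (fact l' * E l' s)"
   by (simp add: Suc algebra_simps)
  also have "\<dots> \<le> x ^ Suc l' + real (Suc l') * \<beta> s * x ^ l'"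
   by (intro add_mono IH mult_left_mono) (simp add: assms)
  \<comment> \<open>The left-hand side consists of the first two terms of the binomial
    expansion.\<close>
  also have "\<dots> \<le> (x + \<beta> s) ^ Suc l'"
  proof (induction l')
   case (Suc k)
   have "x ^ Suc (Suc k) + real (Suc (Suc k)) * \<beta> s * x ^ Suc k \<le> (x ^ Suc k + real (Suc k) * \<beta> s * x ^ k) * (x + \<beta> s)"
    using x assms[of s] by (simp add: algebra_simps)
   also have "\<dots> \<le> (x + \<beta> s) ^ Suc k * (x + \<beta> s)" using x assms[of s] by (intro mult_right_mono Suc) auto
   finally show ?case by (simp add: mult.commute)
  qed simp
  finally show ?thesis by (simp add: E_def x_def Suc)
 qed
qed

text \<open>Grouped by cardinality, the sum is dominated by the series of
  \<open>fact l powr q * B ^ l / fact l\<close>. For \<open>q < 1\<close> its successive quotients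
  tend to zero whatever the size of \<open>B\<close>, so no smallness of the sequence is
  required.\<close>

lemma subset_sum_bounded:
 fixes \<beta> :: "nat \<Rightarrow> real"
 assumes \<beta>: "\<And>j. \<beta> j \<ge> 0" "summable \<beta>" and q: "0 < q" "q < 1"
 shows "\<exists>C. \<forall>s. (\<Sum>u\<in>Pow {..<s}. fact (card u) powr q * (\<Prod>j\<in>u. \<beta> j)) \<le> C"
proof -
 let ?U = "\<lambda>s l. {u. u \<subseteq> {..<s} \<and> card u = l}"
 \<comment> \<open>The added 1 keeps \<open>B\<close>, and with it every \<open>a l\<close>,
   positive also for the zero sequence.\<close>
 define B where "B = suminf \<beta> + 1"
 have B0: "suminf \<beta> \<ge> 0" using \<beta> by (intro suminf_nonneg) auto
 then have B: "B > 0" by (simp add: B_def)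
 define a where "a l = fact l powr q * (B ^ l / fact l)" for l :: nat
 have a0: "a l > 0" for l using B by (simp add: a_def)
 have ratio: "a (Suc l) = (B * real (Suc l) powr (q - 1)) * a l" for l
 proof -
  define S where "S = real (Suc l)"
  have S: "S > 0" by (simp add: S_def)
  have "fact (Suc l) = S * (fact l :: real)" by (simp add: S_def)
  then have "a (Suc l) = (S powr q * fact l powr q) * (B * B ^ l / (S * fact l))"
   using S by (simp add: a_def powr_mult)
  also have "\<dots> = (B * (S powr q / S)) * (fact l powr q * (B ^ l / fact l))" using S by (simp add: field_simps)
  also have "S powr q / S = S powr (q - 1)" using S by (simp add: powr_diff)
  finally show ?thesis by (simp only: a_def S_def)
 qed
 have "(\<lambda>l. B * real (Suc l) powr (q - 1)) \<longlonglongrightarrow> B * 0"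
  using q by (intro tendsto_mult tendsto_const tendsto_neg_powr filterlim_compose[OF filterlim_real_sequentially filterlim_Suc]) auto
 then have "eventually (\<lambda>l. B * real (Suc l) powr (q - 1) < 1/2) sequentially"
  by (intro order_tendstoD(2)) auto
 then obtain N where N: "\<And>l. l \<ge> N \<Longrightarrow> B * real (Suc l) powr (q - 1) < 1/2" by (auto simp: eventually_sequentially)
 have "summable a"
 proof (rule summable_ratio_test[of "1/2" N])
  fix l assume "l \<ge> N"
  then have "(B * real (Suc l) powr (q - 1)) * a l \<le> 1/2 * a l" using N[of l] a0[of l] by (intro mult_right_mono) auto
  then show "norm (a (Suc l)) \<le> 1/2 * norm (a l)" using a0[of l] a0[of "Suc l"] by (simp add: ratio)
 qed simp
 have "(\<Sum>u\<in>Pow {..<s}. fact (card u) powr q * (\<Prod>j\<in>u. \<beta> j)) \<le> suminf a" for s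
 proof -
  have P: "Pow {..<s} = (\<Union>l\<in>{..s}. ?U s l)"
   using card_mono[of "{..<s}"] by fastforce
  have "(\<Sum>u\<in>Pow {..<s}. fact (card u) powr q * (\<Prod>j\<in>u. \<beta> j)) =
   (\<Sum>l\<in>{..s}. \<Sum>u\<in>?U s l. fact (card u) powr q * (\<Prod>j\<in>u. \<beta> j))"
   unfolding P by (subst sum.UNION_disjoint) auto
  also have "\<dots> = (\<Sum>l\<in>{..s}. fact l powr q * (\<Sum>u\<in>?U s l. \<Prod>j\<in>u. \<beta> j))"
   unfolding sum_distrib_left by (intro sum.cong refl) auto
  also have "\<dots> \<le> (\<Sum>l\<in>{..s}. a l)"
  proof (rule sum_mono)
   fix l
   have "fact l * (\<Sum>u\<in>?U s l. \<Prod>j\<in>u. \<beta> j) \<le> (\<Sum>j<s. \<beta> j) ^ l"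
    by (rule elem_sym_bound[OF \<beta>(1)])
   also have "(\<Sum>j<s. \<beta> j) \<le> B" unfolding B_def using sum_le_suminf[OF \<beta>(2), of "{..<s}"] \<beta>(1) by auto
   then have "(\<Sum>j<s. \<beta> j) ^ l \<le> B ^ l" by (intro power_mono) (auto intro: sum_nonneg \<beta>)
   finally have "(\<Sum>u\<in>?U s l. \<Prod>j\<in>u. \<beta> j) \<le> B ^ l / fact l" by (simp add: field_simps)
   then show "fact l powr q * (\<Sum>u\<in>?U s l. \<Prod>j\<in>u. \<beta> j) \<le> a l"
    unfolding a_def by (intro mult_left_mono) auto
  qed
  also have "\<dots> \<le> suminf a" using \<open>summable a\<close> a0 by (intro sum_le_suminf) (auto intro: less_imp_le)
  finally show ?thesis .
 qed
 then show ?thesis by blast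
qed

section \<open>Mean-square cubature error of a rational integrand\<close>

text \<open>The derivatives are taken in the same order as in \<open>mixed_pderiv\<close>, so the
  two can be matched without any symmetry of mixed derivatives.\<close>

definition dmix :: "nat \<Rightarrow> nat set \<Rightarrow> ((nat \<Rightarrow> real) \<Rightarrow> real) \<Rightarrow> (nat \<Rightarrow> real) \<Rightarrow> real" where
 "dmix s u f = foldr (rpd s) (sorted_list_of_set u) f"

abbreviation "dmix_le s A \<beta> b f \<equiv> \<forall>u\<subseteq>{..<s}. \<forall>y\<in>pbox s. \<bar>dmix s u f y\<bar> \<le> A * fact (card u) * (\<Prod>j\<in>u. \<beta> * b j)"

lemma dmix_ratf: "f \<in> ratf s \<Longrightarrow> u \<subseteq> {..<s} \<Longrightarrow> dmix s u f \<in> ratf s"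
 unfolding dmix_def using finite_subset[of u "{..<s}"] by (intro foldr_rpd_ratf) auto

lemma dmix_weak: "f \<in> ratf s \<Longrightarrow> u \<subseteq> {..<s} \<Longrightarrow> has_weak_mixed s u f (dmix s u f)"
proof -
 assume f: "f \<in> ratf s" and u: "u \<subseteq> {..<s}"
 have fu: "finite u" using u finite_subset by blast
 show ?thesis using ratf_weak_mixed[OF f, of "sorted_list_of_set u"] fu u by (simp add: dmix_def)
qed

lemma merge_cube:
 assumes "u \<subseteq> {..<s}" "x \<in> space (cube_measure u)" "y \<in> space (cube_measure ({..<s} - u))"
 shows "merge u ({..<s} - u) (x, y) \<in> cube s"
 using measurable_space[OF measurable_merge_cube[OF assms(1)], of "(x, y)"] assms(2,3)
 by (simp add: space_pair_measure space_cube_measure)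

lemma bar_bound:
 assumes u: "u \<subseteq> {..<s}" and g: "g \<in> borel_measurable (cubeM s)" and M: "\<And>y. y \<in> cube s \<Longrightarrow> \<bar>g y\<bar> \<le> M"
 shows "integrable (cube_measure u) (\<lambda>y. (bar s u g y)\<^sup>2)" "(LINT y|cube_measure u. (bar s u g y)\<^sup>2) \<le> M\<^sup>2"
proof -
 interpret A: prob_space "cube_measure u" by (rule prob_space_cube_measure)
 interpret B: prob_space "cube_measure ({..<s} - u)" by (rule prob_space_cube_measure)
 have b: "\<bar>bar s u g x\<bar> \<le> M" if x: "x \<in> space (cube_measure u)" for x
 proof -
  have m: "(\<lambda>y. g (merge u ({..<s} - u) (x, y))) \<in> borel_measurable (cube_measure ({..<s} - u))"
   using measurable_compose[OF measurable_compose[OF measurable_Pair1'[OF x] measurable_merge_cube[OF u]] g] by simp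
  have i: "integrable (cube_measure ({..<s} - u)) (\<lambda>y. g (merge u ({..<s} - u) (x, y)))"
   by (rule B.integrable_const_bound[OF AE_I2 m, of M]) (use M merge_cube[OF u x] in auto)
  have "\<bar>bar s u g x\<bar> \<le> (LINT y|cube_measure ({..<s} - u). \<bar>g (merge u ({..<s} - u) (x, y))\<bar>)"
   unfolding bar_def by (rule integral_abs_bound)
  also have "\<dots> \<le> (LINT y|cube_measure ({..<s} - u). M)"
   using i by (intro integral_mono) (use M merge_cube[OF u x] in auto)
  also have "\<dots> = M" using B.prob_space by simp
  finally show ?thesis .
 qed
 have sq: "(bar s u g x)\<^sup>2 \<le> M\<^sup>2" if "x \<in> space (cube_measure u)" for x
  using power_mono[OF b[OF that] abs_ge_zero, of 2] by simp
 have m: "(\<lambda>y. (bar s u g y)\<^sup>2) \<in> borel_measurable (cube_measure u)" using bar_measurable[OF u g] by auto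
 show i: "integrable (cube_measure u) (\<lambda>y. (bar s u g y)\<^sup>2)"
  by (rule A.integrable_const_bound[OF AE_I2 m, of "M\<^sup>2"]) (use sq in auto)
 have "(LINT y|cube_measure u. (bar s u g y)\<^sup>2) \<le> (LINT y|cube_measure u. M\<^sup>2)"
  using i sq by (intro integral_mono) auto
 also have "\<dots> = M\<^sup>2" using A.prob_space by simp
 finally show "(LINT y|cube_measure u. (bar s u g y)\<^sup>2) \<le> M\<^sup>2" .
qed

lemma lattice_point_measurable:
 "(\<lambda>\<Delta>. lattice_point n s z i \<Delta>) \<in> measurable (shift_measure s) (cubeM s)"
 unfolding lattice_point_def cube_measure_def
proof (rule measurable_restrict)
 fix j assume "j \<in> {..<s}"
 then have [measurable]: "(\<lambda>\<Delta>. \<Delta> j) \<in> borel_measurable (shift_measure s)" by (intro shift_component_measurable) simp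
 have [measurable]: "(\<lambda>\<Delta>. frac (c + \<Delta> j)) \<in> borel_measurable (shift_measure s)" for c
  by (rule measurable_compose[OF _ frac_measurable]) measurable
 have "frac x - 1/2 \<in> {-1/2..1/2}" for x :: real using less_imp_le[OF frac_lt_1[of x]] by simp
 moreover have "(\<lambda>\<Delta>. frac (frac (lat n z i j) + \<Delta> j) - 1/2) \<in> borel_measurable (shift_measure s)"
  by measurable
 ultimately show "(\<lambda>\<Delta>. frac (frac (lat n z i j) + \<Delta> j) - 1/2) \<in> measurable (shift_measure s) (restrict_space lborel {-1/2..1/2})"
  by (intro measurable_restrict_space2) (blast, simp only: measurable_cong_sets[OF refl sets_lborel])
qed

lemma Q_ran_measurable:
 assumes "f \<in> ratf s"
 shows "(\<lambda>\<Delta>. qerr n 1 s z (\<lambda>_. \<Delta>) f) \<in> borel_measurable (shift_measure s)"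
proof -
 have "f \<in> borel_measurable (cubeM s)" by (rule continuous_cube_measurable[OF ratf_continuous_cube[OF assms]])
 then have [measurable]: "(\<lambda>\<Delta>. f (lattice_point n s z i \<Delta>)) \<in> borel_measurable (shift_measure s)" for i
  by (rule measurable_compose[OF lattice_point_measurable])
 show ?thesis unfolding Q_ran_def by simp
qed

text \<open>The worst-case bound is applied for every fixed shift, with the projected derivatives of
  this one integrand bounded by \<open>M\<close>; averaging over the shift then turns
  \<open>wce2\<close> into \<open>cbc_err\<close>.\<close>

theorem scalar_ms:
 fixes \<gamma> M :: "nat set \<Rightarrow> real" and z :: "nat \<Rightarrow> nat"
 assumes n: "n \<ge> 1" and \<gamma>: "\<And>u. \<gamma> u \<ge> 0" and f: "f \<in> ratf s"
  and M: "\<And>u y. u \<subseteq> {..<s} \<Longrightarrow> y \<in> pbox s \<Longrightarrow> \<bar>dmix s u f y\<bar> \<le> M u"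
  and M0: "\<And>u. u \<subseteq> {..<s} \<Longrightarrow> \<gamma> u = 0 \<Longrightarrow> M u = 0"
 defines "E \<equiv> \<lambda>\<Delta>. qerr n 1 s z (\<lambda>_. \<Delta>) f"
 shows "integrable (shift_measure s) (\<lambda>\<Delta>. (E \<Delta>)\<^sup>2)"
  "(LINT \<Delta>|shift_measure s. (E \<Delta>)\<^sup>2) \<le> (\<Sum>u\<in>PowN s. (M u)\<^sup>2 / \<gamma> u) * cbc_err n \<gamma> s z"
proof -
 let ?S = "PowN s"
 let ?w = "\<lambda>\<Delta>. cubature.wce2 s {1..n} (\<lambda>i. lattice_point n s z i \<Delta>) \<gamma>"
 define V where "V u = (LINT y|cube_measure u. (bar s u (dmix s u f) y)\<^sup>2)" for u
 have gm: "dmix s u f \<in> borel_measurable (cubeM s)" if "u \<subseteq> {..<s}" for u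
  by (rule continuous_cube_measurable[OF ratf_continuous_cube[OF dmix_ratf[OF f that]]])
 have gM: "\<bar>dmix s u f y\<bar> \<le> M u" if "u \<subseteq> {..<s}" "y \<in> cube s" for u y
  using M[OF that(1)] that(2) cube_subset_pbox by blast
 have Vi: "integrable (cube_measure u) (\<lambda>y. (bar s u (dmix s u f) y)\<^sup>2)" and VM: "V u \<le> (M u)\<^sup>2" if "u \<subseteq> {..<s}" for u
  unfolding V_def using bar_bound[OF that gm[OF that] gM[OF that]] by auto
 have Vn: "V u \<ge> 0" for u unfolding V_def by (rule integral_nonneg_AE) auto
 have V0: "V u = 0" if "u \<subseteq> {..<s}" "\<gamma> u = 0" for u using VM[OF that(1)] M0[OF that] Vn[of u] by simp
 have bd: "(E \<Delta>)\<^sup>2 \<le> (\<Sum>u\<in>?S. V u / \<gamma> u) * ?w \<Delta>" for \<Delta>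
  unfolding E_def err_lattice[OF n, of s z \<Delta>, symmetric]
  by (rule cubature.err_bound[OF cubature_lattice[OF n \<gamma>] ratf_continuous_cube[OF f] dmix_weak[OF f]])
   (auto intro: Vi V0[unfolded V_def] simp: V_def)
 have wi: "integrable (shift_measure s) (\<lambda>\<Delta>. (\<Sum>u\<in>?S. V u / \<gamma> u) * ?w \<Delta>)"
  by (intro integrable_mult_right wce2_lattice(1)[OF n \<gamma>])
 show i: "integrable (shift_measure s) (\<lambda>\<Delta>. (E \<Delta>)\<^sup>2)"
 proof (rule Bochner_Integration.integrable_bound[OF wi])
  show "(\<lambda>\<Delta>. (E \<Delta>)\<^sup>2) \<in> borel_measurable (shift_measure s)"
   using Q_ran_measurable[OF f, of n z] unfolding E_def by auto
  show "AE \<Delta> in shift_measure s. norm ((E \<Delta>)\<^sup>2) \<le> norm ((\<Sum>u\<in>?S. V u / \<gamma> u) * ?w \<Delta>)"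
  proof (rule AE_I2)
   fix \<Delta> show "norm ((E \<Delta>)\<^sup>2) \<le> norm ((\<Sum>u\<in>?S. V u / \<gamma> u) * ?w \<Delta>)" using bd[of \<Delta>] by simp
  qed
 qed
 have "(LINT \<Delta>|shift_measure s. (E \<Delta>)\<^sup>2) \<le> (LINT \<Delta>|shift_measure s. (\<Sum>u\<in>?S. V u / \<gamma> u) * ?w \<Delta>)"
  by (rule integral_mono[OF i wi bd])
 also have "\<dots> = (\<Sum>u\<in>?S. V u / \<gamma> u) * cbc_err n \<gamma> s z"
  using wce2_lattice(2)[OF n \<gamma>, of s z] by simp
 also have "\<dots> \<le> (\<Sum>u\<in>?S. (M u)\<^sup>2 / \<gamma> u) * cbc_err n \<gamma> s z"
 proof (rule mult_right_mono)
  show "(\<Sum>u\<in>?S. V u / \<gamma> u) \<le> (\<Sum>u\<in>?S. (M u)\<^sup>2 / \<gamma> u)"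
   using VM \<gamma> by (intro sum_mono divide_right_mono) auto
  show "cbc_err n \<gamma> s z \<ge> 0" unfolding cbc_err_def using \<gamma> korob_nonneg by (intro sum_nonneg mult_nonneg_nonneg) auto
 qed
 finally show "(LINT \<Delta>|shift_measure s. (E \<Delta>)\<^sup>2) \<le> (\<Sum>u\<in>?S. (M u)\<^sup>2 / \<gamma> u) * cbc_err n \<gamma> s z" .
qed

lemma shifts_component:
 fixes h :: "(nat \<Rightarrow> real) \<Rightarrow> real"
 assumes "r < R" "integrable (shift_measure s) h"
 shows "integrable (shifts_measure R s) (\<lambda>\<Delta>. h (\<Delta> r))" "(LINT \<Delta>|shifts_measure R s. h (\<Delta> r)) = (LINT \<Delta>|shift_measure s. h \<Delta>)"
proof -
 have d: "distr (shifts_measure R s) (shift_measure s) (\<lambda>\<omega>. \<omega> r) = shift_measure s"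
  unfolding shifts_measure_def using assms(1) by (intro distr_PiM_component prob_space_shift_measure) auto
 have m: "(\<lambda>\<omega>. \<omega> r) \<in> measurable (shifts_measure R s) (shift_measure s)"
  unfolding shifts_measure_def using assms(1) by (intro measurable_component_singleton) auto
 show "integrable (shifts_measure R s) (\<lambda>\<Delta>. h (\<Delta> r))"
  by (rule integrable_distr[OF m]) (simp add: d assms(2))
 have "(LINT \<Delta>|shift_measure s. h \<Delta>) = (LINT \<Delta>|distr (shifts_measure R s) (shift_measure s) (\<lambda>\<omega>. \<omega> r). h \<Delta>)" by (simp only: d)
 also have "\<dots> = (LINT \<Delta>|shifts_measure R s. h (\<Delta> r))"
  using assms(2) by (intro integral_distr[OF m]) auto
 finally show "(LINT \<Delta>|shifts_measure R s. h (\<Delta> r)) = (LINT \<Delta>|shift_measure s. h \<Delta>)" by simp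
qed

text \<open>The square of a mean is at most the mean of the squares, and each of the
  \<open>R\<close> shifts has the law of a single one, so the bound is the one for a single
  shift.\<close>

theorem scalar_ms_R:
 fixes \<gamma> M :: "nat set \<Rightarrow> real" and z :: "nat \<Rightarrow> nat"
 assumes n: "n \<ge> 1" and \<gamma>: "\<And>u. \<gamma> u \<ge> 0" and f: "f \<in> ratf s" and R: "R \<ge> 1"
  and M: "\<And>u y. u \<subseteq> {..<s} \<Longrightarrow> y \<in> pbox s \<Longrightarrow> \<bar>dmix s u f y\<bar> \<le> M u"
  and M0: "\<And>u. u \<subseteq> {..<s} \<Longrightarrow> \<gamma> u = 0 \<Longrightarrow> M u = 0"
 defines "E \<equiv> \<lambda>\<Delta>. qerr n R s z \<Delta> f"
 shows "integrable (shifts_measure R s) (\<lambda>\<Delta>. (E \<Delta>)\<^sup>2)"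
  "(LINT \<Delta>|shifts_measure R s. (E \<Delta>)\<^sup>2) \<le> (\<Sum>u\<in>PowN s. (M u)\<^sup>2 / \<gamma> u) * cbc_err n \<gamma> s z"
proof -
 define E1 where "E1 \<Delta> = qerr n 1 s z (\<lambda>_. \<Delta>) f" for \<Delta>
 let ?S = "\<lambda>\<Delta>. \<Sum>r<R. (E1 (\<Delta> r))\<^sup>2"
 note ms = scalar_ms[where z=z, OF n \<gamma> f M M0, folded E1_def]
 have E1m: "E1 \<in> borel_measurable (shift_measure s)" unfolding E1_def[abs_def] by (rule Q_ran_measurable[OF f])
 have EE: "E \<Delta> = (1 / real R) * (\<Sum>r<R. E1 (\<Delta> r))" for \<Delta>
 proof -
  have "Q_ran n R s z \<Delta> f = (1 / real R) * (\<Sum>r<R. Q_ran n 1 s z (\<lambda>_. \<Delta> r) f)"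
   unfolding Q_ran_def by (subst sum.swap) (simp add: sum_divide_distrib[symmetric])
  then show ?thesis using R unfolding E_def E1_def by (simp add: sum_subtractf diff_divide_distrib)
 qed
 have sq: "(E \<Delta>)\<^sup>2 \<le> (1 / real R) * ?S \<Delta>" for \<Delta>
 proof -
  have "(\<Sum>r<R. E1 (\<Delta> r) * 1)\<^sup>2 \<le> ?S \<Delta> * (\<Sum>r<R. 1\<^sup>2)" by (rule Cauchy_Schwarz_ineq_sum)
  then have "(\<Sum>r<R. E1 (\<Delta> r))\<^sup>2 \<le> ?S \<Delta> * real R" by simp
  then have "(1 / real R)\<^sup>2 * (\<Sum>r<R. E1 (\<Delta> r))\<^sup>2 \<le> (1 / real R)\<^sup>2 * (?S \<Delta> * real R)" by (intro mult_left_mono) auto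
  then show ?thesis unfolding EE power_mult_distrib using R by (simp add: power2_eq_square)
 qed
 have i: "integrable (shifts_measure R s) (\<lambda>\<Delta>. (1 / real R) * ?S \<Delta>)"
  by (intro integrable_mult_right B_integrable_sum shifts_component(1)[OF _ ms(1)]) auto
 have Em: "E \<in> borel_measurable (shifts_measure R s)"
 proof -
  have "(\<lambda>\<Delta>. E1 (\<Delta> r)) \<in> borel_measurable (shifts_measure R s)" if "r < R" for r
   using that unfolding shifts_measure_def
   by (intro measurable_compose[OF _ E1m] measurable_component_singleton) auto
  then show ?thesis unfolding EE[abs_def] by (intro borel_measurable_times borel_measurable_sum) auto
 qed
 show ie: "integrable (shifts_measure R s) (\<lambda>\<Delta>. (E \<Delta>)\<^sup>2)"
 proof (rule Bochner_Integration.integrable_bound[OF i])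
  show "(\<lambda>\<Delta>. (E \<Delta>)\<^sup>2) \<in> borel_measurable (shifts_measure R s)" using Em by auto
  show "AE \<Delta> in shifts_measure R s. norm ((E \<Delta>)\<^sup>2) \<le> norm ((1 / real R) * ?S \<Delta>)"
  proof (rule AE_I2)
   fix \<Delta> show "norm ((E \<Delta>)\<^sup>2) \<le> norm ((1 / real R) * ?S \<Delta>)"
    unfolding real_norm_def abs_power2 by (rule order_trans[OF sq abs_ge_self])
  qed
 qed
 have "(LINT \<Delta>|shifts_measure R s. (E \<Delta>)\<^sup>2) \<le> (LINT \<Delta>|shifts_measure R s. (1 / real R) * ?S \<Delta>)"
  by (rule integral_mono[OF ie i sq])
 also have "\<dots> = (1 / real R) * (\<Sum>r<R. LINT \<Delta>|shifts_measure R s. (E1 (\<Delta> r))\<^sup>2)"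
  by (subst integral_mult_right_zero, subst B_integral_sum) (auto intro: shifts_component(1)[OF _ ms(1)])
 also have "\<dots> = (1 / real R) * (\<Sum>r<R. LINT \<Delta>|shift_measure s. (E1 \<Delta>)\<^sup>2)"
  using shifts_component(2)[OF _ ms(1), of _ R] by simp
 also have "\<dots> = (LINT \<Delta>|shift_measure s. (E1 \<Delta>)\<^sup>2)" using R by simp
 also have "\<dots> \<le> (\<Sum>u\<in>PowN s. (M u)\<^sup>2 / \<gamma> u) * cbc_err n \<gamma> s z" by (rule ms(2))
 finally show "(LINT \<Delta>|shifts_measure R s. (E \<Delta>)\<^sup>2) \<le> (\<Sum>u\<in>PowN s. (M u)\<^sup>2 / \<gamma> u) * cbc_err n \<gamma> s z" .
qed

section \<open>Outcomes of the CBC algorithm and their rate\<close>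

lemma cbc_err_cong: "(\<And>j. j < l \<Longrightarrow> z j = z' j) \<Longrightarrow> cbc_err n \<gamma> l z = cbc_err n \<gamma> l z'"
 unfolding cbc_err_def by (intro sum.cong refl mult_arg_cong korob_cong) auto

text \<open>A minimizer is appended at position \<open>s\<close>. The earlier minimality conditions
  survive because errors in dimension at most \<open>s\<close> do not see that component.\<close>

lemma CBC_exists:
 fixes \<gamma> :: "nat set \<Rightarrow> real"
 assumes n: "n \<ge> 2" and \<gamma>: "\<And>u. \<gamma> u \<ge> 0"
 shows "\<exists>z. (\<forall>j. z j < n) \<and> CBC_vector n s \<gamma> z"
proof (induction s)
 case 0
 show ?case using n by (intro exI[of _ "\<lambda>_. 1"]) (auto simp: CBC_vector_def)
next
 case (Suc s)
 then obtain z where z: "\<And>j. z j < n" "CBC_vector n s \<gamma> z" by blast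
 show ?case
 proof (cases "s = 0")
  case True
  then show ?thesis using z by (intro exI[of _ z]) (auto simp: CBC_vector_def)
 next
  case False
  let ?C = "{c. 1 \<le> c \<and> c \<le> n - 1 \<and> gcd c n = 1}"
  have w: "shift_avg_wce n l \<gamma> z = sqrt (cbc_err n \<gamma> l z)" for l z using n \<gamma> by (intro shift_avg_wce_eq) auto
  have "finite ?C" by (rule finite_subset[of _ "{..n}"]) auto
  moreover have "1 \<in> ?C" using n by auto
  ultimately obtain c where c: "c \<in> ?C" "\<And>c'. c' \<in> ?C \<Longrightarrow> shift_avg_wce n (Suc s) \<gamma> (z(s := c)) \<le> shift_avg_wce n (Suc s) \<gamma> (z(s := c'))"
   using arg_min_if_finite[of ?C "\<lambda>c. shift_avg_wce n (Suc s) \<gamma> (z(s := c))"]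
   by (metis (no_types, lifting) empty_iff not_le)
  let ?z = "z(s := c)"
  have "CBC_vector n (Suc s) \<gamma> ?z"
   unfolding CBC_vector_def
  proof (intro conjI ballI)
   show "?z 0 = 1" using z(2) False by (simp add: CBC_vector_def)
   fix l assume l: "l \<in> {1..<Suc s}"
   show "?z l \<in> ?C" using l c(1) z(2) by (cases "l = s") (auto simp: CBC_vector_def)
   show "\<forall>c'. 1 \<le> c' \<and> c' \<le> n - 1 \<and> gcd c' n = 1 \<longrightarrow> shift_avg_wce n (Suc l) \<gamma> ?z \<le> shift_avg_wce n (Suc l) \<gamma> (?z(l := c'))"
   proof (intro allI impI)
    fix c' assume c': "1 \<le> c' \<and> c' \<le> n - 1 \<and> gcd c' n = 1"
    show "shift_avg_wce n (Suc l) \<gamma> ?z \<le> shift_avg_wce n (Suc l) \<gamma> (?z(l := c'))"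
    proof (cases "l = s")
     case True
     then show ?thesis using c(2)[of c'] c' by simp
    next
     case False
     then have ls: "l < s" using l by simp
     have "cbc_err n \<gamma> (Suc l) ?z = cbc_err n \<gamma> (Suc l) z" "cbc_err n \<gamma> (Suc l) (?z(l := c')) = cbc_err n \<gamma> (Suc l) (z(l := c'))"
      using ls by (auto intro!: cbc_err_cong)
     moreover have "shift_avg_wce n (Suc l) \<gamma> z \<le> shift_avg_wce n (Suc l) \<gamma> (z(l := c'))"
      using z(2) ls l c' by (auto simp: CBC_vector_def)
     ultimately show ?thesis by (simp only: w)
    qed
   qed
  qed
  moreover have "?z j < n" for j using z(1) c(1) n by auto
  ultimately show ?thesis by blast
 qed
qed

text \<open>Every odd number is coprime to the power of two \<open>n\<close>, so the minimality of
  the algorithm covers all candidates over which the average was taken.\<close>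

lemma CBC_vector_bound:
 fixes \<gamma> :: "nat set \<Rightarrow> real"
 assumes n: "n = 2 ^ m" "m \<ge> 1" and \<gamma>: "\<And>u. \<gamma> u \<ge> 0" and l: "1/2 < lam" "lam \<le> 1" and z: "CBC_vector n s \<gamma> z"
 shows "cbc_err n \<gamma> s z powr lam \<le> 2 / real n * (\<Sum>u\<in>PowN s. \<gamma> u powr lam * kap lam ^ card u)"
proof (rule cbc_bound[OF l \<gamma> n])
 have n1: "n \<ge> 1" using n by simp
 show "z 0 = 1" using z by (simp add: CBC_vector_def)
 fix l c assume l: "1 \<le> l" "l < s" and c: "c < n" "odd c"
 have "gcd c n = 1" using c(2) n by (simp add: coprime_iff_gcd_eq_1[symmetric])
 moreover have "1 \<le> c" using c(2) by (cases c) auto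
 moreover have "c \<le> n - 1" using c(1) by simp
 ultimately have "shift_avg_wce n (Suc l) \<gamma> z \<le> shift_avg_wce n (Suc l) \<gamma> (z(l := c))"
  using z l unfolding CBC_vector_def by auto
 then show "cbc_err n \<gamma> (Suc l) z \<le> cbc_err n \<gamma> (Suc l) (z(l := c))"
  unfolding shift_avg_wce_eq[OF n1 \<gamma>] by simp
qed

lemma rho_pos: "1/2 < lam \<Longrightarrow> rho lam > 0"
proof -
 assume "1/2 < lam"
 then have "(\<Sum>k=1..<2. real k powr (- (2 * lam))) \<le> zeta (2 * lam)" by (intro zeta_partial(1)) simp
 then have "zeta (2 * lam) \<ge> 1" by (simp add: numeral_2_eq_2)
 then show ?thesis unfolding rho_def by simp
qed

lemma prod_powr_le:
 fixes f :: "nat \<Rightarrow> real"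
 assumes "finite u" "\<And>j. f j \<ge> 0"
  and "c \<ge> 0"
 shows "(c * (\<Prod>j\<in>u. f j)) powr x = c powr x * (\<Prod>j\<in>u. f j powr x)"
 using assms by (simp add: powr_mult prod_nonneg prod_powr)

text \<open>The quantifiers matter: \<open>C\<close> precedes \<open>s\<close> and \<open>m\<close>,
  and one vector \<open>z\<close> serves all integrands with the same derivative bounds, as it will
  be applied to all coefficients of the DG solution at once.\<close>

theorem qmc_rate:
 fixes b :: "nat \<Rightarrow> real"
 assumes l: "1/2 < lam" "lam < 1" and b: "\<And>j. b j \<ge> 0" and A: "A \<ge> 0" "\<beta> \<ge> 0"
  and sm: "summable (\<lambda>j. b j powr (2 * lam / (1 + lam)))"
 defines "\<gamma> \<equiv> QMC_weight b lam"
 shows "\<exists>C\<ge>0. \<forall>s m. m \<ge> 1 \<longrightarrow> (\<exists>z. (\<forall>j. z j < 2 ^ m) \<and> CBC_vector (2 ^ m) s \<gamma> z \<and>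
  (\<forall>f\<in>ratf s. \<forall>R\<ge>1. (dmix_le s A \<beta> b f) \<longrightarrow>
    integrable (shifts_measure R s) (\<lambda>\<Delta>. (qerr (2 ^ m) R s z \<Delta> f)\<^sup>2) \<and>
    (LINT \<Delta>|shifts_measure R s. (qerr (2 ^ m) R s z \<Delta> f)\<^sup>2)
    \<le> C * real (2 ^ m) powr (- 1 / lam)))"
proof -
 define q where "q = 2 * lam / (1 + lam)"
 define p where "p = 2 / (1 + lam)"
 define \<rho> where "\<rho> = sqrt (rho lam)"
 have \<rho>: "\<rho> > 0" unfolding \<rho>_def using rho_pos[OF l(1)] by simp
 \<comment> \<open>The exponent \<open>2 / (1 + lam)\<close> of the weights balances the two subset
   sums: both \<open>\<gamma> u powr lam\<close> and \<open>(M u)\<^sup>2 / \<gamma> u\<close> carry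
   the factorial with the same power \<open>q\<close>.\<close>
 have qp: "p * lam = q" "2 - p = q" "p > 0" unfolding q_def p_def using l by (auto simp: field_simps)
 have q: "0 < q" "q < 1" using l by (auto simp: q_def)
 have k1: "kap lam \<ge> 1" by (rule kap_ge_1[OF l(1)])
 have \<gamma>0: "\<gamma> u \<ge> 0" for u unfolding \<gamma>_def QMC_weight_def by simp
 have \<gamma>eq: "\<gamma> u = (fact (card u) * (\<Prod>j\<in>u. b j / \<rho>)) powr p" for u
  unfolding \<gamma>_def QMC_weight_def p_def \<rho>_def ..
 define \<beta>1 where "\<beta>1 j = kap lam * (b j / \<rho>) powr q" for j
 define \<beta>2 where "\<beta>2 j = \<beta>\<^sup>2 * \<rho> powr p * b j powr q" for j
 have sm': "summable (\<lambda>j. b j powr q)" using sm unfolding q_def .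
 have "summable \<beta>1"
 proof -
  have "\<beta>1 = (\<lambda>j. (kap lam / \<rho> powr q) * b j powr q)" using b \<rho> by (auto simp: \<beta>1_def powr_divide)
  then show ?thesis using summable_mult[OF sm'] by simp
 qed
 then obtain C1 where C1: "\<And>s. (\<Sum>u\<in>Pow {..<s}. fact (card u) powr q * (\<Prod>j\<in>u. \<beta>1 j)) \<le> C1"
  using subset_sum_bounded[of \<beta>1 q] q k1 by (auto simp: \<beta>1_def)
 have "summable \<beta>2" using summable_mult[OF sm', of "\<beta>\<^sup>2 * \<rho> powr p"] by (simp add: \<beta>2_def[abs_def])
 then obtain C2 where C2: "\<And>s. (\<Sum>u\<in>Pow {..<s}. fact (card u) powr q * (\<Prod>j\<in>u. \<beta>2 j)) \<le> C2"
  using subset_sum_bounded[of \<beta>2 q] q by (auto simp: \<beta>2_def)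
 have C10: "C1 \<ge> 0"
 proof -
  have "0 \<le> (\<Sum>u\<in>Pow {..<0::nat}. fact (card u) powr q * (\<Prod>j\<in>u. \<beta>1 j))" by simp
  then show ?thesis using C1[of 0] by linarith
 qed
 have C20: "C2 \<ge> 0"
 proof -
  have "0 \<le> (\<Sum>u\<in>Pow {..<0::nat}. fact (card u) powr q * (\<Prod>j\<in>u. \<beta>2 j))" by simp
  then show ?thesis using C2[of 0] by linarith
 qed
 have sumA: "(\<Sum>u\<in>PowN s. \<gamma> u powr lam * kap lam ^ card u) \<le> C1" for s
 proof -
  have "(\<Sum>u\<in>PowN s. \<gamma> u powr lam * kap lam ^ card u) \<le> (\<Sum>u\<in>Pow {..<s}. \<gamma> u powr lam * kap lam ^ card u)"
   using k1 by (intro sum_mono2) auto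
  also have "\<dots> = (\<Sum>u\<in>Pow {..<s}. fact (card u) powr q * (\<Prod>j\<in>u. \<beta>1 j))"
  proof (rule sum.cong[OF refl])
   fix u assume "u \<in> Pow {..<s}"
   then have fu: "finite u" by (auto intro: finite_subset)
   have "\<gamma> u powr lam = fact (card u) powr q * (\<Prod>j\<in>u. (b j / \<rho>) powr q)"
    unfolding \<gamma>eq powr_powr qp(1) using b \<rho> by (intro prod_powr_le fu) auto
   then show "\<gamma> u powr lam * kap lam ^ card u = fact (card u) powr q * (\<Prod>j\<in>u. \<beta>1 j)"
    by (simp add: \<beta>1_def prod.distrib)
  qed
  finally show ?thesis using C1[of s] by linarith
 qed
 define M where "M u = A * fact (card u) * (\<Prod>j\<in>u. \<beta> * b j)" for u
 \<comment> \<open>A weight vanishes only through some \<open>b j = 0\<close> with \<open>j\<close>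
   in \<open>u\<close>, and that factor also occurs in the derivative bound.\<close>
 have M0: "M u = 0" if "finite u" "\<gamma> u = 0" for u
 proof -
  have "(\<Prod>j\<in>u. b j / \<rho>) = 0" using that(2) unfolding \<gamma>eq by simp
  then have "\<exists>j\<in>u. b j = 0" using that(1) \<rho> by (auto simp: prod_zero_iff)
  then have "(\<Prod>j\<in>u. \<beta> * b j) = 0" using that(1) by (intro prod_zero) auto
  then show ?thesis by (simp add: M_def)
 qed
 have sumB: "(\<Sum>u\<in>PowN s. (M u)\<^sup>2 / \<gamma> u) \<le> A\<^sup>2 * C2" for s
 proof -
  have "(\<Sum>u\<in>PowN s. (M u)\<^sup>2 / \<gamma> u) \<le> (\<Sum>u\<in>Pow {..<s}. (M u)\<^sup>2 / \<gamma> u)"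
   using \<gamma>0 by (intro sum_mono2) auto
  also have "\<dots> \<le> (\<Sum>u\<in>Pow {..<s}. A\<^sup>2 * (fact (card u) powr q * (\<Prod>j\<in>u. \<beta>2 j)))"
  proof (rule sum_mono)
   fix u assume "u \<in> Pow {..<s}"
   then have fu: "finite u" by (auto intro: finite_subset)
   have nn: "0 \<le> A\<^sup>2 * (fact (card u) powr q * (\<Prod>j\<in>u. \<beta>2 j))"
    by (intro mult_nonneg_nonneg prod_nonneg) (auto simp: \<beta>2_def)
   show "(M u)\<^sup>2 / \<gamma> u \<le> A\<^sup>2 * (fact (card u) powr q * (\<Prod>j\<in>u. \<beta>2 j))"
   proof (cases "\<gamma> u = 0")
    case True
    then show ?thesis using nn by simp
   next
    case False
    then have bj: "b j > 0" if "j \<in> u" for j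
    proof -
     have "(\<Prod>j\<in>u. b j / \<rho>) \<noteq> 0" using False unfolding \<gamma>eq by auto
     then have "b j \<noteq> 0" using that fu by (auto simp: prod_zero_iff)
     then show ?thesis using b[of j] by simp
    qed
    define F where "F = (fact (card u) :: real)"
    have F: "F > 0" by (simp add: F_def)
    have g: "\<gamma> u = F powr p * (\<Prod>j\<in>u. (b j / \<rho>) powr p)"
     unfolding \<gamma>eq F_def using b \<rho> by (intro prod_powr_le fu) auto
    have "(M u)\<^sup>2 / \<gamma> u = A\<^sup>2 * ((F\<^sup>2 / F powr p) * ((\<Prod>j\<in>u. (\<beta> * b j)\<^sup>2) / (\<Prod>j\<in>u. (b j / \<rho>) powr p)))"
     unfolding M_def g F_def[symmetric] by (simp add: power_mult_distrib prod_power_distrib)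
    also have "F\<^sup>2 / F powr p = F powr q" unfolding qp(2)[symmetric] using F by (simp add: powr_diff)
    also have "(\<Prod>j\<in>u. (\<beta> * b j)\<^sup>2) / (\<Prod>j\<in>u. (b j / \<rho>) powr p) = (\<Prod>j\<in>u. \<beta>2 j)"
     unfolding prod_dividef[symmetric]
    proof (rule prod.cong[OF refl])
     fix j assume j: "j \<in> u"
     show "(\<beta> * b j)\<^sup>2 / (b j / \<rho>) powr p = \<beta>2 j"
      unfolding \<beta>2_def qp(2)[symmetric] using bj[OF j] \<rho>
      by (simp add: powr_divide powr_diff power_mult_distrib)
    qed
    finally show ?thesis by (simp add: F_def)
   qed
  qed
  also have "\<dots> \<le> A\<^sup>2 * C2" unfolding sum_distrib_left[symmetric] by (intro mult_left_mono C2) simp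
  finally show ?thesis .
 qed
 define C where "C = A\<^sup>2 * C2 * (2 * C1) powr (1 / lam)"
 have main: "\<exists>z. (\<forall>j. z j < 2 ^ m) \<and> CBC_vector (2 ^ m) s \<gamma> z \<and>
  (\<forall>f\<in>ratf s. \<forall>R\<ge>1. (\<forall>u\<subseteq>{..<s}. \<forall>y\<in>pbox s. \<bar>dmix s u f y\<bar> \<le> M u) \<longrightarrow>
    integrable (shifts_measure R s) (\<lambda>\<Delta>. (qerr (2 ^ m) R s z \<Delta> f)\<^sup>2) \<and>
    (LINT \<Delta>|shifts_measure R s. (qerr (2 ^ m) R s z \<Delta> f)\<^sup>2)
    \<le> C * real (2 ^ m) powr (- 1 / lam))" if m: "m \<ge> 1" for s m
 proof -
  define n :: nat where "n = 2 ^ m"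
  have n2: "n \<ge> 2" unfolding n_def using m by (cases m) auto
  then have n1: "n \<ge> 1" by simp
  obtain z where z: "\<And>j. z j < n" "CBC_vector n s \<gamma> z" using CBC_exists[OF n2, of \<gamma> s] \<gamma>0 by blast
  define e where "e = cbc_err n \<gamma> s z"
  have e0: "e \<ge> 0" unfolding e_def cbc_err_def using \<gamma>0 korob_nonneg by (intro sum_nonneg mult_nonneg_nonneg) auto
  have "e powr lam \<le> 2 / real n * (\<Sum>u\<in>PowN s. \<gamma> u powr lam * kap lam ^ card u)"
   unfolding e_def using l by (intro CBC_vector_bound[OF n_def m \<gamma>0 _ _ z(2)]) auto
  also have "\<dots> \<le> 2 / real n * C1" by (intro mult_left_mono sumA) simp
  finally have "(e powr lam) powr (1 / lam) \<le> (2 / real n * C1) powr (1 / lam)" using l by (intro powr_mono2) auto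
  then have "e \<le> (2 * C1 / real n) powr (1 / lam)" using e0 l by (simp add: powr_powr)
  also have "\<dots> = (2 * C1) powr (1 / lam) * real n powr (- 1 / lam)"
   using C10 n1 by (simp add: powr_divide powr_minus_divide)
  finally have e: "e \<le> (2 * C1) powr (1 / lam) * real n powr (- 1 / lam)" .
  have bound: "integrable (shifts_measure R s) (\<lambda>\<Delta>. (qerr n R s z \<Delta> f)\<^sup>2) \<and>
    (LINT \<Delta>|shifts_measure R s. (qerr n R s z \<Delta> f)\<^sup>2)
    \<le> C * real n powr (- 1 / lam)" if f: "f \<in> ratf s" and R: "R \<ge> 1" and Mb: "\<forall>u\<subseteq>{..<s}. \<forall>y\<in>pbox s. \<bar>dmix s u f y\<bar> \<le> M u" for f R
  proof -
   have M0': "u \<subseteq> {..<s} \<Longrightarrow> \<gamma> u = 0 \<Longrightarrow> M u = 0" for u using M0[of u] finite_subset by blast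
   note ms = scalar_ms_R[where z=z, OF n1 \<gamma>0 f R _ M0']
   have "(LINT \<Delta>|shifts_measure R s. (qerr n R s z \<Delta> f)\<^sup>2) \<le>
     (\<Sum>u\<in>PowN s. (M u)\<^sup>2 / \<gamma> u) * e"
    unfolding e_def by (rule ms(2)) (use Mb in auto)
   also have "\<dots> \<le> (A\<^sup>2 * C2) * ((2 * C1) powr (1 / lam) * real n powr (- 1 / lam))"
    using C20 by (intro mult_mono sumB e e0) auto
   also have "\<dots> = C * real n powr (- 1 / lam)" by (simp add: C_def)
   finally have "(LINT \<Delta>|shifts_measure R s. (qerr n R s z \<Delta> f)\<^sup>2) \<le> C * real n powr (- 1 / lam)" .
   moreover have "integrable (shifts_measure R s) (\<lambda>\<Delta>. (qerr n R s z \<Delta> f)\<^sup>2)"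
    by (rule ms(1)) (use Mb in auto)
   ultimately show ?thesis by (rule conjI[rotated])
  qed
  show ?thesis
   unfolding n_def[symmetric]
   by (rule exI[of _ z], intro conjI ballI allI impI; (rule z | rule bound[THEN conjunct1] bound[THEN conjunct2]); assumption?)
 qed
 have "C \<ge> 0" unfolding C_def using C20 by simp
 then show ?thesis
  by (intro exI[of _ C] conjI allI impI) (assumption, rule main[unfolded M_def])
qed

section \<open>Faces and jumps\<close>

abbreviation half :: "(real \<Rightarrow> real \<Rightarrow> bool) \<Rightarrow> 'a::euclidean_space \<Rightarrow> real \<Rightarrow> 'a \<Rightarrow> real \<Rightarrow> 'a set" where
 "half R n c q e \<equiv> {z \<in> ball q e. R (n \<bullet> z) c}"

lemma flat_pointsD:
 assumes "x \<in> flat_points T n c"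
 shows "n \<bullet> x = c" "\<exists>e>0. T \<inter> ball x e = (half (\<le>) n c x e)"
 using assms unfolding flat_points_def by auto

lemma flat_points_open:
 assumes e: "T \<inter> ball x e = (half (\<le>) n c x e)" and z: "z \<in> ball x e" "n \<bullet> z = c"
 shows "z \<in> flat_points T n c"
proof -
 define d where "d = e - dist x z"
 have d: "d > 0" using z by (simp add: d_def)
 have sub: "ball z d \<subseteq> ball x e"
 proof
  fix w assume "w \<in> ball z d"
  then show "w \<in> ball x e" using dist_triangle[of x w z] by (simp add: d_def)
 qed
 have "T \<inter> ball z d = {w \<in> ball z d. n \<bullet> w \<le> c}" using e sub by blast
 then show ?thesis unfolding flat_points_def using d z by blast
qed

text \<open>A small disc of the hyperplane around a flat point is connected and consists of flat
  points, hence stays in the same component. Components are thus relatively open.\<close>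

lemma flat_component_open:
 assumes C: "C \<in> components (flat_points T n c)" and x: "x \<in> C"
 shows "\<exists>e>0. ball x e \<inter> {z. n \<bullet> z = c} \<subseteq> C \<and> T \<inter> ball x e = (half (\<le>) n c x e)"
proof -
 have xf: "x \<in> flat_points T n c" using in_components_subset[OF C] x by blast
 then obtain e where e: "e > 0" "T \<inter> ball x e = (half (\<le>) n c x e)" using flat_pointsD(2) by blast
 have "ball x e \<inter> {z. n \<bullet> z = c} \<subseteq> C"
 proof (rule components_maximal[OF C])
  show "connected (ball x e \<inter> {z. n \<bullet> z = c})"
   by (intro convex_connected convex_Int convex_ball convex_hyperplane)
  show "ball x e \<inter> {z. n \<bullet> z = c} \<subseteq> flat_points T n c" using flat_points_open[OF e(2)] by auto
  show "C \<inter> (ball x e \<inter> {z. n \<bullet> z = c}) \<noteq> {}" using x e(1) flat_pointsD(1)[OF xf] by auto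
 qed
 then show ?thesis using e by blast
qed

lemma flat_component_subset:
 assumes "C \<in> components (flat_points T n c)"
 shows "closure C \<subseteq> {x. n \<bullet> x = c}"
proof (rule closure_minimal)
 show "C \<subseteq> {x. n \<bullet> x = c}" using in_components_subset[OF assms] flat_pointsD(1) by fast
qed (rule closed_hyperplane)

text \<open>Moving from \<open>x\<close> along the part \<open>w\<close> of \<open>n'\<close>
  orthogonal to \<open>n\<close> does not leave the first hyperplane, hence not the second; so
  \<open>w = 0\<close> and only the sign of the unit normal remains.\<close>

lemma hyperplane_local:
 fixes n n' :: "'a::euclidean_space"
 assumes n: "norm n = 1" "norm n' = 1" and x: "n \<bullet> x = c" and e: "e > 0"
  and sub: "ball x e \<inter> {z. n \<bullet> z = c} \<subseteq> {z. n' \<bullet> z = c'}"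
 shows "(n' = n \<and> c' = c) \<or> (n' = - n \<and> c' = - c)"
proof -
 have x': "n' \<bullet> x = c'" using subsetD[OF sub, of x] x e by auto
 define w where "w = n' - (n' \<bullet> n) *\<^sub>R n"
 have nn: "n \<bullet> n = 1" "n' \<bullet> n' = 1" using n by (auto simp: norm_eq_1)
 have wn: "n \<bullet> w = 0" by (simp add: w_def inner_diff_right nn inner_commute)
 have "w = 0"
 proof (rule ccontr)
  assume w: "w \<noteq> 0"
  define t where "t = e / (2 * norm w)"
  have t: "t > 0" using w e by (simp add: t_def)
  have "x + t *\<^sub>R w \<in> ball x e" using w e by (simp add: dist_norm t_def)
  moreover have "n \<bullet> (x + t *\<^sub>R w) = c" using x wn by (simp add: inner_add_right)
  ultimately have "n' \<bullet> (x + t *\<^sub>R w) = c'" using sub by auto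
  then have "n' \<bullet> w = 0" using x' t by (simp add: inner_add_right)
  then have "w \<bullet> w = 0" using wn by (simp add: w_def inner_diff_left inner_diff_right inner_commute)
  then show False using w by simp
 qed
 then have n': "n' = (n' \<bullet> n) *\<^sub>R n" by (simp add: w_def)
 define a where "a = n' \<bullet> n"
 have a: "n' = a *\<^sub>R n" using n' by (simp add: a_def)
 then have "\<bar>a\<bar> = 1" using n by simp
 then have "a = 1 \<or> a = -1" by linarith
 then show ?thesis using a x x' by auto
qed

text \<open>A point slightly off the hyperplane would belong to \<open>T\<close> by one description
  and not by the other.\<close>

lemma flat_opposite:
 assumes n: "norm (n::'a::euclidean_space) = 1" and "x \<in> flat_points T n c" "e > 0" "T \<inter> ball x e = (half (\<ge>) n c x e)"
 shows False
proof -
 obtain d where d: "d > 0" "T \<inter> ball x d = (half (\<le>) n c x d)" using flat_pointsD(2)[OF assms(2)] by blast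
 have nn: "n \<bullet> n = 1" using n by (simp add: norm_eq_1)
 define t where "t = min d e / 2"
 have t: "t > 0" "t < d" "t < e" using d assms by (auto simp: t_def)
 have "x + t *\<^sub>R n \<in> T \<inter> ball x e"
  unfolding assms(4) using t n flat_pointsD(1)[OF assms(2)] nn by (auto simp: dist_norm inner_add_right)
 then have "x + t *\<^sub>R n \<in> T \<inter> ball x d" using t n by (auto simp: dist_norm)
 then have "n \<bullet> (x + t *\<^sub>R n) \<le> c" unfolding d(2) by simp
 then show False using t nn flat_pointsD(1)[OF assms(2)] by (simp add: inner_add_right)
qed

lemma face_hyperplane_unique:
 fixes n n' :: "'a::euclidean_space"
 assumes n: "norm n = 1" "norm n' = 1" and C: "C \<in> components (flat_points T n c)"
  and sub: "closure C \<subseteq> {x. n' \<bullet> x = c'}"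
 shows "(n' = n \<and> c' = c) \<or> (n' = - n \<and> c' = - c)"
proof -
 obtain x where x: "x \<in> C" using in_components_nonempty[OF C] by blast
 obtain e where e: "e > 0" "ball x e \<inter> {z. n \<bullet> z = c} \<subseteq> C" using flat_component_open[OF C x] by blast
 have "n \<bullet> x = c" using flat_component_subset[OF C] x closure_subset by blast
 then show ?thesis
  using hyperplane_local[OF n _ e(1), of x c c'] e(2) sub closure_subset[of C] by blast
qed

text \<open>Only the closures of the two components are known to agree, so a point of the second is
  taken close to a point of the first. By relative openness it lies in both, and opposite normals
  would put the element on both sides there.\<close>

lemma outer_normal_eq:
 fixes n :: "'a::euclidean_space"
 assumes n: "norm n = 1" and C: "C \<in> components (flat_points T n c)"
 shows "outer_normal T (closure C) = n"
 unfolding outer_normal_def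
proof (rule the_equality)
 show "norm n = 1 \<and> (\<exists>c. \<exists>C'\<in>components (flat_points T n c). closure C = closure C')" using n C by blast
 fix n' assume "norm n' = 1 \<and> (\<exists>c. \<exists>C'\<in>components (flat_points T n' c). closure C = closure C')"
 then obtain c' C' where n': "norm n' = 1" and C': "C' \<in> components (flat_points T n' c')" "closure C = closure C'" by blast
 have "(n' = n \<and> c' = c) \<or> (n' = - n \<and> c' = - c)"
  by (rule face_hyperplane_unique[OF n n' C]) (use flat_component_subset[OF C'(1)] C'(2) in simp)
 moreover have False if "n' = - n" "c' = - c"
 proof -
  obtain x where x: "x \<in> C" using in_components_nonempty[OF C] by blast
  obtain e where e: "e > 0" "ball x e \<inter> {z. n \<bullet> z = c} \<subseteq> C" using flat_component_open[OF C x] by blast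
  have "x \<in> closure C'" using x C'(2) closure_subset by blast
  then obtain y where y: "y \<in> C'" "dist y x < e" using e(1) closure_approachable by blast
  have yf: "y \<in> flat_points T (- n) (- c)" using in_components_subset[OF C'(1)] y that by blast
  then have "n \<bullet> y = c" using flat_pointsD(1)[OF yf] by simp
  then have "y \<in> C" using e(2) y by (auto simp: dist_commute)
  then have yf': "y \<in> flat_points T n c" using in_components_subset[OF C] by blast
  obtain d where "d > 0" "T \<inter> ball y d = {z \<in> ball y d. (- n) \<bullet> z \<le> - c}" using flat_pointsD(2)[OF yf] by blast
  then show False using flat_opposite[OF n yf', of d] by simp
 qed
 ultimately show "n' = n" by blast
qed

lemma faces_obtain:
 assumes "F \<in> faces T"
 shows "\<exists>n c C. norm n = 1 \<and> C \<in> components (flat_points T n c) \<and> F = closure C"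
 using assms unfolding faces_def by blast

lemma half_ball_convex: "convex (half (>) n c q e)" "convex (half (<) n (c::real) q e)"
proof -
 have "(half (>) n c q e) = ball q e \<inter> {z. n \<bullet> z > c}" "(half (<) n c q e) = ball q e \<inter> {z. n \<bullet> z < c}" by auto
 then show "convex (half (>) n c q e)" "convex (half (<) n c q e)"
  by (auto intro: convex_Int convex_halfspace_lt convex_halfspace_gt)
qed

lemma half_ball_point:
 assumes "norm (n::'a::euclidean_space) = 1" "n \<bullet> q = c" "e > 0"
 shows "q + (e/2) *\<^sub>R n \<in> (half (>) n c q e)" "q - (e/2) *\<^sub>R n \<in> (half (<) n c q e)"
proof -
 have "n \<bullet> n = 1" using assms(1) by (simp add: norm_eq_1)
 then show "q + (e/2) *\<^sub>R n \<in> (half (>) n c q e)" "q - (e/2) *\<^sub>R n \<in> (half (<) n c q e)"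
  using assms by (auto simp: dist_norm inner_add_right inner_diff_right)
qed

text \<open>The open half balls miss the frontier, so each lies in the interior or is disjoint from
  \<open>T\<close>. Were both inside, \<open>q\<close> would be interior; were neither, the interior
  near \<open>q\<close> would be an open set within a hyperplane. Closedness of \<open>T\<close>
  settles the points on the hyperplane.\<close>

lemma local_half_space:
 fixes q n :: "'a::euclidean_space"
 assumes T: "polyhedral_element T" and n: "norm n = 1" and q: "n \<bullet> q = c" "q \<in> T" "q \<notin> interior T" and e: "e > 0"
  and fr: "frontier T \<inter> ball q e \<subseteq> {z. n \<bullet> z = c}"
 shows "T \<inter> ball q e = (half (\<le>) n c q e) \<and> (half (<) n c q e) \<subseteq> interior T \<and> (half (>) n c q e) \<inter> T = {} \<or>
  T \<inter> ball q e = (half (\<ge>) n c q e) \<and> (half (>) n c q e) \<subseteq> interior T \<and> (half (<) n c q e) \<inter> T = {}"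
proof -
 let ?P = "(half (>) n c q e)" and ?N = "(half (<) n c q e)"
 have Tc: "closed T" and Tcl: "T = closure (interior T)" using T unfolding polyhedral_element_def by (auto dest: compact_imp_closed)
 have oP: "open ?P" "open ?N"
 proof -
  have "?P = ball q e \<inter> {z. n \<bullet> z > c}" "?N = ball q e \<inter> {z. n \<bullet> z < c}" by auto
  then show "open ?P" "open ?N" by (auto intro: open_Int open_halfspace_lt open_halfspace_gt)
 qed
 have dich: "S \<subseteq> interior T \<or> S \<inter> T = {}" if "connected S" "open S" "S \<inter> frontier T = {}" for S
 proof (cases "S \<inter> T = {}")
  case False
  then have "S - T = {}" using connected_Int_frontier[OF that(1) False] that(3) by blast
  then have "S \<subseteq> T" by blast
  then show ?thesis using interior_maximal[OF _ that(2)] by simp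
 qed simp
 have dP: "?P \<subseteq> interior T \<or> ?P \<inter> T = {}" using fr by (intro dich convex_connected half_ball_convex oP) auto
 have dN: "?N \<subseteq> interior T \<or> ?N \<inter> T = {}" using fr by (intro dich convex_connected half_ball_convex oP) auto
 have clos: "z \<in> T" if z: "z \<in> ball q e" "n \<bullet> z = c" and S: "S \<subseteq> T" and h: "\<And>d. 0 < d \<Longrightarrow> d < e - dist q z \<Longrightarrow> z + d *\<^sub>R m \<in> S" and m: "norm m = 1" for z S m
 proof -
  have "z \<in> closure T"
   unfolding closure_approachable
  proof (intro allI impI)
   fix r :: real assume r: "r > 0"
   define d where "d = min r (e - dist q z) / 2"
   have d: "0 < d" "d < r" "d < e - dist q z" using r z by (auto simp: d_def min_def)
   have "z + d *\<^sub>R m \<in> T" using h[OF d(1,3)] S by blast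
   moreover have "dist (z + d *\<^sub>R m) z < r" using d m by (simp add: dist_norm)
   ultimately show "\<exists>y\<in>T. dist y z < r" by blast
  qed
  then show ?thesis using Tc by simp
 qed
 have nn: "n \<bullet> n = 1" using n by (simp add: norm_eq_1)
 have hP: "z + d *\<^sub>R n \<in> ?P" "z + d *\<^sub>R (- n) \<in> ?N" if "n \<bullet> z = c" "0 < d" "d < e - dist q z" for z d
 proof -
  have "dist q (z + d *\<^sub>R n) \<le> dist q z + d" "dist q (z + d *\<^sub>R (- n)) \<le> dist q z + d"
   using dist_triangle[of q "z + d *\<^sub>R n" z] dist_triangle[of q "z + d *\<^sub>R (- n)" z] n that by (auto simp: dist_norm)
  then show "z + d *\<^sub>R n \<in> ?P" "z + d *\<^sub>R (- n) \<in> ?N" using that nn by (auto simp: inner_add_right inner_diff_right)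
 qed
 have zP: "z \<in> T" if "?P \<subseteq> T" "z \<in> ball q e" "n \<bullet> z = c" for z
  by (rule clos[OF that(2,3,1) hP(1)[OF that(3)] n])
 have zN: "z \<in> T" if "?N \<subseteq> T" "z \<in> ball q e" "n \<bullet> z = c" for z
 proof -
  have "norm (- n) = 1" using n by (simp only: norm_minus_cancel)
  from clos[OF that(2,3,1) hP(2)[OF that(3)] this] show ?thesis .
 qed
 have ball_split: "z \<in> ?P \<or> z \<in> ?N \<or> n \<bullet> z = c" if "z \<in> ball q e" for z using that by auto
 have notboth: "\<not> (?P \<subseteq> interior T \<and> ?N \<subseteq> interior T)"
 proof
  assume b: "?P \<subseteq> interior T \<and> ?N \<subseteq> interior T"
  then have "?P \<subseteq> T" using interior_subset by blast
  then have "ball q e \<subseteq> T" using ball_split zP b interior_subset by blast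
  then have "q \<in> interior T" using e by (meson centre_in_ball interior_maximal open_ball subsetD)
  then show False using q by simp
 qed
 have notnone: "\<not> (?P \<inter> T = {} \<and> ?N \<inter> T = {})"
 proof
  assume b: "?P \<inter> T = {} \<and> ?N \<inter> T = {}"
  have "q \<in> closure (interior T)" using q Tcl by simp
  then obtain y where y: "y \<in> interior T" "dist y q < e" using e closure_approachable by blast
  let ?U = "interior T \<inter> ball q e"
  have "?U \<subseteq> {z. n \<bullet> z = c}" using b ball_split interior_subset by blast
  moreover have "n \<noteq> 0" using n by auto
  ultimately have "negligible ?U" using negligible_subset[OF negligible_hyperplane[of n c]] by blast
  moreover have "open ?U" "?U \<noteq> {}" using y by (auto simp: dist_commute)
  ultimately show False using open_not_negligible by blast
 qed
 consider "?P \<subseteq> interior T" "?N \<inter> T = {}" | "?N \<subseteq> interior T" "?P \<inter> T = {}" using dP dN notboth notnone by blast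
 then show ?thesis
 proof cases
  case 1
  then have "?P \<subseteq> T" using interior_subset by blast
  have "z \<in> T \<longleftrightarrow> n \<bullet> z \<ge> c" if z: "z \<in> ball q e" for z
   using ball_split[OF z] 1(2) zP[OF \<open>?P \<subseteq> T\<close> z] \<open>?P \<subseteq> T\<close> by fastforce
  then have "T \<inter> ball q e = (half (\<ge>) n c q e)" by blast
  then show ?thesis using 1 by blast
 next
  case 2
  then have "?N \<subseteq> T" using interior_subset by blast
  have "z \<in> T \<longleftrightarrow> n \<bullet> z \<le> c" if z: "z \<in> ball q e" for z
   using ball_split[OF z] 2(2) zN[OF \<open>?N \<subseteq> T\<close> z] \<open>?N \<subseteq> T\<close> by fastforce
  then have "T \<inter> ball q e = (half (\<le>) n c q e)" by blast
  then show ?thesis using 2 by blast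
 qed
qed

locale dg_mesh =
 fixes D :: "'a::euclidean_space set" and \<T> :: "'a set set"
 assumes mesh: "polyhedral_mesh D \<T>" and nohang: "no_hanging_nodes D \<T>"
begin

lemma fin: "finite \<T>" and elem: "T \<in> \<T> \<Longrightarrow> polyhedral_element T" and un: "\<Union>\<T> = D"
 and disj: "T \<in> \<T> \<Longrightarrow> T' \<in> \<T> \<Longrightarrow> T \<noteq> T' \<Longrightarrow> interior T \<inter> interior T' = {}"
 using mesh unfolding polyhedral_mesh_def by auto

lemma elem_props:
 assumes "T \<in> \<T>"
 shows "compact T" "closed T" "interior T \<noteq> {}" "connected (interior T)" "closure (interior T) = T" "T \<subseteq> D" "finite (faces T)"
  "frontier T = \<Union>(faces T)" "T \<in> sets lebesgue" "T \<in> lmeasurable"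
proof -
 show c: "compact T" and "interior T \<noteq> {}" "connected (interior T)" "finite (faces T)" "frontier T = \<Union>(faces T)"
  using elem[OF assms] unfolding polyhedral_element_def by auto
 show "closure (interior T) = T" using elem[OF assms] unfolding polyhedral_element_def by metis
 show "closed T" by (rule compact_imp_closed[OF c])
 show "T \<subseteq> D" using un assms by blast
 show "T \<in> lmeasurable" by (rule lmeasurable_compact[OF c])
 then show "T \<in> sets lebesgue" by (rule fmeasurableD)
qed

lemma fin_faces: "finite (mesh_faces \<T>)"
 unfolding mesh_faces_def using fin elem_props(7) by auto

lemma compact_D: "compact D"
 using un fin elem_props(1) compact_Union by metis

end

text \<open>Models a piecewise constant function with vanishing jumps by one value per element; the
  aim is that all values are zero.\<close>

locale jump_free = dg_mesh D \<T>
 for D :: "'a::euclidean_space set" and \<T> :: "'a set set" +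
 fixes v :: "'a set \<Rightarrow> real"
 assumes jump0: "\<And>F. F \<in> mesh_faces \<T> \<Longrightarrow> (\<Sum>T\<in>adjacent \<T> F. v T *\<^sub>R outer_normal T F) = 0"
begin

text \<open>The extension by zero of the piecewise constant function equals \<open>k\<close> near
  \<open>q\<close>, expressed without values on the mesh skeleton.\<close>

definition locconst :: "'a \<Rightarrow> real \<Rightarrow> bool" where
 "locconst q k \<longleftrightarrow> (\<exists>e>0. (\<forall>T\<in>\<T>. interior T \<inter> ball q e \<noteq> {} \<longrightarrow> v T = k) \<and> (\<not> ball q e \<subseteq> D \<longrightarrow> k = 0))"

definition hyp :: "'a set \<Rightarrow> 'a \<times> real" where
 "hyp F = (SOME p. norm (fst p) = 1 \<and> F \<subseteq> {x. fst p \<bullet> x = snd p})"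

lemma hyp: "F \<in> mesh_faces \<T> \<Longrightarrow> norm (fst (hyp F)) = 1 \<and> F \<subseteq> {x. fst (hyp F) \<bullet> x = snd (hyp F)}"
proof -
 assume "F \<in> mesh_faces \<T>"
 then obtain T where "F \<in> faces T" unfolding mesh_faces_def by blast
 then obtain n c C where "norm n = 1" "C \<in> components (flat_points T n c)" "F = closure C" using faces_obtain by blast
 then have "norm (fst (n, c)) = 1 \<and> F \<subseteq> {x. fst (n, c) \<bullet> x = snd (n, c)}" using flat_component_subset[of C T n c] by simp
 then show ?thesis unfolding hyp_def by (rule someI)
qed

definition hset :: "'a set \<Rightarrow> 'a set" where "hset F = {x. fst (hyp F) \<bullet> x = snd (hyp F)}"

lemma closed_hset: "closed (hset F)" unfolding hset_def by (rule closed_hyperplane)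

lemma frontier_hset: "T \<in> \<T> \<Longrightarrow> frontier T \<subseteq> (\<Union>F\<in>faces T. hset F)"
 using elem[of T] hyp unfolding polyhedral_element_def hset_def mesh_faces_def by fastforce

text \<open>The hypothesis says that all face hyperplanes through \<open>q\<close> coincide. On the
  skeleton every element at \<open>q\<close> then fills one half ball. Either two elements meet
  there and the jump condition on their common face equates the values, or there is only one, its
  face lies on the boundary of the domain, and the jump condition says that its value is
  zero.\<close>

lemma locconst_exists:
 assumes q: "\<And>F F'. F \<in> mesh_faces \<T> \<Longrightarrow> F' \<in> mesh_faces \<T> \<Longrightarrow> q \<in> hset F \<Longrightarrow> q \<in> hset F' \<Longrightarrow> hset F = hset F'"
 shows "\<exists>k. locconst q k"
proof -
 consider T where "T \<in> \<T>" "q \<in> interior T" | "q \<notin> D" | "q \<in> D" "\<And>T. T \<in> \<T> \<Longrightarrow> q \<notin> interior T" by blast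
 then show ?thesis
 proof cases
  case (1 T)
  obtain e where e: "e > 0" "ball q e \<subseteq> interior T" using 1(2) openE[OF open_interior] by blast
  have "ball q e \<subseteq> D" using e(2) interior_subset[of T] 1(1) un by blast
  moreover have "v T' = v T" if "T' \<in> \<T>" "interior T' \<inter> ball q e \<noteq> {}" for T'
   using disj[OF that(1) 1(1)] that(2) e(2) by blast
  ultimately show ?thesis unfolding locconst_def using e(1) by blast
 next
  case 2
  have "open (- D)" using compact_D compact_imp_closed by blast
  then obtain e where e: "e > 0" "ball q e \<subseteq> - D" using 2 openE by blast
  have "v T = 0" if "T \<in> \<T>" "interior T \<inter> ball q e \<noteq> {}" for T
   using that e(2) interior_subset[of T] un by blast
  then show ?thesis unfolding locconst_def using e(1) by blast
 next
  case 3
  then obtain T where T: "T \<in> \<T>" "q \<in> T" using un by blast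
  have qf: "q \<in> frontier T" using T 3 elem_props(2)[OF T(1)] by (simp add: frontier_def)
  then obtain F0 where F0: "F0 \<in> mesh_faces \<T>" "q \<in> hset F0" using frontier_hset[OF T(1)] T(1) unfolding mesh_faces_def by blast
  define n0 where "n0 = fst (hyp F0)"
  define c0 where "c0 = snd (hyp F0)"
  have n0: "norm n0 = 1" "n0 \<bullet> q = c0" using hyp[OF F0(1)] F0(2) by (auto simp: n0_def c0_def hset_def)
  have H: "hset F0 = {x. n0 \<bullet> x = c0}" by (simp add: hset_def n0_def c0_def)
  \<comment> \<open>A finite union of closed sets missing \<open>q\<close>; a ball disjoint from it
    sees only the face hyperplanes and elements that pass through \<open>q\<close>.\<close>
  define A where "A = \<Union>{hset F | F. F \<in> mesh_faces \<T> \<and> q \<notin> hset F} \<union> \<Union>{T'\<in>\<T>. q \<notin> T'}"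
  have "closed A" unfolding A_def using fin fin_faces closed_hset elem_props(2) by (intro closed_Un closed_Union) auto
  moreover have "q \<notin> A" unfolding A_def by blast
  ultimately obtain e where e: "e > 0" "ball q e \<subseteq> - A" using openE[of "- A" q] by auto
  have near: "q \<in> T'" if "T' \<in> \<T>" "T' \<inter> ball q e \<noteq> {}" for T' using that e(2) unfolding A_def by blast
  have fr: "frontier T' \<inter> ball q e \<subseteq> {z. n0 \<bullet> z = c0}" if T': "T' \<in> \<T>" for T'
  proof
   fix z assume z: "z \<in> frontier T' \<inter> ball q e"
   then obtain F where F: "F \<in> mesh_faces \<T>" "z \<in> hset F" using frontier_hset[OF T'] T' unfolding mesh_faces_def by blast
   then have "q \<in> hset F" using z e(2) unfolding A_def by blast
   then have "hset F = hset F0" using q F(1) F0 by blast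
   then show "z \<in> {z. n0 \<bullet> z = c0}" using F(2) H by simp
  qed
  obtain n c where n: "norm n = 1" "n \<bullet> q = c" and Hn: "{x. n \<bullet> x = c} = {x. n0 \<bullet> x = c0}"
   and half: "T \<inter> ball q e = (half (\<le>) n c q e)" "(half (<) n c q e) \<subseteq> interior T" "(half (>) n c q e) \<inter> T = {}"
  proof -
   from local_half_space[OF elem[OF T(1)] n0 T(2) 3(2)[OF T(1)] e(1) fr[OF T(1)]]
   show thesis
   proof
    assume "T \<inter> ball q e = (half (\<le>) n0 c0 q e) \<and> (half (<) n0 c0 q e) \<subseteq> interior T \<and> (half (>) n0 c0 q e) \<inter> T = {}"
    then show thesis using that[of n0 c0] n0 by blast
   next
    assume "T \<inter> ball q e = (half (\<ge>) n0 c0 q e) \<and> (half (>) n0 c0 q e) \<subseteq> interior T \<and> (half (<) n0 c0 q e) \<inter> T = {}"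
    then show thesis using n0 by (intro that[of "- n0" "- c0"]) auto
   qed
  qed
  let ?P = "(half (>) n c q e)" and ?N = "(half (<) n c q e)"
  have Pne: "?P \<noteq> {}" "?N \<noteq> {}" using half_ball_point[OF n e(1)] by blast+
  \<comment> \<open>A second element at \<open>q\<close> must fill the opposite half ball, since
    interiors are disjoint; hence there is at most one.\<close>
  have other: "T' \<inter> ball q e = (half (\<ge>) n c q e) \<and> ?P \<subseteq> interior T'" if T': "T' \<in> \<T>" "T' \<noteq> T" "q \<in> T'" for T'
  proof -
   have "frontier T' \<inter> ball q e \<subseteq> {z. n \<bullet> z = c}" using fr[OF T'(1)] Hn by blast
   from local_half_space[OF elem[OF T'(1)] n T'(3) 3(2)[OF T'(1)] e(1) this]
   show ?thesis
   proof
    assume "T' \<inter> ball q e = (half (\<le>) n c q e) \<and> ?N \<subseteq> interior T' \<and> ?P \<inter> T' = {}"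
    then have "?N \<subseteq> interior T' \<inter> interior T" using half(2) by blast
    then show ?thesis using disj[OF T'(1) T(1) T'(2)] Pne by blast
   qed blast
  qed
  have uniq: "T' = T''" if "T' \<in> \<T>" "T' \<noteq> T" "q \<in> T'" "T'' \<in> \<T>" "T'' \<noteq> T" "q \<in> T''" for T' T''
  proof (rule ccontr)
   assume "T' \<noteq> T''"
   then show False using disj[OF that(1,4)] other[OF that(1-3)] other[OF that(4-6)] Pne by blast
  qed
  have "q \<in> flat_points T n c" unfolding flat_points_def using n e(1) half(1) by blast
  \<comment> \<open>The point \<open>q\<close> is itself flat, and the closure of its component is
    the face whose jump condition is used.\<close>
  then obtain C where C: "C \<in> components (flat_points T n c)" "q \<in> C" by (auto simp: components_def intro: connected_component_refl)
  let ?F = "closure C"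
  have FT: "?F \<in> faces T" unfolding faces_def using n C by blast
  have Fm: "?F \<in> mesh_faces \<T>" unfolding mesh_faces_def using FT T by blast
  have qF: "q \<in> ?F" using C closure_subset by blast
  have nT: "outer_normal T ?F = n" by (rule outer_normal_eq[OF n(1) C(1)])
  have adjq: "q \<in> T'" if "T' \<in> adjacent \<T> ?F" for T'
  proof -
   have T': "T' \<in> \<T>" "?F \<in> faces T'" using that unfolding adjacent_def by auto
   then have "?F \<subseteq> frontier T'" using elem[OF T'(1)] unfolding polyhedral_element_def by blast
   then show ?thesis using qF elem_props(2)[OF T'(1)] frontier_subset_closed by blast
  qed
  have Tadj: "T \<in> adjacent \<T> ?F" unfolding adjacent_def using T FT by blast
  show ?thesis
  proof (cases "\<exists>T'\<in>adjacent \<T> ?F. T' \<noteq> T")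
   case True
   then obtain T' where T': "T' \<in> adjacent \<T> ?F" "T' \<noteq> T" by blast
   have T'm: "T' \<in> \<T>" "?F \<in> faces T'" using T'(1) unfolding adjacent_def by auto
   have adj: "adjacent \<T> ?F = {T, T'}"
    using Tadj T' adjq uniq T'm unfolding adjacent_def by blast
   note o = other[OF T'm(1) T'(2) adjq[OF T'(1)]]
   obtain n' c' C' where C': "norm n' = 1" "C' \<in> components (flat_points T' n' c')" "?F = closure C'"
    using faces_obtain[OF T'm(2)] by blast
   have "(n' = n \<and> c' = c) \<or> (n' = - n \<and> c' = - c)"
    by (rule face_hyperplane_unique[OF n(1) C'(1) C(1)]) (use flat_component_subset[OF C'(2)] C'(3) in simp)
   \<comment> \<open>Equal normals would put \<open>T'\<close> below the hyperplane near a flat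
     point of its face, but it fills the upper half ball.\<close>
   moreover have False if "n' = n" "c' = c"
   proof -
    obtain y where y: "y \<in> C'" "dist y q < e" using qF C'(3) e(1) closure_approachable by blast
    have yf: "y \<in> flat_points T' n c" using in_components_subset[OF C'(2)] y that by blast
    define d where "d = e - dist q y"
    have d: "d > 0" using y by (simp add: d_def dist_commute)
    have sub: "ball y d \<subseteq> ball q e"
    proof
     fix w assume "w \<in> ball y d"
     then show "w \<in> ball q e" using dist_triangle[of q w y] by (simp add: d_def)
    qed
    have "T' \<inter> ball y d = (half (\<ge>) n c y d)" using o sub by blast
    then show False using flat_opposite[OF n(1) yf d] by blast
   qed
   ultimately have "n' = - n" by blast
   then have nT': "outer_normal T' ?F = - n" using outer_normal_eq[OF C'(1,2)] C'(3) by simp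
   have "v T *\<^sub>R n + v T' *\<^sub>R (- n) = 0"
    using jump0[OF Fm] T'(2) unfolding adj by (simp add: nT nT')
   then have "(v T - v T') *\<^sub>R n = 0" by (simp add: scaleR_diff_left)
   then have eq: "v T' = v T" using n(1) by auto
   have "ball q e \<subseteq> T \<union> T'" using half(1) o by (force simp: not_le)
   then have "ball q e \<subseteq> D" using T(1) T'm(1) un by blast
   moreover have "v T'' = v T" if "T'' \<in> \<T>" "interior T'' \<inter> ball q e \<noteq> {}" for T''
   proof -
    have "q \<in> T''" using near[OF that(1)] that(2) interior_subset by blast
    then show ?thesis using uniq[OF T'm(1) T'(2) adjq[OF T'(1)] that(1)] eq by blast
   qed
   ultimately show ?thesis unfolding locconst_def using e(1) by blast
  next
   case False
   then have adj: "adjacent \<T> ?F = {T}" using Tadj by blast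
   have "v T *\<^sub>R n = 0" using jump0[OF Fm] unfolding adj by (simp add: nT)
   then have v0: "v T = 0" using n(1) by auto
   \<comment> \<open>Without a second adjacent element, absence of hanging nodes leaves only this
     possibility.\<close>
   have "?F \<subseteq> frontier D"
    using nohang T(1) FT False unfolding no_hanging_nodes_def adjacent_def by blast
   then have qD: "q \<in> frontier D" using qF by blast
   have only: "T' = T" if T': "T' \<in> \<T>" "q \<in> T'" for T'
   proof (rule ccontr)
    assume "T' \<noteq> T"
    from other[OF T'(1) this T'(2)] have "ball q e \<subseteq> T \<union> T'" using half(1) by (force simp: not_le)
    then have "ball q e \<subseteq> D" using T(1) T'(1) un by blast
    then have "q \<in> interior D" using e(1) by (meson centre_in_ball interior_maximal open_ball subsetD)
    then show False using qD by (simp add: frontier_def)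
   qed
   have "v T'' = 0" if "T'' \<in> \<T>" "interior T'' \<inter> ball q e \<noteq> {}" for T''
   proof -
    have "q \<in> T''" using near[OF that(1)] that(2) interior_subset by blast
    then show ?thesis using only[OF that(1)] v0 by blast
   qed
   then show ?thesis unfolding locconst_def using e(1) by blast
  qed
 qed
qed

text \<open>The two balls overlap near \<open>p\<close>. Either the overlap meets the interior of an
  element, whose value both constants must equal, or it leaves the domain and both are zero.\<close>

lemma locconst_unique:
 assumes "locconst q k"
 shows "\<exists>r>0. \<forall>p\<in>ball q r. \<forall>k'. locconst p k' \<longrightarrow> k' = k"
proof -
 obtain e where e: "e > 0" "\<And>T. T \<in> \<T> \<Longrightarrow> interior T \<inter> ball q e \<noteq> {} \<Longrightarrow> v T = k" "\<not> ball q e \<subseteq> D \<Longrightarrow> k = 0"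
  using assms unfolding locconst_def by blast
 have "k' = k" if p: "p \<in> ball q e" and k': "locconst p k'" for p k'
 proof -
  obtain e' where e': "e' > 0" "\<And>T. T \<in> \<T> \<Longrightarrow> interior T \<inter> ball p e' \<noteq> {} \<Longrightarrow> v T = k'" "\<not> ball p e' \<subseteq> D \<Longrightarrow> k' = 0"
   using k' unfolding locconst_def by blast
  let ?U = "ball q e \<inter> ball p e'"
  have pU: "p \<in> ?U" using p e'(1) by simp
  show ?thesis
  proof (cases "?U \<subseteq> D")
   case False
   then have "\<not> ball q e \<subseteq> D" "\<not> ball p e' \<subseteq> D" by blast+
   then show ?thesis using e(3) e'(3) by simp
  next
   case True
   then obtain T where T: "T \<in> \<T>" "p \<in> T" using pU un by blast
   have "p \<in> closure (interior T)" using T elem[OF T(1)] unfolding polyhedral_element_def by blast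
   then have "interior T \<inter> ?U \<noteq> {}" using pU open_Int_closure_eq_empty[of ?U "interior T"] by (metis IntI Int_commute emptyE open_Int open_ball)
   then show ?thesis using e(2)[OF T(1)] e'(2)[OF T(1)] by blast
  qed
 qed
 then show ?thesis using e(1) by blast
qed

text \<open>The segment joins a point of \<open>T0\<close> off all face hyperplanes to a point
  outside the domain. If it meets no two distinct hyperplanes at once, a local constant exists at
  each of its points and cannot change along it, so the value on \<open>T0\<close> equals the value
  zero outside.\<close>

theorem values_zero:
 assumes T0: "T0 \<in> \<T>"
 shows "v T0 = 0"
proof -
 let ?\<F> = "mesh_faces \<T>"
 have negh: "negligible (hset F)" if "F \<in> ?\<F>" for F
  unfolding hset_def using hyp[OF that] by (intro negligible_hyperplane) auto
 have "negligible (\<Union>F\<in>?\<F>. hset F)" using fin_faces negh by (intro negligible_Union) auto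
 moreover have "\<not> negligible (interior T0)"
  using elem[OF T0] unfolding polyhedral_element_def by (intro open_not_negligible) auto
 ultimately have "\<not> interior T0 \<subseteq> (\<Union>F\<in>?\<F>. hset F)" using negligible_subset by metis
 then obtain x0 where x0: "x0 \<in> interior T0" "\<And>F. F \<in> ?\<F> \<Longrightarrow> x0 \<notin> hset F" by blast
 \<comment> \<open>\<open>bm \<bullet> x = bk\<close> describes the hyperplane of the pencil spanned
   by the two face hyperplanes that passes through \<open>x0\<close>. It contains their
   intersection, so a segment from \<open>x0\<close> to a point \<open>p\<close> off it avoids that
   intersection.\<close>
 define bm where "bm F F' = (fst (hyp F') \<bullet> x0 - snd (hyp F')) *\<^sub>R fst (hyp F) - (fst (hyp F) \<bullet> x0 - snd (hyp F)) *\<^sub>R fst (hyp F')" for F F'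
 define bk where "bk F F' = (fst (hyp F') \<bullet> x0 - snd (hyp F')) * snd (hyp F) - (fst (hyp F) \<bullet> x0 - snd (hyp F)) * snd (hyp F')" for F F'
 \<comment> \<open>If \<open>bm\<close> vanishes the normals are parallel, and two parallel
   hyperplanes with a common point coincide; nothing has to be excluded.\<close>
 define Bad where "Bad F F' = (if bm F F' = 0 then {} else {p. bm F F' \<bullet> p = bk F F'})" for F F'
 have "negligible (Bad F F')" for F F' unfolding Bad_def by (auto intro: negligible_hyperplane)
 then have "negligible (\<Union>F\<in>?\<F>. \<Union>F'\<in>?\<F>. Bad F F')" using fin_faces by (intro negligible_Union) auto
 moreover have "\<not> negligible (- D)"
 proof -
  have "- D \<noteq> {}" using compact_D compact_imp_bounded not_bounded_UNIV by (metis Compl_UNIV_eq double_complement)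
  moreover have "open (- D)" using compact_D compact_imp_closed by blast
  ultimately show ?thesis using open_not_negligible by blast
 qed
 ultimately have "\<not> - D \<subseteq> (\<Union>F\<in>?\<F>. \<Union>F'\<in>?\<F>. Bad F F')" using negligible_subset by metis
 then obtain p where p: "p \<notin> D" "\<And>F F'. F \<in> ?\<F> \<Longrightarrow> F' \<in> ?\<F> \<Longrightarrow> p \<notin> Bad F F'" by blast
 have single: "hset F = hset F'" if q: "q \<in> closed_segment x0 p" and F: "F \<in> ?\<F>" "F' \<in> ?\<F>" "q \<in> hset F" "q \<in> hset F'" for q F F'
 proof (rule ccontr)
  assume ne: "hset F \<noteq> hset F'"
  obtain n c n' c' where h: "hyp F = (n, c)" "hyp F' = (n', c')" by fastforce
  have n: "norm n = 1" "norm n' = 1" using hyp[OF F(1)] hyp[OF F(2)] h by auto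
  have qq: "n \<bullet> q = c" "n' \<bullet> q = c'" using F h by (auto simp: hset_def)
  have x: "n \<bullet> x0 \<noteq> c" "n' \<bullet> x0 \<noteq> c'" using x0(2)[OF F(1)] x0(2)[OF F(2)] h by (auto simp: hset_def)
  define be where "be = n' \<bullet> x0 - c'"
  define be' where "be' = n \<bullet> x0 - c"
  have m: "bm F F' = be *\<^sub>R n - be' *\<^sub>R n'" "bk F F' = be * c - be' * c'" by (auto simp: bm_def bk_def h be_def be'_def)
  have mq: "bm F F' \<bullet> q = bk F F'" unfolding m using qq by (simp add: inner_diff_left)
  have mx: "bm F F' \<bullet> x0 = bk F F'" unfolding m by (simp add: inner_diff_left be_def be'_def algebra_simps)
  have m0: "bm F F' \<noteq> 0"
  proof
   assume "bm F F' = 0"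
   then have "be *\<^sub>R n = be' *\<^sub>R n'" by (simp add: m)
   then have "n' = (be / be') *\<^sub>R n" using x by (simp add: be'_def divide_inverse) (metis (no_types, lifting) be'_def divideR_right mult.commute right_inverse_eq scaleR_scaleR divide_inverse eq_iff_diff_eq_0 inverse_eq_divide)
   then obtain a where a: "n' = a *\<^sub>R n" by blast
   have c': "c' = a * c" using qq a by auto
   have "a \<noteq> 0" using a n by auto
   then have "hset F = hset F'" unfolding hset_def h using a c' by auto
   then show False using ne by simp
  qed
  obtain t where t: "q = x0 + t *\<^sub>R (p - x0)" using q unfolding closed_segment_def by (auto simp: algebra_simps)
  have "t \<noteq> 0" using t qq x by auto
  have "t * (bm F F' \<bullet> (p - x0)) = 0" using mq mx unfolding t by (simp add: inner_add_right)
  then have "bm F F' \<bullet> p = bk F F'" using \<open>t \<noteq> 0\<close> mx by (simp add: inner_diff_right)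
  then show False using p(2)[OF F(1,2)] m0 by (simp add: Bad_def)
 qed
 have ex: "\<exists>k. locconst q k" if "q \<in> closed_segment x0 p" for q
  by (rule locconst_exists) (rule single[OF that])
 define w where "w q = (SOME k. locconst q k)" for q
 have w: "locconst q (w q)" if "q \<in> closed_segment x0 p" for q unfolding w_def using ex[OF that] by (rule someI_ex)
 have "w constant_on closed_segment x0 p"
 proof (rule locally_constant_imp_constant)
  show "connected (closed_segment x0 p)" by (rule connected_segment)
  fix a assume a: "a \<in> closed_segment x0 p"
  obtain r where r: "r > 0" "\<And>y k'. y \<in> ball a r \<Longrightarrow> locconst y k' \<Longrightarrow> k' = w a" using locconst_unique[OF w[OF a]] by blast
  show "\<exists>T. openin (top_of_set (closed_segment x0 p)) T \<and> a \<in> T \<and> (\<forall>x\<in>T. w x = w a)"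
   using r a w by (intro exI[of _ "closed_segment x0 p \<inter> ball a r"]) (auto intro!: openin_open_Int)
 qed
 then have "w x0 = w p" by (auto simp: constant_on_def)
 moreover have "w p = 0"
 proof -
  obtain e where "e > 0" "\<not> ball p e \<subseteq> D \<longrightarrow> w p = 0" using w[of p] unfolding locconst_def by auto
  then show ?thesis using p(1) centre_in_ball[of p e] by blast
 qed
 moreover have "w x0 = v T0"
 proof -
  obtain e where "e > 0" "interior T0 \<inter> ball x0 e \<noteq> {} \<longrightarrow> v T0 = w x0" using w[of x0] T0 unfolding locconst_def by auto
  then show ?thesis using x0(1) by auto
 qed
 ultimately show ?thesis by simp
qed

end

section \<open>The DG form and norm\<close>

text \<open>A globally continuously differentiable extension of \<open>v\<close> from the interior
  of \<open>T\<close>; traces of \<open>v\<close> and of its gradient are then plain values of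
  \<open>q\<close> and \<open>g\<close>.\<close>

definition C1rep :: "'a::euclidean_space set \<Rightarrow> ('a \<Rightarrow> real) \<Rightarrow> ('a \<Rightarrow> real) \<Rightarrow> ('a \<Rightarrow> 'a) \<Rightarrow> bool" where
 "C1rep T v q g \<longleftrightarrow> continuous_on UNIV g \<and> (\<forall>x. GDERIV q x :> g x) \<and> (\<forall>x\<in>interior T. v x = q x)"

definition pwC1 :: "'a::euclidean_space set set \<Rightarrow> ('a \<Rightarrow> real) \<Rightarrow> bool" where
 "pwC1 \<T> v \<longleftrightarrow> (\<forall>T\<in>\<T>. \<exists>q g. C1rep T v q g)"

lemma GDERIV_unique: "GDERIV f x :> a \<Longrightarrow> GDERIV f x :> b \<Longrightarrow> a = b"
proof -
 assume "GDERIV f x :> a" "GDERIV f x :> b"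
 then have "(\<lambda>h. h \<bullet> a) = (\<lambda>h. h \<bullet> b)" unfolding gderiv_def by (rule has_derivative_unique)
 then have "h \<bullet> a = h \<bullet> b" for h by metis
 then show "a = b" by (metis inner_commute vector_eq_rdot)
qed

lemma grad_eq: "GDERIV f x :> a \<Longrightarrow> grad f x = a"
 unfolding grad_def using GDERIV_unique by blast

lemma C1rep_grad: "C1rep T v q g \<Longrightarrow> x \<in> interior T \<Longrightarrow> grad v x = g x"
proof (rule grad_eq)
 assume r: "C1rep T v q g" and x: "x \<in> interior T"
 have "FDERIV q x :> (\<lambda>h. h \<bullet> g x)" using r unfolding C1rep_def gderiv_def by blast
 then show "GDERIV v x :> g x" unfolding gderiv_def
  by (rule has_derivative_transform_within_open[OF _ open_interior x]) (use r in \<open>auto simp: C1rep_def\<close>)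
qed

lemma C1rep_cont: "C1rep T v q g \<Longrightarrow> continuous_on A q" "C1rep T v q g \<Longrightarrow> continuous_on A g"
proof -
 assume r: "C1rep T v q g"
 have "isCont q x" for x
  using r has_derivative_continuous[of q "\<lambda>h. h \<bullet> g x" x UNIV] unfolding C1rep_def gderiv_def by auto
 then show "continuous_on A q" by (simp add: continuous_at_imp_continuous_on)
 show "continuous_on A g" using r unfolding C1rep_def by (auto intro: continuous_on_subset)
qed

lemma C1rep_sum:
 assumes "finite I" "\<And>i. i \<in> I \<Longrightarrow> C1rep T (\<phi> i) (q i) (g i)" "\<And>x. x \<in> interior T \<Longrightarrow> v x = (\<Sum>i\<in>I. c i * \<phi> i x)"
 shows "C1rep T v (\<lambda>x. \<Sum>i\<in>I. c i * q i x) (\<lambda>x. \<Sum>i\<in>I. c i *\<^sub>R g i x)"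
 unfolding C1rep_def
proof (intro conjI allI ballI)
 show "continuous_on UNIV (\<lambda>x. \<Sum>i\<in>I. c i *\<^sub>R g i x)"
  using assms(2) by (intro continuous_on_sum continuous_on_scaleR continuous_on_const C1rep_cont(2))
 fix x
 have "FDERIV (\<lambda>x. \<Sum>i\<in>I. c i * q i x) x :> (\<lambda>h. \<Sum>i\<in>I. c i * (h \<bullet> g i x))"
  using assms(2) by (intro has_derivative_sum has_derivative_mult_right) (auto simp: C1rep_def gderiv_def)
 then show "GDERIV (\<lambda>x. \<Sum>i\<in>I. c i * q i x) x :> (\<Sum>i\<in>I. c i *\<^sub>R g i x)"
  unfolding gderiv_def by (simp add: inner_sum_right)
next
 fix x assume "x \<in> interior T"
 then show "v x = (\<Sum>i\<in>I. c i * q i x)" using assms(2,3) by (auto simp: C1rep_def intro!: sum.cong)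
qed

lemma integral_add_mult:
 fixes f g h :: "'a \<Rightarrow> real"
 assumes "integrable M f" "integrable M g" "\<And>x. x \<in> space M \<Longrightarrow> h x = f x + c * g x"
 shows "(LINT x|M. h x) = (LINT x|M. f x) + c * (LINT x|M. g x)"
proof -
 have "(LINT x|M. h x) = (LINT x|M. f x + c * g x)" by (rule B_integral_cong) (simp_all add: assms(3))
 then show ?thesis using assms(1,2) by simp
qed

lemma integral_lincomb:
 fixes h :: "'a \<Rightarrow> real"
 assumes "\<And>i. i \<in> I \<Longrightarrow> integrable M (f i)" "\<And>x. x \<in> space M \<Longrightarrow> h x = (\<Sum>i\<in>I. c i * f i x)"
 shows "(LINT x|M. h x) = (\<Sum>i\<in>I. c i * (LINT x|M. f i x))"
proof -
 have "(LINT x|M. h x) = (LINT x|M. (\<Sum>i\<in>I. c i * f i x))" by (rule B_integral_cong) (simp_all add: assms(2))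
 then show ?thesis using assms(1) by (simp add: B_integral_sum)
qed

section \<open>Traces from the interior of an element\<close>

context dg_mesh
begin

definition tr :: "'a set \<Rightarrow> ('a \<Rightarrow> real) \<Rightarrow> 'a \<Rightarrow> real" where "tr T v x = elem_trace T v x"
definition G :: "'a set \<Rightarrow> ('a \<Rightarrow> real) \<Rightarrow> 'a \<Rightarrow> 'a" where "G T v x = elem_trace T (grad v) x"

lemma limpt: "T \<in> \<T> \<Longrightarrow> x \<in> T \<Longrightarrow> at x within interior T \<noteq> bot"
proof -
 assume T: "T \<in> \<T>" "x \<in> T"
 have "x \<in> closure (interior T)" using T elem_props(5) by simp
 then have "x islimpt interior T"
  using interior_limit_point[of x "interior T"] by (auto simp: closure_def)
 then show ?thesis by (simp add: trivial_limit_within)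
qed

lemma elem_trace_eq:
 assumes T: "T \<in> \<T>" "x \<in> T" and f: "continuous_on T f" "\<And>x. x \<in> interior T \<Longrightarrow> v x = f x"
 shows "elem_trace T v x = f x"
 unfolding elem_trace_def
proof (rule tendsto_Lim[OF limpt[OF T]])
 have "(f \<longlongrightarrow> f x) (at x within T)" using f(1) T(2) by (simp add: continuous_on_def)
 then have "(f \<longlongrightarrow> f x) (at x within interior T)" by (rule tendsto_within_subset) (rule interior_subset)
 then show "(v \<longlongrightarrow> f x) (at x within interior T)"
  by (rule Lim_transform_eventually) (auto simp: eventually_at_filter f(2))
qed

lemma tr_eq: "C1rep T v q g \<Longrightarrow> T \<in> \<T> \<Longrightarrow> x \<in> T \<Longrightarrow> tr T v x = q x"
 unfolding tr_def by (rule elem_trace_eq) (auto simp: C1rep_cont(1), simp add: C1rep_def)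

lemma G_eq: "C1rep T v q g \<Longrightarrow> T \<in> \<T> \<Longrightarrow> x \<in> T \<Longrightarrow> G T v x = g x"
 unfolding G_def by (rule elem_trace_eq) (auto simp: C1rep_cont(2) C1rep_grad)

lemma aG_eq:
 assumes v: "pwC1 \<T> v" and T: "T \<in> \<T>" "x \<in> T" and a: "continuous_on D a"
 shows "elem_trace T (\<lambda>x. a x *\<^sub>R grad v x) x = a x *\<^sub>R G T v x"
proof -
 obtain q g where r: "C1rep T v q g" using v T unfolding pwC1_def by blast
 have "continuous_on T a" using a elem_props(6)[OF T(1)] continuous_on_subset by blast
 then have "elem_trace T (\<lambda>x. a x *\<^sub>R grad v x) x = a x *\<^sub>R g x"
  using T by (intro elem_trace_eq[of T x "\<lambda>x. a x *\<^sub>R g x"] continuous_on_scaleR C1rep_cont(2)[OF r]) (auto simp: C1rep_grad[OF r])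
 then show ?thesis using G_eq[OF r T] by simp
qed

lemma tr_G_cont:
 assumes v: "pwC1 \<T> v" and T: "T \<in> \<T>"
 shows "continuous_on T (tr T v)" "continuous_on T (G T v)" "\<And>x. x \<in> interior T \<Longrightarrow> grad v x = G T v x"
proof -
 obtain q g where r: "C1rep T v q g" using v T unfolding pwC1_def by blast
 show "continuous_on T (tr T v)" using C1rep_cont(1)[OF r] tr_eq[OF r T] by (simp cong: continuous_on_cong)
 show "continuous_on T (G T v)" using C1rep_cont(2)[OF r] G_eq[OF r T] by (simp cong: continuous_on_cong)
 show "grad v x = G T v x" if "x \<in> interior T" for x
  using G_eq[OF r T subsetD[OF interior_subset that]] C1rep_grad[OF r that] by simp
qed

text \<open>Equality is asked in element interiors only, because members of the DG space are
  arbitrary on the skeleton.\<close>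

definition lincomb :: "('i \<Rightarrow> 'a \<Rightarrow> real) \<Rightarrow> 'i set \<Rightarrow> ('i \<Rightarrow> real) \<Rightarrow> ('a \<Rightarrow> real) \<Rightarrow> bool" where
 "lincomb \<phi> I c v \<longleftrightarrow> finite I \<and> (\<forall>i\<in>I. pwC1 \<T> (\<phi> i)) \<and> (\<forall>T\<in>\<T>. \<forall>x\<in>interior T. v x = (\<Sum>i\<in>I. c i * \<phi> i x))"

lemma lincomb_trace:
 assumes l: "lincomb \<phi> I c v"
 shows "pwC1 \<T> v" "T \<in> \<T> \<Longrightarrow> x \<in> T \<Longrightarrow> tr T v x = (\<Sum>i\<in>I. c i * tr T (\<phi> i) x)"
  "T \<in> \<T> \<Longrightarrow> x \<in> T \<Longrightarrow> G T v x = (\<Sum>i\<in>I. c i *\<^sub>R G T (\<phi> i) x)"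
proof -
 have "\<forall>i\<in>I. \<forall>T\<in>\<T>. \<exists>q g. C1rep T (\<phi> i) q g" using l unfolding lincomb_def pwC1_def by blast
 then obtain q g where r: "\<And>i T. i \<in> I \<Longrightarrow> T \<in> \<T> \<Longrightarrow> C1rep T (\<phi> i) (q i T) (g i T)" by metis
 have R: "C1rep T v (\<lambda>x. \<Sum>i\<in>I. c i * q i T x) (\<lambda>x. \<Sum>i\<in>I. c i *\<^sub>R g i T x)" if "T \<in> \<T>" for T
  using l r that unfolding lincomb_def by (intro C1rep_sum) auto
 then show "pwC1 \<T> v" unfolding pwC1_def by blast
 show "tr T v x = (\<Sum>i\<in>I. c i * tr T (\<phi> i) x)" if "T \<in> \<T>" "x \<in> T"
  using tr_eq[OF R that] tr_eq[OF r that] that by simp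
 show "G T v x = (\<Sum>i\<in>I. c i *\<^sub>R G T (\<phi> i) x)" if "T \<in> \<T>" "x \<in> T"
  using G_eq[OF R that] G_eq[OF r that] that by simp
qed

section \<open>Face measures and integrability\<close>

lemma face_hyp: "F \<in> mesh_faces \<T> \<Longrightarrow> \<exists>n c. norm n = 1 \<and> F \<subseteq> {x. n \<bullet> x = c} \<and> face_measure F = hyperplane_measure n c"
proof -
 assume "F \<in> mesh_faces \<T>"
 then obtain T where "F \<in> faces T" unfolding mesh_faces_def by blast
 then obtain n c C where "norm n = 1" "C \<in> components (flat_points T n c)" "F = closure C" using faces_obtain by blast
 then have "\<exists>\<mu>. \<exists>n c. norm n = 1 \<and> F \<subseteq> {x. n \<bullet> x = c} \<and> \<mu> = hyperplane_measure n c" using flat_component_subset[of C T n c] by blast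
 from someI_ex[OF this] show ?thesis unfolding face_measure_def by blast
qed

lemma face_compact: "F \<in> mesh_faces \<T> \<Longrightarrow> compact F"
proof -
 assume "F \<in> mesh_faces \<T>"
 then obtain T where T: "T \<in> \<T>" "F \<in> faces T" unfolding mesh_faces_def by blast
 then obtain C where "F = closure C" using faces_obtain by blast
 then have "closed F" by simp
 moreover have "F \<subseteq> T" using elem_props[OF T(1)] T(2) frontier_subset_closed by blast
 ultimately show ?thesis using elem_props(1)[OF T(1)] compact_Int_closed[of T F] by (simp add: Int_absorb1)
qed

lemma face_subset: "T \<in> adjacent \<T> F \<Longrightarrow> T \<in> \<T> \<and> F \<subseteq> T"
proof -
 assume "T \<in> adjacent \<T> F"
 then have T: "T \<in> \<T>" "F \<in> faces T" unfolding adjacent_def by auto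
 have "F \<subseteq> frontier T" unfolding elem_props(8)[OF T(1)] using T(2) by blast
 also have "\<dots> \<subseteq> T" by (rule frontier_subset_closed[OF elem_props(2)[OF T(1)]])
 finally show ?thesis using T(1) by simp
qed

lemma face_sets: "F \<in> mesh_faces \<T> \<Longrightarrow> sets (face_measure F) = sets borel"
 using face_hyp unfolding hyperplane_measure_def by fastforce

lemma proj_measurable: "(\<lambda>x. x - (n \<bullet> x - c) *\<^sub>R n) \<in> measurable (restrict_space lborel S) borel" for n :: 'a
 by (intro measurable_restrict_space1) simp

lemma hyperplane_emeasure:
 fixes n :: 'a
 assumes "A \<in> sets borel"
 shows "emeasure (hyperplane_measure n c) A = emeasure lborel {x. c \<le> n \<bullet> x \<and> n \<bullet> x \<le> c + 1 \<and> x - (n \<bullet> x - c) *\<^sub>R n \<in> A}"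
proof -
 let ?H = "{x. c \<le> n \<bullet> x \<and> n \<bullet> x \<le> c + 1}" and ?p = "\<lambda>x. x - (n \<bullet> x - c) *\<^sub>R n"
 have S: "?H \<in> sets borel" by measurable
 have "emeasure (hyperplane_measure n c) A = emeasure (restrict_space lborel ?H)
   (?p -` A \<inter> space (restrict_space lborel ?H))"
  unfolding hyperplane_measure_def using assms by (intro emeasure_distr proj_measurable) auto
 also have "\<dots> = emeasure lborel (?p -` A \<inter> ?H)"
  using S by (subst emeasure_restrict_space) (auto simp: space_restrict_space)
 also have "?p -` A \<inter> ?H =
   {x. c \<le> n \<bullet> x \<and> n \<bullet> x \<le> c + 1 \<and> x - (n \<bullet> x - c) *\<^sub>R n \<in> A}" by auto
 finally show ?thesis .
qed

text \<open>The measure is the volume of the unit-height prism over the face. It is finite because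
  the prism is bounded, and positive because the prism contains an open set above a relative disc of
  the flat component. Positivity later turns a vanishing jump integral into a vanishing
  jump.\<close>

lemma face_emeasure:
 assumes F: "F \<in> mesh_faces \<T>"
 shows "emeasure (face_measure F) F < \<infinity>" "emeasure (face_measure F) F > 0"
proof -
 obtain n c where n: "norm n = 1" "F \<subseteq> {x. n \<bullet> x = c}" "face_measure F = hyperplane_measure n c" using face_hyp[OF F] by blast
 have nn: "n \<bullet> n = 1" using n(1) by (simp add: norm_eq_1)
 have Fb: "F \<in> sets borel" using face_compact[OF F] by (intro borel_closed compact_imp_closed)
 let ?S = "{x. c \<le> n \<bullet> x \<and> n \<bullet> x \<le> c + 1 \<and> x - (n \<bullet> x - c) *\<^sub>R n \<in> F}"
 have Sm: "?S \<in> sets borel"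
 proof -
  have "(\<lambda>x. x - (n \<bullet> x - c) *\<^sub>R n) -` F \<inter> space borel \<in> sets borel" using Fb by (intro measurable_sets[of _ borel borel]) simp_all
  moreover have "{x. c \<le> n \<bullet> x \<and> n \<bullet> x \<le> c + 1} \<in> sets borel" by measurable
  moreover have "?S = ((\<lambda>x. x - (n \<bullet> x - c) *\<^sub>R n) -` F \<inter> space borel) \<inter> {x. c \<le> n \<bullet> x \<and> n \<bullet> x \<le> c + 1}" by auto
  ultimately show ?thesis by auto
 qed
 have eq: "emeasure (face_measure F) F = emeasure lborel ?S" unfolding n(3) by (rule hyperplane_emeasure[OF Fb])
 obtain B where B: "\<And>x. x \<in> F \<Longrightarrow> norm x \<le> B" using compact_imp_bounded[OF face_compact[OF F]] bounded_iff by blast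
 have "?S \<subseteq> cball 0 (B + 1)"
 proof
  fix x assume x: "x \<in> ?S"
  have "norm x \<le> norm (x - (n \<bullet> x - c) *\<^sub>R n) + norm ((n \<bullet> x - c) *\<^sub>R n)"
   using norm_triangle_ineq[of "x - (n \<bullet> x - c) *\<^sub>R n" "(n \<bullet> x - c) *\<^sub>R n"] by simp
  also have "\<dots> \<le> B + 1" using B[of "x - (n \<bullet> x - c) *\<^sub>R n"] x n(1) by (intro add_mono) auto
  finally show "x \<in> cball 0 (B + 1)" by simp
 qed
 then have "emeasure lborel ?S \<le> emeasure lborel (cball (0::'a) (B + 1))" by (intro emeasure_mono) auto
 also have "\<dots> < \<infinity>" using emeasure_lborel_cball_finite .
 finally show "emeasure (face_measure F) F < \<infinity>" unfolding eq .
 obtain T where "F \<in> faces T" using F unfolding mesh_faces_def by blast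
 then obtain n' c' C where C: "norm n' = 1" "C \<in> components (flat_points T n' c')" "F = closure C" using faces_obtain by blast
 obtain x where x: "x \<in> C" using in_components_nonempty[OF C(2)] by blast
 obtain e where e: "e > 0" "ball x e \<inter> {z. n' \<bullet> z = c'} \<subseteq> C" using flat_component_open[OF C(2) x] by blast
 have "(n = n' \<and> c = c') \<or> (n = - n' \<and> c = - c')" by (rule face_hyperplane_unique[OF C(1) n(1) C(2)]) (use n(2) C(3) in simp)
 then have H: "{z. n' \<bullet> z = c'} = {z. n \<bullet> z = c}" by (elim disjE conjE) simp_all
 have xc: "n \<bullet> x = c" using x C(3) n(2) closure_subset by blast
 let ?U = "{z. c < n \<bullet> z \<and> n \<bullet> z < c + 1 \<and> z - (n \<bullet> z - c) *\<^sub>R n \<in> ball x e}"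
 have "open ?U"
 proof -
  have "?U = {z. c < n \<bullet> z} \<inter> {z. n \<bullet> z < c + 1} \<inter> (\<lambda>z. z - (n \<bullet> z - c) *\<^sub>R n) -` ball x e" by auto
  moreover have "open ((\<lambda>z. z - (n \<bullet> z - c) *\<^sub>R n) -` ball x e)" by (intro open_vimage open_ball continuous_intros)
  ultimately show ?thesis by (auto intro!: open_Int open_halfspace_lt open_halfspace_gt)
 qed
 moreover have "x + (1/2) *\<^sub>R n \<in> ?U" using xc nn e(1) by (simp add: inner_add_right)
 ultimately have "emeasure lborel ?U > 0"
  using open_not_negligible[of ?U] by (auto simp: zero_less_iff_neq_zero negligible_iff_null_sets null_sets_def)
 also have "emeasure lborel ?U \<le> emeasure lborel ?S"
 proof (rule emeasure_mono)
  show "?U \<subseteq> ?S"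
  proof
   fix z assume z: "z \<in> ?U"
   have "n \<bullet> (z - (n \<bullet> z - c) *\<^sub>R n) = c" using nn by (simp add: inner_diff_right)
   then have "z - (n \<bullet> z - c) *\<^sub>R n \<in> C" using z e(2) H by auto
   then show "z \<in> ?S" using z C(3) closure_subset by auto
  qed
 qed (use Sm in simp)
 finally show "emeasure (face_measure F) F > 0" unfolding eq .
qed

lemma face_integrable:
 fixes f :: "'a \<Rightarrow> real"
 assumes F: "F \<in> mesh_faces \<T>" and f: "continuous_on F f"
 shows "set_integrable (face_measure F) F f"
proof -
 have Fb: "F \<in> sets borel" using face_compact[OF F] by (intro borel_closed compact_imp_closed)
 obtain B where B: "\<And>x. x \<in> F \<Longrightarrow> norm (f x) \<le> B"
  using compact_imp_bounded[OF compact_continuous_image[OF f face_compact[OF F]]] unfolding bounded_iff by auto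
 have m: "(\<lambda>x. indicator F x *\<^sub>R f x) \<in> borel_measurable (face_measure F)"
  using borel_measurable_continuous_on_indicator[OF Fb f] by (simp add: measurable_cong_sets[OF face_sets[OF F] refl])
 have "integrable (face_measure F) (\<lambda>x. indicator F x *\<^sub>R (indicator F x *\<^sub>R f x))"
  by (rule integrableI_bounded_set_indicator[OF _ m face_emeasure(1)[OF F], of B])
   (use B Fb face_sets[OF F] in auto)
 moreover have e: "indicator F x *\<^sub>R (indicator F x *\<^sub>R f x) = indicator F x *\<^sub>R f x" for x by (simp add: indicator_def)
 ultimately show ?thesis unfolding set_integrable_def e by simp
qed

lemma elem_integrable:
 fixes f :: "'a \<Rightarrow> real"
 assumes T: "T \<in> \<T>" and f: "continuous_on T f"
 shows "integrable (lebesgue_on T) f"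
proof -
 obtain B where B: "\<And>x. x \<in> T \<Longrightarrow> norm (f x) \<le> B"
  using compact_imp_bounded[OF compact_continuous_image[OF f elem_props(1)[OF T]]] unfolding bounded_iff by auto
 have "f \<in> borel_measurable (lebesgue_on T)" by (rule continuous_imp_measurable_on_sets_lebesgue[OF f elem_props(9)[OF T]])
 moreover have "finite_measure (lebesgue_on T)" by (rule finite_measure_lebesgue_on[OF elem_props(10)[OF T]])
 ultimately show ?thesis using B by (intro finite_measure.integrable_const_bound[of _ f B]) (auto intro!: AE_I2)
qed

text \<open>The frontier is a finite union of faces, each contained in a hyperplane.\<close>

lemma AE_interior:
 assumes T: "T \<in> \<T>" shows "AE x in lebesgue_on T. x \<in> interior T"
proof -
 have "negligible (frontier T)"
  unfolding elem_props(8)[OF T]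
 proof (rule negligible_Union[OF elem_props(7)[OF T]])
  fix F assume "F \<in> faces T"
  then obtain n c C where C: "norm n = 1" "C \<in> components (flat_points T n c)" "F = closure C" using faces_obtain by blast
  then have "F \<subseteq> {x. n \<bullet> x = c}" using flat_component_subset by blast
  moreover have "n \<noteq> 0" using C(1) by auto
  ultimately show "negligible F" using negligible_subset[OF negligible_hyperplane[of n c]] by blast
 qed
 then have "frontier T \<in> null_sets lebesgue" by (simp add: negligible_iff_null_sets)
 then have "AE x in lebesgue. x \<notin> frontier T" by (rule AE_not_in)
 then have "AE x in lebesgue. x \<in> T \<longrightarrow> x \<in> interior T"
  by (rule AE_mp) (use elem_props(2)[OF T] in \<open>auto simp: frontier_def\<close>)
 then show ?thesis using elem_props(9)[OF T] by (subst AE_restrict_space_iff) auto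
qed

section \<open>Jumps, averages and linearity of the DG form\<close>

definition J :: "'a set \<Rightarrow> ('a \<Rightarrow> real) \<Rightarrow> 'a \<Rightarrow> 'a" where
 "J F v x = (\<Sum>T\<in>adjacent \<T> F. tr T v x *\<^sub>R outer_normal T F)"
definition Av :: "'a set \<Rightarrow> ('a \<Rightarrow> real) \<Rightarrow> 'a \<Rightarrow> 'a" where
 "Av F v x = (1 / real (card (adjacent \<T> F))) *\<^sub>R (\<Sum>T\<in>adjacent \<T> F. G T v x)"

lemma J_Av_cont:
 assumes v: "pwC1 \<T> v"
 shows "continuous_on F (J F v)" "continuous_on F (Av F v)"
proof -
 have "continuous_on F (tr T v)" "continuous_on F (G T v)" if "T \<in> adjacent \<T> F" for T
  using face_subset[OF that] tr_G_cont[OF v, of T] continuous_on_subset by blast+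
 then show "continuous_on F (J F v)" "continuous_on F (Av F v)"
  unfolding J_def[abs_def] Av_def[abs_def] by (auto intro!: continuous_intros)
qed

lemma jump_eq: "jump \<T> F v x = J F v x" unfolding jump_def J_def tr_def ..

lemma average_eq:
 assumes v: "pwC1 \<T> v" and a: "continuous_on D a" and x: "x \<in> F"
 shows "average \<T> F (\<lambda>x. a x *\<^sub>R grad v x) x = a x *\<^sub>R Av F v x"
proof -
 have "(\<Sum>T\<in>adjacent \<T> F. elem_trace T (\<lambda>x. a x *\<^sub>R grad v x) x) = (\<Sum>T\<in>adjacent \<T> F. a x *\<^sub>R G T v x)"
  using face_subset x by (intro sum.cong refl aG_eq v a) auto
 then show ?thesis unfolding average_def Av_def by (simp add: scaleR_sum_right[symmetric] mult.commute)
qed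

lemma J_Av_lincomb:
 assumes l: "lincomb \<phi> I c v" and x: "x \<in> F"
 shows "J F v x = (\<Sum>i\<in>I. c i *\<^sub>R J F (\<phi> i) x)" "Av F v x = (\<Sum>i\<in>I. c i *\<^sub>R Av F (\<phi> i) x)"
proof -
 have "J F v x = (\<Sum>T\<in>adjacent \<T> F. (\<Sum>i\<in>I. c i * tr T (\<phi> i) x) *\<^sub>R outer_normal T F)"
  unfolding J_def using face_subset x by (intro sum.cong refl arg_cong2[of _ _ _ _ "(*\<^sub>R)"] lincomb_trace(2)[OF l]) auto
 also have "\<dots> = (\<Sum>i\<in>I. c i *\<^sub>R J F (\<phi> i) x)"
  unfolding J_def scaleR_sum_right scaleR_sum_left by (subst sum.swap) simp
 finally show "J F v x = (\<Sum>i\<in>I. c i *\<^sub>R J F (\<phi> i) x)" .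
 have "(\<Sum>T\<in>adjacent \<T> F. G T v x) = (\<Sum>T\<in>adjacent \<T> F. \<Sum>i\<in>I. c i *\<^sub>R G T (\<phi> i) x)"
  using face_subset x by (intro sum.cong refl lincomb_trace(3)[OF l]) auto
 also have "\<dots> = (\<Sum>i\<in>I. c i *\<^sub>R (\<Sum>T\<in>adjacent \<T> F. G T (\<phi> i) x))"
  unfolding scaleR_sum_right by (rule sum.swap)
 finally show "Av F v x = (\<Sum>i\<in>I. c i *\<^sub>R Av F (\<phi> i) x)"
  unfolding Av_def by (simp add: scaleR_sum_right mult.commute)
qed

definition ff :: "real \<Rightarrow> real \<Rightarrow> ('a \<Rightarrow> real) \<Rightarrow> ('a \<Rightarrow> real) \<Rightarrow> ('a \<Rightarrow> real) \<Rightarrow> 'a set \<Rightarrow> 'a \<Rightarrow> real" where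
 "ff \<theta> \<eta> a w v F x = \<theta> * (a x *\<^sub>R Av F v x \<bullet> J F w x) - a x *\<^sub>R Av F w x \<bullet> J F v x + \<eta> / face_size \<T> F * (J F w x \<bullet> J F v x)"

text \<open>Nothing is assumed about \<open>g\<close> on the boundary of \<open>T\<close>, not even
  measurability: completeness of Lebesgue measure supplies it.\<close>

lemma elem_integral_cong:
 fixes f g :: "'a \<Rightarrow> real"
 assumes T: "T \<in> \<T>" and f: "continuous_on T f" and eq: "\<And>x. x \<in> interior T \<Longrightarrow> g x = f x"
 shows "integrable (lebesgue_on T) g" "(LINT x|lebesgue_on T. g x) = (LINT x|lebesgue_on T. f x)"
proof -
 have m: "T \<inter> space lebesgue \<in> sets lebesgue" using elem_props(9)[OF T] by simp
 have i: "integrable lebesgue (\<lambda>x. indicator T x *\<^sub>R f x)"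
  using elem_integrable[OF T f] unfolding integrable_restrict_space[OF m] .
 have "AE x in lebesgue. x \<in> T \<longrightarrow> x \<in> interior T" using AE_interior[OF T] by (simp add: AE_restrict_space_iff[OF m])
 then have ae: "AE x in lebesgue. indicator T x *\<^sub>R f x = indicator T x *\<^sub>R g x"
  by eventually_elim (auto simp: indicator_def eq)
 have mg: "(\<lambda>x. indicator T x *\<^sub>R g x) \<in> borel_measurable lebesgue"
  by (rule borel_measurable_AE[OF borel_measurable_integrable[OF i] ae])
 show "integrable (lebesgue_on T) g"
  unfolding integrable_restrict_space[OF m] using i mg ae by (rule integrable_cong_AE_imp)
 show "(LINT x|lebesgue_on T. g x) = (LINT x|lebesgue_on T. f x)"
  unfolding integral_restrict_space[OF m]
  by (rule integral_cong_AE[OF mg borel_measurable_integrable[OF i]]) (use ae in \<open>auto elim: eventually_mono\<close>)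
qed

lemma DG_form_eq:
 assumes w: "pwC1 \<T> w" and v: "pwC1 \<T> v" and a: "continuous_on D a"
 shows "DG_form \<T> \<theta> \<eta> a w v = (\<Sum>T\<in>\<T>. LINT x|lebesgue_on T. a x * (G T w x \<bullet> G T v x)) +
  (\<Sum>F\<in>mesh_faces \<T>. LINT x:F|face_measure F. ff \<theta> \<eta> a w v F x)"
proof -
 have "(LINT x|lebesgue_on T. a x * (grad w x \<bullet> grad v x)) = (LINT x|lebesgue_on T. a x * (G T w x \<bullet> G T v x))" if T: "T \<in> \<T>" for T
 proof (rule elem_integral_cong(2)[OF T])
  have aT: "continuous_on T a" using a elem_props(6)[OF T] continuous_on_subset by blast
  show "continuous_on T (\<lambda>x. a x * (G T w x \<bullet> G T v x))"
   using tr_G_cont(2)[OF w T] tr_G_cont(2)[OF v T] by (intro continuous_intros aT)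
 qed (simp add: tr_G_cont(3)[OF w T] tr_G_cont(3)[OF v T])
 moreover have "(LINT x:F|face_measure F.
    \<theta> * (average \<T> F (\<lambda>x. a x *\<^sub>R grad v x) x \<bullet> jump \<T> F w x)
    - average \<T> F (\<lambda>x. a x *\<^sub>R grad w x) x \<bullet> jump \<T> F v x
    + \<eta> / face_size \<T> F * (jump \<T> F w x \<bullet> jump \<T> F v x)) = (LINT x:F|face_measure F. ff \<theta> \<eta> a w v F x)" for F
  unfolding set_lebesgue_integral_def
  by (rule B_integral_cong) (auto simp: indicator_def ff_def jump_eq average_eq[OF v a] average_eq[OF w a])
 ultimately show ?thesis unfolding DG_form_def by simp
qed

lemma ff_cont:
 assumes "pwC1 \<T> w" "pwC1 \<T> v" "continuous_on D a" "F \<in> mesh_faces \<T>"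
 shows "continuous_on F (ff \<theta> \<eta> a w v F)"
proof -
 obtain T where "T \<in> adjacent \<T> F" using assms(4) unfolding mesh_faces_def adjacent_def by blast
 then have "F \<subseteq> D" using face_subset elem_props(6) by blast
 then have "continuous_on F a" using assms(3) continuous_on_subset by blast
 then show ?thesis unfolding ff_def[abs_def] using J_Av_cont[OF assms(1)] J_Av_cont[OF assms(2)]
  by (intro continuous_intros)
qed

lemma DG_form_lincomb:
 assumes l: "lincomb \<phi> I c w" and v: "pwC1 \<T> v" and a: "continuous_on D a"
 shows "DG_form \<T> \<theta> \<eta> a w v = (\<Sum>i\<in>I. c i * DG_form \<T> \<theta> \<eta> a (\<phi> i) v)"
  "DG_form \<T> \<theta> \<eta> a v w = (\<Sum>i\<in>I. c i * DG_form \<T> \<theta> \<eta> a v (\<phi> i))"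
proof -
 have p: "\<And>i. i \<in> I \<Longrightarrow> pwC1 \<T> (\<phi> i)" using l unfolding lincomb_def by auto
 note w = lincomb_trace(1)[OF l]
 let ?V = "\<lambda>T z. LINT x|lebesgue_on T. a x * (G T v x \<bullet> G T z x)" and ?F = "\<lambda>F z z'. LINT x:F|face_measure F. ff \<theta> \<eta> a z z' F x"
 have aT: "continuous_on T a" if "T \<in> \<T>" for T using a elem_props(6)[OF that] continuous_on_subset by blast
 have vol: "?V T w = (\<Sum>i\<in>I. c i * ?V T (\<phi> i))" if T: "T \<in> \<T>" for T
 proof (rule integral_lincomb)
  show "integrable (lebesgue_on T) (\<lambda>x. a x * (G T v x \<bullet> G T (\<phi> i) x))" if "i \<in> I" for i
   using tr_G_cont(2)[OF v T] tr_G_cont(2)[OF p[OF that] T] by (intro elem_integrable[OF T] continuous_intros aT T)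
 qed (simp add: lincomb_trace(3)[OF l T] inner_sum_right sum_distrib_left mult.left_commute)
 have ffl: "ff \<theta> \<eta> a v w F x = (\<Sum>i\<in>I. c i * ff \<theta> \<eta> a v (\<phi> i) F x)" "ff \<theta> \<eta> a w v F x = (\<Sum>i\<in>I. c i * ff \<theta> \<eta> a (\<phi> i) v F x)" if "x \<in> F" for x F
  unfolding ff_def J_Av_lincomb[OF l that]
  by (simp_all add: inner_sum_right inner_sum_left sum_distrib_left sum_subtractf sum.distrib algebra_simps)
 have face: "?F F v w = (\<Sum>i\<in>I. c i * ?F F v (\<phi> i))" "?F F w v = (\<Sum>i\<in>I. c i * ?F F (\<phi> i) v)" if F: "F \<in> mesh_faces \<T>" for F
  unfolding set_lebesgue_integral_def
  by (rule integral_lincomb, rule face_integrable[unfolded set_integrable_def, OF F ff_cont];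
    auto simp: indicator_def ffl intro: v p a F)+
 have sw: "(\<Sum>T\<in>\<T>. \<Sum>i\<in>I. c i * g i T) + (\<Sum>F\<in>mesh_faces \<T>. \<Sum>i\<in>I. c i * k i F) = (\<Sum>i\<in>I. c i * ((\<Sum>T\<in>\<T>. g i T) + (\<Sum>F\<in>mesh_faces \<T>. k i F)))" for g k
  unfolding distrib_left sum.distrib sum_distrib_left by (intro arg_cong2[of _ _ _ _ "(+)"] sum.swap)
 show "DG_form \<T> \<theta> \<eta> a v w = (\<Sum>i\<in>I. c i * DG_form \<T> \<theta> \<eta> a v (\<phi> i))"
  unfolding DG_form_eq[OF v w a] by (simp add: vol face sw DG_form_eq[OF v p a])
 show "DG_form \<T> \<theta> \<eta> a w v = (\<Sum>i\<in>I. c i * DG_form \<T> \<theta> \<eta> a (\<phi> i) v)"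
  unfolding DG_form_eq[OF w v a] inner_commute[of "G _ w _"] by (simp add: vol face sw DG_form_eq[OF p v a] inner_commute[of "G _ (\<phi> _) _"])
qed

text \<open>The penalty term does not involve the coefficient, hence the penalty \<open>0\<close> in the summands.\<close>

lemma DG_form_affine:
 fixes s :: nat
 assumes w: "pwC1 \<T> w" and v: "pwC1 \<T> v" and a: "continuous_on D a0" "\<And>l. l < s \<Longrightarrow> continuous_on D (\<psi> l)"
 shows "DG_form \<T> \<theta> \<eta> (\<lambda>x. a0 x + (\<Sum>l<s. y l * \<psi> l x)) w v = DG_form \<T> \<theta> \<eta> a0 w v + (\<Sum>l<s. y l * DG_form \<T> \<theta> 0 (\<psi> l) w v)"
 using a(2)
proof (induction s)
 case (Suc s)
 let ?a = "\<lambda>x. a0 x + (\<Sum>l<s. y l * \<psi> l x)"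
 have ac: "continuous_on D ?a" using a(1) Suc.prems by (intro continuous_intros) auto
 have pc: "continuous_on D (\<psi> s)" using Suc.prems by simp
 have apc: "continuous_on D (\<lambda>x. ?a x + y s * \<psi> s x)" by (intro continuous_intros ac pc)
 have vol: "(LINT x|lebesgue_on T. (?a x + y s * \<psi> s x) * (G T w x \<bullet> G T v x)) =
   (LINT x|lebesgue_on T. ?a x * (G T w x \<bullet> G T v x)) + y s * (LINT x|lebesgue_on T. \<psi> s x * (G T w x \<bullet> G T v x))" if T: "T \<in> \<T>" for T
 proof -
  have c: "continuous_on T ?a" "continuous_on T (\<psi> s)" using ac pc elem_props(6)[OF T] continuous_on_subset by blast+
  have g: "continuous_on T (\<lambda>x. G T w x \<bullet> G T v x)" by (intro continuous_on_inner tr_G_cont(2) w v T)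
  have "integrable (lebesgue_on T) (\<lambda>x. ?a x * (G T w x \<bullet> G T v x))" and "integrable (lebesgue_on T) (\<lambda>x. \<psi> s x * (G T w x \<bullet> G T v x))"
   by (rule elem_integrable[OF T continuous_on_mult[OF c(1) g]], rule elem_integrable[OF T continuous_on_mult[OF c(2) g]])
  then show ?thesis by (rule integral_add_mult) (simp add: algebra_simps)
 qed
 have face: "(LINT x:F|face_measure F. ff \<theta> \<eta> (\<lambda>x. ?a x + y s * \<psi> s x) w v F x) =
   (LINT x:F|face_measure F. ff \<theta> \<eta> ?a w v F x) + y s * (LINT x:F|face_measure F. ff \<theta> 0 (\<psi> s) w v F x)" if F: "F \<in> mesh_faces \<T>" for F
 proof -
  have "set_integrable (face_measure F) F (ff \<theta> \<eta> ?a w v F)" "set_integrable (face_measure F) F (ff \<theta> 0 (\<psi> s) w v F)"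
   by (intro face_integrable ff_cont w v F ac pc)+
  then show ?thesis unfolding set_integrable_def set_lebesgue_integral_def
   by (rule integral_add_mult) (simp add: ff_def algebra_simps)
 qed
 have "DG_form \<T> \<theta> \<eta> (\<lambda>x. ?a x + y s * \<psi> s x) w v = DG_form \<T> \<theta> \<eta> ?a w v + y s * DG_form \<T> \<theta> 0 (\<psi> s) w v"
  unfolding DG_form_eq[OF w v apc] DG_form_eq[OF w v ac] DG_form_eq[OF w v pc] using vol face
  by (simp add: sum.distrib sum_distrib_left distrib_left)
 then show ?case using Suc by (simp add: add.assoc)
qed simp

text \<open>In dimension one the size is the diameter of an element, which contains a ball. In
  higher dimension the face contains a relative disc, and some direction is orthogonal to its
  normal.\<close>

lemma face_size_nonneg: "F \<in> mesh_faces \<T> \<Longrightarrow> face_size \<T> F > 0"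
proof -
 assume F: "F \<in> mesh_faces \<T>"
 then obtain T where T: "T \<in> adjacent \<T> F" unfolding mesh_faces_def adjacent_def by blast
 show ?thesis
 proof (cases "DIM('a) = 1")
  case True
  have "diameter T' > 0" if "T' \<in> adjacent \<T> F" for T'
  proof -
   have T': "T' \<in> \<T>" using that face_subset by blast
   obtain x where "x \<in> interior T'" using elem_props(3)[OF T'] by blast
   then obtain e where e: "e > 0" "cball x e \<subseteq> T'" unfolding mem_interior_cball by blast
   have "diameter (cball x e) \<le> diameter T'"
    by (rule diameter_subset[OF e(2) compact_imp_bounded[OF elem_props(1)[OF T']]])
   then show ?thesis using e(1) by simp
  qed
  moreover have "finite (adjacent \<T> F)" using fin by (simp add: adjacent_def)
  ultimately have "Min (diameter ` adjacent \<T> F) > 0" using T by (subst Min_gr_iff) auto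
  then show ?thesis unfolding face_size_def using True by simp
 next
  case False
  have "bounded F" using face_compact[OF F] compact_imp_bounded by blast
  have "F \<in> faces T" using T unfolding adjacent_def by blast
  then obtain n c C where C: "norm n = 1" "C \<in> components (flat_points T n c)" "F = closure C" using faces_obtain by blast
  obtain x where x: "x \<in> C" using in_components_nonempty[OF C(2)] by blast
  obtain e where e: "e > 0" "ball x e \<inter> {z. n \<bullet> z = c} \<subseteq> C" using flat_component_open[OF C(2) x] by blast
  have "2 \<le> DIM('a)" using False DIM_positive[where 'a='a] by linarith
  then obtain w where w: "w \<noteq> 0" "orthogonal n w" using orthogonal_to_vector_exists[of n] by blast
  define z where "z = x + (e / 2 / norm w) *\<^sub>R w"
  have xc: "n \<bullet> x = c" using x in_components_subset[OF C(2)] flat_pointsD(1) by blast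
  have "dist x z = e / 2" using w(1) e(1) by (simp add: z_def dist_norm)
  moreover have "n \<bullet> z = c" using w(2) xc by (simp add: z_def inner_add_right orthogonal_def)
  ultimately have "z \<in> C" using e by auto
  then have "dist x z \<le> diameter F" using x C(3) closure_subset[of C] by (intro diameter_bounded_bound[OF \<open>bounded F\<close>]) auto
  then show ?thesis unfolding face_size_def using False \<open>dist x z = e / 2\<close> e(1) by simp
 qed
qed

section \<open>Monotonicity and definiteness of the DG norm\<close>

definition vol :: "'a set \<Rightarrow> ('a \<Rightarrow> real) \<Rightarrow> ('a \<Rightarrow> real) \<Rightarrow> real" where
 "vol T a v = (LINT x|lebesgue_on T. a x * (G T v x \<bullet> G T v x))"
definition pen :: "real \<Rightarrow> 'a set \<Rightarrow> ('a \<Rightarrow> real) \<Rightarrow> real" where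
 "pen \<eta> F v = \<eta> / face_size \<T> F * (LINT x:F|face_measure F. J F v x \<bullet> J F v x)"

text \<open>For equal arguments the choice \<theta> = 1 cancels the two consistency terms. The
  squared norm is therefore a DG form itself and inherits bilinearity.\<close>

lemma DG_norm_sq:
 assumes v: "pwC1 \<T> v" and a: "continuous_on D a" "\<And>x. x \<in> D \<Longrightarrow> a x \<ge> 0" and \<eta>: "\<eta> \<ge> 0"
 shows "(DG_norm \<T> \<eta> a v)\<^sup>2 = (\<Sum>T\<in>\<T>. vol T a v) + (\<Sum>F\<in>mesh_faces \<T>. pen \<eta> F v)"
  "(DG_norm \<T> \<eta> a v)\<^sup>2 = DG_form \<T> 1 \<eta> a v v"
proof -
 have vol: "(L2_norm T (\<lambda>x. sqrt (a x) *\<^sub>R grad v x))\<^sup>2 = vol T a v" if T: "T \<in> \<T>" for T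
 proof -
  have aT: "continuous_on T a" using a(1) elem_props(6)[OF T] continuous_on_subset by blast
  have "(L2_norm T (\<lambda>x. sqrt (a x) *\<^sub>R grad v x))\<^sup>2 = (LINT x|lebesgue_on T. (norm (sqrt (a x) *\<^sub>R grad v x))\<^sup>2)"
   unfolding L2_norm_def by (intro real_sqrt_pow2 integral_nonneg_AE) simp
  also have "\<dots> = vol T a v"
   unfolding vol_def
  proof (rule elem_integral_cong(2)[OF T])
   show "continuous_on T (\<lambda>x. a x * (G T v x \<bullet> G T v x))"
    using tr_G_cont(2)[OF v T] by (intro continuous_intros aT)
   fix x assume x: "x \<in> interior T"
   then have "a x \<ge> 0" using a(2) elem_props(6)[OF T] interior_subset by blast
   then show "(norm (sqrt (a x) *\<^sub>R grad v x))\<^sup>2 = a x * (G T v x \<bullet> G T v x)"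
    by (simp add: power_mult_distrib tr_G_cont(3)[OF v T x] dot_square_norm)
  qed
  finally show ?thesis .
 qed
 have "(DG_norm \<T> \<eta> a v)\<^sup>2 = (\<Sum>T\<in>\<T>. (L2_norm T (\<lambda>x. sqrt (a x) *\<^sub>R grad v x))\<^sup>2) +
   (\<Sum>F\<in>mesh_faces \<T>. \<eta> / face_size \<T> F * (LINT x:F|face_measure F. (norm (jump \<T> F v x))\<^sup>2))"
  unfolding DG_norm_def
  by (intro real_sqrt_pow2 add_nonneg_nonneg sum_nonneg mult_nonneg_nonneg divide_nonneg_nonneg \<eta> less_imp_le[OF face_size_nonneg])
   (auto simp: set_lebesgue_integral_def intro!: integral_nonneg_AE)
 also have "\<dots> = (\<Sum>T\<in>\<T>. vol T a v) + (\<Sum>F\<in>mesh_faces \<T>. pen \<eta> F v)"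
  using vol by (simp add: jump_eq pen_def dot_square_norm)
 finally show 1: "(DG_norm \<T> \<eta> a v)\<^sup>2 = (\<Sum>T\<in>\<T>. vol T a v) + (\<Sum>F\<in>mesh_faces \<T>. pen \<eta> F v)" .
 show "(DG_norm \<T> \<eta> a v)\<^sup>2 = DG_form \<T> 1 \<eta> a v v"
  unfolding 1 DG_form_eq[OF v v a(1)] ff_def[abs_def] vol_def pen_def by (simp add: set_lebesgue_integral_def mult.left_commute[of "indicator _ _"])
qed

text \<open>Allows the parametric coefficient to be replaced by its constant lower bound, which
  gives a norm independent of the parameters.\<close>

lemma DG_norm_mono:
 assumes v: "pwC1 \<T> v" and a: "continuous_on D a" "\<And>x. x \<in> D \<Longrightarrow> a x \<ge> m" and m: "m \<ge> 0" and \<eta>: "\<eta> \<ge> 0"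
 shows "(DG_norm \<T> \<eta> (\<lambda>_. m) v)\<^sup>2 \<le> (DG_norm \<T> \<eta> a v)\<^sup>2"
proof -
 have a0: "x \<in> D \<Longrightarrow> a x \<ge> 0" for x using a(2)[of x] m by linarith
 have "vol T (\<lambda>_. m) v \<le> vol T a v" if T: "T \<in> \<T>" for T
  unfolding vol_def
 proof (rule integral_mono)
  have aT: "continuous_on T a" using a(1) elem_props(6)[OF T] continuous_on_subset by blast
  show "integrable (lebesgue_on T) (\<lambda>x. m * (G T v x \<bullet> G T v x))" "integrable (lebesgue_on T) (\<lambda>x. a x * (G T v x \<bullet> G T v x))"
   using tr_G_cont(2)[OF v T] by (intro elem_integrable[OF T] continuous_intros aT; assumption)+
  show "m * (G T v x \<bullet> G T v x) \<le> a x * (G T v x \<bullet> G T v x)" if "x \<in> space (lebesgue_on T)" for x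
   using that a(2)[of x] elem_props(6)[OF T] by (intro mult_right_mono) auto
 qed
 then show ?thesis
  using DG_norm_sq(1)[OF v a(1) a0 \<eta>] DG_norm_sq(1)[OF v continuous_on_const m \<eta>] by (simp only: add_le_cancel_right sum_mono)
qed

text \<open>Vanishing volume terms make the gradient zero, so the function is constant on each
  connected element interior. Its jump is then constant along each face and, the face having
  positive measure, zero. The geometric result \<open>values_zero\<close> finishes.\<close>

lemma DG_norm_definite:
 assumes v: "pwC1 \<T> v" and m: "m > 0" and \<eta>: "\<eta> > 0" and z: "DG_norm \<T> \<eta> (\<lambda>_. m) v = 0" and T0: "T0 \<in> \<T>" "x0 \<in> interior T0"
 shows "v x0 = 0"
proof -
 have vol0: "vol T (\<lambda>_. m) v \<ge> 0" for T unfolding vol_def using m by (intro integral_nonneg_AE) simp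
 have face0: "pen \<eta> F v \<ge> 0" if "F \<in> mesh_faces \<T>" for F
  unfolding pen_def using \<eta> face_size_nonneg[OF that] by (intro mult_nonneg_nonneg) (auto simp: set_lebesgue_integral_def intro!: integral_nonneg_AE)
 have sum0: "(\<Sum>T\<in>\<T>. vol T (\<lambda>_. m) v) + (\<Sum>F\<in>mesh_faces \<T>. pen \<eta> F v) = 0"
  using DG_norm_sq(1)[OF v continuous_on_const, of m \<eta>] z m \<eta> by simp
 have nn: "(\<Sum>T\<in>\<T>. vol T (\<lambda>_. m) v) \<ge> 0"
   "(\<Sum>F\<in>mesh_faces \<T>. pen \<eta> F v) \<ge> 0"
  by (intro sum_nonneg vol0 face0; assumption)+
 have s1: "(\<Sum>T\<in>\<T>. vol T (\<lambda>_. m) v) = 0"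
  and s2: "(\<Sum>F\<in>mesh_faces \<T>. pen \<eta> F v) = 0"
  using sum0 nn by linarith+
 have G0: "G T v x = 0" if T: "T \<in> \<T>" and x: "x \<in> interior T" for T x
 proof (rule ccontr)
  assume ne: "G T v x \<noteq> 0"
  have c: "continuous_on T (\<lambda>x. m * (G T v x \<bullet> G T v x))" using tr_G_cont(2)[OF v T] by (intro continuous_intros)
  have "vol T (\<lambda>_. m) v = 0"
   using s1 T unfolding sum_nonneg_eq_0_iff[OF fin vol0] by blast
  then have "AE x in lebesgue_on T. m * (G T v x \<bullet> G T v x) = 0"
   using integral_nonneg_eq_0_iff_AE[OF elem_integrable[OF T c]] m by (simp add: vol_def)
  then have ae: "AE x in lebesgue. x \<in> T \<longrightarrow> G T v x = 0"
   using m elem_props(9)[OF T] by (subst (asm) AE_restrict_space_iff) auto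
  have "open (interior T \<inter> {x. G T v x \<noteq> 0})"
   using continuous_open_preimage[OF continuous_on_subset[OF tr_G_cont(2)[OF v T] interior_subset] open_interior, of "- {0}"]
   by (simp add: vimage_def Int_def open_Compl)
  then have "\<not> negligible (interior T \<inter> {x. G T v x \<noteq> 0})" using ne x by (intro open_not_negligible) auto
  moreover have "negligible (interior T \<inter> {x. G T v x \<noteq> 0})"
   unfolding negligible_iff_null_sets
  proof -
   have "{x. \<not> (x \<in> T \<longrightarrow> G T v x = 0)} \<in> null_sets lebesgue"
    using ae by (simp add: AE_iff_null_sets completion.AE_iff_null_sets)
   then show "interior T \<inter> {x. G T v x \<noteq> 0} \<in> null_sets lebesgue"
    by (rule null_sets_completion_subset[rotated]) (use interior_subset[of T] in auto)
  qed
  ultimately show False by blast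
 qed
 define val where "val T = v (SOME x. x \<in> interior T)" for T
 have const: "v x = val T" if T: "T \<in> \<T>" and x: "x \<in> interior T" for T x
 proof -
  obtain q g where r: "C1rep T v q g" using v T unfolding pwC1_def by blast
  have some: "(SOME x. x \<in> interior T) \<in> interior T" using x by (rule someI)
  have d: "FDERIV v x :> (\<lambda>h. 0)" if "x \<in> interior T" for x
  proof -
   have "g x = 0" using G_eq[OF r T subsetD[OF interior_subset that]] G0[OF T that] by simp
   moreover have "FDERIV q x :> (\<lambda>h. h \<bullet> g x)" using r unfolding C1rep_def gderiv_def by blast
   ultimately have "FDERIV q x :> (\<lambda>h. 0)" by simp
   then show ?thesis
    by (rule has_derivative_transform_within_open[OF _ open_interior that]) (use r in \<open>auto simp: C1rep_def\<close>)
  qed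
  show ?thesis unfolding val_def
   by (rule has_derivative_zero_unique_connected[OF open_interior elem_props(4)[OF T] d x some])
 qed
 have trc: "tr T v x = val T" if T: "T \<in> \<T>" and x: "x \<in> T" for T x
  unfolding tr_def by (rule elem_trace_eq[OF that continuous_on_const]) (rule const[OF T])
 interpret jump_free D \<T> val
 proof unfold_locales
  fix F assume F: "F \<in> mesh_faces \<T>"
  let ?j = "\<Sum>T\<in>adjacent \<T> F. val T *\<^sub>R outer_normal T F"
  have J: "J F v x = ?j" if "x \<in> F" for x
   unfolding J_def using trc face_subset that by (intro sum.cong refl) (metis subsetD)
  have "pen \<eta> F v = 0"
   using iffD1[OF sum_nonneg_eq_0_iff[OF fin_faces face0] s2] F by blast
  then have "(LINT x:F|face_measure F. J F v x \<bullet> J F v x) = 0" using \<eta> face_size_nonneg[OF F] by (simp add: pen_def)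
  moreover have "(LINT x:F|face_measure F. J F v x \<bullet> J F v x) = (LINT x|face_measure F. (?j \<bullet> ?j) * indicator F x)"
   unfolding set_lebesgue_integral_def by (rule B_integral_cong) (auto simp: indicator_def J)
  moreover have "\<dots> = (?j \<bullet> ?j) * measure (face_measure F) F"
  proof -
   have "F \<in> sets (face_measure F)" unfolding face_sets[OF F] using face_compact[OF F] by (intro borel_closed compact_imp_closed)
   then have "F \<inter> space (face_measure F) = F" using sets.sets_into_space by blast
   then show ?thesis by (simp only: integral_mult_right_zero Bochner_Integration.integral_indicator)
  qed
  moreover have "measure (face_measure F) F > 0" unfolding measure_def using face_emeasure[OF F] by (simp add: enn2real_positive_iff)
  ultimately show "?j = 0" by (simp only: mult_eq_0_iff inner_eq_zero_iff) simp
 qed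
 show ?thesis using values_zero[OF T0(1)] const[OF T0] by simp
qed

lemma DG_norm_cong:
 assumes "\<And>T x. T \<in> \<T> \<Longrightarrow> x \<in> interior T \<Longrightarrow> v x = w x" and v: "pwC1 \<T> v" and a: "continuous_on D a" "\<And>x. x \<in> D \<Longrightarrow> a x \<ge> 0" and \<eta>: "\<eta> \<ge> 0"
 shows "DG_norm \<T> \<eta> a w = DG_norm \<T> \<eta> a v"
proof -
 have l: "lincomb (\<lambda>_::unit. v) {()} (\<lambda>_. 1) w" unfolding lincomb_def using assms(1) v by auto
 note w = lincomb_trace(1)[OF l]
 have "DG_form \<T> 1 \<eta> a w w = DG_form \<T> 1 \<eta> a v v"
  using DG_form_lincomb(1)[OF l w a(1), of 1 \<eta>] DG_form_lincomb(2)[OF l v a(1), of 1 \<eta>] by simp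
 then have "(DG_norm \<T> \<eta> a w)\<^sup>2 = (DG_norm \<T> \<eta> a v)\<^sup>2"
  using DG_norm_sq(2)[OF w a \<eta>] DG_norm_sq(2)[OF v a \<eta>] by simp
 moreover have "DG_norm \<T> \<eta> a w \<ge> 0" "DG_norm \<T> \<eta> a v \<ge> 0"
  unfolding DG_norm_def by (intro real_sqrt_ge_zero add_nonneg_nonneg sum_nonneg mult_nonneg_nonneg divide_nonneg_nonneg \<eta> less_imp_le[OF face_size_nonneg];
   auto simp: set_lebesgue_integral_def intro!: integral_nonneg_AE)+
 ultimately show ?thesis by (simp add: power2_eq_iff_nonneg)
qed

end

section \<open>Finite positive definite systems\<close>

text \<open>Gaussian elimination: the Schur complement of a positive definite matrix is again positive definite.\<close>

lemma solve_posdef: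
 assumes "finite I" "\<And>i j. i \<in> I \<Longrightarrow> j \<in> I \<Longrightarrow> A i j \<in> ratf s" "\<And>i. i \<in> I \<Longrightarrow> F i \<in> ratf s"
  and "\<And>y c. y \<in> pbox s \<Longrightarrow> \<exists>i\<in>I. c i \<noteq> 0 \<Longrightarrow> (\<Sum>i\<in>I. c i * (\<Sum>j\<in>I. A i j y * c j)) > 0"
 shows "\<exists>c. (\<forall>i\<in>I. c i \<in> ratf s) \<and> (\<forall>y\<in>pbox s. \<forall>i\<in>I. (\<Sum>j\<in>I. A i j y * c j y) = F i y)"
 using assms
proof (induction I arbitrary: A F rule: finite_induct)
 case (insert k I)
 have pos: "A k k y > 0" if "y \<in> pbox s" for y
 proof -
  define e where "e i = (if i = k then 1 else 0 :: real)" for i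
  have e: "e k = 1" "\<And>i. i \<in> I \<Longrightarrow> e i = 0" using insert.hyps by (auto simp: e_def)
  have "(\<Sum>i\<in>insert k I. e i * (\<Sum>j\<in>insert k I. A i j y * e j)) > 0" by (rule insert.prems(3)[OF that]) (auto simp: e)
  moreover have "(\<Sum>i\<in>insert k I. e i * (\<Sum>j\<in>insert k I. A i j y * e j)) = A k k y"
   using insert.hyps by (simp add: e)
  ultimately show ?thesis by simp
 qed
 define A' where "A' i j y = A i j y - A i k y * A k j y / A k k y" for i j y
 define F' where "F' i y = F i y - A i k y * F k y / A k k y" for i y
 have rat: "A i j \<in> ratf s" if "i \<in> insert k I" "j \<in> insert k I" for i j using insert.prems(1) that by blast
 have ne: "\<And>y. y \<in> pbox s \<Longrightarrow> A k k y \<noteq> 0" using pos by fastforce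
 have "\<exists>c. (\<forall>i\<in>I. c i \<in> ratf s) \<and> (\<forall>y\<in>pbox s. \<forall>i\<in>I. (\<Sum>j\<in>I. A' i j y * c j y) = F' i y)"
 proof (rule insert.IH)
  show "A' i j \<in> ratf s" if "i \<in> I" "j \<in> I" for i j
   unfolding A'_def[abs_def] by (intro ratf_diff ratf_divide ratf.mult rat ne) (use that in auto)
  show "F' i \<in> ratf s" if "i \<in> I" for i
   unfolding F'_def[abs_def] by (intro ratf_diff ratf_divide ratf.mult rat ne insert.prems(2)) (use that in auto)
  fix y c assume y: "y \<in> pbox s" and c: "\<exists>i\<in>I. c i \<noteq> (0::real)"
  \<comment> \<open>The vector is completed by the pivot coordinate that annihilates row
    \<open>k\<close>; what remains of the quadratic form is that of the Schur complement.\<close>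
  define d where "d = c(k := - (\<Sum>j\<in>I. A k j y * c j) / A k k y)"
  have dI: "d i = c i" if "i \<in> I" for i using that insert.hyps by (auto simp: d_def)
  have dk: "A k k y * d k = - (\<Sum>j\<in>I. A k j y * c j)" using ne[OF y] by (simp add: d_def)
  have s: "(\<Sum>j\<in>I. A i j y * d j) = (\<Sum>j\<in>I. A i j y * c j)" for i using dI by simp
  have "0 < (\<Sum>i\<in>insert k I. d i * (\<Sum>j\<in>insert k I. A i j y * d j))"
   by (rule insert.prems(3)[OF y]) (use c dI in auto)
  also have "\<dots> = (\<Sum>i\<in>I. c i * (A i k y * d k + (\<Sum>j\<in>I. A i j y * c j)))"
   using insert.hyps dk s dI by simp
  also have "\<dots> = (\<Sum>i\<in>I. c i * (\<Sum>j\<in>I. A' i j y * c j))"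
  proof (intro sum.cong refl mult_arg_cong)
   fix i
   have "(\<Sum>j\<in>I. A' i j y * c j) = (\<Sum>j\<in>I. A i j y * c j) - A i k y * (\<Sum>j\<in>I. A k j y * c j) / A k k y"
    unfolding A'_def by (simp add: left_diff_distrib sum_subtractf sum_distrib_left sum_divide_distrib mult.assoc)
   then show "A i k y * d k + (\<Sum>j\<in>I. A i j y * c j) = (\<Sum>j\<in>I. A' i j y * c j)" by (simp add: d_def)
  qed
  finally show "(\<Sum>i\<in>I. c i * (\<Sum>j\<in>I. A' i j y * c j)) > 0" .
 qed
 then obtain c where c: "\<And>i. i \<in> I \<Longrightarrow> c i \<in> ratf s" "\<And>y i. y \<in> pbox s \<Longrightarrow> i \<in> I \<Longrightarrow> (\<Sum>j\<in>I. A' i j y * c j y) = F' i y" by blast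
 define ck where "ck y = (F k y - (\<Sum>j\<in>I. A k j y * c j y)) / A k k y" for y
 define d where "d = c(k := ck)"
 have dI: "d i = c i" if "i \<in> I" for i using that insert.hyps by (auto simp: d_def)
 have dk: "d k = ck" by (simp add: d_def)
 have "ck \<in> ratf s" unfolding ck_def[abs_def]
  by (intro ratf_divide ratf_diff ratf_sum ratf.mult rat ne insert.prems(2) c(1)) (use insert.hyps in auto)
 then have "\<forall>i\<in>insert k I. d i \<in> ratf s" using c(1) dI dk by auto
 moreover have "(\<Sum>j\<in>insert k I. A i j y * d j y) = F i y" if y: "y \<in> pbox s" and i: "i \<in> insert k I" for y i
 proof -
  have e: "(\<Sum>j\<in>insert k I. A i j y * d j y) = A i k y * ck y + (\<Sum>j\<in>I. A i j y * c j y)"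
   using insert.hyps dI dk by simp
  show ?thesis
  proof (cases "i = k")
   case True
   then show ?thesis unfolding e using ne[OF y] by (simp add: ck_def)
  next
   case False
   then have iI: "i \<in> I" using i by simp
   have "(\<Sum>j\<in>I. A' i j y * c j y) = (\<Sum>j\<in>I. A i j y * c j y) - A i k y * (\<Sum>j\<in>I. A k j y * c j y) / A k k y"
    unfolding A'_def by (simp add: left_diff_distrib sum_subtractf sum_distrib_left sum_divide_distrib mult.assoc)
   then show ?thesis unfolding e ck_def using c(2)[OF y iI] by (simp add: F'_def right_diff_distrib diff_divide_distrib)
  qed
 qed
 ultimately show ?case by blast
qed auto

text \<open>The symmetrised form \<open>B\<close> is an inner product. A vector \<open>g\<close>
  representing the coordinate functional, \<open>B c g = c p\<close>, exists by elimination, and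
  Cauchy-Schwarz for \<open>B\<close> gives the constant \<open>B g g\<close>.\<close>

lemma posdef_coeff_bound:
 fixes S :: "'i \<Rightarrow> 'i \<Rightarrow> real"
 assumes I: "finite I" and pos: "\<And>c. \<exists>i\<in>I. c i \<noteq> 0 \<Longrightarrow> (\<Sum>i\<in>I. c i * (\<Sum>j\<in>I. S i j * c j)) > 0" and p: "p \<in> I"
 shows "\<exists>K\<ge>0. \<forall>c. (c p)\<^sup>2 \<le> K * (\<Sum>i\<in>I. c i * (\<Sum>j\<in>I. S i j * c j))"
proof -
 define B where "B c d = (\<Sum>i\<in>I. c i * (\<Sum>j\<in>I. (S i j + S j i) / 2 * d j))" for c d :: "'i \<Rightarrow> real"
 have sw: "(\<Sum>i\<in>I. c i * (\<Sum>j\<in>I. S j i * d j)) = (\<Sum>i\<in>I. d i * (\<Sum>j\<in>I. S i j * c j))" for c d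
  unfolding sum_distrib_left by (subst sum.swap) (simp add: ac_simps)
 have B2: "B c d = ((\<Sum>i\<in>I. c i * (\<Sum>j\<in>I. S i j * d j)) + (\<Sum>i\<in>I. d i * (\<Sum>j\<in>I. S i j * c j))) / 2" for c d
  unfolding B_def sw[of c d, symmetric] by (simp add: add_divide_distrib distrib_left distrib_right sum.distrib sum_divide_distrib sum_distrib_left)
 have Bq: "B c c = (\<Sum>i\<in>I. c i * (\<Sum>j\<in>I. S i j * c j))" for c unfolding B2 by simp
 have Bsym: "B c d = B d c" for c d unfolding B2 by simp
 have Bl: "B (\<lambda>i. c i - t * d i) e = B c e - t * B d e" for c d e t
  unfolding B_def sum_distrib_left sum_subtractf[symmetric] by (intro sum.cong refl) (simp add: field_simps)
 have nn: "B c c \<ge> 0" for c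
 proof (cases "\<exists>i\<in>I. c i \<noteq> 0")
  case True then show ?thesis unfolding Bq by (intro less_imp_le pos)
 next
  case False then show ?thesis unfolding B_def by simp
 qed
 \<comment> \<open>With zero parameters \<open>solve_posdef\<close> is an existence theorem for a
   constant linear system.\<close>
 have "\<exists>g. (\<forall>i\<in>I. g i \<in> ratf 0) \<and> (\<forall>y\<in>pbox 0. \<forall>i\<in>I. (\<Sum>j\<in>I. (S i j + S j i) / 2 * g j y) = (if i = p then 1 else 0))"
 proof (rule solve_posdef[OF I])
  show "(\<Sum>i\<in>I. c i * (\<Sum>j\<in>I. (S i j + S j i) / 2 * c j)) > 0" if "\<exists>i\<in>I. c i \<noteq> 0" for c
   using pos[of c] that unfolding Bq[symmetric] B_def by blast
 qed (auto intro: ratf.const)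
 then obtain g' where g': "\<forall>y\<in>pbox 0. \<forall>i\<in>I. (\<Sum>j\<in>I. (S i j + S j i) / 2 * g' j y) = (if i = p then 1 else 0)" by blast
 have "(\<lambda>_. 0) \<in> pbox 0" by (simp add: pbox_def)
 from bspec[OF g' this] obtain g where g: "\<And>i. i \<in> I \<Longrightarrow> (\<Sum>j\<in>I. (S i j + S j i) / 2 * g j) = (if i = p then 1 else 0)"
  using that[of "\<lambda>j. g' j (\<lambda>_. 0)"] by blast
 have cp: "B c g = c p" for c
 proof -
  have "B c g = (\<Sum>i\<in>I. c i * (if i = p then 1 else 0))" unfolding B_def by (intro sum.cong refl mult_arg_cong g)
  then show ?thesis using I p by (simp add: if_distrib cong: if_cong)
 qed
 have "(c p)\<^sup>2 \<le> B g g * B c c" for c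
 proof (cases "B g g = 0")
  case True
  have "\<not> (\<exists>i\<in>I. g i \<noteq> 0)" using pos[of g] True unfolding Bq by force
  then have "B c g = 0" unfolding B_def by simp
  then show ?thesis using True cp by simp
 next
  case False
  then have q: "B g g > 0" using nn[of g] by simp
  define t where "t = B c g / B g g"
  have "0 \<le> B (\<lambda>i. c i - t * g i) (\<lambda>i. c i - t * g i)" by (rule nn)
  also have "\<dots> = B c c - t * B g c - t * (B c g - t * B g g)"
   unfolding Bl Bsym[of c "\<lambda>i. c i - t * g i"] Bsym[of g "\<lambda>i. c i - t * g i"] by (simp add: Bl Bsym[of g c])
  also have "\<dots> = B c c - (B c g)\<^sup>2 / B g g" using q by (simp add: t_def Bsym[of g c] power2_eq_square)
  finally show ?thesis using q cp by (simp add: field_simps)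
 qed
 then show ?thesis using nn[of g] unfolding Bq by (intro exI[of _ "B g g"]) (simp add: Bq)
qed

section \<open>Polynomials and a basis of the DG space\<close>

definition C1 :: "('a::euclidean_space \<Rightarrow> real) \<Rightarrow> bool" where
 "C1 q \<longleftrightarrow> (\<exists>g. continuous_on UNIV g \<and> (\<forall>x. GDERIV q x :> g x))"

lemma C1_cont: "C1 q \<Longrightarrow> continuous_on A q"
 unfolding C1_def by (metis C1rep_cont(1) C1rep_def)

lemma C1_const: "C1 (\<lambda>_. c)"
 unfolding C1_def by (intro exI[of _ "\<lambda>_. 0"] conjI allI GDERIV_const continuous_on_const)

lemma C1_inner: "C1 (\<lambda>x. x \<bullet> b)"
 unfolding C1_def gderiv_def
 by (intro exI[of _ "\<lambda>_. b"] conjI allI continuous_on_const bounded_linear_imp_has_derivative bounded_linear_inner_left)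

lemma C1_add:
 assumes f: "C1 f" and g: "C1 g" shows "C1 (\<lambda>x. f x + g x)"
proof -
 obtain f' g' where d: "continuous_on UNIV f'" "continuous_on UNIV g'" "\<And>x. GDERIV f x :> f' x" "\<And>x. GDERIV g x :> g' x"
  using f g unfolding C1_def by blast
 show ?thesis unfolding C1_def using continuous_on_add[OF d(1,2)] GDERIV_add[OF d(3) d(4)] by blast
qed

lemma C1_mult:
 assumes f: "C1 f" and g: "C1 g" shows "C1 (\<lambda>x. f x * g x)"
proof -
 obtain f' g' where d: "continuous_on UNIV f'" "continuous_on UNIV g'" "\<And>x. GDERIV f x :> f' x" "\<And>x. GDERIV g x :> g' x"
  using f g unfolding C1_def by blast
 have "continuous_on UNIV (\<lambda>x. f x *\<^sub>R g' x + g x *\<^sub>R f' x)" by (intro continuous_intros C1_cont f g d)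
 then show ?thesis unfolding C1_def using GDERIV_mult[OF d(3) d(4)] by blast
qed

lemma C1_sum: "(\<And>i. i \<in> I \<Longrightarrow> C1 (f i)) \<Longrightarrow> C1 (\<lambda>x. \<Sum>i\<in>I. f i x)"
 by (induction I rule: infinite_finite_induct) (auto intro: C1_add C1_const)

lemma C1_prod: "(\<And>i. i \<in> I \<Longrightarrow> C1 (f i)) \<Longrightarrow> C1 (\<lambda>x. \<Prod>i\<in>I. f i x)"
 by (induction I rule: infinite_finite_induct) (auto intro: C1_mult C1_const)

lemma C1_power: "C1 f \<Longrightarrow> C1 (\<lambda>x. f x ^ n)"
 by (induction n) (auto intro: C1_mult C1_const)

definition exps :: "nat \<Rightarrow> ('a::euclidean_space \<Rightarrow> nat) set" where
 "exps k = {\<alpha> \<in> Basis \<rightarrow>\<^sub>E {..k}. (\<Sum>b\<in>Basis. \<alpha> b) \<le> k}"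

definition mono_fun :: "('a::euclidean_space \<Rightarrow> nat) \<Rightarrow> 'a \<Rightarrow> real" where
 "mono_fun \<alpha> x = (\<Prod>b\<in>Basis. (x \<bullet> b) ^ \<alpha> b)"

lemma fin_exps: "finite (exps k :: ('a::euclidean_space \<Rightarrow> nat) set)"
 unfolding exps_def by (rule finite_subset[of _ "Basis \<rightarrow>\<^sub>E {..k}"]) (auto intro: finite_PiE)

lemma C1_mono: "C1 (mono_fun \<alpha>)"
 unfolding mono_fun_def[abs_def] by (intro C1_prod C1_power C1_inner)

lemma poly_space_eq: "poly_space k = {\<lambda>x. \<Sum>\<alpha>\<in>exps k. c \<alpha> * mono_fun \<alpha> x | c. True}"
 unfolding poly_space_def exps_def mono_fun_def ..

lemma poly_space_C1: "q \<in> poly_space k \<Longrightarrow> C1 q"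
 unfolding poly_space_eq by (auto intro!: C1_sum C1_mult C1_const C1_mono)

lemma poly_space_mono: "\<alpha> \<in> exps k \<Longrightarrow> mono_fun \<alpha> \<in> poly_space k"
 unfolding poly_space_eq
proof -
 assume a: "\<alpha> \<in> exps k"
 have "mono_fun \<alpha> = (\<lambda>x. \<Sum>\<beta>\<in>exps k. (if \<beta> = \<alpha> then 1 else 0) * mono_fun \<beta> x)"
  using a by (intro ext) (simp add: fin_exps if_distrib[of "\<lambda>c. c * _"] cong: if_cong)
 then show "mono_fun \<alpha> \<in> {\<lambda>x. \<Sum>\<alpha>\<in>exps k. c \<alpha> * mono_fun \<alpha> x | c. True}"
  by (intro CollectI exI[of _ "\<lambda>\<beta>. if \<beta> = \<alpha> then 1 else 0"] conjI TrueI)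
qed

lemma poly_space_lincomb:
 assumes "\<And>i. i \<in> I \<Longrightarrow> q i \<in> poly_space k"
 shows "(\<lambda>x. \<Sum>i\<in>I. c i * q i x) \<in> poly_space k"
proof -
 have "\<forall>i\<in>I. \<exists>d. q i = (\<lambda>x. \<Sum>\<alpha>\<in>exps k. d \<alpha> * mono_fun \<alpha> x)" using assms unfolding poly_space_eq by blast
 then obtain d where d: "\<And>i. i \<in> I \<Longrightarrow> q i = (\<lambda>x. \<Sum>\<alpha>\<in>exps k. d i \<alpha> * mono_fun \<alpha> x)" by metis
 have "(\<lambda>x. \<Sum>i\<in>I. c i * q i x) = (\<lambda>x. \<Sum>\<alpha>\<in>exps k. (\<Sum>i\<in>I. c i * d i \<alpha>) * mono_fun \<alpha> x)"
 proof (rule ext)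
  fix x
  have "(\<Sum>i\<in>I. c i * q i x) = (\<Sum>i\<in>I. \<Sum>\<alpha>\<in>exps k. c i * d i \<alpha> * mono_fun \<alpha> x)"
   by (simp add: d sum_distrib_left mult.assoc)
  also have "\<dots> = (\<Sum>\<alpha>\<in>exps k. \<Sum>i\<in>I. c i * d i \<alpha> * mono_fun \<alpha> x)" by (rule sum.swap)
  finally show "(\<Sum>i\<in>I. c i * q i x) = (\<Sum>\<alpha>\<in>exps k. (\<Sum>i\<in>I. c i * d i \<alpha>) * mono_fun \<alpha> x)"
   by (simp only: sum_distrib_right)
 qed
 then show ?thesis unfolding poly_space_eq
  by (intro CollectI exI[of _ "\<lambda>\<alpha>. \<Sum>i\<in>I. c i * d i \<alpha>"] conjI TrueI)
qed

text \<open>Bounded measurable functions: closed under linear combinations, and admissible as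
  factors of an integrable function.\<close>

definition BM :: "'a::euclidean_space set \<Rightarrow> ('a \<Rightarrow> real) set" where
 "BM D = {v. v \<in> borel_measurable (lebesgue_on D) \<and> (\<exists>B. \<forall>x\<in>D. \<bar>v x\<bar> \<le> B)}"

lemma BM_lincomb:
 assumes "finite I" "\<And>i. i \<in> I \<Longrightarrow> v i \<in> BM D"
 shows "(\<lambda>x. \<Sum>i\<in>I. c i * v i x) \<in> BM D"
proof -
 have "\<forall>i\<in>I. \<exists>B. \<forall>x\<in>D. \<bar>v i x\<bar> \<le> B" using assms unfolding BM_def by blast
 then obtain B where B: "\<And>i x. i \<in> I \<Longrightarrow> x \<in> D \<Longrightarrow> \<bar>v i x\<bar> \<le> B i" by metis
 have "\<bar>\<Sum>i\<in>I. c i * v i x\<bar> \<le> (\<Sum>i\<in>I. \<bar>c i\<bar> * B i)" if "x \<in> D" for x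
  using B[OF _ that] by (intro order_trans[OF sum_abs] sum_mono) (simp add: abs_mult mult_left_mono)
 moreover have "(\<lambda>x. \<Sum>i\<in>I. c i * v i x) \<in> borel_measurable (lebesgue_on D)"
  using assms unfolding BM_def by (intro borel_measurable_sum borel_measurable_times) auto
 ultimately show ?thesis unfolding BM_def by blast
qed

lemma BM_integrable:
 assumes D: "D \<in> lmeasurable" and v: "v \<in> BM D" and f: "integrable (lebesgue_on D) f"
 shows "integrable (lebesgue_on D) (\<lambda>x. f x * v x)"
proof -
 obtain B where B: "\<And>x. x \<in> D \<Longrightarrow> \<bar>v x\<bar> \<le> B" using v unfolding BM_def by blast
 show ?thesis
 proof (rule Bochner_Integration.integrable_bound)
  show "integrable (lebesgue_on D) (\<lambda>x. B * f x)" using f by simp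
  show "(\<lambda>x. f x * v x) \<in> borel_measurable (lebesgue_on D)"
   using v f unfolding BM_def by (intro borel_measurable_times) auto
  show "AE x in lebesgue_on D. norm (f x * v x) \<le> norm (B * f x)"
  proof (rule AE_I2)
   fix x assume "x \<in> space (lebesgue_on D)"
   then have "\<bar>v x\<bar> \<le> \<bar>B\<bar>" using B[of x] by fastforce
   then show "norm (f x * v x) \<le> norm (B * f x)" by (simp add: abs_mult mult.commute[of "\<bar>f x\<bar>"] mult_right_mono)
  qed
 qed
qed

lemma BM_mult: "v \<in> BM D \<Longrightarrow> w \<in> BM D \<Longrightarrow> D \<in> lmeasurable \<Longrightarrow> integrable (lebesgue_on D) (\<lambda>x. v x * w x)"
proof (rule BM_integrable)
 assume v: "v \<in> BM D" and D: "D \<in> lmeasurable"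
 interpret finite_measure "lebesgue_on D" by (rule finite_measure_lebesgue_on[OF D])
 have "integrable (lebesgue_on D) (\<lambda>x. 1 * v x)" by (rule BM_integrable[OF D v]) simp
 then show "integrable (lebesgue_on D) v" by simp
qed

lemma BM_L2: "v \<in> BM D \<Longrightarrow> D \<in> lmeasurable \<Longrightarrow> v \<in> L2 D"
 unfolding L2_def power2_eq_square using BM_mult[of v D v] by (simp add: BM_def)

context dg_mesh
begin

lemma D_lmeas: "D \<in> lmeasurable" by (rule lmeasurable_compact[OF compact_D])

lemma DG_pwC1: "v \<in> DG_space D \<T> k \<Longrightarrow> pwC1 \<T> v"
 unfolding DG_space_def pwC1_def C1rep_def using poly_space_C1[unfolded C1_def] by blast

text \<open>A monomial cut off to the interior of one element. Up to values on the skeleton these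
  functions span the DG space.\<close>

definition elem_mono :: "'a set \<times> ('a \<Rightarrow> nat) \<Rightarrow> 'a \<Rightarrow> real" where
 "elem_mono p x = indicator (interior (fst p)) x * mono_fun (snd p) x"

lemma elem_mono_BM: "elem_mono p \<in> BM D"
proof -
 have c: "continuous_on A (mono_fun (snd p))" for A by (rule C1_cont[OF C1_mono])
 have "mono_fun (snd p) \<in> borel_measurable borel" by (rule borel_measurable_continuous_onI[OF c])
 then have "elem_mono p \<in> borel_measurable borel"
  unfolding elem_mono_def[abs_def] by (intro borel_measurable_times borel_measurable_indicator) auto
 then have "elem_mono p \<in> borel_measurable (lebesgue_on D)"
  by (intro measurable_restrict_space1 measurable_completion) simp
 moreover obtain B where "\<And>x. x \<in> D \<Longrightarrow> norm (mono_fun (snd p) x) \<le> B"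
  using compact_imp_bounded[OF compact_continuous_image[OF c compact_D]] unfolding bounded_iff by auto
 then have "\<bar>elem_mono p x\<bar> \<le> B" if "x \<in> D" for x
  using that unfolding elem_mono_def by (auto simp: indicator_def intro: order_trans[OF abs_ge_zero])
 ultimately show ?thesis unfolding BM_def by blast
qed

lemma elem_mono_DG:
 assumes "p \<in> \<T> \<times> exps k" shows "elem_mono p \<in> DG_space D \<T> k"
 unfolding DG_space_def
proof (intro CollectI conjI ballI)
 show "elem_mono p \<in> L2 D" by (rule BM_L2[OF elem_mono_BM D_lmeas])
 fix T assume T: "T \<in> \<T>"
 show "\<exists>q\<in>poly_space k. \<forall>x\<in>interior T. elem_mono p x = q x"
 proof (cases "T = fst p")
  case True
  then show ?thesis using poly_space_mono[of "snd p" k] assms by (intro bexI[of _ "mono_fun (snd p)"]) (auto simp: elem_mono_def)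
 next
  case False
  have "(\<lambda>x. 0) \<in> (poly_space k :: ('a \<Rightarrow> real) set)" using poly_space_lincomb[of "{}" _ k] by simp
  then show ?thesis using disj[OF T _ False] assms
   by (intro bexI[of _ "\<lambda>x. 0"]) (auto simp: elem_mono_def indicator_def)
 qed
qed

definition agree :: "('a \<Rightarrow> real) \<Rightarrow> ('a \<Rightarrow> real) \<Rightarrow> bool" where
 "agree v w \<longleftrightarrow> (\<forall>T\<in>\<T>. \<forall>x\<in>interior T. v x = w x)"

lemma elem_mono_span:
 assumes "v \<in> DG_space D \<T> k"
 shows "\<exists>c. agree v (\<lambda>x. \<Sum>p\<in>\<T> \<times> exps k. c p * elem_mono p x)"
proof -
 have "\<forall>T\<in>\<T>. \<exists>c. \<forall>x\<in>interior T. v x = (\<Sum>\<alpha>\<in>exps k. c \<alpha> * mono_fun \<alpha> x)"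
 proof
  fix T assume "T \<in> \<T>"
  then obtain q where "q \<in> poly_space k" "\<And>x. x \<in> interior T \<Longrightarrow> v x = q x" using assms unfolding DG_space_def by blast
  then show "\<exists>c. \<forall>x\<in>interior T. v x = (\<Sum>\<alpha>\<in>exps k. c \<alpha> * mono_fun \<alpha> x)" unfolding poly_space_eq by auto
 qed
 then obtain c where c: "\<And>T x. T \<in> \<T> \<Longrightarrow> x \<in> interior T \<Longrightarrow> v x = (\<Sum>\<alpha>\<in>exps k. c T \<alpha> * mono_fun \<alpha> x)" by metis
 have "v x = (\<Sum>p\<in>\<T> \<times> exps k. c (fst p) (snd p) * elem_mono p x)" if T: "T \<in> \<T>" "x \<in> interior T" for T x
 proof -
  have "(\<Sum>p\<in>\<T> \<times> exps k. c (fst p) (snd p) * elem_mono p x) = (\<Sum>T'\<in>\<T>. \<Sum>\<alpha>\<in>exps k. c T' \<alpha> * elem_mono (T', \<alpha>) x)"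
   by (simp add: sum.cartesian_product case_prod_beta)
  also have "\<dots> = (\<Sum>T'\<in>\<T>. if T' = T then \<Sum>\<alpha>\<in>exps k. c T' \<alpha> * mono_fun \<alpha> x else 0)"
   using T disj[OF T(1)] by (intro sum.cong refl) (force simp: elem_mono_def indicator_def intro!: sum.neutral)
  also have "\<dots> = v x" using T fin c[OF T] by simp
  finally show ?thesis by simp
 qed
 then show ?thesis unfolding agree_def by (intro exI[of _ "\<lambda>p. c (fst p) (snd p)"]) blast
qed

text \<open>A spanning subfamily of minimal size is linearly independent.\<close>

lemma DG_basis:
 "\<exists>I. finite I \<and> (\<forall>i\<in>I. elem_mono i \<in> DG_space D \<T> k) \<and>
   (\<forall>v\<in>DG_space D \<T> k. \<exists>c. agree v (\<lambda>x. \<Sum>i\<in>I. c i * elem_mono i x)) \<and>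
   (\<forall>c. agree (\<lambda>x. \<Sum>i\<in>I. c i * elem_mono i x) (\<lambda>x. 0) \<longrightarrow> (\<forall>i\<in>I. c i = 0))"
proof -
 let ?sp = "\<lambda>I. I \<subseteq> \<T> \<times> exps k \<and> (\<forall>v\<in>DG_space D \<T> k. \<exists>c. agree v (\<lambda>x. \<Sum>i\<in>I. c i * elem_mono i x))"
 have "?sp (\<T> \<times> exps k)" using elem_mono_span by blast
 then obtain I where I: "?sp I" and min: "\<And>I'. ?sp I' \<Longrightarrow> card I \<le> card I'"
  using ex_has_least_nat[of ?sp "\<T> \<times> exps k" card] by blast
 have fI: "finite I" using I fin fin_exps finite_subset by blast
 have "c i = 0" if c: "agree (\<lambda>x. \<Sum>i\<in>I. c i * elem_mono i x) (\<lambda>x. 0)" and i: "i \<in> I" for c i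
 proof (rule ccontr)
  assume ne: "c i \<noteq> 0"
  have "?sp (I - {i})"
  proof (intro conjI ballI)
   show "I - {i} \<subseteq> \<T> \<times> exps k" using I by blast
   fix v assume "v \<in> DG_space D \<T> k"
   then obtain d where d: "agree v (\<lambda>x. \<Sum>i\<in>I. d i * elem_mono i x)" using I by blast
   have "agree v (\<lambda>x. \<Sum>j\<in>I - {i}. (d j - d i * c j / c i) * elem_mono j x)"
    unfolding agree_def
   proof (intro ballI)
    fix T x assume T: "T \<in> \<T>" "x \<in> interior T"
    have 0: "c i * elem_mono i x + (\<Sum>j\<in>I - {i}. c j * elem_mono j x) = 0"
     using c T sum.remove[OF fI i, of "\<lambda>j. c j * elem_mono j x"] unfolding agree_def by auto
    have "v x = d i * elem_mono i x + (\<Sum>j\<in>I - {i}. d j * elem_mono j x)"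
     using d T sum.remove[OF fI i, of "\<lambda>j. d j * elem_mono j x"] unfolding agree_def by auto
    also have "elem_mono i x = - (\<Sum>j\<in>I - {i}. c j * elem_mono j x) / c i" using 0 ne by (simp add: field_simps)
    finally show "v x = (\<Sum>j\<in>I - {i}. (d j - d i * c j / c i) * elem_mono j x)"
     by (simp add: left_diff_distrib sum_subtractf sum_distrib_left sum_divide_distrib mult.assoc)
   qed
   then show "\<exists>c. agree v (\<lambda>x. \<Sum>j\<in>I - {i}. c j * elem_mono j x)" by (intro exI[of _ "\<lambda>j. d j - d i * c j / c i"])
  qed
  then have "card I \<le> card (I - {i})" by (rule min)
  moreover have "card (I - {i}) < card I" by (rule card_Diff1_less[OF fI i])
  ultimately show False by simp
 qed
 then show ?thesis using I fI elem_mono_DG by (intro exI[of _ I]) blast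
qed

lemma DG_lincomb:
 assumes "finite I" "\<And>i. i \<in> I \<Longrightarrow> elem_mono i \<in> DG_space D \<T> k"
 shows "(\<lambda>x. \<Sum>i\<in>I. c i * elem_mono i x) \<in> DG_space D \<T> k"
 unfolding DG_space_def
proof (intro CollectI conjI ballI)
 show "(\<lambda>x. \<Sum>i\<in>I. c i * elem_mono i x) \<in> L2 D" using assms by (intro BM_L2 BM_lincomb elem_mono_BM D_lmeas)
 fix T assume T: "T \<in> \<T>"
 have "\<forall>i\<in>I. \<exists>q\<in>poly_space k. \<forall>x\<in>interior T. elem_mono i x = q x" using assms T unfolding DG_space_def by blast
 then obtain q where q: "\<And>i. i \<in> I \<Longrightarrow> q i \<in> poly_space k" "\<And>i x. i \<in> I \<Longrightarrow> x \<in> interior T \<Longrightarrow> elem_mono i x = q i x" by metis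
 show "\<exists>q\<in>poly_space k. \<forall>x\<in>interior T. (\<Sum>i\<in>I. c i * elem_mono i x) = q x"
  by (rule bexI[OF _ poly_space_lincomb[of I q k c]]) (use q in auto)
qed

end

section \<open>Parametric regularity\<close>

definition ind :: "nat set \<Rightarrow> nat \<Rightarrow> nat" where "ind w j = (if j \<in> w then 1 else 0)"

text \<open>Parameter sequences truncated after \<open>s\<close> entries. Unlike points of the cube
  they belong to \<open>params\<close>, where the solution and the coercivity are given.\<close>

definition Y :: "nat \<Rightarrow> (nat \<Rightarrow> real) set" where "Y s = {y \<in> params. \<forall>j\<ge>s. y j = 0}"

definition trunc :: "nat \<Rightarrow> (nat \<Rightarrow> real) \<Rightarrow> nat \<Rightarrow> real" where "trunc s y j = (if j < s then y j else 0)"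

lemma Y_pbox: "y \<in> Y s \<Longrightarrow> y \<in> pbox s" unfolding Y_def params_def pbox_def by auto

lemma Y_params: "y \<in> Y s \<Longrightarrow> y \<in> params" unfolding Y_def by auto

lemma Y_comp: "y \<in> Y s \<Longrightarrow> y j \<in> {-1/2..1/2}" unfolding Y_def params_def by blast

lemma Y_upd: "y \<in> Y s \<Longrightarrow> j < s \<Longrightarrow> t \<in> {-1/2..1/2} \<Longrightarrow> y(j := t) \<in> Y s"
 unfolding Y_def params_def by auto

lemma trunc_Y: "y \<in> pbox s \<Longrightarrow> trunc s y \<in> Y s"
 unfolding Y_def params_def pbox_def trunc_def by auto

lemma ratf_trunc: "f \<in> ratf s \<Longrightarrow> f (trunc s y) = f y"
 by (rule ratf_cong) (auto simp: trunc_def)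

lemma affine_Y:
 assumes "y \<in> Y s" shows "affine_coeff a0 \<psi> y = (\<lambda>x. a0 x + (\<Sum>l<s. y l * \<psi> l x))"
proof
 fix x
 have "(\<Sum>j. y j * \<psi> j x) = (\<Sum>l<s. y l * \<psi> l x)"
  by (rule suminf_finite) (use assms in \<open>auto simp: Y_def\<close>)
 then show "affine_coeff a0 \<psi> y x = a0 x + (\<Sum>l<s. y l * \<psi> l x)" by (simp add: affine_coeff_def)
qed

text \<open>The derivative is taken within the closed interval, so values of \<open>G\<close> for
  parameters outside it do not matter; within a nondegenerate interval it is unique also at the
  ends.\<close>

lemma pderiv_param_eq:
 assumes "\<And>t. t \<in> {-1/2..1/2} \<Longrightarrow> G (y(j := t)) x = g t" "y j \<in> {-1/2..1/2}" "(g has_real_derivative d) (at (y j))"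
 shows "pderiv_param j G y x = d"
 unfolding pderiv_param_def
proof (rule vector_derivative_within_closed_interval)
 have "(g has_vector_derivative d) (at (y j) within {-1/2..1/2})"
  using assms(3) has_real_derivative_iff_has_vector_derivative has_vector_derivative_at_within by blast
 then show "((\<lambda>t. G (y(j := t)) x) has_vector_derivative d) (at (y j) within {-1/2..1/2})"
  by (rule has_vector_derivative_transform[rotated 2]) (use assms(1,2) in simp_all)
qed (use assms(2) in auto)

lemma pderiv_fold_ratf:
 assumes "finite I" "\<And>y. y \<in> Y s \<Longrightarrow> G y x = (\<Sum>i\<in>I. c i y * p i)" "\<And>i. i \<in> I \<Longrightarrow> c i \<in> ratf s"
  and "set js \<subseteq> {..<s}" "y \<in> Y s"
 shows "foldr pderiv_param js G y x = (\<Sum>i\<in>I. foldr (rpd s) js (c i) y * p i)"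
 using assms(4,5)
proof (induction js arbitrary: y)
 case (Cons j js)
 have j: "j < s" "set js \<subseteq> {..<s}" using Cons.prems by auto
 have r: "i \<in> I \<Longrightarrow> foldr (rpd s) js (c i) \<in> ratf s" for i using assms(3) j(2) by (intro foldr_rpd_ratf) auto
 have "pderiv_param j (foldr pderiv_param js G) y x = (\<Sum>i\<in>I. rpd s j (foldr (rpd s) js (c i)) y * p i)"
 proof (rule pderiv_param_eq)
  show "foldr pderiv_param js G (y(j := t)) x = (\<Sum>i\<in>I. foldr (rpd s) js (c i) (y(j := t)) * p i)" if "t \<in> {-1/2..1/2}" for t
   by (rule Cons.IH[OF j(2) Y_upd[OF Cons.prems(2) j(1) that]])
  show "y j \<in> {-1/2..1/2}" by (rule Y_comp[OF Cons.prems(2)])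
  show "((\<lambda>t. \<Sum>i\<in>I. foldr (rpd s) js (c i) (y(j := t)) * p i) has_real_derivative (\<Sum>i\<in>I. rpd s j (foldr (rpd s) js (c i)) y * p i)) (at (y j))"
   by (intro DERIV_sum DERIV_cmult_right rpd(2)[OF r j(1) Y_pbox[OF Cons.prems(2)]])
 qed
 then show ?case by simp
qed (use assms(2) in simp)

text \<open>One derivative of an affine function leaves a coefficient that no longer depends on the
  parameters, so any further derivative is zero.\<close>

lemma pderiv_fold_affine:
 assumes "distinct js" "set js \<subseteq> {..<s}" "y \<in> Y s"
 shows "foldr pderiv_param js (affine_coeff a0 \<psi>) y x = (if js = [] then affine_coeff a0 \<psi> y x else if tl js = [] then \<psi> (hd js) x else 0)"
 using assms
proof (induction js arbitrary: y)
 case (Cons j js)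
 have j: "j < s" "set js \<subseteq> {..<s}" "distinct js" using Cons.prems by auto
 note IH = Cons.IH[OF j(3,2) Y_upd[OF Cons.prems(3) j(1)]]
 have "pderiv_param j (foldr pderiv_param js (affine_coeff a0 \<psi>)) y x = (if js = [] then \<psi> j x else 0)"
 proof (cases "js = []")
  case True
  define r where "r = a0 x + (\<Sum>l\<in>{..<s} - {j}. y l * \<psi> l x)"
  have "pderiv_param j (affine_coeff a0 \<psi>) y x = \<psi> j x"
  proof (rule pderiv_param_eq)
   show "affine_coeff a0 \<psi> (y(j := t)) x = r + t * \<psi> j x" if "t \<in> {-1/2..1/2}" for t
    unfolding affine_Y[OF Y_upd[OF Cons.prems(3) j(1) that]] r_def
    using j(1) by (subst sum.remove[of _ j]) auto
   show "((\<lambda>t. r + t * \<psi> j x) has_real_derivative \<psi> j x) (at (y j))" by (auto intro!: derivative_eq_intros)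
  qed (rule Y_comp[OF Cons.prems(3)])
  then show ?thesis using True by simp
 next
  case False
  have "pderiv_param j (foldr pderiv_param js (affine_coeff a0 \<psi>)) y x = 0"
  proof (rule pderiv_param_eq)
   show "foldr pderiv_param js (affine_coeff a0 \<psi>) (y(j := t)) x = (if tl js = [] then \<psi> (hd js) x else 0)" if "t \<in> {-1/2..1/2}" for t
    using IH[OF that] False by (simp only: if_False)
  qed (rule Y_comp[OF Cons.prems(3)], simp)
  then show ?thesis using False by simp
 qed
 then show ?case by simp
qed simp

lemma mixed_pderiv_ind:
 assumes "finite w" shows "mixed_pderiv (ind w) G = foldr pderiv_param (sorted_list_of_set w) G"
proof -
 have w: "{j. ind w j \<noteq> 0} = w" by (auto simp: ind_def)
 show ?thesis unfolding mixed_pderiv_def w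
  by (rule foldr_cong) (use assms in \<open>auto simp: ind_def\<close>)
qed

text \<open>The essential supremum is minus infinity on a null space and infinity for a
  nonmeasurable function; \<open>real_of_ereal\<close> sends both to 0.\<close>

lemma Linf_norm_nonneg: "Linf_norm D v \<ge> 0"
proof (cases "(\<lambda>x. ereal (norm (v x))) \<in> borel_measurable (lebesgue_on D)")
 case m: True
 show ?thesis
 proof (cases "emeasure (lebesgue_on D) (space (lebesgue_on D)) = 0")
  case True
  then show ?thesis unfolding Linf_norm_def using esssup_zero_space[OF True m] by simp
 next
  case False
  have "(\<lambda>_. 0 :: ereal) \<in> borel_measurable (lebesgue_on D)" by simp
  then have "esssup (lebesgue_on D) (\<lambda>_. 0 :: ereal) \<le> esssup (lebesgue_on D) (\<lambda>x. ereal (norm (v x)))" by (rule esssup_mono) simp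
  then show ?thesis unfolding Linf_norm_def using False by (simp add: esssup_const real_of_ereal_pos)
 qed
next
 case False
 then show ?thesis unfolding Linf_norm_def by (simp add: esssup_non_measurable top_ereal_def)
qed

lemma Linf_norm_zero: "Linf_norm D (\<lambda>x. 0 :: real) = 0"
 unfolding Linf_norm_def
 by (cases "emeasure (lebesgue_on D) (space (lebesgue_on D)) = 0") (simp_all add: esssup_zero_space esssup_const)

lemma Linf_norm_divide:
 assumes v: "v \<in> Linf D" and a: "a \<in> borel_measurable (lebesgue_on D)" "\<And>x. x \<in> D \<Longrightarrow> m \<le> a x" and m: "m > (0::real)"
 shows "Linf_norm D (\<lambda>x. v x / a x) \<le> Linf_norm D v / (m :: real)"
proof (cases "emeasure (lebesgue_on D) (space (lebesgue_on D)) = 0")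
 case True
 have "(\<lambda>x. ereal (norm (v x / a x))) \<in> borel_measurable (lebesgue_on D)" using v a unfolding Linf_def by auto
 then have "Linf_norm D (\<lambda>x. v x / a x) = 0" unfolding Linf_norm_def using True by (simp add: esssup_zero_space)
 then show ?thesis using Linf_norm_nonneg[of D v] m by simp
next
 case False
 let ?E = "esssup (lebesgue_on D) (\<lambda>x. ereal (norm (v x)))"
 have "(\<lambda>_. 0 :: ereal) \<in> borel_measurable (lebesgue_on D)" by simp
 then have "esssup (lebesgue_on D) (\<lambda>_. 0 :: ereal) \<le> ?E" by (rule esssup_mono) simp
 then have E0: "0 \<le> ?E" using False by (simp add: esssup_const)
 have Ef: "?E < \<infinity>" using v unfolding Linf_def by simp
 have E: "?E = ereal (Linf_norm D v)" unfolding Linf_norm_def using E0 Ef by (cases ?E) auto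
 have "AE x in lebesgue_on D. ereal (norm (v x)) \<le> ?E" by (rule esssup_AE)
 then have "AE x in lebesgue_on D. ereal (norm (v x / a x)) \<le> ereal (Linf_norm D v / m)"
 proof (rule AE_mp[OF _ AE_I2], intro impI)
  fix x assume x: "x \<in> space (lebesgue_on D)" and "ereal (norm (v x)) \<le> ?E"
  then have "\<bar>v x\<bar> \<le> Linf_norm D v" unfolding E by simp
  moreover have "m \<le> a x" using x a(2) by simp
  ultimately have "\<bar>v x\<bar> / a x \<le> Linf_norm D v / m" using m by (intro frac_le) auto
  then show "ereal (norm (v x / a x)) \<le> ereal (Linf_norm D v / m)" using m \<open>m \<le> a x\<close> by (simp add: abs_divide)
 qed
 then have le: "esssup (lebesgue_on D) (\<lambda>x. ereal (norm (v x / a x))) \<le> ereal (Linf_norm D v / m)"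
  using v a unfolding Linf_def by (intro esssup_I) auto
 show ?thesis
  unfolding Linf_norm_def[of D "\<lambda>x. v x / a x"]
  using le Linf_norm_nonneg[of D v] m by (cases "esssup (lebesgue_on D) (\<lambda>x. ereal (norm (v x / a x)))") auto
qed

text \<open>For a squarefree multi-index the sum in the recursion runs over nonempty subsets, with
  all binomial coefficients equal to 1.\<close>

lemma ind_below: "{m. m \<noteq> (\<lambda>_. 0) \<and> (\<forall>j. m j \<le> ind w j)} = ind ` (Pow w - {{}})"
proof (intro set_eqI iffI)
 fix m assume "m \<in> {m. m \<noteq> (\<lambda>_. 0) \<and> (\<forall>j. m j \<le> ind w j)}"
 then have m: "m \<noteq> (\<lambda>_. 0)" "\<And>j. m j \<le> ind w j" by auto
 have "m = ind {j. m j \<noteq> 0}"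
 proof
  fix j show "m j = ind {j. m j \<noteq> 0} j" using m(2)[of j] by (auto simp: ind_def split: if_splits)
 qed
 moreover have "{j. m j \<noteq> 0} \<in> Pow w - {{}}" using m by (fastforce simp: ind_def fun_eq_iff split: if_splits)
 ultimately show "m \<in> ind ` (Pow w - {{}})" by blast
qed (auto simp: ind_def fun_eq_iff)

lemma ind_minus: "v \<subseteq> w \<Longrightarrow> (\<lambda>j. ind w j - ind v j) = ind (w - v)"
 by (auto simp: ind_def fun_eq_iff)

lemma multi_binom_ind: "v \<subseteq> w \<Longrightarrow> multi_binom (ind w) (ind v) = 1"
 unfolding multi_binom_def by (rule prod.neutral) (auto simp: ind_def)

lemma inj_ind: "inj ind" by (rule injI) (auto simp: ind_def fun_eq_iff split: if_splits)

locale dg_param = dg_mesh D \<T>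
 for D :: "'a::euclidean_space set" and \<T> :: "'a set set" +
 fixes k :: nat and \<theta> \<eta> a_min \<alpha> C_DG :: real and a0 f :: "'a \<Rightarrow> real" and \<psi> :: "nat \<Rightarrow> 'a \<Rightarrow> real"
  and u :: "(nat \<Rightarrow> real) \<Rightarrow> 'a \<Rightarrow> real"
 assumes a_cont: "continuous_on D a0" "\<And>j. continuous_on D (\<psi> j)" and \<psi>_Linf: "\<And>j. \<psi> j \<in> Linf D"
  and a_min: "a_min > 0" "\<And>x y. x \<in> D \<Longrightarrow> y \<in> params \<Longrightarrow> a_min \<le> affine_coeff a0 \<psi> y x"
  and \<eta>_pos: "\<eta> > 0" and f_L2: "f \<in> L2 D" and \<alpha>_pos: "\<alpha> > 0" and C_DG_pos: "C_DG > 0"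
  and sol: "\<And>y. y \<in> params \<Longrightarrow> DG_solution D \<T> k \<theta> \<eta> (affine_coeff a0 \<psi> y) f (u y)"
  and coercive: "\<And>y v. y \<in> params \<Longrightarrow> v \<in> DG_space D \<T> k \<Longrightarrow>
     \<alpha> * (DG_norm \<T> \<eta> (affine_coeff a0 \<psi> y) v)\<^sup>2 \<le> DG_form \<T> \<theta> \<eta> (affine_coeff a0 \<psi> y) v v"
  and recursion: "\<And>y \<nu>. y \<in> params \<Longrightarrow> finite {j. \<nu> j \<noteq> 0} \<Longrightarrow> \<nu> \<noteq> (\<lambda>_. 0) \<Longrightarrow>
     DG_norm \<T> \<eta> (affine_coeff a0 \<psi> y) (mixed_pderiv \<nu> u y)
     \<le> C_DG * (\<Sum>m\<in>{m. m \<noteq> (\<lambda>_. 0) \<and> (\<forall>j. m j \<le> \<nu> j)}.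
       real (multi_binom \<nu> m) * Linf_norm D (\<lambda>x. mixed_pderiv m (affine_coeff a0 \<psi>) y x / affine_coeff a0 \<psi> y x)
       * DG_norm \<T> \<eta> (affine_coeff a0 \<psi> y) (mixed_pderiv (\<lambda>j. \<nu> j - m j) u y))"
begin

abbreviation "a \<equiv> affine_coeff a0 \<psi>"

lemma a_Y_cont: "y \<in> Y s \<Longrightarrow> continuous_on D (a y)"
 by (simp only: affine_Y) (intro continuous_intros a_cont)

lemma a_Y_lower: "y \<in> Y s \<Longrightarrow> x \<in> D \<Longrightarrow> a_min \<le> a y x"
 by (rule a_min(2)[OF _ Y_params])

definition basis :: "('a set \<times> ('a \<Rightarrow> nat)) set \<Rightarrow> bool" where
 "basis I \<longleftrightarrow> finite I \<and> (\<forall>i\<in>I. elem_mono i \<in> DG_space D \<T> k) \<and>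
   (\<forall>v\<in>DG_space D \<T> k. \<exists>c. agree v (\<lambda>x. \<Sum>i\<in>I. c i * elem_mono i x)) \<and>
   (\<forall>c. agree (\<lambda>x. \<Sum>i\<in>I. c i * elem_mono i x) (\<lambda>x. 0) \<longrightarrow> (\<forall>i\<in>I. c i = 0))"

definition comb :: "('a set \<times> ('a \<Rightarrow> nat)) set \<Rightarrow> ('a set \<times> ('a \<Rightarrow> nat) \<Rightarrow> real) \<Rightarrow> 'a \<Rightarrow> real" where
 "comb I c x = (\<Sum>i\<in>I. c i * elem_mono i x)"

lemma basisD:
 assumes "basis I"
 shows "finite I" "i \<in> I \<Longrightarrow> elem_mono i \<in> DG_space D \<T> k" "comb I c \<in> DG_space D \<T> k"
  "agree v (comb I c) \<Longrightarrow> lincomb elem_mono I c v" "i \<in> I \<Longrightarrow> pwC1 \<T> (elem_mono i)"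
  "agree (comb I c) (\<lambda>x. 0) \<Longrightarrow> i \<in> I \<Longrightarrow> c i = 0" "pwC1 \<T> (comb I c)"
  "v \<in> DG_space D \<T> k \<Longrightarrow> \<exists>c. agree v (comb I c)"
proof -
 show fI: "finite I" and sp: "\<And>i. i \<in> I \<Longrightarrow> elem_mono i \<in> DG_space D \<T> k" using assms unfolding basis_def by auto
 show "comb I c \<in> DG_space D \<T> k" unfolding comb_def[abs_def] by (rule DG_lincomb[OF fI sp])
 then show "pwC1 \<T> (comb I c)" by (rule DG_pwC1)
 show pw: "\<And>i. i \<in> I \<Longrightarrow> pwC1 \<T> (elem_mono i)" by (rule DG_pwC1[OF sp])
 show "lincomb elem_mono I c v" if "agree v (comb I c)"
  using that fI pw unfolding lincomb_def agree_def comb_def by blast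
 show "c i = 0" if "agree (comb I c) (\<lambda>x. 0)" "i \<in> I" using assms that unfolding basis_def comb_def[abs_def] by blast
 show "\<exists>c. agree v (comb I c)" if "v \<in> DG_space D \<T> k" using assms that unfolding basis_def comb_def[abs_def] by blast
qed

lemma agree_refl: "agree v v" unfolding agree_def by simp

text \<open>A parameter-free norm that lies below all the parametric DG norms and in which
  coefficients are measured.\<close>

definition N0 :: "('a \<Rightarrow> real) \<Rightarrow> real" where "N0 v = DG_norm \<T> \<eta> (\<lambda>_. a_min) v"

lemma form_comb:
 assumes I: "basis I" and a: "continuous_on D b"
 shows "DG_form \<T> t e b (comb I c) (comb I c) = (\<Sum>i\<in>I. c i * (\<Sum>j\<in>I. DG_form \<T> t e b (elem_mono j) (elem_mono i) * c j))"
proof -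
 note l = basisD(4)[OF I agree_refl]
 have "DG_form \<T> t e b (comb I c) (comb I c) = (\<Sum>i\<in>I. c i * DG_form \<T> t e b (comb I c) (elem_mono i))"
  by (rule DG_form_lincomb(2)[OF l basisD(7)[OF I] a])
 also have "\<dots> = (\<Sum>i\<in>I. c i * (\<Sum>j\<in>I. DG_form \<T> t e b (elem_mono j) (elem_mono i) * c j))"
  using DG_form_lincomb(1)[OF l basisD(5)[OF I] a] by (intro sum.cong refl) (simp add: mult.commute)
 finally show ?thesis .
qed

lemma DG_norm_nonneg: "DG_norm \<T> \<eta> b v \<ge> 0"
proof -
 have "(LINT x:F|face_measure F. (norm (jump \<T> F v x))\<^sup>2) \<ge> 0" for F
  unfolding set_lebesgue_integral_def by (intro integral_nonneg_AE) simp
 then show ?thesis unfolding DG_norm_def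
  using \<eta>_pos by (intro real_sqrt_ge_zero add_nonneg_nonneg sum_nonneg mult_nonneg_nonneg divide_nonneg_nonneg less_imp_le[OF face_size_nonneg]) auto
qed

lemma N0_nonneg: "N0 v \<ge> 0"
 unfolding N0_def by (rule DG_norm_nonneg)

lemma N0_pos:
 assumes I: "basis I" and c: "\<exists>i\<in>I. c i \<noteq> 0" shows "N0 (comb I c) > 0"
proof (rule ccontr)
 assume "\<not> N0 (comb I c) > 0"
 then have "N0 (comb I c) = 0" using N0_nonneg[of "comb I c"] by simp
 then have "agree (comb I c) (\<lambda>_. 0)"
  unfolding agree_def N0_def using DG_norm_definite[OF basisD(7)[OF I] a_min(1) \<eta>_pos] by blast
 then show False using basisD(6)[OF I] c by blast
qed

text \<open>The square of \<open>N0\<close> is a positive definite quadratic form in the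
  coefficients, by definiteness of the norm and independence of the basis. The constant depends on
  the mesh only.\<close>

lemma coeff_bound:
 assumes I: "basis I"
 shows "\<exists>K\<ge>0. \<forall>c. \<forall>p\<in>I. \<bar>c p\<bar> \<le> K * N0 (comb I c)"
proof -
 define S where "S i j = DG_form \<T> 1 \<eta> (\<lambda>_. a_min) (elem_mono j) (elem_mono i)" for i j
 have N2: "(N0 (comb I c))\<^sup>2 = (\<Sum>i\<in>I. c i * (\<Sum>j\<in>I. S i j * c j))" for c
  unfolding S_def form_comb[OF I continuous_on_const, symmetric] N0_def
  using a_min(1) \<eta>_pos by (intro DG_norm_sq(2)[OF basisD(7)[OF I] continuous_on_const]) auto
 have "\<exists>K\<ge>0. \<forall>c. (c p)\<^sup>2 \<le> K * (N0 (comb I c))\<^sup>2" if "p \<in> I" for p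
  unfolding N2
 proof (rule posdef_coeff_bound[OF basisD(1)[OF I] _ that])
  fix c :: "'a set \<times> ('a \<Rightarrow> nat) \<Rightarrow> real" assume "\<exists>i\<in>I. c i \<noteq> 0"
  then show "(\<Sum>i\<in>I. c i * (\<Sum>j\<in>I. S i j * c j)) > 0" using N0_pos[OF I, of c] unfolding N2[symmetric] by simp
 qed
 then obtain K where K: "\<And>p. p \<in> I \<Longrightarrow> K p \<ge> 0" "\<And>p c. p \<in> I \<Longrightarrow> (c p)\<^sup>2 \<le> K p * (N0 (comb I c))\<^sup>2" by metis
 have "\<bar>c p\<bar> \<le> (\<Sum>p\<in>I. sqrt (K p)) * N0 (comb I c)" if p: "p \<in> I" for c p
 proof -
  have "\<bar>c p\<bar> = sqrt ((c p)\<^sup>2)" by simp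
  also have "\<dots> \<le> sqrt (K p * (N0 (comb I c))\<^sup>2)" using K(2)[OF p] by (rule real_sqrt_le_mono)
  also have "\<dots> = sqrt (K p) * N0 (comb I c)" using N0_nonneg by (simp add: real_sqrt_mult)
  also have "\<dots> \<le> (\<Sum>p\<in>I. sqrt (K p)) * N0 (comb I c)"
   using member_le_sum[OF p, of "\<lambda>p. sqrt (K p)"] K(1) basisD(1)[OF I] by (intro mult_right_mono N0_nonneg) auto
  finally show ?thesis .
 qed
 then show ?thesis using K(1) by (intro exI[of _ "\<Sum>p\<in>I. sqrt (K p)"]) (auto intro!: sum_nonneg)
qed

lemma N0_le: "y \<in> Y s \<Longrightarrow> pwC1 \<T> v \<Longrightarrow> (N0 v)\<^sup>2 \<le> (DG_norm \<T> \<eta> (a y) v)\<^sup>2"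
 unfolding N0_def using a_min(1) \<eta>_pos by (intro DG_norm_mono a_Y_cont a_Y_lower) auto

lemma form_pos:
 assumes I: "basis I" and y: "y \<in> Y s" and c: "\<exists>i\<in>I. c i \<noteq> 0"
 shows "DG_form \<T> \<theta> \<eta> (a y) (comb I c) (comb I c) > 0"
proof -
 have "0 < \<alpha> * (N0 (comb I c))\<^sup>2" using N0_pos[OF I c] \<alpha>_pos by simp
 also have "\<dots> \<le> \<alpha> * (DG_norm \<T> \<eta> (a y) (comb I c))\<^sup>2"
  using N0_le[OF y basisD(7)[OF I]] \<alpha>_pos by (intro mult_left_mono) auto
 also have "\<dots> \<le> DG_form \<T> \<theta> \<eta> (a y) (comb I c) (comb I c)" by (rule coercive[OF Y_params[OF y] basisD(3)[OF I]])
 finally show ?thesis .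
qed

text \<open>The matrix \<open>A\<close> is defined by the finite affine sum for every
  \<open>y\<close> and hence has affine entries. Positive definiteness, known at truncated
  parameters through coercivity, also forces the coefficients of the given solution to coincide with
  the rational ones.\<close>

lemma rational_coeffs:
 assumes I: "basis I"
 shows "\<exists>c. (\<forall>i\<in>I. c i \<in> ratf s) \<and> (\<forall>y\<in>Y s. agree (u y) (comb I (\<lambda>i. c i y)))"
proof -
 define A where "A i j y = DG_form \<T> \<theta> \<eta> (\<lambda>x. a0 x + (\<Sum>l<s. y l * \<psi> l x)) (elem_mono j) (elem_mono i)" for i j and y :: "nat \<Rightarrow> real"
 define F where "F i = (LINT x|lebesgue_on D. f x * elem_mono i x)" for i
 \<comment> \<open>Only the first \<open>s\<close> parameters occur, which carries positive
   definiteness from \<open>Y s\<close> to all of \<open>pbox s\<close>.\<close>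
 have Atr: "A i j (trunc s y) = A i j y" for i j y by (simp add: A_def trunc_def cong: sum.cong_simp)
 have AY: "A i j y = DG_form \<T> \<theta> \<eta> (a y) (elem_mono j) (elem_mono i)" if "y \<in> Y s" for i j y
  unfolding A_def affine_Y[OF that] ..
 have pos: "(\<Sum>i\<in>I. c i * (\<Sum>j\<in>I. A i j y * c j)) > 0" if y: "y \<in> pbox s" and c: "\<exists>i\<in>I. c i \<noteq> 0" for y c
 proof -
  have "(\<Sum>i\<in>I. c i * (\<Sum>j\<in>I. A i j (trunc s y) * c j)) > 0"
   unfolding AY[OF trunc_Y[OF y]] form_comb[OF I a_Y_cont[OF trunc_Y[OF y]], symmetric] by (rule form_pos[OF I trunc_Y[OF y] c])
  then show ?thesis unfolding Atr .
 qed
 have rat: "A i j \<in> ratf s" if "i \<in> I" "j \<in> I" for i j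
 proof -
  have "A i j = (\<lambda>y. DG_form \<T> \<theta> \<eta> a0 (elem_mono j) (elem_mono i) + (\<Sum>l<s. y l * DG_form \<T> \<theta> 0 (\<psi> l) (elem_mono j) (elem_mono i)))"
   unfolding A_def[abs_def] by (intro ext DG_form_affine basisD(5)[OF I] that a_cont)
  then show ?thesis by (simp only:) (intro ratf.add ratf.const ratf_sum ratf.mult ratf.coord; simp)
 qed
 have "\<exists>c. (\<forall>i\<in>I. c i \<in> ratf s) \<and> (\<forall>y\<in>pbox s. \<forall>i\<in>I. (\<Sum>j\<in>I. A i j y * c j y) = F i)"
  by (rule solve_posdef[OF basisD(1)[OF I] rat ratf.const pos])
 then obtain c where c: "\<And>i. i \<in> I \<Longrightarrow> c i \<in> ratf s" "\<And>y i. y \<in> pbox s \<Longrightarrow> i \<in> I \<Longrightarrow> (\<Sum>j\<in>I. A i j y * c j y) = F i" by blast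
 have "agree (u y) (comb I (\<lambda>i. c i y))" if y: "y \<in> Y s" for y
 proof -
  have uD: "u y \<in> DG_space D \<T> k" and us: "\<And>v. v \<in> DG_space D \<T> k \<Longrightarrow> DG_form \<T> \<theta> \<eta> (a y) (u y) v = (LINT x|lebesgue_on D. f x * v x)"
   using sol[OF Y_params[OF y]] unfolding DG_solution_def by auto
  obtain d where d: "agree (u y) (comb I d)" using basisD(8)[OF I uD] by blast
  have sd: "(\<Sum>j\<in>I. A i j y * d j) = F i" if i: "i \<in> I" for i
  proof -
   have "F i = DG_form \<T> \<theta> \<eta> (a y) (u y) (elem_mono i)" unfolding F_def by (rule us[OF basisD(2)[OF I i], symmetric])
   also have "\<dots> = (\<Sum>j\<in>I. d j * DG_form \<T> \<theta> \<eta> (a y) (elem_mono j) (elem_mono i))"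
    by (rule DG_form_lincomb(1)[OF basisD(4)[OF I d] basisD(5)[OF I i] a_Y_cont[OF y]])
   finally show ?thesis unfolding AY[OF y] by (simp add: mult.commute)
  qed
  have "d i = c i y" if i: "i \<in> I" for i
  proof (rule ccontr)
   assume ne: "d i \<noteq> c i y"
   let ?e = "\<lambda>i. d i - c i y"
   have "(\<Sum>i\<in>I. ?e i * (\<Sum>j\<in>I. A i j y * ?e j)) > 0" by (rule pos[OF Y_pbox[OF y]]) (use ne i in auto)
   moreover have "(\<Sum>j\<in>I. A i j y * ?e j) = 0" if "i \<in> I" for i
    using sd[OF that] c(2)[OF Y_pbox[OF y] that] by (simp add: right_diff_distrib sum_subtractf)
   ultimately show False by simp
  qed
  then have "comb I d = comb I (\<lambda>i. c i y)" unfolding comb_def by (intro ext sum.cong) auto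
  then show ?thesis using d by simp
 qed
 then show ?thesis using c(1) by blast
qed

text \<open>The equation is tested with the solution itself. Coercivity bounds \<alpha> times the
  squared norm by the load, and the load is bounded linearly in the norm through the
  coefficients.\<close>

lemma solution_bound:
 assumes I: "basis I" and K: "K \<ge> 0" "\<And>c p. p \<in> I \<Longrightarrow> \<bar>c p\<bar> \<le> K * N0 (comb I c)" and y: "y \<in> Y s"
 shows "DG_norm \<T> \<eta> (a y) (u y) \<le> (\<Sum>i\<in>I. K * \<bar>LINT x|lebesgue_on D. f x * elem_mono i x\<bar>) / \<alpha>"
proof -
 let ?F = "\<lambda>i. LINT x|lebesgue_on D. f x * elem_mono i x" and ?n = "DG_norm \<T> \<eta> (a y) (u y)"
 have uD: "u y \<in> DG_space D \<T> k" and us: "\<And>v. v \<in> DG_space D \<T> k \<Longrightarrow> DG_form \<T> \<theta> \<eta> (a y) (u y) v = (LINT x|lebesgue_on D. f x * v x)"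
  using sol[OF Y_params[OF y]] unfolding DG_solution_def by auto
 obtain d where d: "agree (u y) (comb I d)" using basisD(8)[OF I uD] by blast
 have ay: "x \<in> D \<Longrightarrow> 0 \<le> a y x" for x using a_Y_lower[OF y, of x] a_min(1) by linarith
 have nn: "?n \<ge> 0" by (rule DG_norm_nonneg)
 have "N0 (comb I d) \<le> ?n"
 proof (rule power2_le_imp_le[OF _ nn])
  have "?n = DG_norm \<T> \<eta> (a y) (comb I d)"
   using d \<eta>_pos unfolding agree_def by (intro DG_norm_cong basisD(7)[OF I] a_Y_cont[OF y] ay) auto
  then show "(N0 (comb I d))\<^sup>2 \<le> ?n\<^sup>2" using N0_le[OF y basisD(7)[OF I]] by simp
 qed
 then have db: "\<bar>d i\<bar> \<le> K * ?n" if "i \<in> I" for i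
  using K(2)[OF that, of d] mult_left_mono[OF _ K(1)] by (meson order_trans)
 have "\<alpha> * ?n\<^sup>2 \<le> DG_form \<T> \<theta> \<eta> (a y) (u y) (u y)" by (rule coercive[OF Y_params[OF y] uD])
 also have "\<dots> = (\<Sum>i\<in>I. d i * DG_form \<T> \<theta> \<eta> (a y) (u y) (elem_mono i))"
  by (rule DG_form_lincomb(2)[OF basisD(4)[OF I d] DG_pwC1[OF uD] a_Y_cont[OF y]])
 also have "\<dots> = (\<Sum>i\<in>I. d i * ?F i)" using us basisD(2)[OF I] by (intro sum.cong refl) simp
 also have "\<dots> \<le> (\<Sum>i\<in>I. (K * ?n) * \<bar>?F i\<bar>)"
 proof (rule sum_mono)
  fix i assume i: "i \<in> I"
  have "d i * ?F i \<le> \<bar>d i\<bar> * \<bar>?F i\<bar>" by (metis abs_ge_self abs_mult)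
  also have "\<dots> \<le> (K * ?n) * \<bar>?F i\<bar>" by (intro mult_right_mono db[OF i]) simp
  finally show "d i * ?F i \<le> (K * ?n) * \<bar>?F i\<bar>" .
 qed
 also have "\<dots> = (\<Sum>i\<in>I. K * \<bar>?F i\<bar>) * ?n" by (simp add: sum_distrib_left ac_simps)
 finally have *: "\<alpha> * ?n\<^sup>2 \<le> (\<Sum>i\<in>I. K * \<bar>?F i\<bar>) * ?n" .
 show ?thesis
 proof (cases "?n = 0")
  case True
  then show ?thesis using K(1) \<alpha>_pos by (simp add: sum_nonneg)
 next
  case False
  then have "?n > 0" using nn by simp
  moreover have "(\<alpha> * ?n) * ?n \<le> (\<Sum>i\<in>I. K * \<bar>?F i\<bar>) * ?n" using * by (simp add: power2_eq_square mult.assoc)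
  ultimately have "\<alpha> * ?n \<le> (\<Sum>i\<in>I. K * \<bar>?F i\<bar>)" by (simp only: mult_le_cancel_right_pos)
  then show ?thesis using \<alpha>_pos by (simp add: field_simps)
 qed
qed

lemma coefficient_pderiv:
 assumes y: "y \<in> Y s" and w: "w \<subseteq> {..<s}" "w \<noteq> {}"
 shows "Linf_norm D (\<lambda>x. mixed_pderiv (ind w) a y x / a y x) \<le> (if is_singleton w then Linf_norm D (\<psi> (the_elem w)) / a_min else 0)"
proof -
 have fw: "finite w" using w(1) finite_subset by blast
 have e: "mixed_pderiv (ind w) a y = (\<lambda>x. if tl (sorted_list_of_set w) = [] then \<psi> (hd (sorted_list_of_set w)) x else 0)"
  unfolding mixed_pderiv_ind[OF fw] using w fw by (intro ext) (subst pderiv_fold_affine[OF _ _ y]; simp)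
 show ?thesis
 proof (cases "is_singleton w")
  case True
  then obtain j where j: "w = {j}" unfolding is_singleton_def by blast
  have "a y \<in> borel_measurable (lebesgue_on D)"
   using continuous_imp_measurable_on_sets_lebesgue[OF a_Y_cont[OF y]] D_lmeas by auto
  then have "Linf_norm D (\<lambda>x. \<psi> j x / a y x) \<le> Linf_norm D (\<psi> j) / a_min"
   by (intro Linf_norm_divide \<psi>_Linf a_Y_lower[OF y] a_min(1))
  then show ?thesis unfolding e using True j by simp
 next
  case False
  have "tl (sorted_list_of_set w) \<noteq> []"
  proof
   assume "tl (sorted_list_of_set w) = []"
   moreover have "sorted_list_of_set w \<noteq> []" using w(2) fw by simp
   ultimately have "sorted_list_of_set w = [hd (sorted_list_of_set w)]" by (cases "sorted_list_of_set w") auto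
   then have "w = {hd (sorted_list_of_set w)}" using fw by (metis empty_set list.simps(15) set_sorted_list_of_set)
   then show False using False is_singletonI by metis
  qed
  then show ?thesis unfolding e using False by (simp add: Linf_norm_zero)
 qed
qed

text \<open>Only singletons contribute to the recursion, so a set of cardinality
  \<open>Suc n\<close> leaves that many equal bounds, one for each removed index; their number
  produces the factorial.\<close>

lemma mixed_bound:
 assumes y: "y \<in> Y s" and w: "w \<subseteq> {..<s}"
 shows "DG_norm \<T> \<eta> (a y) (mixed_pderiv (ind w) u y) \<le>
  fact (card w) * (\<Prod>j\<in>w. C_DG * Linf_norm D (\<psi> j) / a_min) * DG_norm \<T> \<eta> (a y) (u y)"
 using w
proof (induction "card w" arbitrary: w)
 case 0
 then have "w = {}" using finite_subset[of w "{..<s}"] by simp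
 then show ?case by (simp add: mixed_pderiv_ind)
next
 case (Suc n)
 have fw: "finite w" using Suc.prems finite_subset by blast
 define N where "N v = DG_norm \<T> \<eta> (a y) (mixed_pderiv (ind v) u y)" for v
 define L where "L v = Linf_norm D (\<lambda>x. mixed_pderiv (ind v) a y x / a y x)" for v
 define \<beta> where "\<beta> j = C_DG * Linf_norm D (\<psi> j) / a_min" for j
 have \<beta>0: "\<beta> j \<ge> 0" for j
  unfolding \<beta>_def by (intro divide_nonneg_nonneg mult_nonneg_nonneg Linf_norm_nonneg less_imp_le C_DG_pos a_min(1))
 have wne: "w \<noteq> {}" using Suc.hyps(2) by auto
 have "{j. ind w j \<noteq> 0} = w" by (auto simp: ind_def)
 moreover have "ind w \<noteq> (\<lambda>_. 0)" using wne by (auto simp: ind_def fun_eq_iff)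
 ultimately have "N w \<le> C_DG * (\<Sum>m\<in>ind ` (Pow w - {{}}). real (multi_binom (ind w) m) * Linf_norm D (\<lambda>x. mixed_pderiv m a y x / a y x)
       * DG_norm \<T> \<eta> (a y) (mixed_pderiv (\<lambda>j. ind w j - m j) u y))"
  unfolding N_def ind_below[symmetric] using fw by (intro recursion Y_params[OF y]) auto
 also have "\<dots> = C_DG * (\<Sum>v\<in>Pow w - {{}}. L v * N (w - v))"
  by (subst sum.reindex[OF inj_on_subset[OF inj_ind subset_UNIV]])
   (auto simp: multi_binom_ind ind_minus L_def N_def intro!: sum.cong)
 also have "\<dots> \<le> C_DG * (\<Sum>v\<in>Pow w - {{}}. if is_singleton v then Linf_norm D (\<psi> (the_elem v)) / a_min * N (w - v) else 0)"
 proof (intro mult_left_mono sum_mono less_imp_le[OF C_DG_pos])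
  fix v assume v: "v \<in> Pow w - {{}}"
  have "L v \<le> (if is_singleton v then Linf_norm D (\<psi> (the_elem v)) / a_min else 0)"
   unfolding L_def using v Suc.prems by (intro coefficient_pderiv[OF y]) auto
  from mult_right_mono[OF this, of "N (w - v)"]
  show "L v * N (w - v) \<le> (if is_singleton v then Linf_norm D (\<psi> (the_elem v)) / a_min * N (w - v) else 0)"
   unfolding N_def using DG_norm_nonneg by (auto split: if_splits)
 qed
 also have "\<dots> = C_DG * (\<Sum>v\<in>(\<lambda>j. {j}) ` w. Linf_norm D (\<psi> (the_elem v)) / a_min * N (w - v))"
  using fw by (intro mult_arg_cong refl sum.mono_neutral_cong_right) (auto simp: is_singleton_def)
 also have "\<dots> = (\<Sum>j\<in>w. \<beta> j * N (w - {j}))"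
  by (subst sum.reindex) (auto simp: \<beta>_def sum_distrib_left ac_simps)
 also have "\<dots> \<le> (\<Sum>j\<in>w. fact n * (\<Prod>j\<in>w. \<beta> j) * DG_norm \<T> \<eta> (a y) (u y))"
 proof (rule sum_mono)
  fix j assume j: "j \<in> w"
  have c: "card (w - {j}) = n" using Suc.hyps(2) j fw by simp
  have "N (w - {j}) \<le> fact n * (\<Prod>j\<in>w - {j}. \<beta> j) * DG_norm \<T> \<eta> (a y) (u y)"
   using Suc.hyps(1)[of "w - {j}"] c Suc.prems unfolding N_def \<beta>_def by auto
  then have "\<beta> j * N (w - {j}) \<le> \<beta> j * (fact n * (\<Prod>j\<in>w - {j}. \<beta> j) * DG_norm \<T> \<eta> (a y) (u y))"
   using \<beta>0 by (rule mult_left_mono)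
  also have "\<dots> = fact n * (\<Prod>j\<in>w. \<beta> j) * DG_norm \<T> \<eta> (a y) (u y)"
   using prod.remove[OF fw j, of \<beta>] by simp
  finally show "\<beta> j * N (w - {j}) \<le> fact n * (\<Prod>j\<in>w. \<beta> j) * DG_norm \<T> \<eta> (a y) (u y)" .
 qed
 also have "\<dots> = fact (card w) * (\<Prod>j\<in>w. \<beta> j) * DG_norm \<T> \<eta> (a y) (u y)"
  using Suc.hyps(2)[symmetric] by simp
 finally show ?case unfolding N_def \<beta>_def .
qed

text \<open>\<open>I\<close> and \<open>A\<close> are fixed before \<open>s\<close>, and only the
  coefficient functions vary with the dimension. The bounds are proved on \<open>Y s\<close> and
  carried to \<open>pbox s\<close>, since rational functions see the first \<open>s\<close>
  coordinates only.\<close>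

theorem parametric_regularity:
 "\<exists>I A. finite I \<and> A \<ge> 0 \<and> (\<forall>s. \<exists>c. (\<forall>i\<in>I. c i \<in> ratf s) \<and>
   (\<forall>y\<in>Y s. agree (u y) (\<lambda>x. \<Sum>i\<in>I. c i y * elem_mono i x)) \<and>
   (\<forall>i\<in>I. \<forall>w\<subseteq>{..<s}. \<forall>y\<in>pbox s. \<bar>dmix s w (c i) y\<bar> \<le> A * fact (card w) * (\<Prod>j\<in>w. C_DG * Linf_norm D (\<psi> j) / a_min)))"
proof -
 obtain I where I: "basis I" using DG_basis[of k] unfolding basis_def by blast
 obtain K where K: "K \<ge> 0" "\<And>c p. p \<in> I \<Longrightarrow> \<bar>c p\<bar> \<le> K * N0 (comb I c)" using coeff_bound[OF I] by blast
 define U where "U = (\<Sum>i\<in>I. K * \<bar>LINT x|lebesgue_on D. f x * elem_mono i x\<bar>) / \<alpha>"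
 have U0: "U \<ge> 0" unfolding U_def using K(1) \<alpha>_pos by (intro divide_nonneg_nonneg sum_nonneg) auto
 let ?P = "\<lambda>w. (\<Prod>j\<in>w. C_DG * Linf_norm D (\<psi> j) / a_min)"
 have P0: "?P w \<ge> 0" for w by (intro prod_nonneg ballI divide_nonneg_nonneg mult_nonneg_nonneg Linf_norm_nonneg less_imp_le C_DG_pos a_min(1))
 have "\<exists>c. (\<forall>i\<in>I. c i \<in> ratf s) \<and> (\<forall>y\<in>Y s. agree (u y) (\<lambda>x. \<Sum>i\<in>I. c i y * elem_mono i x)) \<and>
   (\<forall>i\<in>I. \<forall>w\<subseteq>{..<s}. \<forall>y\<in>pbox s. \<bar>dmix s w (c i) y\<bar> \<le> K * U * fact (card w) * ?P w)" for s
 proof -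
  obtain c where c: "\<And>i. i \<in> I \<Longrightarrow> c i \<in> ratf s" "\<And>y. y \<in> Y s \<Longrightarrow> agree (u y) (comb I (\<lambda>i. c i y))"
   using rational_coeffs[OF I] by blast
  have bY: "\<bar>dmix s w (c i) y\<bar> \<le> K * U * fact (card w) * ?P w" if i: "i \<in> I" and w: "w \<subseteq> {..<s}" and y: "y \<in> Y s" for i w y
  proof -
   have fw: "finite w" using w finite_subset by blast
   let ?n = "DG_norm \<T> \<eta> (a y) (mixed_pderiv (ind w) u y)" and ?v = "comb I (\<lambda>i. dmix s w (c i) y)"
   have ag: "mixed_pderiv (ind w) u y x = ?v x" if T: "T \<in> \<T>" "x \<in> interior T" for T x
    unfolding mixed_pderiv_ind[OF fw] comb_def dmix_def
   proof (rule pderiv_fold_ratf[OF basisD(1)[OF I] _ c(1) _ y])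
    show "y' \<in> Y s \<Longrightarrow> u y' x = (\<Sum>i\<in>I. c i y' * elem_mono i x)" for y'
     using c(2)[of y'] T unfolding agree_def comb_def by blast
   qed (use fw w in auto)
   have ay: "x \<in> D \<Longrightarrow> 0 \<le> a y x" for x using a_Y_lower[OF y, of x] a_min(1) by linarith
   have "?n = DG_norm \<T> \<eta> (a y) ?v"
    using ag \<eta>_pos by (intro DG_norm_cong basisD(7)[OF I] a_Y_cont[OF y] ay) auto
   then have "N0 ?v \<le> ?n" using N0_le[OF y basisD(7)[OF I]] by (intro power2_le_imp_le[OF _ DG_norm_nonneg]) simp
   also have "\<dots> \<le> fact (card w) * ?P w * DG_norm \<T> \<eta> (a y) (u y)" by (rule mixed_bound[OF y w])
   also have "\<dots> \<le> fact (card w) * ?P w * U"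
    unfolding U_def by (intro mult_left_mono solution_bound[OF I K y] mult_nonneg_nonneg P0) auto
   finally have "K * N0 ?v \<le> K * (fact (card w) * ?P w * U)" using K(1) by (rule mult_left_mono)
   then show ?thesis using K(2)[OF i, of "\<lambda>i. dmix s w (c i) y"] by (simp add: ac_simps)
  qed
  have "\<bar>dmix s w (c i) y\<bar> \<le> K * U * fact (card w) * ?P w" if "i \<in> I" "w \<subseteq> {..<s}" "y \<in> pbox s" for i w y
   using bY[OF that(1,2) trunc_Y[OF that(3)]] ratf_trunc[OF dmix_ratf[OF c(1)[OF that(1)] that(2)]] by simp
  then show ?thesis using c unfolding comb_def[abs_def] by blast
 qed
 then show ?thesis using basisD(1)[OF I] K(1) U0 by (intro exI[of _ I] exI[of _ "K * U"]) auto
qed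

end

section \<open>From coefficients to the error in L2\<close>

context dg_mesh
begin

lemma AE_elem_interior: "AE x in lebesgue_on D. \<exists>T\<in>\<T>. x \<in> interior T"
proof -
 have "AE x in lebesgue. x \<in> T \<longrightarrow> x \<in> interior T" if T: "T \<in> \<T>" for T
  using AE_interior[OF T] elem_props(9)[OF T] by (subst (asm) AE_restrict_space_iff) auto
 then have "AE x in lebesgue. \<forall>T\<in>\<T>. x \<in> T \<longrightarrow> x \<in> interior T"
  using fin by (intro AE_finite_allI) auto
 then have "AE x in lebesgue. x \<in> D \<longrightarrow> (\<exists>T\<in>\<T>. x \<in> interior T)"
  by eventually_elim (use un in blast)
 then show ?thesis using D_lmeas by (subst AE_restrict_space_iff) auto
qed

text \<open>Integral and cubature rule are linear, so off the skeleton the error is the combination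
  of the scalar coefficient errors with the basis functions. The finite Cauchy-Schwarz inequality
  separates the shift from the space variable.\<close>

lemma QMC_error_split:
 assumes I: "finite I" and c: "\<And>i. i \<in> I \<Longrightarrow> c i \<in> ratf s"
  and rep: "\<And>y. y \<in> Y s \<Longrightarrow> agree (u y) (\<lambda>x. \<Sum>i\<in>I. c i y * elem_mono i x)"
 shows "(L2_norm D (\<lambda>x. (LINT y|cubeM s. truncated s u y x) - Q_ran n R s z \<Delta> (\<lambda>y. truncated s u y x)))\<^sup>2
  \<le> (\<Sum>i\<in>I. (qerr n R s z \<Delta> (c i))\<^sup>2) * (LINT x|lebesgue_on D. (\<Sum>i\<in>I. (elem_mono i x)\<^sup>2))"
proof -
 define E where "E i = qerr n R s z \<Delta> (c i)" for i
 let ?e = "\<lambda>x. (LINT y|cubeM s. truncated s u y x) - Q_ran n R s z \<Delta> (\<lambda>y. truncated s u y x)"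
 have eq: "?e x = (\<Sum>i\<in>I. E i * elem_mono i x)" if T: "T \<in> \<T>" "x \<in> interior T" for T x
 proof -
  have tr: "truncated s u y x = (\<Sum>i\<in>I. c i y * elem_mono i x)" if "y \<in> pbox s" for y
  proof -
   have "truncated s u y x = u (trunc s y) x" by (simp add: truncated_def trunc_def[abs_def])
   also have "\<dots> = (\<Sum>i\<in>I. c i (trunc s y) * elem_mono i x)" using rep[OF trunc_Y[OF that]] T unfolding agree_def by blast
   also have "\<dots> = (\<Sum>i\<in>I. c i y * elem_mono i x)" using ratf_trunc[OF c] by (intro sum.cong refl) simp
   finally show ?thesis .
  qed
  have int: "integrable (cubeM s) (c i)" if "i \<in> I" for i
   by (rule continuous_cube_integrable[OF ratf_continuous_cube[OF c[OF that]]])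
  have "(LINT y|cubeM s. truncated s u y x) = (LINT y|cubeM s. (\<Sum>i\<in>I. c i y * elem_mono i x))"
   by (rule B_integral_cong) (use tr cube_subset_pbox in \<open>auto simp: space_cube_measure\<close>)
  also have "\<dots> = (\<Sum>i\<in>I. (LINT y|cubeM s. c i y) * elem_mono i x)"
   using int by (subst B_integral_sum) auto
  finally have 1: "(LINT y|cubeM s. truncated s u y x) = (\<Sum>i\<in>I. (LINT y|cubeM s. c i y) * elem_mono i x)" .
  have lp: "lattice_point n s z i d \<in> pbox s" for i d
   unfolding pbox_def lattice_point_def by (simp add: less_imp_le[OF frac_lt_1])
  have "Q_ran n R s z \<Delta> (\<lambda>y. truncated s u y x) = (\<Sum>i\<in>I. Q_ran n R s z \<Delta> (c i) * elem_mono i x)"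
  proof -
   have q: "(\<Sum>l\<in>{1..n}. \<Sum>r<R. \<Sum>i\<in>I. c i (lattice_point n s z l (\<Delta> r)) * elem_mono i x) =
     (\<Sum>i\<in>I. (\<Sum>l\<in>{1..n}. \<Sum>r<R. c i (lattice_point n s z l (\<Delta> r))) * elem_mono i x)"
    unfolding sum_distrib_right by (subst sum.swap[of _ I], subst sum.swap[of _ I]) (rule refl)
   show ?thesis unfolding Q_ran_def tr[OF lp] q sum_distrib_left[of _ _ I] mult.assoc ..
  qed
  then show ?thesis unfolding 1 E_def by (simp add: left_diff_distrib sum_subtractf)
 qed
 have int2: "integrable (lebesgue_on D) (\<lambda>x. (elem_mono i x)\<^sup>2)" for i
  unfolding power2_eq_square by (rule BM_mult[OF elem_mono_BM elem_mono_BM D_lmeas])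
 have "(L2_norm D ?e)\<^sup>2 = (LINT x|lebesgue_on D. (?e x)\<^sup>2)"
  unfolding L2_norm_def by (subst real_sqrt_pow2) (auto intro!: integral_nonneg_AE)
 also have "\<dots> \<le> (LINT x|lebesgue_on D. (\<Sum>i\<in>I. (E i)\<^sup>2) * (\<Sum>i\<in>I. (elem_mono i x)\<^sup>2))"
 proof (rule integral_mono_AE')
  show "integrable (lebesgue_on D) (\<lambda>x. (\<Sum>i\<in>I. (E i)\<^sup>2) * (\<Sum>i\<in>I. (elem_mono i x)\<^sup>2))"
   by (intro integrable_mult_right B_integrable_sum int2)
  show "AE x in lebesgue_on D. (?e x)\<^sup>2 \<le> (\<Sum>i\<in>I. (E i)\<^sup>2) * (\<Sum>i\<in>I. (elem_mono i x)\<^sup>2)"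
   using AE_elem_interior
  proof eventually_elim
   case (elim x)
   then obtain T where "T \<in> \<T>" "x \<in> interior T" by blast
   from eq[OF this] show ?case by (simp only: Cauchy_Schwarz_ineq_sum)
  qed
 qed (intro AE_I2 mult_nonneg_nonneg sum_nonneg; simp)
 finally show ?thesis unfolding E_def by simp
qed

end

text \<open>Eventually \<open>x j < 1\<close>, and from there on a larger exponent gives a smaller
  power.\<close>

lemma weight_summable:
 fixes x :: "nat \<Rightarrow> real"
 assumes p: "0 < p" "summable (\<lambda>j. x j powr p)" "p \<le> q" and x: "\<And>j. x j \<ge> 0" "summable x" and K: "K \<ge> 0"
 shows "summable (\<lambda>j. (K * x j) powr q)"
proof -
 have "(\<lambda>j. x j) \<longlonglongrightarrow> 0" by (rule summable_LIMSEQ_zero[OF x(2)])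
 then have "\<forall>\<^sub>F j in sequentially. x j < 1" by (rule order_tendstoD(2)) simp
 then have "\<forall>\<^sub>F j in sequentially. norm (x j powr q) \<le> x j powr p"
 proof eventually_elim
  case (elim j)
  then show ?case using p(3) x(1)[of j] by (cases "x j = 0") (auto simp: powr_mono')
 qed
 then have "summable (\<lambda>j. x j powr q)" using p(2) by (rule summable_comparison_test_ev)
 then have "summable (\<lambda>j. K powr q * x j powr q)" by (rule summable_mult)
 then show ?thesis using K x(1) by (simp add: powr_mult)
qed

text \<open>For \<open>p > 2/3\<close> the choice of \<open>lam\<close> solves 2 lam / (1 + lam) =
  p; otherwise that quotient is 2 / (3 - 2 \<epsilon>), which exceeds 2/3. The restriction
  \<open>lam > 1/2\<close>, needed for convergence of the zeta series, is what costs the \<epsilon>.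
  The factor 2 in the last equation is the passage from mean-square to root-mean-square
  error.\<close>

lemma lam_facts:
 fixes p \<epsilon> :: real
 assumes p: "0 < p" "p < 1" and \<epsilon>: "0 < \<epsilon>" "\<epsilon> < 1/2"
  and lam: "lam = (if p > 2/3 then p / (2 - p) else 1 / (2 - 2 * \<epsilon>))"
 shows "1/2 < lam" "lam < 1" "p \<le> 2 * lam / (1 + lam)"
  "- 1 / lam = 2 * (if p > 2/3 then - 1 / p + 1 / 2 else - 1 + \<epsilon>)"
proof -
 have "1/2 < lam \<and> lam < 1 \<and> p \<le> 2 * lam / (1 + lam) \<and> - 1 / lam = 2 * (if p > 2/3 then - 1 / p + 1 / 2 else - 1 + \<epsilon>)"
 proof (cases "p > 2/3")
  case True
  then have l: "lam = p / (2 - p)" using lam by simp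
  have "1 + lam = 2 / (2 - p)" using p unfolding l by (simp add: field_simps)
  then have "2 * lam / (1 + lam) = p" using p unfolding l by simp
  moreover have "1/2 < lam" "lam < 1" "- 1 / lam = 2 * (- 1 / p + 1 / 2)" using True p unfolding l by (simp_all add: field_simps)
  ultimately show ?thesis using True by simp
 next
  case False
  then have l: "lam = 1 / (2 - 2 * \<epsilon>)" using lam by simp
  have "1 + lam = (3 - 2 * \<epsilon>) / (2 - 2 * \<epsilon>)" using \<epsilon> unfolding l by (simp add: field_simps)
  then have "2 * lam / (1 + lam) = 2 / (3 - 2 * \<epsilon>)" using \<epsilon> unfolding l by (simp add: divide_simps)
  also have "\<dots> \<ge> 2 / 3" using \<epsilon> by (simp add: field_simps)
  finally have "p \<le> 2 * lam / (1 + lam)" using False by linarith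
  moreover have "1/2 < lam" "lam < 1" "- 1 / lam = 2 * (- 1 + \<epsilon>)" using \<epsilon> unfolding l by (simp_all add: field_simps)
  ultimately show ?thesis using False by simp
 qed
 then show "1/2 < lam" "lam < 1" "p \<le> 2 * lam / (1 + lam)"
  "- 1 / lam = 2 * (if p > 2/3 then - 1 / p + 1 / 2 else - 1 + \<epsilon>)" by blast+
qed

theorem theorem6p2:
  fixes D :: "(real ^ 'd) set"
    and a0 f :: "real ^ 'd \<Rightarrow> real"
    and \<psi> :: "nat \<Rightarrow> real ^ 'd \<Rightarrow> real"
    and a :: "(nat \<Rightarrow> real) \<Rightarrow> real ^ 'd \<Rightarrow> real"
    and \<T> :: "nat \<Rightarrow> (real ^ 'd) set set"
    and u :: "nat \<Rightarrow> (nat \<Rightarrow> real) \<Rightarrow> real ^ 'd \<Rightarrow> real"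
    and b :: "nat \<Rightarrow> real"
    and \<gamma> :: "nat set \<Rightarrow> real"
    and a_min a_max p \<theta> \<eta> \<tau> \<tau>' C_tr \<alpha> C_DG \<epsilon> lam :: real
    and k R :: nat
  assumes dim: "CARD('d) \<in> {1, 2, 3}"
    and U5: "polytope D" "interior D \<noteq> {}"
    and f: "f \<in> L2 D"
    and a_def: "a = affine_coeff a0 \<psi>"
    and U1: "a0 \<in> Linf D" "\<And>j. \<psi> j \<in> Linf D" "summable (\<lambda>j. Linf_norm D (\<psi> j))"
    and U2: "a_min > 0" "a_max > 0"
      "\<And>x y. x \<in> D \<Longrightarrow> y \<in> params \<Longrightarrow> a_min \<le> a y x \<and> a y x \<le> a_max"
    and U3: "0 < p" "p < 1" "summable (\<lambda>j. Linf_norm D (\<psi> j) powr p)"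
    and U4: "a0 \<in> W1inf D" "\<And>j. \<psi> j \<in> W1inf D" "summable (\<lambda>j. W1inf_norm D (\<psi> j))"
    and mesh: "shape_contact_regular D \<T>"
    and C_tr: "\<And>h. is_trace_const D (\<T> h) k C_tr"
    and \<theta>: "\<theta> \<in> {-1, 0, 1}"
    and \<tau>: "\<tau> > 1" "\<tau>' > 0"
    and \<eta>: "\<eta> > 0"
      "\<And>h. \<eta> \<ge> \<tau> * (a_max\<^sup>2 * C_tr\<^sup>2 * real (max_faces (\<T> h)) * (\<theta> - 1)\<^sup>2 / (4 * a_min))"
      "\<eta> \<ge> \<tau>' * (a_max\<^sup>2 / a_min)"
    and u: "\<And>h y. y \<in> params \<Longrightarrow> DG_solution D (\<T> h) k \<theta> \<eta> (a y) f (u h y)"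
    and \<alpha>: "\<alpha> > 0"
      "\<And>h y v. y \<in> params \<Longrightarrow> v \<in> DG_space D (\<T> h) k \<Longrightarrow>
         \<alpha> * (DG_norm (\<T> h) \<eta> (a y) v)\<^sup>2 \<le> DG_form (\<T> h) \<theta> \<eta> (a y) v v"
    and C_DG: "C_DG > 0"
      "\<And>h y \<nu>. y \<in> params \<Longrightarrow> finite {j. \<nu> j \<noteq> 0} \<Longrightarrow> \<nu> \<noteq> (\<lambda>_. 0) \<Longrightarrow>
         DG_norm (\<T> h) \<eta> (a y) (mixed_pderiv \<nu> (u h) y)
         \<le> C_DG * (\<Sum>m\<in>{m. m \<noteq> (\<lambda>_. 0) \<and> (\<forall>j. m j \<le> \<nu> j)}.
              real (multi_binom \<nu> m)
              * Linf_norm D (\<lambda>x. mixed_pderiv m a y x / a y x)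
              * DG_norm (\<T> h) \<eta> (a y) (mixed_pderiv (\<lambda>j. \<nu> j - m j) (u h) y))"
    and b_def: "b = (\<lambda>j. C_DG * Linf_norm D (\<psi> j) / (\<alpha> * a_min))"
    and R: "R \<ge> 1"
    and \<epsilon>: "0 < \<epsilon>" "\<epsilon> < 1/2"
    and lam_def: "lam = (if p > 2/3 then p / (2 - p) else 1 / (2 - 2 * \<epsilon>))"
    and \<gamma>_def: "\<gamma> = QMC_weight b lam"
  shows "\<forall>h. \<exists>C. \<forall>s\<ge>1. \<forall>m\<ge>1. \<exists>z.
           (\<forall>j<s. z j < 2 ^ m) \<and> CBC_vector (2 ^ m) s \<gamma> z \<and>
           QMC_rms_error D (2 ^ m) R s z (truncated s (u h))
           \<le> C * (if p > 2/3 then real (2 ^ m) powr (- 1 / p + 1 / 2)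
                  else real (2 ^ m) powr (- 1 + \<epsilon>))"
proof
 fix h
 have pm: "polyhedral_mesh D (\<T> h)" "no_hanging_nodes D (\<T> h)" using mesh unfolding shape_contact_regular_def by blast+
 interpret dg_param D "\<T> h" k \<theta> \<eta> a_min \<alpha> C_DG a0 f \<psi> "u h"
 proof unfold_locales
  show "continuous_on D a0" "\<And>j. continuous_on D (\<psi> j)" using U4 unfolding W1inf_def by auto
  show "\<And>x y. x \<in> D \<Longrightarrow> y \<in> params \<Longrightarrow> a_min \<le> affine_coeff a0 \<psi> y x" using U2(3) unfolding a_def by blast
 qed (fact pm U1(2) U2(1) \<eta>(1) f \<alpha>(1) C_DG(1) u[unfolded a_def] \<alpha>(2)[unfolded a_def] C_DG(2)[unfolded a_def])+
 \<comment> \<open>The numbers \<open>b j\<close> contain a division by \<alpha> that the derivative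
   bound does not; the resulting factor per coordinate is the parameter \<open>\<beta>\<close> of
   \<open>qmc_rate\<close>.\<close>
 have b\<beta>: "C_DG * Linf_norm D (\<psi> j) / a_min = \<alpha> * b j" for j using \<alpha>(1) by (simp add: b_def)
 obtain I A where I: "finite I" "A \<ge> 0" and reg: "\<And>s. \<exists>c. (\<forall>i\<in>I. c i \<in> ratf s) \<and>
   (\<forall>y\<in>Y s. agree (u h y) (\<lambda>x. \<Sum>i\<in>I. c i y * elem_mono i x)) \<and>
   (\<forall>i\<in>I. dmix_le s A \<alpha> b (c i))"
  using parametric_regularity unfolding b\<beta> by blast
 note l = lam_facts[OF U3(1,2) \<epsilon> lam_def]
 have b0: "b j \<ge> 0" for j unfolding b_def by (intro divide_nonneg_nonneg mult_nonneg_nonneg Linf_norm_nonneg less_imp_le C_DG(1) U2(1) \<alpha>(1))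
 have "summable (\<lambda>j. (C_DG / (\<alpha> * a_min) * Linf_norm D (\<psi> j)) powr (2 * lam / (1 + lam)))"
  by (intro weight_summable[OF U3(1,3) l(3) Linf_norm_nonneg U1(3)] divide_nonneg_nonneg mult_nonneg_nonneg less_imp_le C_DG(1) U2(1) \<alpha>(1))
 then have sb: "summable (\<lambda>j. b j powr (2 * lam / (1 + lam)))" by (simp add: b_def)
 obtain C where C: "C \<ge> 0" and rate: "\<And>s m. m \<ge> 1 \<Longrightarrow> \<exists>z. (\<forall>j. z j < 2 ^ m) \<and> CBC_vector (2 ^ m) s \<gamma> z \<and>
  (\<forall>f\<in>ratf s. \<forall>R\<ge>1. (dmix_le s A \<alpha> b f) \<longrightarrow>
    integrable (shifts_measure R s) (\<lambda>\<Delta>. (qerr (2 ^ m) R s z \<Delta> f)\<^sup>2) \<and>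
    (LINT \<Delta>|shifts_measure R s. (qerr (2 ^ m) R s z \<Delta> f)\<^sup>2)
    \<le> C * real (2 ^ m) powr (- 1 / lam))"
  using qmc_rate[OF l(1,2) b0 I(2) less_imp_le[OF \<alpha>(1)] sb] unfolding \<gamma>_def[symmetric] by blast
 define P where "P = (LINT x|lebesgue_on D. (\<Sum>i\<in>I. (elem_mono i x)\<^sup>2))"
 have P0: "P \<ge> 0" unfolding P_def by (intro integral_nonneg_AE AE_I2 sum_nonneg) simp
 \<comment> \<open>The basis and its L2 mass \<open>P\<close> depend on the mesh, but neither on
   \<open>s\<close> nor on \<open>m\<close>.\<close>
 define B where "B = sqrt (real (card I) * C * P)"
 show "\<exists>C. \<forall>s\<ge>1. \<forall>m\<ge>1. \<exists>z. (\<forall>j<s. z j < 2 ^ m) \<and> CBC_vector (2 ^ m) s \<gamma> z \<and>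
      QMC_rms_error D (2 ^ m) R s z (truncated s (u h))
      \<le> C * (if p > 2/3 then real (2 ^ m) powr (- 1 / p + 1 / 2) else real (2 ^ m) powr (- 1 + \<epsilon>))"
 proof (intro exI[of _ B] allI impI)
  fix s m :: nat assume m: "m \<ge> 1"
  obtain z where z: "\<forall>j. z j < 2 ^ m" "CBC_vector (2 ^ m) s \<gamma> z" and
   zr0: "\<forall>f\<in>ratf s. \<forall>R\<ge>1. (dmix_le s A \<alpha> b f) \<longrightarrow>
    integrable (shifts_measure R s) (\<lambda>\<Delta>. (qerr (2 ^ m) R s z \<Delta> f)\<^sup>2) \<and>
    (LINT \<Delta>|shifts_measure R s. (qerr (2 ^ m) R s z \<Delta> f)\<^sup>2)
    \<le> C * real (2 ^ m) powr (- 1 / lam)"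
   using rate[OF m, of s] by (elim exE conjE) (rule that)
  have zr: "f \<in> ratf s \<Longrightarrow> (dmix_le s A \<alpha> b f) \<Longrightarrow>
    integrable (shifts_measure R s) (\<lambda>\<Delta>. (qerr (2 ^ m) R s z \<Delta> f)\<^sup>2) \<and>
    (LINT \<Delta>|shifts_measure R s. (qerr (2 ^ m) R s z \<Delta> f)\<^sup>2)
    \<le> C * real (2 ^ m) powr (- 1 / lam)" for f
   using zr0[THEN bspec, THEN spec, THEN mp, THEN mp, OF _ R] .
  obtain c where c': "\<forall>i\<in>I. c i \<in> ratf s" "\<forall>y\<in>Y s. agree (u h y) (\<lambda>x. \<Sum>i\<in>I. c i y * elem_mono i x)"
   "\<forall>i\<in>I. dmix_le s A \<alpha> b (c i)"
   using reg[of s] by (elim exE conjE) (rule that)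
  note c = c'[THEN bspec]
  define E where "E i \<Delta> = qerr (2 ^ m) R s z \<Delta> (c i)" for i \<Delta>
  have Ei: "integrable (shifts_measure R s) (\<lambda>\<Delta>. (E i \<Delta>)\<^sup>2)"
   "(LINT \<Delta>|shifts_measure R s. (E i \<Delta>)\<^sup>2) \<le> C * real (2 ^ m) powr (- 1 / lam)" if "i \<in> I" for i
   using zr[OF c(1)[OF that] c(3)[OF that]] unfolding E_def by auto
  let ?X = "if p > 2/3 then real (2 ^ m) powr (- 1 / p + 1 / 2) else real (2 ^ m) powr (- 1 + \<epsilon>)"
  have X0: "?X \<ge> 0" by simp
  have X: "real (2 ^ m) powr (- 1 / lam) = ?X\<^sup>2"
   unfolding l(4) power2_eq_square by (simp add: powr_add[symmetric])
  have "(LINT \<Delta>|shifts_measure R s. (L2_norm D (\<lambda>x. (LINT y|cubeM s. truncated s (u h) y x)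
     - Q_ran (2 ^ m) R s z \<Delta> (\<lambda>y. truncated s (u h) y x)))\<^sup>2) \<le> (LINT \<Delta>|shifts_measure R s. (\<Sum>i\<in>I. (E i \<Delta>)\<^sup>2) * P)"
  proof (rule integral_mono_AE')
   show "integrable (shifts_measure R s) (\<lambda>\<Delta>. (\<Sum>i\<in>I. (E i \<Delta>)\<^sup>2) * P)"
    using Ei(1) by (intro integrable_mult_left B_integrable_sum) auto
  next
   show "AE \<Delta> in shifts_measure R s. 0 \<le> (\<Sum>i\<in>I. (E i \<Delta>)\<^sup>2) * P"
    using P0 by (intro AE_I2 mult_nonneg_nonneg sum_nonneg) auto
  next
   show "AE \<Delta> in shifts_measure R s. (L2_norm D (\<lambda>x. (LINT y|cubeM s. truncated s (u h) y x)
     - Q_ran (2 ^ m) R s z \<Delta> (\<lambda>y. truncated s (u h) y x)))\<^sup>2 \<le> (\<Sum>i\<in>I. (E i \<Delta>)\<^sup>2) * P"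
    unfolding E_def P_def by (intro AE_I2 QMC_error_split[OF I(1) c(1,2)])
  qed
  also have "\<dots> = (\<Sum>i\<in>I. LINT \<Delta>|shifts_measure R s. (E i \<Delta>)\<^sup>2) * P"
   using Ei(1) by (simp add: B_integral_sum)
  also have "\<dots> \<le> (\<Sum>i\<in>I. C * real (2 ^ m) powr (- 1 / lam)) * P"
   by (intro mult_right_mono sum_mono Ei(2) P0)
  also have "\<dots> = (real (card I) * C * P) * ?X\<^sup>2" unfolding X by simp
  finally have "QMC_rms_error D (2 ^ m) R s z (truncated s (u h)) \<le> sqrt ((real (card I) * C * P) * ?X\<^sup>2)"
   unfolding QMC_rms_error_def by (rule real_sqrt_le_mono)
  also have "\<dots> = B * ?X" unfolding B_def real_sqrt_mult real_sqrt_abs using X0 by simp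
  finally show "\<exists>z. (\<forall>j<s. z j < 2 ^ m) \<and> CBC_vector (2 ^ m) s \<gamma> z \<and> QMC_rms_error D (2 ^ m) R s z (truncated s (u h)) \<le> B * ?X"
   using z by blast
 qed
qed

end
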